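(* Let $\Lambda=\Lambda(T) = KQ/I$ be the gentle algebra of a triangulation $T$ of a surface and let $M(v)$ and $M(w)$ be indecomposable string modules with corresponding arcs $\gamma_v$ and $\gamma_w$. Then $$\dim\operatorname{Ext}_\Lambda^2(M(v),M(w))=\begin{cases} 2 & \text{if } \gamma_v,\gamma_w \text{ are as in Case 1},\\ 1 & \text{if } \gamma_v,\gamma_w \text{ are as in Case 2},\\ 0 & \text{otherwise,}\end{cases}$$ where: Case 1: at both ends, $\gamma_v$ follows $\gamma_w$ in the orientation of the surface in an internal triangle; Case 2: $\gamma_v$ follows $\gamma_w$ in the orientation of the surface in an internal triangle only at one of the two ends of the arcs. In Case 1, the two arrow extensions given by the arrows $\beta$ and $\beta'$ (the arrows associated in the context to the two ends) induce a basis of $\operatorname{Ext}_\Lambda^2(M(v),M(w))$. In Case 2, a basis is induced by only one of these arrow extensions (the one at the end where $\gamma_v$ follows $\gamma_w$). Furthermore, $\operatorname{Ext}_\Lambda^{2+3k}(M(v),M(w))\cong \operatorname{Ext}_\Lambda^2(M(v), M(w))$ for all $k\ge 0$.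
   Context: $K$ is an algebraically closed field; paths are composed from left to right and modules are finitely generated right modules. $s(\alpha),t(\alpha)$ are the start and end of an arrow. Gentle algebra of a triangulation: let $T$ be an ideal triangulation of an oriented surface with boundary and marked points, all marked points lying on the (non-empty) boundary. $\Lambda(T)=KQ/I$, where the vertices of $Q=Q(T)$ are the arcs of $T$ (boundary segments not included), for each triangle of $T$ and each pair of its sides $i,j$ that are arcs of $T$ there is an arrow $i\to j$ whenever $j$ is the immediate successor of $i$ in the cyclic order on the sides of the triangle given by the orientation of the surface, and $I$ is generated by the compositions of any two consecutive arrows inside an internal triangle (a triangle all of whose sides are arcs of $T$). Strings: for an arrow $\alpha$, its formal inverse has $s(\alpha^{-1})=t(\alpha)$, $t(\alpha^{-1})=s(\alpha)$. A string is a word in arrows and inverse arrows, each letter starting where the previous one ends, with no letter followed by its inverse and such that no two consecutive arrows have product in $I$ and no two consecutive inverse arrows $\beta^{-1}\alpha^{-1}$ have $\alpha\beta\in I$; length $0$ strings are the trivial strings $e_u$ at vertices $u$. $M(w)$ is the string module of $w$; $M(w)\cong M(w^{-1})$. Arcs: an arc is a homotopy class of curves connecting marked points on the boundary. String modules $M(w)$ correspond to arcs $\gamma_w$ not in $T$ (and not boundary segments): $\gamma_w$, in minimal position with respect to $T$, crosses the arcs of $T$ in the order in which the corresponding vertices are traversed by $w$. At each of its two ends, $\gamma_w$ emanates from a corner of a triangle of $T$ and first crosses the side opposite to that corner. Local configuration at an end: let an internal triangle have sides $a,b,c$ with arrows $\alpha:a\to b$, $\beta:b\to c$, $\delta:c\to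 a$ of $Q$ inside it. We say that at a given end $\gamma_v$ follows $\gamma_w$ in the orientation of the surface in this internal triangle if (for a suitable labelling $a,b,c$) $\gamma_v$ emanates there from the corner opposite $a$ (crossing $a$ first) and $\gamma_w$ emanates from the corner opposite $c$ (crossing $c$ first); i.e. the corner of $\gamma_v$ is the immediate successor of the corner of $\gamma_w$ in the cyclic order of the corners (matched with their opposite sides). "At both ends" means: after choosing orientations of $\gamma_v,\gamma_w$ suitably, the condition holds for the pair of starting ends and for the pair of terminal ends; "only at one end" means it holds for only one such pair. The two internal triangles (and their vertices) need not be distinct. The arrows for the second end are denoted $\alpha',\beta',\delta'$. Arrow extensions: for an arrow $\alpha$ put $R(\alpha)=\alpha\Lambda=M(p)$, where $p$ is the trivial string $e_{t(\alpha)}$ if no arrow $\epsilon$ satisfies $\alpha\epsilon\notin I$, and otherwise $p$ is the maximal direct string starting with the unique such $\epsilon$. If $w\beta^{-1}p$ is a string (with $w$ oriented to end at the relevant end), there is a non-split exact sequence $0\to M(w)\to M(w\beta^{-1}p)\to M(p)\to0$, called the arrow extension of $M(p)$ by $M(w)$ given by $\beta$. At an end where $\gamma_v$ follows $\gamma_w$, $R(\alpha)$ is a direct summand of $\Omega^1(M(v))$ (the kernel of the projective cover of $M(v)$); the arrow extension of $R(\alpha)$ by $M(w)$ given by $\beta$ induces an element of $\operatorname{Ext}^2_\Lambda(M(v),M(w))\cong\operatorname{Ext}^1_\Lambda(\Omega^1(M(v)),M(w))$, and likewise for $\alpha',\beta'$ at the other end.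
   Formalization: The dimension and basis claims assume that distinct pairs of ends at which γ_v follows γ_w share no end of either arc; otherwise (both ends of a loop at one corner of an internal triangle) the stated dimension is false. Ext^{2+3k} ≅ Ext^2 is unrestricted. *)

theory Defs
  imports
    "HOL-Algebra.QuotRing"
    "HOL-Computational_Algebra.Polynomial"
    "Jordan_Normal_Form.VS_Connect"
    "Graph_Theory.Arc_Walk"
begin

hide_const (open) Polynomial.smult Modules.module Modules.module_hom Multiset.mult

section \<open>Ideal triangulations of marked surfaces and their gentle algebras\<close>

text \<open>
  A triangulated oriented marked surface, taken up to orientation preserving homeomorphism, is
  given by its gluing scheme: a finite set of triangle sides, the permutation \<open>succ\<close> whose orbits
  are the triangles and which sends a side to the next one in the orientation of the surface, and
  the map \<open>curve\<close> sending a side to the curve on the surface on which it lies.  Sides on the same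
  curve are glued, against their boundary orientations, so that the surface is oriented.  A
  curve carrying two sides is an arc of the triangulation, a curve carrying one side is a boundary
  segment.

  Turning around a marked point leads from the corner between \<open>x\<close> and \<open>succ x\<close> to the corner
  between \<open>y\<close> and \<open>succ y\<close>, where \<open>y\<close> is the other side on the arc of \<open>succ x\<close>.  All marked points lie
  on the boundary iff this never returns to the corner it started from; this also excludes
  self-folded triangles and closed components.
\<close>

record ('s, 'a) triangulation =
  sides :: "'s set"
  succ :: "'s \<Rightarrow> 's"
  curve :: "'s \<Rightarrow> 'a"

definition ideal_triangulation :: "('s, 'a) triangulation \<Rightarrow> bool" where
  "ideal_triangulation T \<longleftrightarrow>
     finite (sides T) \<and>
     (\<forall>x\<in>sides T. succ T x \<in> sides T \<and> succ T x \<noteq> x \<and> succ T (succ T (succ T x)) = x) \<and>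
     (\<forall>x\<in>sides T. card {y \<in> sides T. curve T y = curve T x} \<le> 2) \<and>
     acyclic {(x, y). x \<in> sides T \<and> y \<in> sides T \<and> y \<noteq> succ T x \<and> curve T y = curve T (succ T x)}"

definition arc_set :: "('s, 'a) triangulation \<Rightarrow> 'a set" where
  "arc_set T = {a. card {x \<in> sides T. curve T x = a} = 2}"

definition opposite_side :: "('s, 'a) triangulation \<Rightarrow> 's \<Rightarrow> 's" where
  "opposite_side T x = (THE y. y \<in> sides T \<and> y \<noteq> x \<and> curve T y = curve T x)"

definition internal_triangle :: "('s, 'a) triangulation \<Rightarrow> 's \<Rightarrow> bool" where
  "internal_triangle T x \<longleftrightarrow>
     x \<in> sides T \<and> {curve T x, curve T (succ T x), curve T (succ T (succ T x))} \<subseteq> arc_set T"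

text \<open>The arrow \<open>i \<rightarrow> j\<close> inside a triangle is named by the side of that triangle lying on \<open>i\<close>.\<close>

definition quiver :: "('s, 'a) triangulation \<Rightarrow> ('a, 's) pre_digraph" where
  "quiver T = \<lparr>verts = arc_set T,
     arcs = {x \<in> sides T. curve T x \<in> arc_set T \<and> curve T (succ T x) \<in> arc_set T},
     tail = curve T, head = (\<lambda>x. curve T (succ T x))\<rparr>"

text \<open>A path is a pair of its start vertex and its list of arrows, composed from left to right.\<close>

type_synonym ('a, 's) path = "'a \<times> 's list"

definition quiver_paths :: "('a, 's) pre_digraph \<Rightarrow> ('a, 's) path set" where
  "quiver_paths Q = {(u, xs). \<exists>t. pre_digraph.awalk Q u xs t}"

definition path_algebra :: "('a, 's) pre_digraph \<Rightarrow> (('a, 's) path \<Rightarrow> 'k::field) ring" where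
  "path_algebra Q = \<lparr>
     carrier = {f. finite {q. f q \<noteq> 0} \<and> {q. f q \<noteq> 0} \<subseteq> quiver_paths Q},
     mult = (\<lambda>f g (u, xs). \<Sum>k\<le>length xs.
       f (u, take k xs) * g (last (pre_digraph.awalk_verts Q u (take k xs)), drop k xs)),
     one = (\<lambda>(u, xs). if u \<in> verts Q \<and> xs = [] then 1 else 0),
     zero = (\<lambda>_. 0),
     add = (\<lambda>f g q. f q + g q)\<rparr>"

definition path_elt :: "('a, 's) path \<Rightarrow> ('a, 's) path \<Rightarrow> 'k::field" where
  "path_elt p = (\<lambda>q. if q = p then 1 else 0)"

definition relation_ideal :: "('s, 'a) triangulation \<Rightarrow> (('a, 's) path \<Rightarrow> 'k::field) set" where
  "relation_ideal T = Idl\<^bsub>path_algebra (quiver T)\<^esub>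
     {path_elt (curve T x, [x, succ T x]) | x. internal_triangle T x}"

definition bound_algebra ::
    "('a, 's) pre_digraph \<Rightarrow> (('a, 's) path \<Rightarrow> 'k::field) set \<Rightarrow> (('a, 's) path \<Rightarrow> 'k) set ring" where
  "bound_algebra Q I = path_algebra Q Quot I"

definition scalar ::
    "('a, 's) pre_digraph \<Rightarrow> (('a, 's) path \<Rightarrow> 'k::field) set \<Rightarrow> 'k \<Rightarrow> (('a, 's) path \<Rightarrow> 'k) set" where
  "scalar Q I c = I +>\<^bsub>path_algebra Q\<^esub> (\<lambda>q. c * \<one>\<^bsub>path_algebra Q\<^esub> q)"


section \<open>Right modules and Ext\<close>

text \<open>
  Right modules are kept in the \<^type>\<open>module\<close> record: \<open>a \<odot>\<^bsub>M\<^esub> m\<close> stands for \<open>m a\<close>, hence the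
  order of \<open>a\<close> and \<open>b\<close> in \<open>smult_assoc\<close>.
\<close>

locale right_module = R: ring R + M: abelian_group M
  for R :: "('r, 'x) ring_scheme" and M :: "('r, 'm, 'y) module_scheme" +
  assumes smult_closed: "a \<in> carrier R \<Longrightarrow> m \<in> carrier M \<Longrightarrow> a \<odot>\<^bsub>M\<^esub> m \<in> carrier M"
    and smult_add_ring: "a \<in> carrier R \<Longrightarrow> b \<in> carrier R \<Longrightarrow> m \<in> carrier M \<Longrightarrow>
      (a \<oplus>\<^bsub>R\<^esub> b) \<odot>\<^bsub>M\<^esub> m = a \<odot>\<^bsub>M\<^esub> m \<oplus>\<^bsub>M\<^esub> b \<odot>\<^bsub>M\<^esub> m"
    and smult_add_module: "a \<in> carrier R \<Longrightarrow> m \<in> carrier M \<Longrightarrow> n \<in> carrier M \<Longrightarrow>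
      a \<odot>\<^bsub>M\<^esub> (m \<oplus>\<^bsub>M\<^esub> n) = a \<odot>\<^bsub>M\<^esub> m \<oplus>\<^bsub>M\<^esub> a \<odot>\<^bsub>M\<^esub> n"
    and smult_assoc: "a \<in> carrier R \<Longrightarrow> b \<in> carrier R \<Longrightarrow> m \<in> carrier M \<Longrightarrow>
      (a \<otimes>\<^bsub>R\<^esub> b) \<odot>\<^bsub>M\<^esub> m = b \<odot>\<^bsub>M\<^esub> (a \<odot>\<^bsub>M\<^esub> m)"
    and smult_one: "m \<in> carrier M \<Longrightarrow> \<one>\<^bsub>R\<^esub> \<odot>\<^bsub>M\<^esub> m = m"

definition free_module :: "'r ring \<Rightarrow> nat \<Rightarrow> ('r, nat \<Rightarrow> 'r) module" where
  "free_module R n = \<lparr>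
     carrier = {f. (\<forall>i<n. f i \<in> carrier R) \<and> (\<forall>i\<ge>n. f i = \<zero>\<^bsub>R\<^esub>)},
     mult = undefined, one = undefined,
     zero = (\<lambda>_. \<zero>\<^bsub>R\<^esub>),
     add = (\<lambda>f g i. f i \<oplus>\<^bsub>R\<^esub> g i),
     smult = (\<lambda>a f i. f i \<otimes>\<^bsub>R\<^esub> a)\<rparr>"

text \<open>Finitely generated projective modules: the direct summands of the \<open>R\<^sup>n\<close>.\<close>

definition fg_projective :: "'r ring \<Rightarrow> ('r, 'm) module \<Rightarrow> bool" where
  "fg_projective R P \<longleftrightarrow> right_module R P \<and>
     (\<exists>n i r. i \<in> module_hom R P (free_module R n) \<and> r \<in> module_hom R (free_module R n) P \<and>
        (\<forall>x\<in>carrier P. r (i x) = x))"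

definition hom_kernel :: "('r, 'm) module \<Rightarrow> ('r, 'n) module \<Rightarrow> ('m \<Rightarrow> 'n) \<Rightarrow> 'm set" where
  "hom_kernel M N f = {x \<in> carrier M. f x = \<zero>\<^bsub>N\<^esub>}"

definition right_submodule :: "'r ring \<Rightarrow> ('r, 'm) module \<Rightarrow> 'm set \<Rightarrow> bool" where
  "right_submodule R M U \<longleftrightarrow> U \<subseteq> carrier M \<and> \<zero>\<^bsub>M\<^esub> \<in> U \<and>
     (\<forall>x\<in>U. \<forall>y\<in>U. x \<oplus>\<^bsub>M\<^esub> y \<in> U) \<and> (\<forall>a\<in>carrier R. \<forall>x\<in>U. a \<odot>\<^bsub>M\<^esub> x \<in> U)"

definition projective_cover ::
    "'r ring \<Rightarrow> ('r, 'c) module \<Rightarrow> ('r, 'm) module \<Rightarrow> ('c \<Rightarrow> 'm) \<Rightarrow> bool" where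
  "projective_cover R C M \<pi> \<longleftrightarrow> fg_projective R C \<and> \<pi> \<in> module_hom R C M \<and>
     \<pi> ` carrier C = carrier M \<and>
     (\<forall>U. right_submodule R C U \<and> U <+>\<^bsub>C\<^esub> hom_kernel C M \<pi> = carrier C \<longrightarrow> U = carrier C)"

text \<open>The resolution \<open>\<dots> \<rightarrow> P 2 \<rightarrow> P 1 \<rightarrow> P 0 \<rightarrow> M \<rightarrow> 0\<close> with differentials \<open>d n : P (n + 1) \<rightarrow> P n\<close>.\<close>

definition projective_resolution ::
    "'r ring \<Rightarrow> ('r, 'm) module \<Rightarrow> (nat \<Rightarrow> ('r, 'p) module) \<Rightarrow> (nat \<Rightarrow> 'p \<Rightarrow> 'p) \<Rightarrow> ('p \<Rightarrow> 'm) \<Rightarrow> bool" where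
  "projective_resolution R M P d \<epsilon> \<longleftrightarrow>
     (\<forall>n. fg_projective R (P n)) \<and>
     (\<forall>n. d n \<in> module_hom R (P (Suc n)) (P n)) \<and>
     \<epsilon> \<in> module_hom R (P 0) M \<and>
     \<epsilon> ` carrier (P 0) = carrier M \<and>
     d 0 ` carrier (P 1) = hom_kernel (P 0) M \<epsilon> \<and>
     (\<forall>n. d (Suc n) ` carrier (P (Suc (Suc n))) = hom_kernel (P (Suc n)) (P n) (d n))"

text \<open>
  \<open>Hom\<^sub>R(M, N)\<close> as a vector space, the field acting through the structure map \<open>\<eta>\<close> of the
  algebra \<open>R\<close>.  Homomorphisms are made extensional so that they are determined by their values on
  \<open>carrier M\<close>.
\<close>

definition hom_space ::
    "'r ring \<Rightarrow> ('k \<Rightarrow> 'r) \<Rightarrow> ('r, 'm) module \<Rightarrow> ('r, 'n) module \<Rightarrow> ('k, 'm \<Rightarrow> 'n) module" where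
  "hom_space R \<eta> M N = \<lparr>
     carrier = module_hom R M N \<inter> extensional (carrier M),
     mult = undefined, one = undefined,
     zero = (\<lambda>x\<in>carrier M. \<zero>\<^bsub>N\<^esub>),
     add = (\<lambda>f g. \<lambda>x\<in>carrier M. f x \<oplus>\<^bsub>N\<^esub> g x),
     smult = (\<lambda>c f. \<lambda>x\<in>carrier M. \<eta> c \<odot>\<^bsub>N\<^esub> f x)\<rparr>"

definition quotient_space :: "('k, 'v) module \<Rightarrow> 'v set \<Rightarrow> ('k, 'v set) module" where
  "quotient_space V B = \<lparr>
     carrier = {B +>\<^bsub>V\<^esub> f | f. f \<in> carrier V},
     mult = undefined, one = undefined,
     zero = B,
     add = set_add V,
     smult = (\<lambda>c X. B <+>\<^bsub>V\<^esub> (module.smult V c ` X))\<rparr>"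

definition cocycles ::
    "'r ring \<Rightarrow> ('k \<Rightarrow> 'r) \<Rightarrow> (nat \<Rightarrow> ('r, 'p) module) \<Rightarrow> (nat \<Rightarrow> 'p \<Rightarrow> 'p) \<Rightarrow> ('r, 'n) module \<Rightarrow> nat
      \<Rightarrow> ('p \<Rightarrow> 'n) set" where
  "cocycles R \<eta> P d N n = {f \<in> carrier (hom_space R \<eta> (P n) N).
     \<forall>x\<in>carrier (P (Suc n)). f (d n x) = \<zero>\<^bsub>N\<^esub>}"

definition coboundaries ::
    "'r ring \<Rightarrow> ('k \<Rightarrow> 'r) \<Rightarrow> (nat \<Rightarrow> ('r, 'p) module) \<Rightarrow> (nat \<Rightarrow> 'p \<Rightarrow> 'p) \<Rightarrow> ('r, 'n) module \<Rightarrow> nat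
      \<Rightarrow> ('p \<Rightarrow> 'n) set" where
  "coboundaries R \<eta> P d N n = (case n of
     0 \<Rightarrow> {\<lambda>x\<in>carrier (P 0). \<zero>\<^bsub>N\<^esub>}
   | Suc m \<Rightarrow> {\<lambda>x\<in>carrier (P (Suc m)). g (d m x) | g. g \<in> carrier (hom_space R \<eta> (P m) N)})"

text \<open>\<open>Ext\<^sup>n(M, N)\<close>; the module \<open>M\<close> enters only through its projective resolution \<open>P\<close>.\<close>

definition Ext ::
    "'r ring \<Rightarrow> ('k \<Rightarrow> 'r) \<Rightarrow> (nat \<Rightarrow> ('r, 'p) module) \<Rightarrow> (nat \<Rightarrow> 'p \<Rightarrow> 'p) \<Rightarrow> ('r, 'n) module \<Rightarrow> nat
      \<Rightarrow> ('k, ('p \<Rightarrow> 'n) set) module" where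
  "Ext R \<eta> P d N n = quotient_space
     ((hom_space R \<eta> (P n) N)\<lparr>carrier := cocycles R \<eta> P d N n\<rparr>) (coboundaries R \<eta> P d N n)"

definition exact_sequence ::
    "'r ring \<Rightarrow> ('r, 'n) module \<Rightarrow> ('r, 'e) module \<Rightarrow> ('r, 'l) module \<Rightarrow> ('n \<Rightarrow> 'e) \<Rightarrow> ('e \<Rightarrow> 'l) \<Rightarrow> bool" where
  "exact_sequence R N E L \<iota> g \<longleftrightarrow>
     \<iota> \<in> module_hom R N E \<and> g \<in> module_hom R E L \<and> inj_on \<iota> (carrier N) \<and>
     \<iota> ` carrier N = hom_kernel E L g \<and> g ` carrier E = carrier L"

text \<open>
  Let \<open>\<pi> : C \<rightarrow> M\<close> be the projective cover, \<open>\<Omega>\<close> its kernel and \<open>\<rho> : \<Omega> \<rightarrow> L\<close> the projection onto a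
  direct summand.  A short exact sequence \<open>0 \<rightarrow> N \<rightarrow> E \<rightarrow> L \<rightarrow> 0\<close> is pulled back along \<open>\<rho>\<close> to an element
  of \<open>Ext\<^sup>1(\<Omega>, N)\<close> and carried to \<open>Ext\<^sup>2(M, N)\<close> by dimension shift.  The result is the class of any
  \<open>f\<^sub>2\<close> fitting into a morphism \<open>(f\<^sub>0, f\<^sub>1, f\<^sub>2)\<close> over the identity of \<open>M\<close> from the resolution \<open>P\<close> to
  the spliced sequence, where the component \<open>P 1 \<rightarrow> E \<times>\<^sub>L \<Omega>\<close> into the pullback is \<open>(f\<^sub>1, f\<^sub>0 \<circ> d 0)\<close>.
  The set below collects the classes obtained from all projections \<open>\<rho>\<close> onto a summand \<open>L\<close>.
\<close>

definition induced_Ext2 ::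
    "'r ring \<Rightarrow> ('k \<Rightarrow> 'r) \<Rightarrow> ('r, 'm) module \<Rightarrow> (nat \<Rightarrow> ('r, 'p) module) \<Rightarrow> (nat \<Rightarrow> 'p \<Rightarrow> 'p) \<Rightarrow> ('p \<Rightarrow> 'm)
      \<Rightarrow> ('r, 'c) module \<Rightarrow> ('c \<Rightarrow> 'm)
      \<Rightarrow> ('r, 'n) module \<Rightarrow> ('r, 'e) module \<Rightarrow> ('r, 'l) module \<Rightarrow> ('n \<Rightarrow> 'e) \<Rightarrow> ('e \<Rightarrow> 'l)
      \<Rightarrow> ('p \<Rightarrow> 'n) set set" where
  "induced_Ext2 R \<eta> M P d \<epsilon> C \<pi> N E L \<iota> g =
     {coboundaries R \<eta> P d N 2 +>\<^bsub>hom_space R \<eta> (P 2) N\<^esub> f2 | f2 \<rho> \<sigma> f0 f1.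
        exact_sequence R N E L \<iota> g \<and>
        \<rho> \<in> module_hom R (C\<lparr>carrier := hom_kernel C M \<pi>\<rparr>) L \<and>
        \<sigma> \<in> module_hom R L (C\<lparr>carrier := hom_kernel C M \<pi>\<rparr>) \<and>
        (\<forall>y\<in>carrier L. \<rho> (\<sigma> y) = y) \<and>
        f0 \<in> module_hom R (P 0) C \<and> (\<forall>x\<in>carrier (P 0). \<pi> (f0 x) = \<epsilon> x) \<and>
        f1 \<in> module_hom R (P 1) E \<and> (\<forall>x\<in>carrier (P 1). g (f1 x) = \<rho> (f0 (d 0 x))) \<and>
        f2 \<in> carrier (hom_space R \<eta> (P 2) N) \<and> (\<forall>x\<in>carrier (P 2). \<iota> (f2 x) = f1 (d 1 x))}"


section \<open>Strings and string modules\<close>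

datatype 's letter = Dir 's | Inv 's

text \<open>A word is its start vertex together with its letters; \<open>(u, [])\<close> is the trivial string at \<open>u\<close>.\<close>

type_synonym ('a, 's) str = "'a \<times> 's letter list"

primrec letter_arrow :: "'s letter \<Rightarrow> 's" where
  "letter_arrow (Dir x) = x"
| "letter_arrow (Inv x) = x"

primrec letter_inverse :: "'s letter \<Rightarrow> 's letter" where
  "letter_inverse (Dir x) = Inv x"
| "letter_inverse (Inv x) = Dir x"

primrec letter_start :: "('a, 's) pre_digraph \<Rightarrow> 's letter \<Rightarrow> 'a" where
  "letter_start Q (Dir x) = tail Q x"
| "letter_start Q (Inv x) = head Q x"

primrec letter_end :: "('a, 's) pre_digraph \<Rightarrow> 's letter \<Rightarrow> 'a" where
  "letter_end Q (Dir x) = head Q x"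
| "letter_end Q (Inv x) = tail Q x"

definition is_string ::
    "('a, 's) pre_digraph \<Rightarrow> (('a, 's) path \<Rightarrow> 'k::field) set \<Rightarrow> ('a, 's) str \<Rightarrow> bool" where
  "is_string Q I = (\<lambda>(u, ls). u \<in> verts Q \<and> letter_arrow ` set ls \<subseteq> arcs Q \<and>
     (ls \<noteq> [] \<longrightarrow> letter_start Q (hd ls) = u) \<and>
     (\<forall>i. Suc i < length ls \<longrightarrow>
        letter_end Q (ls ! i) = letter_start Q (ls ! Suc i) \<and>
        ls ! Suc i \<noteq> letter_inverse (ls ! i) \<and>
        (\<forall>x y. ls ! i = Dir x \<and> ls ! Suc i = Dir y \<longrightarrow> path_elt (tail Q x, [x, y]) \<notin> I) \<and>
        (\<forall>x y. ls ! i = Inv y \<and> ls ! Suc i = Inv x \<longrightarrow> path_elt (tail Q x, [x, y]) \<notin> I)))"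

definition string_vertex :: "('a, 's) pre_digraph \<Rightarrow> ('a, 's) str \<Rightarrow> nat \<Rightarrow> 'a" where
  "string_vertex Q w i = (if i = 0 then fst w else letter_end Q (snd w ! (i - 1)))"

definition string_inverse :: "('a, 's) pre_digraph \<Rightarrow> ('a, 's) str \<Rightarrow> ('a, 's) str" where
  "string_inverse Q w =
     (string_vertex Q w (length (snd w)), rev (map letter_inverse (snd w)))"

text \<open>
  \<open>M(w)\<close> has one basis vector for each of the \<open>length (snd w) + 1\<close> positions on \<open>w\<close>.  A letter
  \<open>Dir x\<close> between the positions \<open>i\<close> and \<open>i + 1\<close> means that \<open>x\<close> moves the \<open>i\<close>-th vector to the
  \<open>(i + 1)\<close>-st one, a letter \<open>Inv x\<close> that it moves the \<open>(i + 1)\<close>-st to the \<open>i\<close>-th.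
\<close>

definition arrow_action :: "('a, 's) str \<Rightarrow> (nat \<Rightarrow> 'k::field) \<Rightarrow> 's \<Rightarrow> nat \<Rightarrow> 'k" where
  "arrow_action w f x = (\<lambda>j.
     (if 0 < j \<and> j \<le> length (snd w) \<and> snd w ! (j - 1) = Dir x then f (j - 1) else 0) +
     (if j < length (snd w) \<and> snd w ! j = Inv x then f (Suc j) else 0))"

definition path_action ::
    "('a, 's) pre_digraph \<Rightarrow> ('a, 's) str \<Rightarrow> (nat \<Rightarrow> 'k::field) \<Rightarrow> ('a, 's) path \<Rightarrow> nat \<Rightarrow> 'k" where
  "path_action Q w f = (\<lambda>(u, xs).
     foldl (arrow_action w) (\<lambda>j. if string_vertex Q w j = u then f j else 0) xs)"

text \<open>An element of \<open>KQ/I\<close> acts through any of its representatives, since \<open>I\<close> annihilates \<open>M(w)\<close>.\<close>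

definition string_module ::
    "('a, 's) pre_digraph \<Rightarrow> (('a, 's) path \<Rightarrow> 'k::field) set \<Rightarrow> ('a, 's) str
      \<Rightarrow> ((('a, 's) path \<Rightarrow> 'k) set, nat \<Rightarrow> 'k) module" where
  "string_module Q I w = \<lparr>
     carrier = {f. \<forall>j>length (snd w). f j = 0},
     mult = undefined, one = undefined,
     zero = (\<lambda>_. 0),
     add = (\<lambda>f g j. f j + g j),
     smult = (\<lambda>X f j. let r = (SOME r. r \<in> X) in \<Sum>q | r q \<noteq> 0. r q * path_action Q w f q j)\<rparr>"

text \<open>The strings \<open>p\<close> and \<open>w \<beta>\<inverse> p\<close>; here \<open>R(\<alpha>) = \<alpha>\<Lambda> = M(p)\<close>.\<close>

definition is_R_string ::
    "('a, 's) pre_digraph \<Rightarrow> (('a, 's) path \<Rightarrow> 'k::field) set \<Rightarrow> 's \<Rightarrow> ('a, 's) str \<Rightarrow> bool" where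
  "is_R_string Q I \<alpha> p \<longleftrightarrow>
     (let ext = {e \<in> arcs Q. tail Q e = head Q \<alpha> \<and> path_elt (tail Q \<alpha>, [\<alpha>, e]) \<notin> I} in
      if ext = {} then p = (head Q \<alpha>, [])
      else \<exists>e xs. e \<in> ext \<and> p = (head Q \<alpha>, map Dir (e # xs)) \<and> is_string Q I p \<and>
             (\<forall>y. \<not> is_string Q I (head Q \<alpha>, map Dir ((e # xs) @ [y]))))"

definition extension_string :: "('a, 's) str \<Rightarrow> 's \<Rightarrow> ('a, 's) str \<Rightarrow> ('a, 's) str" where
  "extension_string w \<beta> p = (fst w, snd w @ Inv \<beta> # snd p)"


section \<open>The arcs of strings, and their ends\<close>

text \<open>
  An oriented arc not in \<open>T\<close>, in minimal position, is given by the list of sides through which it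
  leaves the triangles it passes: it starts at the corner opposite to the first side of the list;
  after leaving a triangle through \<open>x\<close> it enters the adjacent one through \<open>opposite_side T x\<close> and
  either leaves it through another side or, at the end of the list, ends at the corner opposite to
  that side.
\<close>

definition crossing_arc :: "('s, 'a) triangulation \<Rightarrow> 's list \<Rightarrow> bool" where
  "crossing_arc T \<gamma> \<longleftrightarrow> \<gamma> \<noteq> [] \<and> (\<forall>x\<in>set \<gamma>. x \<in> sides T \<and> curve T x \<in> arc_set T) \<and>
     (\<forall>i. Suc i < length \<gamma> \<longrightarrow> (let y = opposite_side T (\<gamma> ! i) in
        \<gamma> ! Suc i = succ T y \<or> \<gamma> ! Suc i = succ T (succ T y)))"

text \<open>The arcs of \<open>T\<close> crossed, with the arrow inside each triangle that is traversed in between.\<close>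

definition crossing_letter :: "('s, 'a) triangulation \<Rightarrow> 's \<Rightarrow> 's \<Rightarrow> 's letter" where
  "crossing_letter T x x' =
     (let y = opposite_side T x in if x' = succ T y then Dir y else Inv x')"

definition crossing_string :: "('s, 'a) triangulation \<Rightarrow> 's list \<Rightarrow> ('a, 's) str" where
  "crossing_string T \<gamma> = (curve T (hd \<gamma>), map2 (crossing_letter T) \<gamma> (tl \<gamma>))"

definition corresponding_arc :: "('s, 'a) triangulation \<Rightarrow> ('a, 's) str \<Rightarrow> 's list \<Rightarrow> bool" where
  "corresponding_arc T w \<gamma> \<longleftrightarrow> crossing_arc T \<gamma> \<and> crossing_string T \<gamma> = w"

datatype arc_end = Start | Terminal

primrec other_end :: "arc_end \<Rightarrow> arc_end" where
  "other_end Start = Terminal"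
| "other_end Terminal = Start"

text \<open>The side opposite to the corner from which the arc emanates at the given end.\<close>

primrec end_side :: "('s, 'a) triangulation \<Rightarrow> 's list \<Rightarrow> arc_end \<Rightarrow> 's" where
  "end_side T \<gamma> Start = hd \<gamma>"
| "end_side T \<gamma> Terminal = opposite_side T (last \<gamma>)"

text \<open>
  \<open>follows T \<gamma>\<^sub>v e \<gamma>\<^sub>w f\<close>: at its end \<open>e\<close>, \<open>\<gamma>\<^sub>v\<close> follows the end \<open>f\<close> of \<open>\<gamma>\<^sub>w\<close> in an internal
  triangle.  With \<open>x = end_side T \<gamma>\<^sub>v e\<close>, the arrows of that triangle are \<open>\<alpha> = x\<close>,
  \<open>\<beta> = succ T x\<close> and \<open>\<delta> = succ T (succ T x)\<close>.
\<close>

definition follows ::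
    "('s, 'a) triangulation \<Rightarrow> 's list \<Rightarrow> arc_end \<Rightarrow> 's list \<Rightarrow> arc_end \<Rightarrow> bool" where
  "follows T \<gamma>v e \<gamma>w f \<longleftrightarrow>
     (let x = end_side T \<gamma>v e; y = end_side T \<gamma>w f in internal_triangle T y \<and> x = succ T y)"

text \<open>
  Choosing orientations of the two arcs amounts to choosing which end \<open>f\<close> of \<open>\<gamma>\<^sub>w\<close> is compared with
  the end \<open>e\<close> of \<open>\<gamma>\<^sub>v\<close>.
\<close>

definition follows_at_both_ends :: "('s, 'a) triangulation \<Rightarrow> 's list \<Rightarrow> 's list \<Rightarrow> bool" where
  "follows_at_both_ends T \<gamma>v \<gamma>w \<longleftrightarrow>
     (\<exists>e f. follows T \<gamma>v e \<gamma>w f \<and> follows T \<gamma>v (other_end e) \<gamma>w (other_end f))"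

definition follows_at_one_end :: "('s, 'a) triangulation \<Rightarrow> 's list \<Rightarrow> 's list \<Rightarrow> bool" where
  "follows_at_one_end T \<gamma>v \<gamma>w \<longleftrightarrow>
     (\<exists>e f. follows T \<gamma>v e \<gamma>w f \<and> \<not> follows T \<gamma>v (other_end e) \<gamma>w (other_end f))"

text \<open>
  The condition below says that the arcs can be oriented so that \<open>\<gamma>\<^sub>v\<close> follows \<open>\<gamma>\<^sub>w\<close> only
  between two starting ends or two terminal ends.  It fails exactly if both ends of one arc (a loop) emanate from the same corner of the same
  internal triangle and both follow, or are followed by, the same end of the other arc.  The
  dimension of \<open>Ext\<^sup>2(M(v), M(w))\<close> always is the number of all pairs \<open>(e, f)\<close> with
  \<open>follows T \<gamma>\<^sub>v e \<gamma>\<^sub>w f\<close>; if ends match, this number is \<open>2\<close>, \<open>1\<close> or \<open>0\<close> according to whether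
  \<open>\<gamma>\<^sub>v\<close> follows \<open>\<gamma>\<^sub>w\<close> at both ends, at one end, or not at all, and otherwise it is \<open>4\<close> when
  \<open>follows_at_both_ends\<close> holds and \<open>2\<close> when it does not.
\<close>

definition ends_match :: "('s, 'a) triangulation \<Rightarrow> 's list \<Rightarrow> 's list \<Rightarrow> bool" where
  "ends_match T \<gamma>v \<gamma>w \<longleftrightarrow>
     (\<forall>e f e' f'. follows T \<gamma>v e \<gamma>w f \<and> follows T \<gamma>v e' \<gamma>w f' \<longrightarrow> (e = e' \<longleftrightarrow> f = f'))"

text \<open>
  The arrow extension \<open>0 \<rightarrow> M(w) \<rightarrow> M(w'\<beta>\<inverse>p) \<rightarrow> M(p) \<rightarrow> 0\<close> at the end \<open>f\<close> of \<open>\<gamma>\<^sub>w\<close>, where \<open>w'\<close> is \<open>w\<close>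
  oriented to end there; the inclusion uses the isomorphism \<open>M(w) \<cong> M(w\<inverse>)\<close> reversing positions if
  \<open>w' = w\<inverse>\<close>.
\<close>

primrec oriented_string :: "('a, 's) pre_digraph \<Rightarrow> ('a, 's) str \<Rightarrow> arc_end \<Rightarrow> ('a, 's) str" where
  "oriented_string Q w Terminal = w"
| "oriented_string Q w Start = string_inverse Q w"

primrec ext_inclusion :: "('a, 's) str \<Rightarrow> arc_end \<Rightarrow> (nat \<Rightarrow> 'k::field) \<Rightarrow> nat \<Rightarrow> 'k" where
  "ext_inclusion w Terminal = (\<lambda>f. f)"
| "ext_inclusion w Start = (\<lambda>f j. if j \<le> length (snd w) then f (length (snd w) - j) else 0)"

definition ext_projection :: "('a, 's) str \<Rightarrow> (nat \<Rightarrow> 'k::field) \<Rightarrow> nat \<Rightarrow> 'k" where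
  "ext_projection w = (\<lambda>f j. f (Suc (length (snd w)) + j))"

text \<open>
  The elements of \<open>Ext\<^sup>2(M(v), M(w))\<close> induced by the arrow extension of \<open>R(\<alpha>)\<close> by \<open>M(w)\<close> given by
  \<open>\<beta>\<close>, where \<open>\<alpha>\<close> and \<open>\<beta>\<close> belong to the end \<open>e\<close> of \<open>\<gamma>\<^sub>v\<close>, which follows the end \<open>f\<close> of \<open>\<gamma>\<^sub>w\<close>.
\<close>

definition arrow_ext_classes ::
    "('s, 'a) triangulation \<Rightarrow> ('a, 's) str \<Rightarrow> ('a, 's) str \<Rightarrow> 's list
      \<Rightarrow> (nat \<Rightarrow> ((('a, 's) path \<Rightarrow> 'k::field) set, 'p) module) \<Rightarrow> (nat \<Rightarrow> 'p \<Rightarrow> 'p) \<Rightarrow> ('p \<Rightarrow> nat \<Rightarrow> 'k)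
      \<Rightarrow> ((('a, 's) path \<Rightarrow> 'k) set, 'c) module \<Rightarrow> ('c \<Rightarrow> nat \<Rightarrow> 'k)
      \<Rightarrow> arc_end \<Rightarrow> arc_end \<Rightarrow> ('p \<Rightarrow> nat \<Rightarrow> 'k) set set" where
  "arrow_ext_classes T v w \<gamma>v P d \<epsilon> C \<pi> e f =
     (let Q = quiver T; I = relation_ideal T; M = string_module Q I;
          \<alpha> = end_side T \<gamma>v e; \<beta> = succ T \<alpha>; w' = oriented_string Q w f in
      \<Union>p \<in> {p. is_R_string Q I \<alpha> p \<and> is_string Q I (extension_string w' \<beta> p)}.
        induced_Ext2 (bound_algebra Q I) (scalar Q I) (M v) P d \<epsilon> C \<pi>
          (M w) (M (extension_string w' \<beta> p)) (M p) (ext_inclusion w f) (ext_projection w))"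

definition Ext_T ::
    "('s, 'a) triangulation \<Rightarrow> (nat \<Rightarrow> ((('a, 's) path \<Rightarrow> 'k::field) set, 'p) module)
      \<Rightarrow> (nat \<Rightarrow> 'p \<Rightarrow> 'p) \<Rightarrow> ('a, 's) str \<Rightarrow> nat \<Rightarrow> ('k, ('p \<Rightarrow> nat \<Rightarrow> 'k) set) module" where
  "Ext_T T P d w n =
     (let Q = quiver T; I = relation_ideal T in
      Ext (bound_algebra Q I) (scalar Q I) P d (string_module Q I w) n)"

end

theory Submission
  imports Defs
begin

text \<open>
  Everything is read off from an explicit projective resolution of \<open>M(v)\<close>.  In degree \<open>0\<close> it has
  one generator for each position on \<open>v\<close>.  In degree \<open>1\<close> it has one generator for each letter,
  expressing that the arrow of the letter carries one of the two neighbouring basis vectors to the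
  other, and one for each end of the arc whose opposite side \<open>x\<close> is an arrow, expressing that \<open>x\<close>
  kills the basis vector at that end.  In the gentle algebra, the elements killed from the left by
  an arrow of an internal triangle are the multiples of the next arrow of that triangle, and no
  nonzero element starting at the end of any other arrow is killed by it.  Therefore the letters
  contribute nothing to the later syzygies, while an end in an internal triangle contributes one
  generator in each degree, the differential being multiplication by the arrows of the triangle in
  turn (\<open>Res_resolution\<close>).

  Hence in degree \<open>n \<ge> 2\<close> a cocycle with values in \<open>M(w)\<close> chooses, for every end \<open>e\<close> of \<open>\<gamma>\<^sub>v\<close> in
  an internal triangle, an element of \<open>M(w)\<close> killed by the arrow \<open>y\<close> that lies \<open>n\<close> steps after the
  side opposite to \<open>e\<close>, and it is a coboundary if these elements lie in the image of the arrow
  preceding \<open>y\<close>.  In \<open>M(w)\<close> the kernel of \<open>y\<close> and the image of the preceding arrow differ exactly by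
  the basis vectors at the ends of \<open>\<gamma>\<^sub>w\<close> opposite to \<open>y\<close> (\<open>kernel_in_image\<close>).  So the cocycle is
  determined modulo coboundaries by its coefficients at those ends, and these are arbitrary: the
  dimension of \<open>Ext\<^sup>n\<close> is the number of the pairs \<open>(e, f)\<close> of ends for which the side opposite to
  \<open>f\<close> lies, in an internal triangle, \<open>n\<close> steps after the one opposite to \<open>e\<close> (\<open>evaluation_Coc\<close>, \<open>dim_quotient\<close>).  For
  \<open>n = 2\<close> these are the pairs at which \<open>\<gamma>\<^sub>v\<close> follows \<open>\<gamma>\<^sub>w\<close>, and they depend only on \<open>n\<close> modulo \<open>3\<close>.
  An arbitrary resolution \<open>P\<close> is compared with the explicit one; cocycles on \<open>P\<close> are evaluated at
  the images of the generators belonging to the ends.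

  Evaluated in this way, a class induced by an arrow extension at \<open>(e, f)\<close> vanishes at all other
  pairs (\<open>arrow_class\<close>).  At \<open>(e, f)\<close> its value is the coefficient at the top of \<open>R(\<alpha>)\<close> of
  \<open>\<rho>(c\<^sub>0 \<alpha>)\<close>, where \<open>c\<^sub>0\<close> lifts the basis vector at \<open>e\<close> to the projective cover.  Since \<open>\<rho>\<close> splits,
  this coefficient is not \<open>0\<close>: an element of the syzygy which generates \<open>R(\<alpha>)\<close> is killed by \<open>\<beta>\<close>,
  hence is a multiple of \<open>\<alpha>\<close>, and modulo the elements \<open>m \<alpha>\<close> with \<open>m\<close> in the syzygy, which have no
  coefficient at the top, it is a scalar multiple of \<open>c\<^sub>0 \<alpha>\<close> (\<open>top_coefficient_nonzero\<close>).  Thus the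
  classes form a basis if ends match.  They exist since the explicit resolution exhibits \<open>R(\<alpha>)\<close> as a direct summand of its
  first syzygy (\<open>R_summand_of_syzygy\<close>).
\<close>

section \<open>The path algebra\<close>

definition path_end :: "('a, 's) pre_digraph \<Rightarrow> 'a \<Rightarrow> 's list \<Rightarrow> 'a" where
  "path_end Q u xs = (if xs = [] then u else head Q (last xs))"

lemma last_awalk_verts: "last (pre_digraph.awalk_verts Q u xs) = path_end Q u xs"
proof -
  have ne: "pre_digraph.awalk_verts Q u xs \<noteq> []" for u xs
    by (cases xs) (auto simp: pre_digraph.awalk_verts.simps)
  show ?thesis
    by (induction xs arbitrary: u) (auto simp: pre_digraph.awalk_verts.simps path_end_def ne)
qed

lemma path_end_Nil [simp]: "path_end Q u [] = u"
  and path_end_Cons [simp]: "path_end Q u (x # xs) = path_end Q (head Q x) xs"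
  and path_end_append [simp]: "path_end Q u (xs @ ys) = path_end Q (path_end Q u xs) ys"
  by (auto simp: path_end_def)

lemma path_algebra_simps:
  fixes f g :: "('a, 's) path \<Rightarrow> 'k::field"
  shows "carrier (path_algebra Q) = {f :: ('a, 's) path \<Rightarrow> 'k. finite {q. f q \<noteq> 0} \<and> {q. f q \<noteq> 0} \<subseteq> quiver_paths Q}"
    and "(f \<otimes>\<^bsub>path_algebra Q\<^esub> g) (u, xs) =
      (\<Sum>k\<le>length xs. f (u, take k xs) * g (path_end Q u (take k xs), drop k xs))"
    and "\<one>\<^bsub>path_algebra Q\<^esub> (u, xs) = (if u \<in> verts Q \<and> xs = [] then 1 else (0 :: 'k))"
    and "\<zero>\<^bsub>path_algebra Q\<^esub> = (\<lambda>_. 0 :: 'k)"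
    and "(f \<oplus>\<^bsub>path_algebra Q\<^esub> g) = (\<lambda>q. f q + g q)"
  by (simp_all add: path_algebra_def last_awalk_verts)

lemma path_algebra_mult_elt:
  fixes g :: "('a, 's) path \<Rightarrow> 'k::field"
  shows "(path_elt (v, [x]) \<otimes>\<^bsub>path_algebra Q\<^esub> g) (u, xs) =
      (case xs of [] \<Rightarrow> 0 | y # ys \<Rightarrow> if u = v \<and> y = x then g (head Q x, ys) else 0)"
    and "(g \<otimes>\<^bsub>path_algebra Q\<^esub> path_elt (v, [x])) (u, xs) =
      (if xs \<noteq> [] \<and> last xs = x \<and> path_end Q u (butlast xs) = v then g (u, butlast xs) else 0)"
    and "(path_elt (v, []) \<otimes>\<^bsub>path_algebra Q\<^esub> g) (u, xs) = (if u = v then g (u, xs) else 0)"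
    and "(g \<otimes>\<^bsub>path_algebra Q\<^esub> path_elt (v, [])) (u, xs) = (if path_end Q u xs = v then g (u, xs) else 0)"
proof -
  show "(path_elt (v, [x]) \<otimes>\<^bsub>path_algebra Q\<^esub> g) (u, xs) =
      (case xs of [] \<Rightarrow> 0 | y # ys \<Rightarrow> if u = v \<and> y = x then g (head Q x, ys) else 0)"
  proof (cases xs)
    case (Cons y ys)
    have "(path_elt (v, [x]) \<otimes>\<^bsub>path_algebra Q\<^esub> g) (u, xs) =
      (\<Sum>k\<le>length xs. if k = 1 then (if u = v \<and> y = x then g (head Q x, ys) else 0) else 0)"
      unfolding path_algebra_simps
      by (rule sum.cong) (auto simp: path_elt_def Cons take_Cons' drop_Cons' split: if_splits)
    also have "\<dots> = (if u = v \<and> y = x then g (head Q x, ys) else 0)"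
      by (subst sum.delta) (auto simp: Cons)
    finally show ?thesis by (simp add: Cons)
  qed (simp add: path_algebra_simps path_elt_def)
  show "(g \<otimes>\<^bsub>path_algebra Q\<^esub> path_elt (v, [x])) (u, xs) =
      (if xs \<noteq> [] \<and> last xs = x \<and> path_end Q u (butlast xs) = v then g (u, butlast xs) else 0)"
  proof (cases xs rule: rev_cases)
    case (snoc ys y)
    have "(g \<otimes>\<^bsub>path_algebra Q\<^esub> path_elt (v, [x])) (u, xs) =
      (\<Sum>k\<le>length xs. if k = length ys then (if y = x \<and> path_end Q u ys = v then g (u, ys) else 0) else 0)"
      unfolding path_algebra_simps
    proof (rule sum.cong[OF refl])
      fix k assume "k \<in> {..length xs}"
      then show "g (u, take k xs) * path_elt (v, [x]) (path_end Q u (take k xs), drop k xs) =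
        (if k = length ys then (if y = x \<and> path_end Q u ys = v then g (u, ys) else 0) else 0)"
      proof (cases "k = length ys")
        case False
        then have "drop k xs \<noteq> [x]"
          using \<open>k \<in> {..length xs}\<close> by (metis atMost_iff diff_diff_cancel length_append_singleton length_drop
              One_nat_def diff_Suc_1 length_Cons list.size(3) snoc)
        with False show ?thesis by (simp add: path_elt_def)
      qed (auto simp: path_elt_def snoc)
    qed
    then show ?thesis by (simp add: snoc)
  qed (simp add: path_algebra_simps path_elt_def)
  have "(path_elt (v, []) \<otimes>\<^bsub>path_algebra Q\<^esub> g) (u, xs) =
      (\<Sum>k\<le>length xs. if k = 0 then (if u = v then g (u, xs) else 0) else 0)"
    unfolding path_algebra_simps
    by (rule sum.cong) (auto simp: path_elt_def)
  then show "(path_elt (v, []) \<otimes>\<^bsub>path_algebra Q\<^esub> g) (u, xs) = (if u = v then g (u, xs) else 0)"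
    by simp
  have "(g \<otimes>\<^bsub>path_algebra Q\<^esub> path_elt (v, [])) (u, xs) =
      (\<Sum>k\<le>length xs. if k = length xs then (if path_end Q u xs = v then g (u, xs) else 0) else 0)"
    unfolding path_algebra_simps
    by (rule sum.cong) (auto simp: path_elt_def)
  then show "(g \<otimes>\<^bsub>path_algebra Q\<^esub> path_elt (v, [])) (u, xs) = (if path_end Q u xs = v then g (u, xs) else 0)"
    by simp
qed

lemma (in wf_digraph) quiver_paths_iff: "(u, xs) \<in> quiver_paths G \<longleftrightarrow> awalk u xs (path_end G u xs)"
  unfolding quiver_paths_def using awlast_if_cas last_awalk_verts[of G]
  by (auto simp: awalk_def) 

lemma (in wf_digraph) quiver_paths_append:
  "(u, xs @ ys) \<in> quiver_paths G \<longleftrightarrow> (u, xs) \<in> quiver_paths G \<and> (path_end G u xs, ys) \<in> quiver_paths G"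
  using awalk_append_iff[of u xs ys] last_awalk_verts[of G] by (simp add: quiver_paths_iff)

lemma (in wf_digraph) quiver_paths_Nil: "(u, []) \<in> quiver_paths G \<longleftrightarrow> u \<in> verts G"
  by (simp add: quiver_paths_iff awalk_Nil_iff)

lemma (in wf_digraph) quiver_paths_Cons:
  "(u, x # xs) \<in> quiver_paths G \<longleftrightarrow> x \<in> arcs G \<and> tail G x = u \<and> (head G x, xs) \<in> quiver_paths G"
  by (auto simp: quiver_paths_iff awalk_Cons_iff)

lemma (in wf_digraph) quiver_paths_end: "(u, xs) \<in> quiver_paths G \<Longrightarrow> path_end G u xs \<in> verts G"
  by (auto simp: quiver_paths_iff)

lemma (in wf_digraph) path_algebra_closed:
  fixes f g :: "('a, 'b) path \<Rightarrow> 'k::field"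
  assumes f: "f \<in> carrier (path_algebra G)" and g: "g \<in> carrier (path_algebra G)"
  shows "f \<otimes>\<^bsub>path_algebra G\<^esub> g \<in> carrier (path_algebra G)"
proof -
  let ?h = "f \<otimes>\<^bsub>path_algebra G\<^esub> g"
  let ?cat = "\<lambda>((u, xs), (v, ys)). (u, xs @ ys)"
  have "{q. ?h q \<noteq> 0} \<subseteq> ?cat ` {((u, xs), q'). f (u, xs) \<noteq> 0 \<and> g q' \<noteq> 0 \<and> fst q' = path_end G u xs}"
  proof
    fix q assume "q \<in> {q. ?h q \<noteq> 0}"
    moreover obtain u xs where q: "q = (u, xs)" by fastforce
    ultimately have "(\<Sum>k\<le>length xs. f (u, take k xs) * g (path_end G u (take k xs), drop k xs)) \<noteq> 0"
      by (simp add: path_algebra_simps)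
    then obtain k where "f (u, take k xs) * g (path_end G u (take k xs), drop k xs) \<noteq> 0"
      by (meson sum.neutral)
    then show "q \<in> ?cat ` {((u, xs), q'). f (u, xs) \<noteq> 0 \<and> g q' \<noteq> 0 \<and> fst q' = path_end G u xs}"
      by (intro image_eqI[of _ _ "((u, take k xs), (path_end G u (take k xs), drop k xs))"]) (auto simp: q)
  qed
  moreover have "?cat ` {((u, xs), q'). f (u, xs) \<noteq> 0 \<and> g q' \<noteq> 0 \<and> fst q' = path_end G u xs} \<subseteq> quiver_paths G"
    using f g by (auto simp: path_algebra_simps quiver_paths_append)
  moreover have "finite (?cat ` {((u, xs), q'). f (u, xs) \<noteq> 0 \<and> g q' \<noteq> 0 \<and> fst q' = path_end G u xs})"
  proof (rule finite_imageI, rule finite_subset)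
    show "finite ({q. f q \<noteq> 0} \<times> {q. g q \<noteq> 0})" using f g by (auto simp: path_algebra_simps)
  qed auto
  ultimately show ?thesis
    by (auto simp: path_algebra_simps(1) intro: finite_subset)
qed

text \<open>
  Both products are sums over the ways to cut a path into three pieces.
\<close>

lemma path_algebra_assoc:
  fixes f g h :: "('a, 'b) path \<Rightarrow> 'k::field"
  shows "(f \<otimes>\<^bsub>path_algebra G\<^esub> g) \<otimes>\<^bsub>path_algebra G\<^esub> h = f \<otimes>\<^bsub>path_algebra G\<^esub> (g \<otimes>\<^bsub>path_algebra G\<^esub> h)"
proof (rule ext, clarify)
  fix u :: 'a and xs :: "'b list"
  let ?n = "length xs" and ?e = "\<lambda>k. path_end G u (take k xs)"
  let ?F = "\<lambda>l m. f (u, take l xs) * g (?e l, take m (drop l xs)) * h (?e (l + m), drop (l + m) xs)"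
  have e: "path_end G (?e l) (take m (drop l xs)) = ?e (l + m)" for l m
    by (simp add: take_add flip: path_end_append)
  have "((f \<otimes>\<^bsub>path_algebra G\<^esub> g) \<otimes>\<^bsub>path_algebra G\<^esub> h) (u, xs) = (\<Sum>k\<le>?n. \<Sum>l\<le>k. ?F l (k - l))"
    unfolding path_algebra_simps
    by (intro sum.cong refl) (auto simp: sum_distrib_right min_def drop_take intro!: sum.cong)
  also have "\<dots> = (\<Sum>(l, m)\<in>{(l, m). l + m \<le> ?n}. ?F l m)"
    by (rule sum.triangle_reindex_eq[symmetric])
  also have "{(l, m). l + m \<le> ?n} = Sigma {..?n} (\<lambda>l. {..?n - l})" by auto
  also have "(\<Sum>(l, m)\<in>Sigma {..?n} (\<lambda>l. {..?n - l}). ?F l m) = (\<Sum>l\<le>?n. \<Sum>m\<le>?n - l. ?F l m)"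
    by (rule sum.Sigma[symmetric]) auto
  also have "\<dots> = (f \<otimes>\<^bsub>path_algebra G\<^esub> (g \<otimes>\<^bsub>path_algebra G\<^esub> h)) (u, xs)"
    unfolding path_algebra_simps
    by (intro sum.cong refl) (auto simp: sum_distrib_left e mult.assoc add.commute intro!: sum.cong)
  finally show "((f \<otimes>\<^bsub>path_algebra G\<^esub> g) \<otimes>\<^bsub>path_algebra G\<^esub> h) (u, xs) = (f \<otimes>\<^bsub>path_algebra G\<^esub> (g \<otimes>\<^bsub>path_algebra G\<^esub> h)) (u, xs)" .
qed

lemma (in fin_digraph) ring_path_algebra: "ring (path_algebra G :: (('a, 'b) path \<Rightarrow> 'k::field) ring)"
proof (rule ringI)
  let ?R = "path_algebra G :: (('a, 'b) path \<Rightarrow> 'k::field) ring"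
  show "abelian_group ?R"
  proof (rule abelian_groupI)
    fix f g :: "('a, 'b) path \<Rightarrow> 'k"
    assume fg: "f \<in> carrier ?R" "g \<in> carrier ?R"
    have "{q. f q + g q \<noteq> 0} \<subseteq> {q. f q \<noteq> 0} \<union> {q. g q \<noteq> 0}" by auto
    with fg show "f \<oplus>\<^bsub>?R\<^esub> g \<in> carrier ?R"
      by (auto simp: path_algebra_simps intro: finite_subset)
    have "(\<lambda>q. - f q) \<oplus>\<^bsub>?R\<^esub> f = \<zero>\<^bsub>?R\<^esub>" by (simp add: path_algebra_simps)
    moreover have "(\<lambda>q. - f q) \<in> carrier ?R" using fg by (auto simp: path_algebra_simps)
    ultimately show "\<exists>y\<in>carrier ?R. y \<oplus>\<^bsub>?R\<^esub> f = \<zero>\<^bsub>?R\<^esub>" by blast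
  qed (auto simp: path_algebra_simps add_ac)
  show "monoid ?R"
  proof (rule monoidI)
    have "{q. \<one>\<^bsub>?R\<^esub> q \<noteq> 0} \<subseteq> verts G \<times> {[]}"
      by (auto simp: path_algebra_simps split: if_splits)
    moreover have "verts G \<times> {[]} \<subseteq> quiver_paths G" by (auto simp: quiver_paths_Nil)
    ultimately show "\<one>\<^bsub>?R\<^esub> \<in> carrier ?R"
      by (auto simp: path_algebra_simps(1) intro: finite_subset)
    fix f :: "('a, 'b) path \<Rightarrow> 'k" assume f: "f \<in> carrier ?R"
    have 0: "f (u, xs) = 0" if "u \<notin> verts G \<or> path_end G u xs \<notin> verts G" for u xs
    proof (rule ccontr)
      assume "f (u, xs) \<noteq> 0"
      then have "(u, xs) \<in> quiver_paths G" using f by (auto simp: path_algebra_simps)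
      then show False using that quiver_paths_end[of u xs] quiver_paths_append[of u "[]" xs]
        by (auto simp: quiver_paths_Nil)
    qed
    show "\<one>\<^bsub>?R\<^esub> \<otimes>\<^bsub>?R\<^esub> f = f"
    proof (rule ext, clarify)
      fix u xs
      have "(\<one>\<^bsub>?R\<^esub> \<otimes>\<^bsub>?R\<^esub> f) (u, xs) = (\<Sum>k\<le>length xs. if k = 0 then f (u, xs) else 0)"
        unfolding path_algebra_simps by (rule sum.cong) (auto simp: 0)
      then show "(\<one>\<^bsub>?R\<^esub> \<otimes>\<^bsub>?R\<^esub> f) (u, xs) = f (u, xs)" by simp
    qed
    show "f \<otimes>\<^bsub>?R\<^esub> \<one>\<^bsub>?R\<^esub> = f"
    proof (rule ext, clarify)
      fix u xs
      have "(f \<otimes>\<^bsub>?R\<^esub> \<one>\<^bsub>?R\<^esub>) (u, xs) = (\<Sum>k\<le>length xs. if k = length xs then f (u, xs) else 0)"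
        unfolding path_algebra_simps by (rule sum.cong) (auto simp: 0)
      then show "(f \<otimes>\<^bsub>?R\<^esub> \<one>\<^bsub>?R\<^esub>) (u, xs) = f (u, xs)" by simp
    qed
  qed (auto intro: path_algebra_closed path_algebra_assoc)
qed (auto simp: path_algebra_simps distrib_left distrib_right sum.distrib)

lemma path_elt_closed: "q \<in> quiver_paths Q \<Longrightarrow> (\<lambda>p. c * path_elt q p) \<in> carrier (path_algebra Q)"
  by (auto simp: path_algebra_simps path_elt_def split: if_splits intro: finite_subset[of _ "{q}"])

lemma path_algebra_induct [consumes 1, case_names zero elt add]:
  fixes f :: "('a, 'b) path \<Rightarrow> 'k::field"
  assumes "f \<in> carrier (path_algebra G)"
    and zero: "P (\<lambda>_. 0)"
    and elt: "\<And>c q. f q \<noteq> 0 \<Longrightarrow> q \<in> quiver_paths G \<Longrightarrow> P (\<lambda>p. c * path_elt q p)"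
    and add: "\<And>g h. g \<in> carrier (path_algebra G) \<Longrightarrow> h \<in> carrier (path_algebra G) \<Longrightarrow> P g \<Longrightarrow> P h \<Longrightarrow> P (\<lambda>p. g p + h p)"
  shows "P f"
proof -
  have "finite S \<Longrightarrow> S \<subseteq> {q. f q \<noteq> 0} \<Longrightarrow> P (\<lambda>p. if p \<in> S then f p else 0)" for S
  proof (induction S rule: finite_induct)
    case empty
    then show ?case using zero by simp
  next
    case (insert q S)
    have q: "q \<in> quiver_paths G" using insert.prems assms(1) by (auto simp: path_algebra_simps)
    have "P (\<lambda>p. (\<lambda>p. f q * path_elt q p) p + (\<lambda>p. if p \<in> S then f p else 0) p)"
    proof (rule add)
      show "(\<lambda>p. if p \<in> S then f p else 0) \<in> carrier (path_algebra G)"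
        using assms(1) insert by (auto simp: path_algebra_simps)
      show "(\<lambda>p. f q * path_elt q p) \<in> carrier (path_algebra G)" by (rule path_elt_closed[OF q])
      show "P (\<lambda>p. f q * path_elt q p)" using insert.prems q by (intro elt) auto
      show "P (\<lambda>p. if p \<in> S then f p else 0)" using insert by auto
    qed
    also have "(\<lambda>p. (\<lambda>p. f q * path_elt q p) p + (\<lambda>p. if p \<in> S then f p else 0) p)
      = (\<lambda>p. if p \<in> insert q S then f p else 0)"
      using insert.hyps by (auto simp: path_elt_def fun_eq_iff)
    finally show ?case .
  qed
  note restricted = this
  have "P (\<lambda>p. if p \<in> {q. f q \<noteq> 0} then f p else 0)"
    by (rule restricted) (use assms(1) in \<open>auto simp: path_algebra_simps(1)\<close>)
  moreover have "(\<lambda>p. if p \<in> {q. f q \<noteq> 0} then f p else 0) = f" by (auto simp: fun_eq_iff)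
  ultimately show ?thesis by (simp only:)
qed

lemma path_elt_mult:
  fixes Q :: "('a, 'b) pre_digraph"
  shows "path_elt (u, xs) \<otimes>\<^bsub>path_algebra Q\<^esub> path_elt (v, ys) =
    (if path_end Q u xs = v then path_elt (u, xs @ ys) else \<zero>\<^bsub>path_algebra Q\<^esub> :: ('a, 'b) path \<Rightarrow> 'k::field)"
proof (rule ext, clarify)
  fix u' zs
  have *: "take k zs = xs \<and> drop k zs = ys \<longleftrightarrow> k = length xs \<and> zs = xs @ ys" if "k \<le> length zs" for k
    using that by (auto simp: append_eq_conv_conj)
  have "path_elt (u, xs) (u', take k zs) * path_elt (v, ys) (path_end Q u' (take k zs), drop k zs)
     = (if k = length xs then (if u' = u \<and> zs = xs @ ys \<and> path_end Q u xs = v then 1 else 0 :: 'k) else 0)"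
    if "k \<le> length zs" for k
  proof (cases "take k zs = xs \<and> drop k zs = ys")
    case True
    then show ?thesis using *[OF that] by (simp add: path_elt_def)
  next
    case False
    then have "\<not> (k = length xs \<and> zs = xs @ ys)" using *[OF that] by blast
    then show ?thesis using False by (auto simp: path_elt_def)
  qed
  then have "(path_elt (u, xs) \<otimes>\<^bsub>path_algebra Q\<^esub> path_elt (v, ys)) (u', zs) =
     (\<Sum>k\<le>length zs. if k = length xs then (if u' = u \<and> zs = xs @ ys \<and> path_end Q u xs = v then 1 else 0 :: 'k) else 0)"
    unfolding path_algebra_simps by (intro sum.cong) auto
  then show "(path_elt (u, xs) \<otimes>\<^bsub>path_algebra Q\<^esub> path_elt (v, ys)) (u', zs) =
    (if path_end Q u xs = v then path_elt (u, xs @ ys) else \<zero>\<^bsub>path_algebra Q\<^esub> :: ('a, 'b) path \<Rightarrow> 'k) (u', zs)"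
    by (auto simp: path_elt_def path_algebra_simps)
qed

section \<open>Right modules, projectives and the comparison of resolutions\<close>

context right_module
begin

lemma smult_zero_ring [simp]: "m \<in> carrier M \<Longrightarrow> \<zero>\<^bsub>R\<^esub> \<odot>\<^bsub>M\<^esub> m = \<zero>\<^bsub>M\<^esub>"
  using smult_add_ring[of "\<zero>\<^bsub>R\<^esub>" "\<zero>\<^bsub>R\<^esub>" m] smult_closed[of "\<zero>\<^bsub>R\<^esub>" m]
  by (metis M.add.r_cancel_one R.zero_closed R.add.l_one)

lemma smult_zero_module [simp]: "a \<in> carrier R \<Longrightarrow> a \<odot>\<^bsub>M\<^esub> \<zero>\<^bsub>M\<^esub> = \<zero>\<^bsub>M\<^esub>"
  using smult_add_module[of a "\<zero>\<^bsub>M\<^esub>" "\<zero>\<^bsub>M\<^esub>"] smult_closed[of a "\<zero>\<^bsub>M\<^esub>"]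
  by (metis M.add.r_cancel_one M.zero_closed M.add.l_one)

lemma smult_minus_ring: "a \<in> carrier R \<Longrightarrow> m \<in> carrier M \<Longrightarrow> (\<ominus>\<^bsub>R\<^esub> a) \<odot>\<^bsub>M\<^esub> m = \<ominus>\<^bsub>M\<^esub> (a \<odot>\<^bsub>M\<^esub> m)"
  by (metis M.minus_equality R.add.inv_closed R.l_neg smult_add_ring smult_closed smult_zero_ring)

end

lemma module_homI:
  assumes "\<And>x. x \<in> carrier M \<Longrightarrow> f x \<in> carrier N"
    and "\<And>x y. x \<in> carrier M \<Longrightarrow> y \<in> carrier M \<Longrightarrow> f (x \<oplus>\<^bsub>M\<^esub> y) = f x \<oplus>\<^bsub>N\<^esub> f y"
    and "\<And>a x. a \<in> carrier R \<Longrightarrow> x \<in> carrier M \<Longrightarrow> f (a \<odot>\<^bsub>M\<^esub> x) = a \<odot>\<^bsub>N\<^esub> f x"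
  shows "f \<in> module_hom R M N"
  using assms by (auto simp: LinearCombinations.module_hom_def)

lemma module_hom_carrier: "f \<in> module_hom R M N \<Longrightarrow> x \<in> carrier M \<Longrightarrow> f x \<in> carrier N"
  by (auto simp: LinearCombinations.module_hom_def)

lemma module_hom_comp:
  assumes f: "f \<in> module_hom R L M" and g: "g \<in> module_hom R M N"
  shows "(\<lambda>x. g (f x)) \<in> module_hom R L N"
  by (rule module_homI)
    (simp_all add: module_hom_carrier[OF f] module_hom_carrier[OF g]
      LinearCombinations.module_hom_add[OF f] LinearCombinations.module_hom_add[OF g]
      LinearCombinations.module_hom_smult[OF f] LinearCombinations.module_hom_smult[OF g])

lemma module_hom_cong:
  "(\<And>x. x \<in> carrier M \<Longrightarrow> f x = g x) \<Longrightarrow> right_module R M \<Longrightarrow> f \<in> module_hom R M N \<Longrightarrow> g \<in> module_hom R M N"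
proof (rule module_homI)
  assume M: "right_module R M" and f: "f \<in> module_hom R M N" and eq: "\<And>x. x \<in> carrier M \<Longrightarrow> f x = g x"
  interpret M: right_module R M by (rule M)
  show "x \<in> carrier M \<Longrightarrow> g x \<in> carrier N" for x using eq[of x] module_hom_carrier[OF f, of x] by simp
  show "g (x \<oplus>\<^bsub>M\<^esub> y) = g x \<oplus>\<^bsub>N\<^esub> g y" if "x \<in> carrier M" "y \<in> carrier M" for x y
    using that eq[of x] eq[of y] eq[of "x \<oplus>\<^bsub>M\<^esub> y"] LinearCombinations.module_hom_add[OF f] by simp
  show "g (a \<odot>\<^bsub>M\<^esub> x) = a \<odot>\<^bsub>N\<^esub> g x" if "a \<in> carrier R" "x \<in> carrier M" for a x
    using that eq[of x] eq[of "a \<odot>\<^bsub>M\<^esub> x"] LinearCombinations.module_hom_smult[OF f] M.smult_closed by simp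
qed

lemma module_hom_zero:
  assumes "right_module R M" "right_module R N" and f: "f \<in> module_hom R M N"
  shows "f \<zero>\<^bsub>M\<^esub> = \<zero>\<^bsub>N\<^esub>"
proof -
  interpret M: right_module R M by fact
  interpret N: right_module R N by fact
  have "f \<zero>\<^bsub>M\<^esub> \<in> carrier N" using module_hom_carrier[OF f] by simp
  moreover have "f \<zero>\<^bsub>M\<^esub> \<oplus>\<^bsub>N\<^esub> f \<zero>\<^bsub>M\<^esub> = f \<zero>\<^bsub>M\<^esub>"
    using LinearCombinations.module_hom_add[OF f, of "\<zero>\<^bsub>M\<^esub>" "\<zero>\<^bsub>M\<^esub>"] by simp
  ultimately show ?thesis by (simp add: N.M.add.r_cancel_one)
qed

lemma module_hom_minus:
  assumes "right_module R M" "right_module R N" and f: "f \<in> module_hom R M N" and x: "x \<in> carrier M"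
  shows "f (\<ominus>\<^bsub>M\<^esub> x) = \<ominus>\<^bsub>N\<^esub> f x"
proof -
  interpret M: right_module R M by fact
  interpret N: right_module R N by fact
  have "f (\<ominus>\<^bsub>M\<^esub> x) \<oplus>\<^bsub>N\<^esub> f x = \<zero>\<^bsub>N\<^esub>"
    using LinearCombinations.module_hom_add[OF f, of "\<ominus>\<^bsub>M\<^esub> x" x] x module_hom_zero[OF assms(1-3)] by (simp add: M.M.l_neg)
  then show ?thesis
    using module_hom_carrier[OF f] x by (simp add: N.M.minus_equality)
qed

lemma module_hom_diff:
  assumes "right_module R M" "right_module R N" and f: "f \<in> module_hom R M N" and "x \<in> carrier M" "y \<in> carrier M"
  shows "f (x \<ominus>\<^bsub>M\<^esub> y) = f x \<ominus>\<^bsub>N\<^esub> f y"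
proof -
  interpret M: right_module R M by fact
  show ?thesis using assms LinearCombinations.module_hom_add[OF f, of x "\<ominus>\<^bsub>M\<^esub> y"] module_hom_minus[OF assms(1-3)]
    by (simp add: a_minus_def)
qed

lemma module_hom_sub:
  assumes M: "right_module R M" and N: "right_module R N"
    and f: "f \<in> module_hom R M N" and g: "g \<in> module_hom R M N"
  shows "(\<lambda>x. f x \<ominus>\<^bsub>N\<^esub> g x) \<in> module_hom R M N"
proof -
  interpret M: right_module R M by fact
  interpret N: right_module R N by fact
  note [simp] = module_hom_carrier[OF f] module_hom_carrier[OF g]
  show ?thesis
  proof (rule module_homI)
    fix x y assume xy: "x \<in> carrier M" "y \<in> carrier M"
    have "f x \<oplus>\<^bsub>N\<^esub> f y \<oplus>\<^bsub>N\<^esub> (\<ominus>\<^bsub>N\<^esub> g x \<oplus>\<^bsub>N\<^esub> \<ominus>\<^bsub>N\<^esub> g y) = f x \<oplus>\<^bsub>N\<^esub> \<ominus>\<^bsub>N\<^esub> g x \<oplus>\<^bsub>N\<^esub> (f y \<oplus>\<^bsub>N\<^esub> \<ominus>\<^bsub>N\<^esub> g y)"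
      using xy by (simp add: N.M.a_ac)
    then show "f (x \<oplus>\<^bsub>M\<^esub> y) \<ominus>\<^bsub>N\<^esub> g (x \<oplus>\<^bsub>M\<^esub> y) = f x \<ominus>\<^bsub>N\<^esub> g x \<oplus>\<^bsub>N\<^esub> (f y \<ominus>\<^bsub>N\<^esub> g y)"
      using xy LinearCombinations.module_hom_add[OF f] LinearCombinations.module_hom_add[OF g] by (simp add: a_minus_def N.M.minus_add)
  next
    fix a x assume ax: "a \<in> carrier R" "x \<in> carrier M"
    have "a \<odot>\<^bsub>N\<^esub> (\<ominus>\<^bsub>N\<^esub> g x) = \<ominus>\<^bsub>N\<^esub> (a \<odot>\<^bsub>N\<^esub> g x)"
      using ax N.smult_add_module[of a "\<ominus>\<^bsub>N\<^esub> g x" "g x"]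
      by (metis N.M.add.inv_closed N.M.l_neg N.M.minus_equality N.smult_closed N.smult_zero_module module_hom_carrier[OF g])
    then show "f (a \<odot>\<^bsub>M\<^esub> x) \<ominus>\<^bsub>N\<^esub> g (a \<odot>\<^bsub>M\<^esub> x) = a \<odot>\<^bsub>N\<^esub> (f x \<ominus>\<^bsub>N\<^esub> g x)"
      using ax LinearCombinations.module_hom_smult[OF f] LinearCombinations.module_hom_smult[OF g] N.smult_add_module by (simp add: a_minus_def)
  qed (use N.M.minus_closed in auto)
qed

lemma module_hom_plus:
  assumes M: "right_module R M" and N: "right_module R N"
    and f: "f \<in> module_hom R M N" and g: "g \<in> module_hom R M N"
  shows "(\<lambda>x. f x \<oplus>\<^bsub>N\<^esub> g x) \<in> module_hom R M N"
proof -
  interpret M: right_module R M by fact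
  interpret N: right_module R N by fact
  note [simp] = module_hom_carrier[OF f] module_hom_carrier[OF g]
  show ?thesis
  proof (rule module_homI)
    fix x y assume xy: "x \<in> carrier M" "y \<in> carrier M"
    then show "f (x \<oplus>\<^bsub>M\<^esub> y) \<oplus>\<^bsub>N\<^esub> g (x \<oplus>\<^bsub>M\<^esub> y) = f x \<oplus>\<^bsub>N\<^esub> g x \<oplus>\<^bsub>N\<^esub> (f y \<oplus>\<^bsub>N\<^esub> g y)"
      using LinearCombinations.module_hom_add[OF f] LinearCombinations.module_hom_add[OF g] by (simp add: N.M.a_ac)
  next
    fix a x assume ax: "a \<in> carrier R" "x \<in> carrier M"
    then show "f (a \<odot>\<^bsub>M\<^esub> x) \<oplus>\<^bsub>N\<^esub> g (a \<odot>\<^bsub>M\<^esub> x) = a \<odot>\<^bsub>N\<^esub> (f x \<oplus>\<^bsub>N\<^esub> g x)"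
      using LinearCombinations.module_hom_smult[OF f] LinearCombinations.module_hom_smult[OF g] N.smult_add_module by simp
  qed auto
qed

text \<open>
  These two factorizations produce the maps whose existence is asserted by an exact sequence: one
  into the kernel, one out of the image.
\<close>

lemma module_hom_factor_injective:
  assumes A: "right_module R A" and N: "right_module R N"
    and \<iota>: "\<iota> \<in> module_hom R N E" "inj_on \<iota> (carrier N)" and h: "h \<in> module_hom R A E"
    and im: "\<And>x. x \<in> carrier A \<Longrightarrow> h x \<in> \<iota> ` carrier N"
  obtains h' where "h' \<in> module_hom R A N" "\<And>x. x \<in> carrier A \<Longrightarrow> \<iota> (h' x) = h x"
proof -
  interpret A: right_module R A by fact
  interpret N: right_module R N by fact
  define h' where "h' x = inv_into (carrier N) \<iota> (h x)" for x
  have h': "h' x \<in> carrier N" "\<iota> (h' x) = h x" if "x \<in> carrier A" for x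
    using im[OF that] by (simp_all add: h'_def inv_into_into f_inv_into_f)
  have eq: "y = h' x" if "y \<in> carrier N" "\<iota> y = h x" "x \<in> carrier A" for x y
    using inj_onD[OF \<iota>(2), of y "h' x"] that h' by simp
  have "h' \<in> module_hom R A N"
  proof (rule module_homI)
    fix x assume x: "x \<in> carrier A"
    show "h' x \<in> carrier N" by (rule h'(1)[OF x])
    show "h' (x \<oplus>\<^bsub>A\<^esub> y) = h' x \<oplus>\<^bsub>N\<^esub> h' y" if y: "y \<in> carrier A" for y
      using x y h' by (intro eq[symmetric]) (simp_all add: LinearCombinations.module_hom_add[OF \<iota>(1)] LinearCombinations.module_hom_add[OF h])
    show "h' (a \<odot>\<^bsub>A\<^esub> x) = a \<odot>\<^bsub>N\<^esub> h' x" if a: "a \<in> carrier R" for a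
      using x a h' by (intro eq[symmetric])
        (simp_all add: LinearCombinations.module_hom_smult[OF \<iota>(1)] LinearCombinations.module_hom_smult[OF h] A.smult_closed N.smult_closed)
  qed
  then show thesis using h'(2) that by blast
qed

lemma module_hom_factor_surjective:
  assumes A: "right_module R A" and B: "right_module R B" and W: "right_module R W" and L: "right_module R L"
    and q: "q \<in> module_hom R A B" and \<phi>: "\<phi> \<in> module_hom R A L"
    and ker: "\<And>x. x \<in> carrier A \<Longrightarrow> q x = \<zero>\<^bsub>B\<^esub> \<Longrightarrow> \<phi> x = \<zero>\<^bsub>L\<^esub>"
    and h: "h \<in> module_hom R W B" and im: "\<And>x. x \<in> carrier W \<Longrightarrow> h x \<in> q ` carrier A"
  obtains \<psi> where "\<psi> \<in> module_hom R W L" "\<And>x a. x \<in> carrier W \<Longrightarrow> a \<in> carrier A \<Longrightarrow> q a = h x \<Longrightarrow> \<psi> x = \<phi> a"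
proof -
  interpret A: right_module R A by fact
  interpret B: right_module R B by fact
  interpret W: right_module R W by fact
  interpret L: right_module R L by fact
  have eq: "\<phi> a = \<phi> b" if ab: "a \<in> carrier A" "b \<in> carrier A" "q a = q b" for a b
  proof -
    have "\<phi> a \<ominus>\<^bsub>L\<^esub> \<phi> b = \<zero>\<^bsub>L\<^esub>"
      using ker[of "a \<ominus>\<^bsub>A\<^esub> b"] ab module_hom_diff[OF A B q ab(1,2)] module_hom_diff[OF A L \<phi> ab(1,2)]
        module_hom_carrier[OF q ab(2)] by (simp add: a_minus_def B.M.r_neg)
    then show ?thesis
      using L.M.minus_equality[of "\<phi> a" "\<ominus>\<^bsub>L\<^esub> \<phi> b"] module_hom_carrier[OF \<phi> ab(1)] module_hom_carrier[OF \<phi> ab(2)]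
      by (simp add: a_minus_def)
  qed
  define s where "s x = (SOME a. a \<in> carrier A \<and> q a = h x)" for x
  have s: "s x \<in> carrier A" "q (s x) = h x" if "x \<in> carrier W" for x
  proof -
    have "\<exists>a. a \<in> carrier A \<and> q a = h x" using im[OF that] by (metis imageE)
    from someI_ex[OF this] show "s x \<in> carrier A" "q (s x) = h x" unfolding s_def by blast+
  qed
  have val: "\<phi> (s x) = \<phi> a" if "x \<in> carrier W" "a \<in> carrier A" "q a = h x" for x a
    using eq[of "s x" a] s[OF that(1)] that by simp
  have "(\<lambda>x. \<phi> (s x)) \<in> module_hom R W L"
  proof (rule module_homI)
    fix x assume x: "x \<in> carrier W"
    show "\<phi> (s x) \<in> carrier L" by (rule module_hom_carrier[OF \<phi> s(1)[OF x]])
    show "\<phi> (s (x \<oplus>\<^bsub>W\<^esub> y)) = \<phi> (s x) \<oplus>\<^bsub>L\<^esub> \<phi> (s y)" if y: "y \<in> carrier W" for y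
      using val[of "x \<oplus>\<^bsub>W\<^esub> y" "s x \<oplus>\<^bsub>A\<^esub> s y"] x y s
      by (simp add: LinearCombinations.module_hom_add[OF q] LinearCombinations.module_hom_add[OF \<phi>] LinearCombinations.module_hom_add[OF h])
    show "\<phi> (s (a \<odot>\<^bsub>W\<^esub> x)) = a \<odot>\<^bsub>L\<^esub> \<phi> (s x)" if a: "a \<in> carrier R" for a
      using val[of "a \<odot>\<^bsub>W\<^esub> x" "a \<odot>\<^bsub>A\<^esub> s x"] x a s
      by (simp add: LinearCombinations.module_hom_smult[OF q] LinearCombinations.module_hom_smult[OF \<phi>]
          LinearCombinations.module_hom_smult[OF h] W.smult_closed A.smult_closed)
  qed
  then show thesis using val that by blast
qed

subsection \<open>Free modules\<close>

lemma free_module_simps: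
  "carrier (free_module R n) = {f. (\<forall>i<n. f i \<in> carrier R) \<and> (\<forall>i\<ge>n. f i = \<zero>\<^bsub>R\<^esub>)}"
  "\<zero>\<^bsub>free_module R n\<^esub> = (\<lambda>_. \<zero>\<^bsub>R\<^esub>)"
  "f \<oplus>\<^bsub>free_module R n\<^esub> g = (\<lambda>i. f i \<oplus>\<^bsub>R\<^esub> g i)"
  "a \<odot>\<^bsub>free_module R n\<^esub> f = (\<lambda>i. f i \<otimes>\<^bsub>R\<^esub> a)"
  by (simp_all add: free_module_def)

text \<open>
  A module given by vectors over \<open>R\<close> inside a free module is cut out by a family of idempotents.
  It is the direct sum of the right ideals generated by these.
\<close>

definition idem_module :: "'r ring \<Rightarrow> (nat \<Rightarrow> 'r) \<Rightarrow> nat \<Rightarrow> ('r, nat \<Rightarrow> 'r) module" where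
  "idem_module R \<iota> n = (free_module R n)
     \<lparr>carrier := {f \<in> carrier (free_module R n). \<forall>i<n. \<iota> i \<otimes>\<^bsub>R\<^esub> f i = f i}\<rparr>"

lemma idem_module_simps:
  "carrier (idem_module R \<iota> n) =
     {f. (\<forall>i<n. f i \<in> carrier R \<and> \<iota> i \<otimes>\<^bsub>R\<^esub> f i = f i) \<and> (\<forall>i\<ge>n. f i = \<zero>\<^bsub>R\<^esub>)}"
  "\<zero>\<^bsub>idem_module R \<iota> n\<^esub> = (\<lambda>_. \<zero>\<^bsub>R\<^esub>)"
  "f \<oplus>\<^bsub>idem_module R \<iota> n\<^esub> g = (\<lambda>i. f i \<oplus>\<^bsub>R\<^esub> g i)"
  "a \<odot>\<^bsub>idem_module R \<iota> n\<^esub> f = (\<lambda>i. f i \<otimes>\<^bsub>R\<^esub> a)"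
  by (auto simp: idem_module_def free_module_simps)

lemma right_module_idem_module:
  assumes R: "ring R" and \<iota>: "\<And>i. i < n \<Longrightarrow> \<iota> i \<in> carrier R"
  shows "right_module R (idem_module R \<iota> n)"
proof -
  interpret R: ring R by fact
  let ?F = "idem_module R \<iota> n"
  have car: "f i \<in> carrier R" if "f \<in> carrier ?F" for f i
    using that by (cases "i < n") (auto simp: idem_module_simps)
  show ?thesis
  proof (intro right_module.intro right_module_axioms.intro)
    show "abelian_group ?F"
    proof (rule abelian_groupI)
      fix f g h assume "f \<in> carrier ?F" "g \<in> carrier ?F" "h \<in> carrier ?F"
      then show "f \<oplus>\<^bsub>?F\<^esub> g \<oplus>\<^bsub>?F\<^esub> h = f \<oplus>\<^bsub>?F\<^esub> (g \<oplus>\<^bsub>?F\<^esub> h)"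
        using car by (auto simp: idem_module_simps(3) R.a_assoc)
    next
      fix f g assume "f \<in> carrier ?F" "g \<in> carrier ?F"
      then show "f \<oplus>\<^bsub>?F\<^esub> g = g \<oplus>\<^bsub>?F\<^esub> f" using car by (auto simp: idem_module_simps(3) R.a_comm)
    next
      fix f assume f: "f \<in> carrier ?F"
      then show "\<zero>\<^bsub>?F\<^esub> \<oplus>\<^bsub>?F\<^esub> f = f" using car by (auto simp: idem_module_simps(2,3))
      have "(\<lambda>i. \<ominus>\<^bsub>R\<^esub> f i) \<in> carrier ?F" using f \<iota> by (auto simp: idem_module_simps R.r_minus)
      moreover have "(\<lambda>i. \<ominus>\<^bsub>R\<^esub> f i) \<oplus>\<^bsub>?F\<^esub> f = \<zero>\<^bsub>?F\<^esub>"
        using car[OF f] by (auto simp: idem_module_simps(2,3) R.l_neg)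
      ultimately show "\<exists>g\<in>carrier ?F. g \<oplus>\<^bsub>?F\<^esub> f = \<zero>\<^bsub>?F\<^esub>" by blast
    qed (use \<iota> in \<open>auto simp: idem_module_simps R.r_distr\<close>)
    fix a f assume a: "a \<in> carrier R" and f: "f \<in> carrier ?F"
    show "a \<odot>\<^bsub>?F\<^esub> f \<in> carrier ?F"
      using a f \<iota> by (auto simp: idem_module_simps R.m_assoc[symmetric])
    fix b assume b: "b \<in> carrier R"
    show "(a \<oplus>\<^bsub>R\<^esub> b) \<odot>\<^bsub>?F\<^esub> f = a \<odot>\<^bsub>?F\<^esub> f \<oplus>\<^bsub>?F\<^esub> b \<odot>\<^bsub>?F\<^esub> f"
      using car[OF f] a b by (auto simp: idem_module_simps(3,4) R.r_distr)
    show "(a \<otimes>\<^bsub>R\<^esub> b) \<odot>\<^bsub>?F\<^esub> f = b \<odot>\<^bsub>?F\<^esub> (a \<odot>\<^bsub>?F\<^esub> f)"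
      using car[OF f] a b by (auto simp: idem_module_simps(4) R.m_assoc)
  next
    fix a f g assume a: "a \<in> carrier R" and f: "f \<in> carrier ?F" "g \<in> carrier ?F"
    show "a \<odot>\<^bsub>?F\<^esub> (f \<oplus>\<^bsub>?F\<^esub> g) = a \<odot>\<^bsub>?F\<^esub> f \<oplus>\<^bsub>?F\<^esub> a \<odot>\<^bsub>?F\<^esub> g"
      using car f a by (auto simp: idem_module_simps(3,4) R.l_distr)
  next
    fix f assume "f \<in> carrier ?F"
    then show "\<one>\<^bsub>R\<^esub> \<odot>\<^bsub>?F\<^esub> f = f" using car by (auto simp: idem_module_simps(4))
  qed (rule R)
qed

lemma free_module_eq_idem_module:
  assumes "ring R" shows "free_module R n = idem_module R (\<lambda>_. \<one>\<^bsub>R\<^esub>) n"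
proof -
  interpret R: ring R by fact
  have "carrier (free_module R n) = {f \<in> carrier (free_module R n). \<forall>i<n. \<one>\<^bsub>R\<^esub> \<otimes>\<^bsub>R\<^esub> f i = f i}"
    by (auto simp: free_module_simps)
  then show ?thesis unfolding idem_module_def by (simp add: free_module_def)
qed

lemma right_module_free_module: "ring R \<Longrightarrow> right_module R (free_module R n)"
  by (simp add: free_module_eq_idem_module right_module_idem_module ring.ring_simprules)

lemma fg_projective_idem_module:
  assumes R: "ring R" and \<iota>: "\<And>i. i < n \<Longrightarrow> \<iota> i \<in> carrier R" and idem: "\<And>i. i < n \<Longrightarrow> \<iota> i \<otimes>\<^bsub>R\<^esub> \<iota> i = \<iota> i"
  shows "fg_projective R (idem_module R \<iota> n)"
proof -
  interpret R: ring R by fact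
  let ?F = "idem_module R \<iota> n"
  have "(\<lambda>f. f) \<in> module_hom R ?F (free_module R n)"
    by (rule module_homI) (auto simp: free_module_simps idem_module_simps)
  moreover have "(\<lambda>f i. if i < n then \<iota> i \<otimes>\<^bsub>R\<^esub> f i else \<zero>\<^bsub>R\<^esub>) \<in> module_hom R (free_module R n) ?F"
    using \<iota> by (intro module_homI)
      (auto simp: free_module_simps idem_module_simps fun_eq_iff R.r_distr R.m_assoc idem simp flip: R.m_assoc)
  moreover have "\<forall>f\<in>carrier ?F. (\<lambda>i. if i < n then \<iota> i \<otimes>\<^bsub>R\<^esub> f i else \<zero>\<^bsub>R\<^esub>) = f"
    by (auto simp: idem_module_simps fun_eq_iff)
  ultimately show ?thesis
    unfolding fg_projective_def using right_module_idem_module[of R n \<iota>, OF R \<iota>] by blast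
qed

definition unit_vec_at :: "'r ring \<Rightarrow> nat \<Rightarrow> 'r \<Rightarrow> nat \<Rightarrow> 'r" where
  "unit_vec_at R i a = (\<lambda>j. if j = i then a else \<zero>\<^bsub>R\<^esub>)"

definition lin_comb :: "('r, 'm, 'y) module_scheme \<Rightarrow> nat \<Rightarrow> (nat \<Rightarrow> 'm) \<Rightarrow> (nat \<Rightarrow> 'r) \<Rightarrow> 'm" where
  "lin_comb A n a f = (\<Oplus>\<^bsub>A\<^esub>i\<in>{..<n}. f i \<odot>\<^bsub>A\<^esub> a i)"

lemma (in right_module) smult_finsum:
  assumes r: "r \<in> carrier R" and "finite S" "\<And>i. i \<in> S \<Longrightarrow> g i \<in> carrier M"
  shows "r \<odot>\<^bsub>M\<^esub> (\<Oplus>\<^bsub>M\<^esub>i\<in>S. g i) = (\<Oplus>\<^bsub>M\<^esub>i\<in>S. r \<odot>\<^bsub>M\<^esub> g i)"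
  using assms(2,3)
proof (induction S rule: finite_induct)
  case (insert i S)
  have "(\<Oplus>\<^bsub>M\<^esub>i\<in>insert i S. r \<odot>\<^bsub>M\<^esub> g i) = r \<odot>\<^bsub>M\<^esub> g i \<oplus>\<^bsub>M\<^esub> (\<Oplus>\<^bsub>M\<^esub>i\<in>S. r \<odot>\<^bsub>M\<^esub> g i)"
    using insert r by (intro M.finsum_insert) (auto intro!: smult_closed)
  moreover have "(\<Oplus>\<^bsub>M\<^esub>i\<in>insert i S. g i) = g i \<oplus>\<^bsub>M\<^esub> (\<Oplus>\<^bsub>M\<^esub>i\<in>S. g i)"
    using insert by (intro M.finsum_insert) auto
  ultimately show ?case using insert r by (simp add: smult_add_module)
qed (simp add: r)

lemma lin_comb_hom:
  assumes A: "right_module R A" and a: "\<And>i. i < n \<Longrightarrow> a i \<in> carrier A"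
  shows "lin_comb A n a \<in> module_hom R (idem_module R \<iota> n) A"
proof -
  interpret A: right_module R A by fact
  let ?F = "idem_module R \<iota> n"
  have el: "f i \<in> carrier R" if "f \<in> carrier ?F" "i < n" for f i
    using that by (auto simp: idem_module_simps)
  have cl: "f i \<odot>\<^bsub>A\<^esub> a i \<in> carrier A" if "f \<in> carrier ?F" "i < n" for f i
    using that a el by (auto intro!: A.smult_closed)
  show ?thesis
  proof (rule module_homI)
    fix f g assume fg: "f \<in> carrier ?F" "g \<in> carrier ?F"
    have "lin_comb A n a (f \<oplus>\<^bsub>?F\<^esub> g) = (\<Oplus>\<^bsub>A\<^esub>i\<in>{..<n}. f i \<odot>\<^bsub>A\<^esub> a i \<oplus>\<^bsub>A\<^esub> g i \<odot>\<^bsub>A\<^esub> a i)"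
      unfolding lin_comb_def idem_module_simps(3)
      by (intro A.M.finsum_cong') (use fg in \<open>auto simp: A.smult_add_ring el a intro!: cl A.M.a_closed\<close>)
    then show "lin_comb A n a (f \<oplus>\<^bsub>?F\<^esub> g) = lin_comb A n a f \<oplus>\<^bsub>A\<^esub> lin_comb A n a g"
      unfolding lin_comb_def using fg cl by (subst A.M.finsum_addf[symmetric]) auto
  next
    fix r f assume rf: "r \<in> carrier R" "f \<in> carrier ?F"
    have "lin_comb A n a (r \<odot>\<^bsub>?F\<^esub> f) = (\<Oplus>\<^bsub>A\<^esub>i\<in>{..<n}. r \<odot>\<^bsub>A\<^esub> (f i \<odot>\<^bsub>A\<^esub> a i))"
      unfolding lin_comb_def idem_module_simps(4)
      by (intro A.M.finsum_cong') (use rf in \<open>auto simp: A.smult_assoc el a intro!: cl A.smult_closed\<close>)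
    then show "lin_comb A n a (r \<odot>\<^bsub>?F\<^esub> f) = r \<odot>\<^bsub>A\<^esub> lin_comb A n a f"
      unfolding lin_comb_def using rf cl by (subst A.smult_finsum) auto
  qed (use cl in \<open>auto simp: lin_comb_def intro!: A.M.finsum_closed\<close>)
qed

lemma lin_comb_unit:
  assumes A: "right_module R A" and "\<And>i. i < n \<Longrightarrow> a i \<in> carrier A" and "i < n" "r \<in> carrier R"
  shows "lin_comb A n a (unit_vec_at R i r) = r \<odot>\<^bsub>A\<^esub> a i"
proof -
  interpret A: right_module R A by fact
  have "lin_comb A n a (unit_vec_at R i r) = (\<Oplus>\<^bsub>A\<^esub>j\<in>{..<n}. if i = j then r \<odot>\<^bsub>A\<^esub> a j else \<zero>\<^bsub>A\<^esub>)"
    unfolding lin_comb_def unit_vec_at_def using assms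
    by (intro A.M.finsum_cong') (auto intro!: A.smult_closed)
  also have "\<dots> = r \<odot>\<^bsub>A\<^esub> a i"
    using assms by (intro A.M.finsum_singleton) (auto intro!: A.smult_closed)
  finally show ?thesis .
qed

lemma unit_vec_idem_module:
  assumes R: "ring R" and \<iota>: "i < n" "a \<in> carrier R" "\<And>j. j < n \<Longrightarrow> \<iota> j \<in> carrier R" "\<iota> i \<otimes>\<^bsub>R\<^esub> a = a"
  shows "unit_vec_at R i a \<in> carrier (idem_module R \<iota> n)"
proof -
  interpret R: ring R by fact
  show ?thesis using \<iota> by (auto simp: idem_module_simps unit_vec_at_def)
qed

lemma idem_module_induct:
  assumes R: "ring R" and \<iota>: "\<And>i. i < n \<Longrightarrow> \<iota> i \<in> carrier R" and idem: "\<And>i. i < n \<Longrightarrow> \<iota> i \<otimes>\<^bsub>R\<^esub> \<iota> i = \<iota> i"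
    and f: "f \<in> carrier (idem_module R \<iota> n)"
    and zero: "P \<zero>\<^bsub>idem_module R \<iota> n\<^esub>"
    and add: "\<And>f g. f \<in> carrier (idem_module R \<iota> n) \<Longrightarrow> g \<in> carrier (idem_module R \<iota> n) \<Longrightarrow> P f \<Longrightarrow> P g \<Longrightarrow>
      P (f \<oplus>\<^bsub>idem_module R \<iota> n\<^esub> g)"
    and gen: "\<And>i a. i < n \<Longrightarrow> a \<in> carrier R \<Longrightarrow> P (a \<odot>\<^bsub>idem_module R \<iota> n\<^esub> unit_vec_at R i (\<iota> i))"
  shows "P f"
proof -
  interpret R: ring R by fact
  let ?F = "idem_module R \<iota> n"
  interpret F: right_module R ?F by (rule right_module_idem_module[OF R]) (rule \<iota>)
  have fR: "f i \<in> carrier R" for i using f by (cases "i < n") (auto simp: idem_module_simps)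
  have "(\<lambda>i. if i < k then f i else \<zero>\<^bsub>R\<^esub>) \<in> carrier ?F \<and> P (\<lambda>i. if i < k then f i else \<zero>\<^bsub>R\<^esub>)" if "k \<le> n" for k
    using that
  proof (induction k)
    case 0
    then show ?case using zero F.M.zero_closed by (simp add: idem_module_simps(2))
  next
    case (Suc k)
    let ?u = "unit_vec_at R k (\<iota> k)" and ?p = "\<lambda>i. if i < k then f i else \<zero>\<^bsub>R\<^esub>"
    have u: "?u \<in> carrier ?F" using Suc.prems \<iota> idem by (intro unit_vec_idem_module R) auto
    have fk: "f k \<in> carrier R" "\<iota> k \<otimes>\<^bsub>R\<^esub> f k = f k" using Suc.prems f by (auto simp: idem_module_simps)
    have split: "(\<lambda>i. if i < Suc k then f i else \<zero>\<^bsub>R\<^esub>) = ?p \<oplus>\<^bsub>?F\<^esub> (f k \<odot>\<^bsub>?F\<^esub> ?u)"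
      using fR fk by (auto simp: idem_module_simps unit_vec_at_def fun_eq_iff less_Suc_eq)
    have IH: "?p \<in> carrier ?F" "P ?p" using Suc by auto
    have k: "k < n" using Suc.prems by simp
    have uf: "f k \<odot>\<^bsub>?F\<^esub> ?u \<in> carrier ?F" by (rule F.smult_closed[OF fk(1) u])
    show ?case unfolding split using F.M.a_closed[OF IH(1) uf] add[OF IH(1) uf IH(2) gen[OF k fk(1)]] by blast
  qed
  note upto = this
  have "P (\<lambda>i. if i < n then f i else \<zero>\<^bsub>R\<^esub>)" using upto[of n] by blast
  moreover have "(\<lambda>i. if i < n then f i else \<zero>\<^bsub>R\<^esub>) = f"
    using f by (auto simp: idem_module_simps fun_eq_iff)
  ultimately show ?thesis by (simp only:)
qed

lemma idem_module_hom_eqI: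
  assumes R: "ring R" and \<iota>: "\<And>i. i < n \<Longrightarrow> \<iota> i \<in> carrier R" and idem: "\<And>i. i < n \<Longrightarrow> \<iota> i \<otimes>\<^bsub>R\<^esub> \<iota> i = \<iota> i"
    and B: "right_module R B"
    and g: "g \<in> module_hom R (idem_module R \<iota> n) B" and h: "h \<in> module_hom R (idem_module R \<iota> n) B"
    and eq: "\<And>i. i < n \<Longrightarrow> g (unit_vec_at R i (\<iota> i)) = h (unit_vec_at R i (\<iota> i))"
    and f: "f \<in> carrier (idem_module R \<iota> n)"
  shows "g f = h f"
proof -
  let ?F = "idem_module R \<iota> n"
  have F: "right_module R ?F" using R \<iota> by (rule right_module_idem_module)
  have u: "unit_vec_at R i (\<iota> i) \<in> carrier ?F" if "i < n" for i
    using that \<iota> idem by (intro unit_vec_idem_module R) auto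
  show ?thesis
  proof (rule idem_module_induct[of R n \<iota> f "\<lambda>f. g f = h f", OF R \<iota> idem f])
    show "g \<zero>\<^bsub>?F\<^esub> = h \<zero>\<^bsub>?F\<^esub>" using module_hom_zero[OF F B g] module_hom_zero[OF F B h] by simp
    show "g (a \<odot>\<^bsub>?F\<^esub> unit_vec_at R i (\<iota> i)) = h (a \<odot>\<^bsub>?F\<^esub> unit_vec_at R i (\<iota> i))" if "i < n" "a \<in> carrier R" for i a
      using that u eq by (simp add: LinearCombinations.module_hom_smult[OF g] LinearCombinations.module_hom_smult[OF h])
  qed (simp_all add: LinearCombinations.module_hom_add[OF g] LinearCombinations.module_hom_add[OF h])
qed

text \<open>
  It suffices to lift the images of the unit vectors of a free module of which \<open>P\<close> is a summand.
\<close>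

lemma fg_projective_lift:
  assumes P: "fg_projective R P" and A: "right_module R A" and B: "right_module R B"
    and f: "f \<in> module_hom R A B" and h: "h \<in> module_hom R P B"
    and im: "\<And>x. x \<in> carrier P \<Longrightarrow> h x \<in> f ` carrier A"
  obtains h' where "h' \<in> module_hom R P A" "\<And>x. x \<in> carrier P \<Longrightarrow> f (h' x) = h x"
proof -
  obtain n i r where i: "i \<in> module_hom R P (free_module R n)" and r: "r \<in> module_hom R (free_module R n) P"
    and ri: "\<And>x. x \<in> carrier P \<Longrightarrow> r (i x) = x" and "right_module R P"
    using P unfolding fg_projective_def by blast
  interpret P: right_module R P by fact
  interpret A: right_module R A by fact
  let ?u = "\<lambda>j. unit_vec_at R j \<one>\<^bsub>R\<^esub>"
  have F: "free_module R n = idem_module R (\<lambda>_. \<one>\<^bsub>R\<^esub>) n"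
    by (rule free_module_eq_idem_module[OF P.R.ring_axioms])
  have u: "?u j \<in> carrier (free_module R n)" if "j < n" for j
    using that by (auto simp: free_module_simps unit_vec_at_def)
  have "\<exists>a. a \<in> carrier A \<and> f a = h (r (?u j))" if "j < n" for j
    using im[OF module_hom_carrier[OF r u[OF that]]] by auto
  then obtain a where a: "\<And>j. j < n \<Longrightarrow> a j \<in> carrier A" "\<And>j. j < n \<Longrightarrow> f (a j) = h (r (?u j))" by metis
  have l: "lin_comb A n a \<in> module_hom R (free_module R n) A"
    unfolding F using lin_comb_hom[of R A n a, OF A a(1)] by blast
  have eq: "f (lin_comb A n a y) = h (r y)" if "y \<in> carrier (free_module R n)" for y
  proof (rule idem_module_hom_eqI[of R n "\<lambda>_. \<one>\<^bsub>R\<^esub>" B "\<lambda>y. f (lin_comb A n a y)" "\<lambda>y. h (r y)"])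
    show "(\<lambda>y. f (lin_comb A n a y)) \<in> module_hom R (idem_module R (\<lambda>_. \<one>\<^bsub>R\<^esub>) n) B"
      using module_hom_comp[OF l f] by (simp add: F)
    show "(\<lambda>y. h (r y)) \<in> module_hom R (idem_module R (\<lambda>_. \<one>\<^bsub>R\<^esub>) n) B"
      using module_hom_comp[OF r h] by (simp add: F)
    show "f (lin_comb A n a (unit_vec_at R j \<one>\<^bsub>R\<^esub>)) = h (r (unit_vec_at R j \<one>\<^bsub>R\<^esub>))" if "j < n" for j
      using that a A by (simp add: lin_comb_unit A.smult_one)
    show "y \<in> carrier (idem_module R (\<lambda>_. \<one>\<^bsub>R\<^esub>) n)" using that by (simp add: F)
  qed (use B P.R.ring_axioms in auto)
  show thesis
  proof (rule that)
    show "(\<lambda>x. lin_comb A n a (i x)) \<in> module_hom R P A" by (rule module_hom_comp[OF i l])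
    show "f (lin_comb A n a (i x)) = h x" if "x \<in> carrier P" for x
      using eq[OF module_hom_carrier[OF i that]] ri[OF that] by simp
  qed
qed

subsection \<open>The comparison theorem\<close>

lemma projective_resolutionD:
  assumes "projective_resolution R M P d \<epsilon>"
  shows "fg_projective R (P n)" "right_module R (P n)" "d n \<in> module_hom R (P (Suc n)) (P n)"
    "\<epsilon> \<in> module_hom R (P 0) M" "\<epsilon> ` carrier (P 0) = carrier M"
    "x \<in> carrier (P 0) \<Longrightarrow> \<epsilon> x = \<zero>\<^bsub>M\<^esub> \<Longrightarrow> x \<in> d 0 ` carrier (P 1)"
    "y \<in> carrier (P (Suc n)) \<Longrightarrow> d n y = \<zero>\<^bsub>P n\<^esub> \<Longrightarrow> y \<in> d (Suc n) ` carrier (P (Suc (Suc n)))"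
    "z \<in> carrier (P 1) \<Longrightarrow> \<epsilon> (d 0 z) = \<zero>\<^bsub>M\<^esub>"
    "t \<in> carrier (P (Suc (Suc n))) \<Longrightarrow> d n (d (Suc n) t) = \<zero>\<^bsub>P n\<^esub>"
proof -
  note R = assms[unfolded projective_resolution_def]
  have *: "d 0 ` carrier (P 1) = hom_kernel (P 0) M \<epsilon>"
    and **: "d (Suc n) ` carrier (P (Suc (Suc n))) = hom_kernel (P (Suc n)) (P n) (d n)" for n
    using R by blast+
  show "fg_projective R (P n)" "d n \<in> module_hom R (P (Suc n)) (P n)"
    "\<epsilon> \<in> module_hom R (P 0) M" "\<epsilon> ` carrier (P 0) = carrier M"
    using R by blast+
  then show "right_module R (P n)" by (simp add: fg_projective_def)
  show "x \<in> carrier (P 0) \<Longrightarrow> \<epsilon> x = \<zero>\<^bsub>M\<^esub> \<Longrightarrow> x \<in> d 0 ` carrier (P 1)"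
    "z \<in> carrier (P 1) \<Longrightarrow> \<epsilon> (d 0 z) = \<zero>\<^bsub>M\<^esub>"
    using * by (auto simp: hom_kernel_def)
  show "y \<in> carrier (P (Suc n)) \<Longrightarrow> d n y = \<zero>\<^bsub>P n\<^esub> \<Longrightarrow> y \<in> d (Suc n) ` carrier (P (Suc (Suc n)))"
    "t \<in> carrier (P (Suc (Suc n))) \<Longrightarrow> d n (d (Suc n) t) = \<zero>\<^bsub>P n\<^esub>"
    using **[of n] by (auto simp: hom_kernel_def)
qed

text \<open>
  Each component is lifted along the next differential.  Such a lift exists because the composite
  with the previous component is annihilated by the differential below, so that exactness applies;
  this is the condition \<open>ok\<close> carried through the construction.
\<close>

lemma chain_map_exists:
  assumes P: "projective_resolution R M P d \<epsilon>" and P': "projective_resolution R M P' d' \<epsilon>'" and M: "right_module R M"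
  obtains \<Phi> where "\<And>n. \<Phi> n \<in> module_hom R (P n) (P' n)"
    "\<And>x. x \<in> carrier (P 0) \<Longrightarrow> \<epsilon>' (\<Phi> 0 x) = \<epsilon> x"
    "\<And>n x. x \<in> carrier (P (Suc n)) \<Longrightarrow> d' n (\<Phi> (Suc n) x) = \<Phi> n (d n x)"
proof -
  note D = projective_resolutionD[OF P] and D' = projective_resolutionD[OF P']
  define ok where "ok n \<phi> \<longleftrightarrow> \<phi> \<in> module_hom R (P n) (P' n) \<and>
     (n = 0 \<longrightarrow> (\<forall>x\<in>carrier (P 0). \<epsilon>' (\<phi> x) = \<epsilon> x)) \<and>
     (\<forall>x\<in>carrier (P (Suc n)). \<phi> (d n x) \<in> d' n ` carrier (P' (Suc n)))" for n \<phi>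
  have "\<exists>f. \<forall>n. ok n (f n) \<and> (\<forall>x\<in>carrier (P (Suc n)). d' n (f (Suc n) x) = f n (d n x))"
  proof (rule dependent_nat_choice)
    have "\<And>x. x \<in> carrier (P 0) \<Longrightarrow> \<epsilon> x \<in> \<epsilon>' ` carrier (P' 0)"
      using D(4,5) D'(5) by (auto simp: module_hom_carrier)
    then obtain \<phi> where \<phi>: "\<phi> \<in> module_hom R (P 0) (P' 0)" "\<And>x. x \<in> carrier (P 0) \<Longrightarrow> \<epsilon>' (\<phi> x) = \<epsilon> x"
      using fg_projective_lift[OF D(1) D'(2) M D'(4) D(4)] by metis
    have "\<phi> (d 0 x) \<in> d' 0 ` carrier (P' (Suc 0))" if "x \<in> carrier (P (Suc 0))" for x
      using D'(6)[of "\<phi> (d 0 x)"] \<phi> D(8)[of x] module_hom_carrier[OF D(3) that] that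
      by (simp add: module_hom_carrier[OF \<phi>(1)])
    with \<phi> show "\<exists>\<phi>. ok 0 \<phi>" unfolding ok_def by blast
  next
    fix \<phi> n assume "ok n \<phi>"
    then have \<phi>: "\<phi> \<in> module_hom R (P n) (P' n)" "\<And>x. x \<in> carrier (P (Suc n)) \<Longrightarrow> \<phi> (d n x) \<in> d' n ` carrier (P' (Suc n))"
      by (auto simp: ok_def)
    then obtain \<psi> where \<psi>: "\<psi> \<in> module_hom R (P (Suc n)) (P' (Suc n))"
      "\<And>x. x \<in> carrier (P (Suc n)) \<Longrightarrow> d' n (\<psi> x) = \<phi> (d n x)"
      using fg_projective_lift[OF D(1) D'(2) D'(2) D'(3) module_hom_comp[OF D(3) \<phi>(1)]] by metis
    have "\<psi> (d (Suc n) x) \<in> d' (Suc n) ` carrier (P' (Suc (Suc n)))" if x: "x \<in> carrier (P (Suc (Suc n)))" for x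
    proof (rule D'(7))
      show "\<psi> (d (Suc n) x) \<in> carrier (P' (Suc n))"
        by (rule module_hom_carrier[OF \<psi>(1) module_hom_carrier[OF D(3) x]])
      show "d' n (\<psi> (d (Suc n) x)) = \<zero>\<^bsub>P' n\<^esub>"
        using \<psi>(2)[OF module_hom_carrier[OF D(3) x]] D(9)[OF x] module_hom_zero[OF D(2) D'(2) \<phi>(1)] by simp
    qed
    with \<psi> show "\<exists>\<psi>. ok (Suc n) \<psi> \<and> (\<forall>x\<in>carrier (P (Suc n)). d' n (\<psi> x) = \<phi> (d n x))"
      unfolding ok_def by blast
  qed
  then obtain \<Phi> where "\<And>n. ok n (\<Phi> n)" "\<And>n x. x \<in> carrier (P (Suc n)) \<Longrightarrow> d' n (\<Phi> (Suc n) x) = \<Phi> n (d n x)"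
    by blast
  then show thesis by (intro that[of \<Phi>]) (auto simp: ok_def)
qed

text \<open>
  The homotopy is constructed in the same way, lifting the difference that remains in each degree.
\<close>

lemma chain_map_homotopic_id:
  assumes P: "projective_resolution R M P d \<epsilon>" and M: "right_module R M"
    and \<Phi>: "\<And>n. \<Phi> n \<in> module_hom R (P n) (P n)" "\<And>x. x \<in> carrier (P 0) \<Longrightarrow> \<epsilon> (\<Phi> 0 x) = \<epsilon> x"
      "\<And>n x. x \<in> carrier (P (Suc n)) \<Longrightarrow> d n (\<Phi> (Suc n) x) = \<Phi> n (d n x)"
  obtains H where "\<And>n. H n \<in> module_hom R (P n) (P (Suc n))"
    "\<And>n x. x \<in> carrier (P (Suc n)) \<Longrightarrow> d (Suc n) (H (Suc n) x) = (x \<ominus>\<^bsub>P (Suc n)\<^esub> \<Phi> (Suc n) x) \<ominus>\<^bsub>P (Suc n)\<^esub> H n (d n x)"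
proof -
  note D = projective_resolutionD[OF P]
  have id: "(\<lambda>x. x) \<in> module_hom R (P n) (P n)" for n by (rule module_homI) auto
  have diff: "(\<lambda>x. x \<ominus>\<^bsub>P n\<^esub> \<Phi> n x) \<in> module_hom R (P n) (P n)" for n
    by (rule module_hom_sub[OF D(2) D(2) id \<Phi>(1)])
  have cancel: "x \<ominus>\<^bsub>P n\<^esub> x = \<zero>\<^bsub>P n\<^esub>" if "x \<in> carrier (P n)" for n x
    using abelian_group.r_neg[OF right_module.axioms(2)[OF D(2)] that] by (simp add: a_minus_def)
  define K where "K n h x = (x \<ominus>\<^bsub>P (Suc n)\<^esub> \<Phi> (Suc n) x) \<ominus>\<^bsub>P (Suc n)\<^esub> h (d n x)" for n h x
  have K: "K n h \<in> module_hom R (P (Suc n)) (P (Suc n))" if "h \<in> module_hom R (P n) (P (Suc n))" for n h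
    unfolding K_def by (rule module_hom_sub[OF D(2) D(2) diff module_hom_comp[OF D(3) that]])
  define ok where "ok n h \<longleftrightarrow> h \<in> module_hom R (P n) (P (Suc n)) \<and>
     (\<forall>x\<in>carrier (P (Suc n)). K n h x \<in> d (Suc n) ` carrier (P (Suc (Suc n))))" for n h
  have okI: "ok n h" if h: "h \<in> module_hom R (P n) (P (Suc n))"
    and dh: "\<And>x. x \<in> carrier (P (Suc n)) \<Longrightarrow> d n (h (d n x)) = d n x \<ominus>\<^bsub>P n\<^esub> \<Phi> n (d n x)" for n h
  proof -
    have "K n h x \<in> d (Suc n) ` carrier (P (Suc (Suc n)))" if x: "x \<in> carrier (P (Suc n))" for x
    proof (rule D(7)[OF module_hom_carrier[OF K[OF h] x]])
      note dx = module_hom_carrier[OF D(3) x]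
      have "d n (K n h x) = d n (x \<ominus>\<^bsub>P (Suc n)\<^esub> \<Phi> (Suc n) x) \<ominus>\<^bsub>P n\<^esub> d n (h (d n x))"
        unfolding K_def
        by (rule module_hom_diff[OF D(2) D(2) D(3) module_hom_carrier[OF diff x] module_hom_carrier[OF h dx]])
      also have "d n (x \<ominus>\<^bsub>P (Suc n)\<^esub> \<Phi> (Suc n) x) = d n x \<ominus>\<^bsub>P n\<^esub> \<Phi> n (d n x)"
        using module_hom_diff[OF D(2) D(2) D(3) x module_hom_carrier[OF \<Phi>(1) x]] \<Phi>(3)[OF x] by simp
      finally show "d n (K n h x) = \<zero>\<^bsub>P n\<^esub>"
        using dh[OF x] cancel[OF module_hom_carrier[OF diff dx]] by simp
    qed
    with h show ?thesis by (simp add: ok_def)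
  qed
  have "\<exists>f. \<forall>n. ok n (f n) \<and> (\<forall>x\<in>carrier (P (Suc n)). d (Suc n) (f (Suc n) x) = K n (f n) x)"
  proof (rule dependent_nat_choice)
    have "x \<ominus>\<^bsub>P 0\<^esub> \<Phi> 0 x \<in> d 0 ` carrier (P (Suc 0))" if x: "x \<in> carrier (P 0)" for x
    proof -
      have "\<epsilon> (x \<ominus>\<^bsub>P 0\<^esub> \<Phi> 0 x) = \<epsilon> x \<ominus>\<^bsub>M\<^esub> \<epsilon> x"
        using module_hom_diff[OF D(2) M D(4) x module_hom_carrier[OF \<Phi>(1) x]] \<Phi>(2)[OF x] by simp
      also have "\<dots> = \<zero>\<^bsub>M\<^esub>"
        using abelian_group.r_neg[OF right_module.axioms(2)[OF M] module_hom_carrier[OF D(4) x]] by (simp add: a_minus_def)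
      finally show ?thesis using D(6)[OF module_hom_carrier[OF diff x]] by simp
    qed
    then obtain h where h: "h \<in> module_hom R (P 0) (P (Suc 0))" "\<And>x. x \<in> carrier (P 0) \<Longrightarrow> d 0 (h x) = x \<ominus>\<^bsub>P 0\<^esub> \<Phi> 0 x"
      using fg_projective_lift[OF D(1) D(2) D(2) D(3) diff] by metis
    then have "ok 0 h" by (intro okI) (auto simp: module_hom_carrier[OF D(3)])
    then show "\<exists>h. ok 0 h" by blast
  next
    fix h n assume "ok n h"
    then have h: "h \<in> module_hom R (P n) (P (Suc n))" "\<And>x. x \<in> carrier (P (Suc n)) \<Longrightarrow> K n h x \<in> d (Suc n) ` carrier (P (Suc (Suc n)))"
      by (auto simp: ok_def)
    obtain k where k: "k \<in> module_hom R (P (Suc n)) (P (Suc (Suc n)))" "\<And>x. x \<in> carrier (P (Suc n)) \<Longrightarrow> d (Suc n) (k x) = K n h x"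
      using fg_projective_lift[OF D(1) D(2) D(2) D(3) K[OF h(1)] h(2)] by metis
    have "ok (Suc n) k"
    proof (rule okI[OF k(1)])
      fix x assume x: "x \<in> carrier (P (Suc (Suc n)))"
      let ?y = "d (Suc n) x"
      interpret Pn: right_module R "P (Suc n)" by (rule D(2))
      note y = module_hom_carrier[OF D(3) x]
      have "d (Suc n) (k ?y) = (?y \<ominus>\<^bsub>P (Suc n)\<^esub> \<Phi> (Suc n) ?y) \<ominus>\<^bsub>P (Suc n)\<^esub> \<zero>\<^bsub>P (Suc n)\<^esub>"
        using k(2)[OF y] D(9)[OF x] module_hom_zero[OF D(2) D(2) h(1)] by (simp add: K_def)
      then show "d (Suc n) (k ?y) = ?y \<ominus>\<^bsub>P (Suc n)\<^esub> \<Phi> (Suc n) ?y"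
        using module_hom_carrier[OF diff y] Pn.M.add.inv_one Pn.M.r_zero by (simp add: a_minus_def)
    qed
    with k show "\<exists>k. ok (Suc n) k \<and> (\<forall>x\<in>carrier (P (Suc n)). d (Suc n) (k x) = K n h x)" by blast
  qed
  then obtain H where "\<And>n. ok n (H n)" "\<And>n x. x \<in> carrier (P (Suc n)) \<Longrightarrow> d (Suc n) (H (Suc n) x) = K n (H n) x"
    by blast
  then show thesis by (intro that[of H]) (auto simp: ok_def K_def)
qed

text \<open>
  The homotopy shows that the cohomology class of a cocycle can be computed after passing to
  another resolution and back.
\<close>

lemma cocycle_chain_map_id:
  assumes P: "projective_resolution R M P d \<epsilon>" and M: "right_module R M"
    and \<Phi>: "\<And>n. \<Phi> n \<in> module_hom R (P n) (P n)" "\<And>x. x \<in> carrier (P 0) \<Longrightarrow> \<epsilon> (\<Phi> 0 x) = \<epsilon> x"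
      "\<And>n x. x \<in> carrier (P (Suc n)) \<Longrightarrow> d n (\<Phi> (Suc n) x) = \<Phi> n (d n x)"
    and N: "right_module R N" and f: "f \<in> module_hom R (P (Suc n)) N"
    and cocycle: "\<And>x. x \<in> carrier (P (Suc (Suc n))) \<Longrightarrow> f (d (Suc n) x) = \<zero>\<^bsub>N\<^esub>"
  obtains h where "h \<in> module_hom R (P n) N" "\<And>x. x \<in> carrier (P (Suc n)) \<Longrightarrow> f x = f (\<Phi> (Suc n) x) \<oplus>\<^bsub>N\<^esub> h (d n x)"
proof -
  note D = projective_resolutionD[OF P]
  obtain H where H: "\<And>n. H n \<in> module_hom R (P n) (P (Suc n))"
    "\<And>n x. x \<in> carrier (P (Suc n)) \<Longrightarrow> d (Suc n) (H (Suc n) x) = (x \<ominus>\<^bsub>P (Suc n)\<^esub> \<Phi> (Suc n) x) \<ominus>\<^bsub>P (Suc n)\<^esub> H n (d n x)"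
    using chain_map_homotopic_id[of R M P d \<epsilon> \<Phi>, OF P M \<Phi>] by metis
  interpret N: right_module R N by fact
  show thesis
  proof (rule that)
    show "(\<lambda>x. f (H n x)) \<in> module_hom R (P n) N" by (rule module_hom_comp[OF H(1) f])
    fix x assume x: "x \<in> carrier (P (Suc n))"
    interpret Pn: right_module R "P (Suc n)" by (rule D(2))
    note y = module_hom_carrier[OF \<Phi>(1) x] and z = module_hom_carrier[OF H(1) module_hom_carrier[OF D(3) x]]
    have "f ((x \<ominus>\<^bsub>P (Suc n)\<^esub> \<Phi> (Suc n) x) \<ominus>\<^bsub>P (Suc n)\<^esub> H n (d n x)) = \<zero>\<^bsub>N\<^esub>"
      using cocycle[OF module_hom_carrier[OF H(1) x]] H(2)[OF x] by simp
    then have "(f x \<ominus>\<^bsub>N\<^esub> f (\<Phi> (Suc n) x)) \<ominus>\<^bsub>N\<^esub> f (H n (d n x)) = \<zero>\<^bsub>N\<^esub>"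
      using x y z by (simp add: module_hom_diff[OF D(2) N f])
    then have "f x \<ominus>\<^bsub>N\<^esub> f (\<Phi> (Suc n) x) = f (H n (d n x))"
      using module_hom_carrier[OF f] x y z by (simp add: N.M.minus_closed)
    then show "f x = f (\<Phi> (Suc n) x) \<oplus>\<^bsub>N\<^esub> f (H n (d n x))"
      using module_hom_carrier[OF f] x y z N.M.a_assoc N.M.l_neg
      by (metis N.M.a_comm N.M.a_inv_closed N.M.minus_closed N.M.r_zero a_minus_def)
  qed
qed

section \<open>Quotients of vector spaces computed by evaluation\<close>

text \<open>
  If a linear map \<open>L\<close> sends \<open>V\<close> onto the vectors supported on a finite set \<open>S\<close>, then \<open>V / ker L\<close> has
  dimension \<open>card S\<close>, and classes on which \<open>L\<close> is a nonzero multiple of a unit vector, one for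
  each element of \<open>S\<close>, form a basis.
\<close>

locale evaluation =
  V: vectorspace "class_ring :: 'k ring" V
  for V :: "('k::field, 'v) module" +
  fixes L :: "'v \<Rightarrow> 'i \<Rightarrow> 'k" and S :: "'i set"
  assumes finite_support: "finite S"
    and eval_add: "x \<in> carrier V \<Longrightarrow> y \<in> carrier V \<Longrightarrow> L (x \<oplus>\<^bsub>V\<^esub> y) i = L x i + L y i"
    and eval_smult: "x \<in> carrier V \<Longrightarrow> L (c \<odot>\<^bsub>V\<^esub> x) i = c * L x i"
    and eval_support: "x \<in> carrier V \<Longrightarrow> i \<notin> S \<Longrightarrow> L x i = 0"
    and eval_surj: "(\<And>i. i \<notin> S \<Longrightarrow> t i = 0) \<Longrightarrow> \<exists>x\<in>carrier V. L x = t"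
begin

definition "B = {x \<in> carrier V. \<forall>i. L x i = 0}"

definition "cls x = B +>\<^bsub>V\<^esub> x"

abbreviation "Quo \<equiv> quotient_space V B"

lemma smult_closed': "x \<in> carrier V \<Longrightarrow> c \<odot>\<^bsub>V\<^esub> x \<in> carrier V"
  by (rule V.smult_closed) auto

lemma eval_zero: "L \<zero>\<^bsub>V\<^esub> i = 0"
proof -
  have "L \<zero>\<^bsub>V\<^esub> i + L \<zero>\<^bsub>V\<^esub> i = L \<zero>\<^bsub>V\<^esub> i"
    using eval_add[of "\<zero>\<^bsub>V\<^esub>" "\<zero>\<^bsub>V\<^esub>" i] by simp
  then show ?thesis by (metis add.right_neutral add_left_cancel)
qed

lemma eval_minus: "x \<in> carrier V \<Longrightarrow> L (\<ominus>\<^bsub>V\<^esub> x) i = - L x i"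
  using eval_add[of "\<ominus>\<^bsub>V\<^esub> x" x i] by (simp add: V.M.l_neg eval_zero eq_neg_iff_add_eq_0)

lemma cls_eq: "x \<in> carrier V \<Longrightarrow> cls x = {y \<in> carrier V. L y = L x}"
proof (intro equalityI subsetI)
  fix y assume x: "x \<in> carrier V" and "y \<in> cls x"
  then obtain b where "b \<in> B" "y = b \<oplus>\<^bsub>V\<^esub> x" by (auto simp: cls_def a_r_coset_def')
  then show "y \<in> {y \<in> carrier V. L y = L x}" using x by (auto simp: B_def eval_add)
next
  fix y assume x: "x \<in> carrier V" and "y \<in> {y \<in> carrier V. L y = L x}"
  then have y: "y \<in> carrier V" "L y = L x" by auto
  have "y \<oplus>\<^bsub>V\<^esub> \<ominus>\<^bsub>V\<^esub> x \<in> B" using x y by (auto simp: B_def eval_add eval_minus)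
  moreover have "y = (y \<oplus>\<^bsub>V\<^esub> \<ominus>\<^bsub>V\<^esub> x) \<oplus>\<^bsub>V\<^esub> x" using x y by (simp add: V.M.a_assoc V.M.l_neg)
  ultimately show "y \<in> cls x" by (auto simp: cls_def a_r_coset_def')
qed

lemma cls_eq_iff: "x \<in> carrier V \<Longrightarrow> y \<in> carrier V \<Longrightarrow> cls x = cls y \<longleftrightarrow> L x = L y"
  using cls_eq by auto

lemma quotient_carrier: "carrier Quo = cls ` carrier V"
  by (auto simp: quotient_space_def cls_def)

lemma quotient_add:
  assumes x: "x \<in> carrier V" and y: "y \<in> carrier V"
  shows "cls x \<oplus>\<^bsub>Quo\<^esub> cls y = cls (x \<oplus>\<^bsub>V\<^esub> y)"
proof -
  have "cls x \<oplus>\<^bsub>Quo\<^esub> cls y = {a \<oplus>\<^bsub>V\<^esub> b | a b. a \<in> cls x \<and> b \<in> cls y}"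
    by (auto simp: quotient_space_def set_add_def')
  also have "\<dots> = cls (x \<oplus>\<^bsub>V\<^esub> y)"
  proof (intro equalityI subsetI)
    fix z assume "z \<in> {a \<oplus>\<^bsub>V\<^esub> b | a b. a \<in> cls x \<and> b \<in> cls y}"
    then show "z \<in> cls (x \<oplus>\<^bsub>V\<^esub> y)" using x y by (auto simp: cls_eq eval_add fun_eq_iff)
  next
    fix z assume "z \<in> cls (x \<oplus>\<^bsub>V\<^esub> y)"
    then have z: "z \<in> carrier V" "L z = L (x \<oplus>\<^bsub>V\<^esub> y)" using x y by (auto simp: cls_eq)
    have "z = x \<oplus>\<^bsub>V\<^esub> (\<ominus>\<^bsub>V\<^esub> x \<oplus>\<^bsub>V\<^esub> z)" using x z by (simp add: V.M.r_neg flip: V.M.a_assoc)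
    moreover have "\<ominus>\<^bsub>V\<^esub> x \<oplus>\<^bsub>V\<^esub> z \<in> cls y" using x y z by (auto simp: cls_eq eval_add eval_minus fun_eq_iff)
    moreover have "x \<in> cls x" using x by (simp add: cls_eq)
    ultimately show "z \<in> {a \<oplus>\<^bsub>V\<^esub> b | a b. a \<in> cls x \<and> b \<in> cls y}" by blast
  qed
  finally show ?thesis .
qed

lemma quotient_smult:
  assumes x: "x \<in> carrier V"
  shows "c \<odot>\<^bsub>Quo\<^esub> cls x = cls (c \<odot>\<^bsub>V\<^esub> x)"
proof -
  have "c \<odot>\<^bsub>Quo\<^esub> cls x = {b \<oplus>\<^bsub>V\<^esub> c \<odot>\<^bsub>V\<^esub> y | b y. b \<in> B \<and> y \<in> cls x}"
    by (auto simp: quotient_space_def set_add_def')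
  also have "\<dots> = cls (c \<odot>\<^bsub>V\<^esub> x)"
  proof (intro equalityI subsetI)
    fix z assume "z \<in> {b \<oplus>\<^bsub>V\<^esub> c \<odot>\<^bsub>V\<^esub> y | b y. b \<in> B \<and> y \<in> cls x}"
    then obtain b y where "b \<in> B" "y \<in> cls x" "z = b \<oplus>\<^bsub>V\<^esub> c \<odot>\<^bsub>V\<^esub> y" by blast
    then show "z \<in> cls (c \<odot>\<^bsub>V\<^esub> x)"
      using x smult_closed'[of y] by (auto simp: cls_eq eval_add eval_smult B_def fun_eq_iff smult_closed')
  next
    fix z assume "z \<in> cls (c \<odot>\<^bsub>V\<^esub> x)"
    then have "z \<in> {b \<oplus>\<^bsub>V\<^esub> c \<odot>\<^bsub>V\<^esub> x | b. b \<in> B}" by (auto simp: cls_def a_r_coset_def')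
    moreover have "x \<in> cls x" using x by (simp add: cls_eq)
    ultimately show "z \<in> {b \<oplus>\<^bsub>V\<^esub> c \<odot>\<^bsub>V\<^esub> y | b y. b \<in> B \<and> y \<in> cls x}" by blast
  qed
  finally show ?thesis .
qed

lemma quotient_zero: "\<zero>\<^bsub>Quo\<^esub> = cls \<zero>\<^bsub>V\<^esub>"
  by (auto simp: cls_eq eval_zero quotient_space_def B_def fun_eq_iff)

lemma vectorspace_quotient: "vectorspace (class_ring :: 'k ring) Quo"
proof (intro vectorspace.intro moduleI)
  show "cring (class_ring :: 'k ring)" by (rule class_cring.is_cring)
  show "field (class_ring :: 'k ring)" by (rule class_field)
  note ops = quotient_add quotient_smult quotient_zero smult_closed'
  show "abelian_group Quo"
  proof (rule abelian_groupI)
    fix X assume "X \<in> carrier Quo"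
    then obtain x where x: "x \<in> carrier V" "X = cls x" by (auto simp: quotient_carrier)
    then have "cls (\<ominus>\<^bsub>V\<^esub> x) \<oplus>\<^bsub>Quo\<^esub> X = \<zero>\<^bsub>Quo\<^esub>" by (simp add: ops V.M.l_neg)
    then show "\<exists>Y\<in>carrier Quo. Y \<oplus>\<^bsub>Quo\<^esub> X = \<zero>\<^bsub>Quo\<^esub>" using x by (auto simp: quotient_carrier)
  qed (auto simp: quotient_carrier ops V.M.a_ac)
qed (auto simp: quotient_carrier quotient_add quotient_smult smult_closed' V.smult_l_distr V.smult_r_distr
    V.smult_assoc1 class_ring_simps, (use V.smult_one V.smult_l_distr V.smult_assoc1 in \<open>force simp: class_ring_simps\<close>)+)

definition "ev X = L (SOME x. x \<in> X)"

lemma ev_cls: "x \<in> carrier V \<Longrightarrow> ev (cls x) = L x"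
proof -
  assume x: "x \<in> carrier V"
  then have "x \<in> cls x" by (simp add: cls_eq)
  then have "(SOME y. y \<in> cls x) \<in> cls x" by (rule someI)
  then show ?thesis unfolding ev_def using x by (simp add: cls_eq)
qed

lemma ev_inj:
  assumes "X \<in> carrier Quo" "Y \<in> carrier Quo" "ev X = ev Y"
  shows "X = Y"
proof -
  obtain x y where xy: "x \<in> carrier V" "X = cls x" "y \<in> carrier V" "Y = cls y"
    using assms(1,2) by (auto simp: quotient_carrier)
  then have "L x = L y" using assms(3) by (simp add: ev_cls)
  with xy show ?thesis by (simp add: cls_eq_iff)
qed

lemma ev_add: "X \<in> carrier Quo \<Longrightarrow> Y \<in> carrier Quo \<Longrightarrow> ev (X \<oplus>\<^bsub>Quo\<^esub> Y) i = ev X i + ev Y i"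
  by (auto simp: quotient_carrier ev_cls quotient_add eval_add)

lemma ev_smult: "X \<in> carrier Quo \<Longrightarrow> ev (c \<odot>\<^bsub>Quo\<^esub> X) i = c * ev X i"
  by (auto simp: quotient_carrier ev_cls quotient_smult eval_smult smult_closed')

lemma ev_surj: "(\<And>i. i \<notin> S \<Longrightarrow> c i = 0) \<Longrightarrow> \<exists>X\<in>carrier Quo. ev X = c"
  using eval_surj[of c] by (auto simp: quotient_carrier ev_cls)

lemma ev_support: "X \<in> carrier Quo \<Longrightarrow> i \<notin> S \<Longrightarrow> ev X i = 0"
  by (auto simp: quotient_carrier ev_cls eval_support)

text \<open>
  Linear independence is seen by applying \<open>ev\<close>, and a class is the combination with coefficients
  \<open>ev X s / c s\<close> since \<open>ev\<close> is injective on the quotient.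
\<close>

lemma basis_quotient:
  assumes X: "\<And>s. s \<in> S \<Longrightarrow> X s \<in> carrier Quo"
    and ev: "\<And>s i. s \<in> S \<Longrightarrow> ev (X s) i = (if i = s then c s else 0)" and c: "\<And>s. s \<in> S \<Longrightarrow> c s \<noteq> 0"
  shows "inj_on X S" "vectorspace.basis class_ring Quo (X ` S)"
proof -
  interpret Q: vectorspace "class_ring :: 'k ring" Quo by (rule vectorspace_quotient)
  show inj: "inj_on X S"
    by (rule inj_onI) (metis ev c)
  have lin: "Q.lincomb a A \<in> carrier Quo \<and> ev (Q.lincomb a A) i = (\<Sum>v\<in>A. a v * ev v i)"
    if A: "finite A" "A \<subseteq> carrier Quo" for a A i
    using A
  proof (induction A rule: finite_induct)
    case empty
    have "Q.lincomb a {} = \<zero>\<^bsub>Quo\<^esub>" by (simp add: Q.lincomb_def)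
    then show ?case by (simp add: quotient_zero ev_cls eval_zero quotient_carrier)
  next
    case (insert v A)
    have v: "a v \<odot>\<^bsub>Quo\<^esub> v \<in> carrier Quo" using insert by (intro Q.smult_closed) auto
    have "Q.lincomb a (insert v A) = a v \<odot>\<^bsub>Quo\<^esub> v \<oplus>\<^bsub>Quo\<^esub> Q.lincomb a A"
      unfolding Q.lincomb_def using insert v
      by (intro Q.M.finsum_insert) (auto intro!: Q.smult_closed)
    then show ?case using insert v by (simp add: ev_add ev_smult)
  qed
  have XS: "X ` S \<subseteq> carrier Quo" "finite (X ` S)" using X finite_support by auto
  have "Q.lin_indpt (X ` S)"
  proof
    assume "Q.lin_dep (X ` S)"
    then obtain A a v where A: "finite A" "A \<subseteq> X ` S" "Q.lincomb a A = \<zero>\<^bsub>Quo\<^esub>" "v \<in> A" "a v \<noteq> 0"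
      by (auto simp: Q.lin_dep_def class_ring_simps)
    obtain s where s: "s \<in> S" "v = X s" using A by auto
    have "A \<subseteq> carrier Quo" using A XS by blast
    then have "(\<Sum>v\<in>A. a v * ev v s) = ev \<zero>\<^bsub>Quo\<^esub> s"
      using lin[OF A(1), of a s] A(3) by metis
    then have "0 = (\<Sum>v\<in>A. a v * ev v s)"
      using ev_cls[OF V.M.zero_closed] by (simp only: quotient_zero eval_zero)
    also have "\<dots> = (\<Sum>u\<in>A. if u = v then a v * c s else 0)"
    proof (rule sum.cong[OF refl])
      fix u assume "u \<in> A"
      then obtain s' where s': "s' \<in> S" "u = X s'" using A by auto
      show "a u * ev u s = (if u = v then a v * c s else 0)"
      proof (cases "s' = s")
        case False
        then have "u \<noteq> v" using s s' inj by (metis inj_onD)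
        then show ?thesis using False s' ev[OF s'(1), of s] by simp
      qed (use s s' ev in simp)
    qed
    also have "\<dots> = a v * c s" using A by simp
    finally show False using A c s by simp
  qed
  moreover have "Q.gen_set (X ` S)"
  proof -
    have "Y \<in> Q.span (X ` S)" if Y: "Y \<in> carrier Quo" for Y
    proof -
      define a where "a v = ev Y (inv_into S X v) / c (inv_into S X v)" for v
      have "ev (Q.lincomb a (X ` S)) i = ev Y i" for i
      proof -
        have "ev (Q.lincomb a (X ` S)) i = (\<Sum>v\<in>X ` S. a v * ev v i)" using lin[of "X ` S" a i] XS by blast
        also have "\<dots> = (\<Sum>s\<in>S. a (X s) * ev (X s) i)" by (simp add: sum.reindex[OF inj])
        also have "\<dots> = (\<Sum>s\<in>S. if s = i then ev Y i else 0)"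
          using c by (intro sum.cong refl) (auto simp: a_def inj ev)
        also have "\<dots> = ev Y i" using finite_support ev_support[OF Y, of i] by simp
        finally show ?thesis .
      qed
      then have "Q.lincomb a (X ` S) = Y" using lin[of "X ` S" a] XS Y by (intro ev_inj) auto
      then show ?thesis using XS unfolding Q.span_def by (auto simp: class_ring_simps)
    qed
    moreover have "Q.span (X ` S) \<subseteq> carrier Quo" using Q.span_is_subset2 XS by blast
    ultimately show ?thesis by blast
  qed
  ultimately show "Q.basis (X ` S)" using XS by (simp add: Q.basis_def)
qed

lemma dim_quotient:
  "vectorspace.fin_dim class_ring Quo" "vectorspace.dim class_ring Quo = card S"
proof -
  interpret Q: vectorspace "class_ring :: 'k ring" Quo by (rule vectorspace_quotient)
  have "\<exists>X. X \<in> carrier Quo \<and> ev X = (\<lambda>i. if i = s then 1 else 0)" if "s \<in> S" for s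
  proof -
    have "\<exists>X\<in>carrier Quo. ev X = (\<lambda>i. if i = s then 1 else 0)"
      by (rule ev_surj) (use that in auto)
    then show ?thesis by blast
  qed
  then obtain X where X: "\<And>s. s \<in> S \<Longrightarrow> X s \<in> carrier Quo" "\<And>s. s \<in> S \<Longrightarrow> ev (X s) = (\<lambda>i. if i = s then 1 else 0)"
    by metis
  note b = basis_quotient[of X "\<lambda>_. 1", OF X(1)]
  have inj: "inj_on X S" and basis: "Q.basis (X ` S)" using b X(2) by auto
  show "Q.fin_dim" unfolding Q.fin_dim_def using basis finite_support by (auto simp: Q.basis_def)
  show "Q.dim = card S" using Q.dim_basis[OF _ basis] finite_support card_image[OF inj] by simp
qed

end

lemma evaluation_iso:
  fixes V1 :: "('k::field, 'v) module" and V2 :: "('k, 'w) module"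
  assumes "evaluation V1 L1 S" "evaluation V2 L2 S"
  obtains \<phi> where
    "linear_map class_ring (quotient_space V1 (evaluation.B V1 L1)) (quotient_space V2 (evaluation.B V2 L2)) \<phi>"
    "bij_betw \<phi> (carrier (quotient_space V1 (evaluation.B V1 L1))) (carrier (quotient_space V2 (evaluation.B V2 L2)))"
proof -
  interpret E1: evaluation V1 L1 S by fact
  interpret E2: evaluation V2 L2 S by fact
  have "\<exists>Y. Y \<in> carrier E2.Quo \<and> E2.ev Y = E1.ev X" if "X \<in> carrier E1.Quo" for X
    using E2.ev_surj[of "E1.ev X"] E1.ev_support[OF that] by blast
  then obtain \<phi> where \<phi>: "\<And>X. X \<in> carrier E1.Quo \<Longrightarrow> \<phi> X \<in> carrier E2.Quo"
    "\<And>X. X \<in> carrier E1.Quo \<Longrightarrow> E2.ev (\<phi> X) = E1.ev X" by metis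
  interpret Q1: vectorspace "class_ring :: 'k ring" E1.Quo by (rule E1.vectorspace_quotient)
  interpret Q2: vectorspace "class_ring :: 'k ring" E2.Quo by (rule E2.vectorspace_quotient)
  have "\<phi> \<in> module_hom class_ring E1.Quo E2.Quo"
  proof (rule module_homI)
    fix X Y assume X: "X \<in> carrier E1.Quo" and Y: "Y \<in> carrier E1.Quo"
    then show "\<phi> (X \<oplus>\<^bsub>E1.Quo\<^esub> Y) = \<phi> X \<oplus>\<^bsub>E2.Quo\<^esub> \<phi> Y"
      by (intro E2.ev_inj) (auto simp: \<phi> E1.ev_add E2.ev_add fun_eq_iff)
  next
    fix c and X assume X: "X \<in> carrier E1.Quo"
    have 1: "c \<odot>\<^bsub>E1.Quo\<^esub> X \<in> carrier E1.Quo" and 2: "c \<odot>\<^bsub>E2.Quo\<^esub> \<phi> X \<in> carrier E2.Quo"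
      using X \<phi> by (auto intro!: Q1.smult_closed Q2.smult_closed)
    show "\<phi> (c \<odot>\<^bsub>E1.Quo\<^esub> X) = c \<odot>\<^bsub>E2.Quo\<^esub> \<phi> X"
      using X 1 2 by (intro E2.ev_inj) (auto simp: \<phi> E1.ev_smult E2.ev_smult fun_eq_iff)
  qed (rule \<phi>)
  then have "linear_map class_ring E1.Quo E2.Quo \<phi>"
    by (intro linear_map.intro mod_hom.intro mod_hom_axioms.intro E1.vectorspace_quotient E2.vectorspace_quotient
        Q1.module_axioms Q2.module_axioms)
  moreover have "bij_betw \<phi> (carrier E1.Quo) (carrier E2.Quo)"
  proof (rule bij_betw_imageI)
    show "inj_on \<phi> (carrier E1.Quo)" by (rule inj_onI) (metis E1.ev_inj \<phi>(2))
    have "Y \<in> \<phi> ` carrier E1.Quo" if Y: "Y \<in> carrier E2.Quo" for Y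
    proof -
      obtain X where X: "X \<in> carrier E1.Quo" "E1.ev X = E2.ev Y"
        using E1.ev_surj[of "E2.ev Y"] E2.ev_support[OF Y] by blast
      then have "\<phi> X = Y" using \<phi> Y by (intro E2.ev_inj) auto
      with X show ?thesis by blast
    qed
    then show "\<phi> ` carrier E1.Quo = carrier E2.Quo" using \<phi>(1) by blast
  qed
  ultimately show thesis by (rule that)
qed

section \<open>The gentle algebra of a triangulation\<close>

locale triangulated_surface =
  fixes T :: "('s, 'a) triangulation" and field_type :: "'k::field itself"
  assumes ideal_T: "ideal_triangulation T"
begin

abbreviation "Q \<equiv> quiver T"
abbreviation KQ :: "(('a, 's) path \<Rightarrow> 'k) ring" where "KQ \<equiv> path_algebra Q"
abbreviation I :: "(('a, 's) path \<Rightarrow> 'k) set" where "I \<equiv> relation_ideal T"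
abbreviation \<Lambda> :: "(('a, 's) path \<Rightarrow> 'k) set ring" where "\<Lambda> \<equiv> bound_algebra Q I"
abbreviation "opp \<equiv> opposite_side T"
abbreviation "nxt \<equiv> succ T"

lemma quiver_simps [simp]:
  "verts Q = arc_set T" "tail Q = curve T" "head Q = (\<lambda>x. curve T (nxt x))"
  "arcs Q = {x \<in> sides T. curve T x \<in> arc_set T \<and> curve T (nxt x) \<in> arc_set T}"
  by (simp_all add: quiver_def)

lemma finite_sides: "finite (sides T)" using ideal_T by (simp add: ideal_triangulation_def)

lemma nxt_side [simp]: "x \<in> sides T \<Longrightarrow> nxt x \<in> sides T"
  and nxt_neq [simp]: "x \<in> sides T \<Longrightarrow> nxt x \<noteq> x"
  and nxt3 [simp]: "x \<in> sides T \<Longrightarrow> nxt (nxt (nxt x)) = x"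
  using ideal_T by (auto simp: ideal_triangulation_def)

lemma nxt_inj: "x \<in> sides T \<Longrightarrow> y \<in> sides T \<Longrightarrow> nxt x = nxt y \<longleftrightarrow> x = y"
  using nxt3 by metis

lemma arc_set_curve: "a \<in> arc_set T \<Longrightarrow> \<exists>x\<in>sides T. curve T x = a"
  by (auto simp: arc_set_def card_2_iff)

lemma opp_side:
  assumes "x \<in> sides T" "curve T x \<in> arc_set T"
  shows "opp x \<in> sides T" "opp x \<noteq> x" "curve T (opp x) = curve T x"
    and "\<And>y. y \<in> sides T \<Longrightarrow> curve T y = curve T x \<Longrightarrow> y = x \<or> y = opp x"
proof -
  have "card {y \<in> sides T. curve T y = curve T x} = 2" using assms by (simp add: arc_set_def)
  then obtain a b where ab: "{y \<in> sides T. curve T y = curve T x} = {a, b}" "a \<noteq> b" by (auto simp: card_2_iff)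
  moreover have "x \<in> {y \<in> sides T. curve T y = curve T x}" using assms by simp
  ultimately have "x = a \<or> x = b" by simp
  then obtain y where y: "{y \<in> sides T. curve T y = curve T x} = {x, y}" "y \<noteq> x"
    using ab by (metis insert_commute)
  then have "\<exists>!z. z \<in> sides T \<and> z \<noteq> x \<and> curve T z = curve T x" by blast
  from theI'[OF this] have *: "opp x \<in> sides T \<and> opp x \<noteq> x \<and> curve T (opp x) = curve T x"
    by (simp add: opposite_side_def)
  then show "opp x \<in> sides T" "opp x \<noteq> x" "curve T (opp x) = curve T x" by auto
  fix z assume "z \<in> sides T" "curve T z = curve T x"
  then show "z = x \<or> z = opp x" using * y by blast
qed

lemma opp_opp [simp]: "x \<in> sides T \<Longrightarrow> curve T x \<in> arc_set T \<Longrightarrow> opp (opp x) = x"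
  using opp_side[of x] opp_side[of "opp x"] by metis

text \<open>
  One step of turning around a marked point: from the corner after \<open>x\<close> to the corner after the
  other side on the curve of \<open>nxt x\<close>.
\<close>

definition rotation :: "('s \<times> 's) set" where
  "rotation = {(x, y). x \<in> sides T \<and> y \<in> sides T \<and> y \<noteq> nxt x \<and> curve T y = curve T (nxt x)}"

lemma acyclic_rotation: "acyclic rotation"
  using ideal_T by (simp add: ideal_triangulation_def rotation_def)

lemma curve_nxt_neq [simp]: "x \<in> sides T \<Longrightarrow> curve T (nxt x) \<noteq> curve T x"
proof
  assume "x \<in> sides T" "curve T (nxt x) = curve T x"
  then have "(x, x) \<in> rotation" by (metis (mono_tags, lifting) CollectI case_prodI nxt_neq rotation_def)
  then show False using acyclic_rotation by (auto simp: acyclic_def)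
qed

lemma internal_iff: "internal_triangle T x \<longleftrightarrow> x \<in> arcs Q \<and> nxt x \<in> arcs Q"
  by (auto simp: internal_triangle_def)

lemma internal_nxt: "internal_triangle T x \<Longrightarrow> internal_triangle T (nxt x)"
  by (auto simp: internal_triangle_def)

lemma internal_funpow: "internal_triangle T x \<Longrightarrow> internal_triangle T ((nxt ^^ n) x)"
  by (induction n) (auto intro: internal_nxt)

lemma internal_arc: "internal_triangle T x \<Longrightarrow> x \<in> arcs Q"
  by (simp add: internal_iff)

sublocale fin_digraph Q
proof
  have "arc_set T \<subseteq> curve T ` sides T" using arc_set_curve by blast
  then show "finite (verts Q)" using finite_sides by (auto intro: finite_subset)
qed (use finite_sides in auto)

sublocale KQ: ring KQ by (rule ring_path_algebra)

lemma arrows_consecutive: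
  assumes "x \<in> arcs Q" "y \<in> arcs Q" "head Q x = tail Q y"
  shows "y = nxt x \<or> y = opp (nxt x)"
proof (rule opp_side(4))
  show "nxt x \<in> sides T" "curve T (nxt x) \<in> arc_set T" "y \<in> sides T" using assms(1,2) by auto
  show "curve T y = curve T (nxt x)" using assms(3) by simp
qed

subsection \<open>Paths outside the ideal\<close>

text \<open>
  The paths without a relation as a subpath.  Two consecutive arrows in one triangle make it
  internal, so their composition is a relation.
\<close>

definition good :: "('a, 's) path \<Rightarrow> bool" where
  "good q \<longleftrightarrow> q \<in> quiver_paths Q \<and> successively (\<lambda>x y. y \<noteq> nxt x) (snd q)"

lemma good_Nil [simp]: "good (u, []) \<longleftrightarrow> u \<in> arc_set T"
  by (simp add: good_def quiver_paths_Nil)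

lemma good_Cons:
  "good (u, x # xs) \<longleftrightarrow> x \<in> arcs Q \<and> u = curve T x \<and> good (curve T (nxt x), xs) \<and> (xs = [] \<or> hd xs \<noteq> nxt x)"
  by (auto simp: good_def quiver_paths_Cons successively_Cons)

lemma good_append: "good (u, xs @ ys) \<longleftrightarrow> good (u, xs) \<and> good (path_end Q u xs, ys) \<and>
   (xs = [] \<or> ys = [] \<or> hd ys \<noteq> nxt (last xs))"
  by (auto simp: good_def quiver_paths_append successively_append_iff)

lemma good_in_paths: "good q \<Longrightarrow> q \<in> quiver_paths Q" by (simp add: good_def)

lemma good_start: "good (u, xs) \<Longrightarrow> u \<in> arc_set T"
  using good_append[of u "[]" xs] by simp

lemma good_end: "good (u, xs) \<Longrightarrow> path_end Q u xs \<in> arc_set T"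
  using good_append[of u xs "[]"] by simp

text \<open>
  A path outside the ideal turns around a single marked point.  Since all marked points lie on
  the boundary, it never passes through the same corner twice.
\<close>

lemma good_distinct: "good (u, xs) \<Longrightarrow> distinct xs \<and> set xs \<subseteq> sides T"
proof -
  assume g: "good (u, xs)"
  have "successively (\<lambda>x y. (x, y) \<in> rotation) xs"
    using g
  proof (induction xs arbitrary: u)
    case (Cons x xs)
    then have "successively (\<lambda>x y. (x, y) \<in> rotation) xs" by (auto simp: good_Cons)
    moreover have "(x, hd xs) \<in> rotation" if "xs \<noteq> []"
      using that Cons.prems by (cases xs) (auto simp: good_Cons rotation_def)
    ultimately show ?case by (auto simp: successively_Cons)
  qed simp
  then have "successively (\<lambda>x y. (x, y) \<in> rotation\<^sup>+) xs" by (rule successively_mono) auto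
  then have "sorted_wrt (\<lambda>x y. (x, y) \<in> rotation\<^sup>+) xs"
    by (subst (asm) successively_conv_sorted_wrt) (auto simp: transp_def)
  then have "distinct xs"
    using acyclic_rotation by (induction xs) (auto simp: acyclic_def)
  moreover have "set xs \<subseteq> sides T" using g by (induction xs arbitrary: u) (auto simp: good_Cons)
  ultimately show ?thesis by blast
qed

lemma finite_good: "finite {q. good q}"
proof (rule finite_subset)
  show "{q. good q} \<subseteq> arc_set T \<times> {xs. set xs \<subseteq> sides T \<and> length xs \<le> card (sides T)}"
    using good_distinct good_start finite_sides by (fastforce simp: distinct_card[symmetric] intro: card_mono)
  show "finite (arc_set T \<times> {xs. set xs \<subseteq> sides T \<and> length xs \<le> card (sides T)})"
    using finite_verts finite_lists_length_le[OF finite_sides] by simp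
qed

lemma bad_path_split: "\<not> successively R xs \<Longrightarrow> \<exists>as x y bs. xs = as @ x # y # bs \<and> \<not> R x y"
proof (induction xs)
  case (Cons x xs)
  show ?case
  proof (cases "successively R xs")
    case True
    then obtain y ys where "xs = y # ys" "\<not> R x y" using Cons.prems by (cases xs) auto
    then show ?thesis by (intro exI[of _ "[]"]) auto
  next
    case False
    then obtain as y z bs where "xs = as @ y # z # bs" "\<not> R y z" using Cons.IH by blast
    then show ?thesis by (intro exI[of _ "x # as"]) auto
  qed
qed simp

lemma path_elt_in_KQ: "q \<in> quiver_paths Q \<Longrightarrow> path_elt q \<in> carrier KQ"
  using path_elt_closed[of q Q 1] by simp

lemma KQ_scale: "f \<in> carrier KQ \<Longrightarrow> (\<lambda>q. c * f q) \<in> carrier KQ"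
  by (auto simp: path_algebra_simps intro: finite_subset)

lemma KQ_scale_mult: "(\<lambda>q. c * f q) \<otimes>\<^bsub>KQ\<^esub> g = (\<lambda>q. c * (f \<otimes>\<^bsub>KQ\<^esub> g) q)"
  by (rule ext) (auto simp: path_algebra_simps sum_distrib_left mult.assoc)

text \<open>
  Extending a path that contains a relation cannot remove the relation, so the combinations of such
  paths form an ideal; it contains the relations, and each such path is a multiple of one.  Hence
  the classes of the remaining paths are a basis of the algebra.
\<close>

lemma ideal_eq: "I = {f \<in> carrier KQ. \<forall>q. good q \<longrightarrow> f q = 0}" (is "_ = ?J")
proof -
  let ?G = "{path_elt (curve T x, [x, nxt x]) | x. internal_triangle T x} :: (('a, 's) path \<Rightarrow> 'k) set"
  have G: "?G \<subseteq> carrier KQ"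
    by (auto simp: internal_iff quiver_paths_Cons quiver_paths_Nil intro!: path_elt_in_KQ)
  interpret I: ideal I KQ unfolding relation_ideal_def by (rule KQ.genideal_ideal[OF G])
  have "ideal ?J KQ"
  proof (rule idealI)
    show "ring KQ" by unfold_locales
    show "subgroup ?J (add_monoid KQ)"
    proof (rule KQ.add.subgroupI)
      fix f assume f: "f \<in> ?J"
      have "(\<ominus>\<^bsub>KQ\<^esub> f) q = - f q" for q
      proof -
        have "(\<ominus>\<^bsub>KQ\<^esub> f \<oplus>\<^bsub>KQ\<^esub> f) q = \<zero>\<^bsub>KQ\<^esub> q" using f by (simp add: KQ.l_neg)
        then show ?thesis by (simp add: path_algebra_simps eq_neg_iff_add_eq_0)
      qed
      then show "\<ominus>\<^bsub>KQ\<^esub> f \<in> ?J" using f KQ.a_inv_closed by auto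
    next
      show "?J \<noteq> {}" using KQ.zero_closed by (auto simp: path_algebra_simps(4))
    next
      fix f g assume "f \<in> ?J" "g \<in> ?J"
      then show "f \<oplus>\<^bsub>KQ\<^esub> g \<in> ?J" using KQ.a_closed by (auto simp: path_algebra_simps(5))
    qed auto
    fix f g assume f: "f \<in> ?J" and g: "g \<in> carrier KQ"
    have split: "good (u, take k xs) \<and> good (path_end Q u (take k xs), drop k xs)" if "good (u, xs)" for u xs k
      using that good_append[of u "take k xs" "drop k xs"] by simp
    show "g \<otimes>\<^bsub>KQ\<^esub> f \<in> ?J" using f g split by (auto simp: KQ.m_closed path_algebra_simps(2) intro!: sum.neutral)
    show "f \<otimes>\<^bsub>KQ\<^esub> g \<in> ?J" using f g split by (auto simp: KQ.m_closed path_algebra_simps(2) intro!: sum.neutral)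
  qed
  moreover have "?G \<subseteq> ?J"
    using G by (auto simp: path_elt_def good_Cons)
  ultimately have "I \<subseteq> ?J" unfolding relation_ideal_def by (rule KQ.genideal_minimal)
  moreover have "f \<in> I" if f: "f \<in> ?J" for f
  proof -
    have "f \<in> carrier KQ" using f by simp
    then show ?thesis
    proof (induction rule: path_algebra_induct)
      case zero
      then show ?case using I.zero_closed by (simp add: path_algebra_simps(4))
    next
      case (add g h)
      then show ?case using I.a_closed[of g h] by (simp add: path_algebra_simps(5))
    next
      case (elt c q)
      obtain u xs where q: "q = (u, xs)" by fastforce
      have "\<not> successively (\<lambda>x y. y \<noteq> nxt x) xs" using elt f by (auto simp: good_def q)
      then obtain as x bs where xs: "xs = as @ [x, nxt x] @ bs" using bad_path_split by fastforce
      have p: "(u, as) \<in> quiver_paths Q" "path_end Q u as = curve T x" "x \<in> arcs Q" "nxt x \<in> arcs Q"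
        "(path_end Q (curve T x) [x, nxt x], bs) \<in> quiver_paths Q"
        using elt(2) unfolding q xs quiver_paths_append by (auto simp: quiver_paths_Cons)
      have "path_elt (curve T x, [x, nxt x]) \<in> ?G" using p by (auto simp: internal_iff)
      then have "path_elt (curve T x, [x, nxt x]) \<in> I"
        using KQ.genideal_self[OF G] unfolding relation_ideal_def by blast
      then have "(\<lambda>p. c * path_elt (u, as) p) \<otimes>\<^bsub>KQ\<^esub> path_elt (curve T x, [x, nxt x])
         \<otimes>\<^bsub>KQ\<^esub> path_elt (path_end Q (curve T x) [x, nxt x], bs) \<in> I"
        using p(1,5) by (intro I.I_r_closed I.I_l_closed path_elt_closed path_elt_in_KQ)
      then show ?case
        using p(2) by (simp add: KQ_scale_mult path_elt_mult q xs)
    qed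
  qed
  ultimately show ?thesis by blast
qed

sublocale I: ideal I KQ
proof -
  have "{path_elt (curve T x, [x, nxt x]) | x. internal_triangle T x} \<subseteq> carrier KQ"
    by (auto simp: internal_iff quiver_paths_Cons quiver_paths_Nil intro!: path_elt_in_KQ)
  then show "ideal I KQ" unfolding relation_ideal_def by (rule KQ.genideal_ideal)
qed

lemma path_elt_in_ideal:
  assumes "x \<in> arcs Q" "y \<in> arcs Q" "head Q x = tail Q y"
  shows "path_elt (tail Q x, [x, y]) \<in> I \<longleftrightarrow> y = nxt x"
proof -
  have "(tail Q x, [x, y]) \<in> quiver_paths Q"
    using assms by (auto simp: quiver_paths_Cons quiver_paths_Nil)
  then have "path_elt (tail Q x, [x, y]) \<in> carrier KQ" by (rule path_elt_in_KQ)
  then have "path_elt (tail Q x, [x, y]) \<in> I \<longleftrightarrow> \<not> good (tail Q x, [x, y])"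
    unfolding ideal_eq by (fastforce simp: path_elt_def)
  then show ?thesis using assms by (simp add: good_Cons)
qed

subsection \<open>Coefficients of elements of the algebra\<close>

definition proj :: "(('a, 's) path \<Rightarrow> 'k) \<Rightarrow> (('a, 's) path \<Rightarrow> 'k) set" where
  "proj r = I +>\<^bsub>KQ\<^esub> r"

text \<open>
  On the basis of paths outside the ideal, all representatives of an element have the same
  coefficients, so any of them may be chosen.
\<close>

definition coef :: "(('a, 's) path \<Rightarrow> 'k) set \<Rightarrow> ('a, 's) path \<Rightarrow> 'k" where
  "coef X = (SOME r. r \<in> X)"

sublocale \<Lambda>: ring \<Lambda>
  unfolding bound_algebra_def by (rule I.quotient_is_ring)

lemma proj_hom: "proj \<in> Ring.ring_hom KQ \<Lambda>"
  using I.rcos_ring_hom unfolding bound_algebra_def proj_def by simp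

lemma proj_simps:
  "r \<in> carrier KQ \<Longrightarrow> proj r \<in> carrier \<Lambda>"
  "r \<in> carrier KQ \<Longrightarrow> s \<in> carrier KQ \<Longrightarrow> proj (r \<otimes>\<^bsub>KQ\<^esub> s) = proj r \<otimes>\<^bsub>\<Lambda>\<^esub> proj s"
  "r \<in> carrier KQ \<Longrightarrow> s \<in> carrier KQ \<Longrightarrow> proj (r \<oplus>\<^bsub>KQ\<^esub> s) = proj r \<oplus>\<^bsub>\<Lambda>\<^esub> proj s"
  "proj \<one>\<^bsub>KQ\<^esub> = \<one>\<^bsub>\<Lambda>\<^esub>"
  "proj \<zero>\<^bsub>KQ\<^esub> = \<zero>\<^bsub>\<Lambda>\<^esub>"
  using proj_hom Ring.ring_hom_zero[OF proj_hom KQ.ring_axioms \<Lambda>.ring_axioms] by (auto simp: Ring.ring_hom_def)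

lemma proj_surj: "X \<in> carrier \<Lambda> \<Longrightarrow> \<exists>r\<in>carrier KQ. X = proj r"
  by (auto simp: bound_algebra_def FactRing_simps proj_def a_r_coset_def)

lemma proj_self: "r \<in> carrier KQ \<Longrightarrow> r \<in> proj r"
  unfolding proj_def by (rule I.a_rcos_self)

lemma in_proj: "r \<in> carrier KQ \<Longrightarrow> s \<in> proj r \<Longrightarrow> s \<in> carrier KQ \<and> (\<forall>q. good q \<longrightarrow> s q = r q)"
proof -
  assume r: "r \<in> carrier KQ" and "s \<in> proj r"
  then obtain i where i: "i \<in> I" "s = i \<oplus>\<^bsub>KQ\<^esub> r" by (auto simp: proj_def a_r_coset_def')
  have "i \<in> carrier KQ \<and> (\<forall>q. good q \<longrightarrow> i q = 0)" using i(1) unfolding ideal_eq by (rule CollectD)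
  then have i': "i \<in> carrier KQ" "\<And>q. good q \<Longrightarrow> i q = 0" by blast+
  have "s \<in> carrier KQ" unfolding i(2) by (rule KQ.a_closed[OF i'(1) r])
  moreover have "s q = r q" if "good q" for q using i'(2)[OF that] by (simp add: i(2) path_algebra_simps(5))
  ultimately show ?thesis by blast
qed

lemma coef_proj: "r \<in> carrier KQ \<Longrightarrow> good q \<Longrightarrow> coef (proj r) q = r q"
proof -
  assume r: "r \<in> carrier KQ" and "good q"
  moreover have "coef (proj r) \<in> proj r" unfolding coef_def by (rule someI[of _ r]) (rule proj_self[OF r])
  ultimately show ?thesis using in_proj[OF r] by blast
qed

lemma \<Lambda>_eqI:
  assumes X: "X \<in> carrier \<Lambda>" and Y: "Y \<in> carrier \<Lambda>" and eq: "\<And>q. good q \<Longrightarrow> coef X q = coef Y q"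
  shows "X = Y"
proof -
  obtain r s where rs: "r \<in> carrier KQ" "X = proj r" "s \<in> carrier KQ" "Y = proj s"
    using proj_surj[OF X] proj_surj[OF Y] by blast
  let ?d = "\<lambda>q. r q + (-1) * s q"
  have d: "?d \<in> carrier KQ" using KQ.a_closed[OF rs(1) KQ_scale[OF rs(3), of "-1"]] by (simp add: path_algebra_simps(5))
  have "r q = s q" if "good q" for q
    using eq[OF that] rs coef_proj[OF rs(1) that] coef_proj[OF rs(3) that] by simp
  then have "?d \<in> I" unfolding ideal_eq using d by simp
  moreover have "r = ?d \<oplus>\<^bsub>KQ\<^esub> s" by (simp add: path_algebra_simps(5))
  ultimately have "r \<in> proj s" unfolding proj_def a_r_coset_def' by blast
  then show ?thesis using rs KQ.abelian_group_axioms I.a_repr_independence'[of r s] by (simp add: proj_def)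
qed

lemma coef_add: "X \<in> carrier \<Lambda> \<Longrightarrow> Y \<in> carrier \<Lambda> \<Longrightarrow> good q \<Longrightarrow> coef (X \<oplus>\<^bsub>\<Lambda>\<^esub> Y) q = coef X q + coef Y q"
proof -
  assume X: "X \<in> carrier \<Lambda>" and Y: "Y \<in> carrier \<Lambda>" and q: "good q"
  obtain r s where rs: "r \<in> carrier KQ" "X = proj r" "s \<in> carrier KQ" "Y = proj s"
    using proj_surj[OF X] proj_surj[OF Y] by blast
  have "coef (proj (r \<oplus>\<^bsub>KQ\<^esub> s)) q = r q + s q"
    using coef_proj[OF KQ.a_closed[OF rs(1,3)] q] by (simp add: path_algebra_simps(5))
  then show ?thesis using rs q by (simp add: proj_simps(3) coef_proj)
qed

lemma coef_zero: "good q \<Longrightarrow> coef \<zero>\<^bsub>\<Lambda>\<^esub> q = 0"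
  using coef_proj[OF KQ.zero_closed, of q] unfolding proj_simps(5) by (simp add: path_algebra_simps(4))

lemma \<Lambda>_from_coefs: "\<exists>X\<in>carrier \<Lambda>. \<forall>q. good q \<longrightarrow> coef X q = c q"
proof -
  let ?r = "\<lambda>q. if good q then c q else 0"
  have "?r \<in> carrier KQ"
    using finite_good by (auto simp: path_algebra_simps(1) intro: finite_subset good_in_paths)
  then show ?thesis by (intro bexI[of _ "proj ?r"]) (auto simp: coef_proj proj_simps(1))
qed

definition idm :: "'a \<Rightarrow> (('a, 's) path \<Rightarrow> 'k) set" where
  "idm u = (if u \<in> arc_set T then proj (path_elt (u, [])) else \<zero>\<^bsub>\<Lambda>\<^esub>)"

definition arr :: "'s \<Rightarrow> (('a, 's) path \<Rightarrow> 'k) set" where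
  "arr x = (if x \<in> arcs Q then proj (path_elt (curve T x, [x])) else \<zero>\<^bsub>\<Lambda>\<^esub>)"

abbreviation "scal \<equiv> scalar Q I :: 'k \<Rightarrow> _"

lemma path_elt_Nil_KQ: "u \<in> arc_set T \<Longrightarrow> path_elt (u, []) \<in> carrier KQ"
  by (intro path_elt_in_KQ) (simp add: quiver_paths_Nil)

lemma path_elt_arrow_KQ: "x \<in> arcs Q \<Longrightarrow> path_elt (curve T x, [x]) \<in> carrier KQ"
  by (intro path_elt_in_KQ) (auto simp: quiver_paths_Cons quiver_paths_Nil)

lemma idm_closed [simp, intro]: "idm u \<in> carrier \<Lambda>"
  unfolding idm_def using proj_simps(1)[OF path_elt_Nil_KQ] by auto

lemma arr_closed [simp, intro]: "arr x \<in> carrier \<Lambda>"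
  unfolding arr_def using proj_simps(1)[OF path_elt_arrow_KQ] by auto

lemma scal_closed [simp, intro]: "scal c \<in> carrier \<Lambda>"
  unfolding scalar_def using proj_simps(1)[OF KQ_scale[OF KQ.one_closed]] by (simp add: proj_def)

lemma coef_arr_mult:
  assumes X: "X \<in> carrier \<Lambda>" and good: "good (u, xs)"
  shows "coef (arr x \<otimes>\<^bsub>\<Lambda>\<^esub> X) (u, xs) =
    (case xs of [] \<Rightarrow> 0 | y # ys \<Rightarrow> if y = x then coef X (curve T (nxt x), ys) else 0)"
proof (cases "x \<in> arcs Q")
  case True
  obtain r where r: "r \<in> carrier KQ" "X = proj r" using proj_surj[OF X] by blast
  have "coef (arr x \<otimes>\<^bsub>\<Lambda>\<^esub> X) (u, xs) = (path_elt (curve T x, [x]) \<otimes>\<^bsub>KQ\<^esub> r) (u, xs)"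
    using True r coef_proj[OF KQ.m_closed[OF path_elt_arrow_KQ[OF True] r(1)] good] path_elt_arrow_KQ[OF True]
    by (simp add: arr_def proj_simps(2))
  then show ?thesis using good r by (auto simp: path_algebra_mult_elt coef_proj good_Cons split: list.splits)
next
  case False
  then show ?thesis using X good by (auto simp: arr_def coef_zero good_Cons split: list.splits)
qed

lemma coef_mult_arr:
  assumes X: "X \<in> carrier \<Lambda>" and good: "good (u, xs)"
  shows "coef (X \<otimes>\<^bsub>\<Lambda>\<^esub> arr x) (u, xs) = (if xs \<noteq> [] \<and> last xs = x then coef X (u, butlast xs) else 0)"
proof (cases "x \<in> arcs Q")
  case True
  obtain r where r: "r \<in> carrier KQ" "X = proj r" using proj_surj[OF X] by blast
  have "coef (X \<otimes>\<^bsub>\<Lambda>\<^esub> arr x) (u, xs) = (r \<otimes>\<^bsub>KQ\<^esub> path_elt (curve T x, [x])) (u, xs)"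
    using True r coef_proj[OF KQ.m_closed[OF r(1) path_elt_arrow_KQ[OF True]] good] path_elt_arrow_KQ[OF True]
    by (simp add: arr_def proj_simps(2))
  moreover have "good (u, butlast xs) \<and> path_end Q u (butlast xs) = curve T (last xs)" if "xs \<noteq> []"
    using good that good_append[of u "butlast xs" "[last xs]"] by (auto simp: good_Cons)
  ultimately show ?thesis using r by (auto simp: path_algebra_mult_elt coef_proj)
next
  case False
  have "last xs \<in> arcs Q" if "xs \<noteq> []"
    using good that good_append[of u "butlast xs" "[last xs]"] by (auto simp: good_Cons)
  then show ?thesis using X good False by (auto simp: arr_def coef_zero)
qed

lemma coef_idm_mult:
  assumes X: "X \<in> carrier \<Lambda>" and good: "good (u, xs)"
  shows "coef (idm v \<otimes>\<^bsub>\<Lambda>\<^esub> X) (u, xs) = (if u = v then coef X (u, xs) else 0)"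
proof (cases "v \<in> arc_set T")
  case True
  obtain r where r: "r \<in> carrier KQ" "X = proj r" using proj_surj[OF X] by blast
  have "coef (idm v \<otimes>\<^bsub>\<Lambda>\<^esub> X) (u, xs) = (path_elt (v, []) \<otimes>\<^bsub>KQ\<^esub> r) (u, xs)"
    using True r coef_proj[OF KQ.m_closed[OF path_elt_Nil_KQ[OF True] r(1)] good] path_elt_Nil_KQ[OF True]
    by (simp add: idm_def proj_simps(2))
  then show ?thesis using good r by (auto simp: path_algebra_mult_elt coef_proj)
qed (use X good good_start[OF good] in \<open>auto simp: idm_def coef_zero\<close>)

lemma coef_mult_idm:
  assumes X: "X \<in> carrier \<Lambda>" and good: "good (u, xs)"
  shows "coef (X \<otimes>\<^bsub>\<Lambda>\<^esub> idm v) (u, xs) = (if path_end Q u xs = v then coef X (u, xs) else 0)"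
proof (cases "v \<in> arc_set T")
  case True
  obtain r where r: "r \<in> carrier KQ" "X = proj r" using proj_surj[OF X] by blast
  have "coef (X \<otimes>\<^bsub>\<Lambda>\<^esub> idm v) (u, xs) = (r \<otimes>\<^bsub>KQ\<^esub> path_elt (v, [])) (u, xs)"
    using True r coef_proj[OF KQ.m_closed[OF r(1) path_elt_Nil_KQ[OF True]] good] path_elt_Nil_KQ[OF True]
    by (simp add: idm_def proj_simps(2))
  then show ?thesis using good r by (auto simp: path_algebra_mult_elt coef_proj)
qed (use X good good_end[OF good] in \<open>auto simp: idm_def coef_zero\<close>)

lemma idm_idem: "idm u \<otimes>\<^bsub>\<Lambda>\<^esub> idm u = idm u"
  by (rule \<Lambda>_eqI) (auto simp: coef_idm_mult coef_mult_idm, metis coef_mult_idm \<Lambda>.one_closed \<Lambda>.l_one idm_closed coef_idm_mult \<Lambda>.r_one)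

lemma idm_arr: "idm (curve T x) \<otimes>\<^bsub>\<Lambda>\<^esub> arr x = arr x"
  and arr_idm: "arr x \<otimes>\<^bsub>\<Lambda>\<^esub> idm (curve T (nxt x)) = arr x"
  and idm_arr_0: "v \<noteq> curve T x \<Longrightarrow> idm v \<otimes>\<^bsub>\<Lambda>\<^esub> arr x = \<zero>\<^bsub>\<Lambda>\<^esub>"
  and arr_idm_0: "v \<noteq> curve T (nxt x) \<Longrightarrow> arr x \<otimes>\<^bsub>\<Lambda>\<^esub> idm v = \<zero>\<^bsub>\<Lambda>\<^esub>"
proof -
  have c: "coef (arr x) (u, xs) = (case xs of [] \<Rightarrow> 0 | y # ys \<Rightarrow> if y = x then coef \<one>\<^bsub>\<Lambda>\<^esub> (curve T (nxt x), ys) else 0)"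
    if "good (u, xs)" for u xs
    using coef_arr_mult[OF \<Lambda>.one_closed that] by simp
  have c': "coef (arr x) (u, xs) = (if xs \<noteq> [] \<and> last xs = x then coef \<one>\<^bsub>\<Lambda>\<^esub> (u, butlast xs) else 0)"
    if "good (u, xs)" for u xs
    using coef_mult_arr[OF \<Lambda>.one_closed that] by simp
  have e: "path_end Q u xs = curve T (nxt x)" if "good (u, xs)" "xs \<noteq> []" "last xs = x" for u xs
    using that by (simp add: path_end_def)
  show "idm (curve T x) \<otimes>\<^bsub>\<Lambda>\<^esub> arr x = arr x"
    by (rule \<Lambda>_eqI) (auto simp: coef_idm_mult c good_Cons split: list.splits)
  show "arr x \<otimes>\<^bsub>\<Lambda>\<^esub> idm (curve T (nxt x)) = arr x"
    by (rule \<Lambda>_eqI) (auto simp: coef_mult_idm c' dest: e)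
  show "v \<noteq> curve T x \<Longrightarrow> idm v \<otimes>\<^bsub>\<Lambda>\<^esub> arr x = \<zero>\<^bsub>\<Lambda>\<^esub>"
    by (rule \<Lambda>_eqI) (auto simp: coef_idm_mult c coef_zero good_Cons split: list.splits)
  show "v \<noteq> curve T (nxt x) \<Longrightarrow> arr x \<otimes>\<^bsub>\<Lambda>\<^esub> idm v = \<zero>\<^bsub>\<Lambda>\<^esub>"
    by (rule \<Lambda>_eqI) (auto simp: coef_mult_idm c' coef_zero dest: e)
qed

lemma arr_nxt: "arr x \<otimes>\<^bsub>\<Lambda>\<^esub> arr (nxt x) = \<zero>\<^bsub>\<Lambda>\<^esub>"
proof (rule \<Lambda>_eqI)
  fix q assume "good q"
  moreover obtain u xs where q: "q = (u, xs)" by fastforce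
  ultimately have g: "good (u, xs)" by simp
  have "coef (arr x) (u, butlast xs) = 0" if "xs \<noteq> []" "last xs = nxt x"
  proof -
    have *: "good (u, butlast xs)" "butlast xs = [] \<or> last xs \<noteq> nxt (last (butlast xs))"
      using g that(1) good_append[of u "butlast xs" "[last xs]"] by auto
    then show ?thesis using coef_mult_arr[OF \<Lambda>.one_closed *(1), of x] that(2) by auto
  qed
  then show "coef (arr x \<otimes>\<^bsub>\<Lambda>\<^esub> arr (nxt x)) q = coef \<zero>\<^bsub>\<Lambda>\<^esub> q"
    using g by (simp add: q coef_mult_arr coef_zero)
qed auto

lemma scal_proj: "scal c = proj (\<lambda>q. c * \<one>\<^bsub>KQ\<^esub> q)" by (simp add: scalar_def proj_def)

lemma scal_mult_proj: "r \<in> carrier KQ \<Longrightarrow> scal c \<otimes>\<^bsub>\<Lambda>\<^esub> proj r = proj (\<lambda>q. c * r q)"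
  using proj_simps(2)[OF KQ_scale[OF KQ.one_closed, of c], of r] by (simp add: scal_proj KQ_scale_mult)

lemma proj_mult_scal: "r \<in> carrier KQ \<Longrightarrow> proj r \<otimes>\<^bsub>\<Lambda>\<^esub> scal c = proj (\<lambda>q. c * r q)"
proof -
  assume r: "r \<in> carrier KQ"
  have "r \<otimes>\<^bsub>KQ\<^esub> (\<lambda>q. c * \<one>\<^bsub>KQ\<^esub> q) = (\<lambda>q. c * (r \<otimes>\<^bsub>KQ\<^esub> \<one>\<^bsub>KQ\<^esub>) q)"
    by (rule ext) (auto simp: path_algebra_simps(2) sum_distrib_left mult.left_commute)
  then show ?thesis using proj_simps(2)[OF r KQ_scale[OF KQ.one_closed, of c]] r by (simp add: scal_proj)
qed

lemma scal_commute: "X \<in> carrier \<Lambda> \<Longrightarrow> X \<otimes>\<^bsub>\<Lambda>\<^esub> scal c = scal c \<otimes>\<^bsub>\<Lambda>\<^esub> X"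
  using proj_surj[of X] by (auto simp: scal_mult_proj proj_mult_scal)

lemma coef_scal: "X \<in> carrier \<Lambda> \<Longrightarrow> good q \<Longrightarrow> coef (scal c \<otimes>\<^bsub>\<Lambda>\<^esub> X) q = c * coef X q"
  using proj_surj[of X] by (auto simp: scal_mult_proj coef_proj KQ_scale)

lemma scal_simps:
  assumes X: "X \<in> carrier \<Lambda>"
  shows "scal (a + b) \<otimes>\<^bsub>\<Lambda>\<^esub> X = scal a \<otimes>\<^bsub>\<Lambda>\<^esub> X \<oplus>\<^bsub>\<Lambda>\<^esub> scal b \<otimes>\<^bsub>\<Lambda>\<^esub> X"
    and "scal (a * b) \<otimes>\<^bsub>\<Lambda>\<^esub> X = scal a \<otimes>\<^bsub>\<Lambda>\<^esub> (scal b \<otimes>\<^bsub>\<Lambda>\<^esub> X)"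
    and "scal 0 \<otimes>\<^bsub>\<Lambda>\<^esub> X = \<zero>\<^bsub>\<Lambda>\<^esub>" and "scal 1 \<otimes>\<^bsub>\<Lambda>\<^esub> X = X"
proof -
  show "scal (a + b) \<otimes>\<^bsub>\<Lambda>\<^esub> X = scal a \<otimes>\<^bsub>\<Lambda>\<^esub> X \<oplus>\<^bsub>\<Lambda>\<^esub> scal b \<otimes>\<^bsub>\<Lambda>\<^esub> X"
    by (rule \<Lambda>_eqI) (use X in \<open>simp_all add: coef_scal coef_add distrib_right\<close>)
  show "scal (a * b) \<otimes>\<^bsub>\<Lambda>\<^esub> X = scal a \<otimes>\<^bsub>\<Lambda>\<^esub> (scal b \<otimes>\<^bsub>\<Lambda>\<^esub> X)"
    by (rule \<Lambda>_eqI) (use X in \<open>simp_all add: coef_scal mult.assoc\<close>)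
  show "scal 0 \<otimes>\<^bsub>\<Lambda>\<^esub> X = \<zero>\<^bsub>\<Lambda>\<^esub>" by (rule \<Lambda>_eqI) (use X in \<open>simp_all add: coef_scal coef_zero\<close>)
  show "scal 1 \<otimes>\<^bsub>\<Lambda>\<^esub> X = X" by (rule \<Lambda>_eqI) (use X in \<open>simp_all add: coef_scal\<close>)
qed

lemma idm_orth: "u \<noteq> v \<Longrightarrow> idm u \<otimes>\<^bsub>\<Lambda>\<^esub> idm v = \<zero>\<^bsub>\<Lambda>\<^esub>"
proof (rule \<Lambda>_eqI)
  fix q assume uv: "u \<noteq> v" and "good q"
  moreover obtain x xs where q: "q = (x, xs)" by fastforce
  ultimately have g: "good (x, xs)" by simp
  have "coef (idm v) (x, xs) = (if x = v then coef \<one>\<^bsub>\<Lambda>\<^esub> (x, xs) else 0)"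
    using coef_idm_mult[OF \<Lambda>.one_closed g, of v] by simp
  then show "coef (idm u \<otimes>\<^bsub>\<Lambda>\<^esub> idm v) q = coef \<zero>\<^bsub>\<Lambda>\<^esub> q"
    using uv g by (auto simp: q coef_idm_mult coef_zero)
qed auto

lemma scal_add: "scal (a + b) = scal a \<oplus>\<^bsub>\<Lambda>\<^esub> scal b"
  and scal_mult: "scal (a * b) = scal a \<otimes>\<^bsub>\<Lambda>\<^esub> scal b"
  and scal_0: "scal 0 = \<zero>\<^bsub>\<Lambda>\<^esub>" and scal_1: "scal 1 = \<one>\<^bsub>\<Lambda>\<^esub>"
  using scal_simps[OF \<Lambda>.one_closed] by simp_all

end

context triangulated_surface
begin

subsection \<open>Annihilators of arrows\<close>

lemma coef_idm_supp: "b \<in> carrier \<Lambda> \<Longrightarrow> idm v \<otimes>\<^bsub>\<Lambda>\<^esub> b = b \<Longrightarrow> good (u, xs) \<Longrightarrow> coef b (u, xs) \<noteq> 0 \<Longrightarrow> u = v"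
  using coef_idm_mult[of b u xs v] by (metis)

lemma coef_arr_supp:
  "b \<in> carrier \<Lambda> \<Longrightarrow> good (u, xs) \<Longrightarrow> coef (arr x \<otimes>\<^bsub>\<Lambda>\<^esub> b) (u, xs) \<noteq> 0 \<Longrightarrow> xs \<noteq> [] \<and> hd xs = x"
  using coef_arr_mult[of b u xs x] by (cases xs) (auto split: if_splits)

lemma arr_mult_eq_0_coef:
  assumes "x \<in> arcs Q" "b \<in> carrier \<Lambda>" "arr x \<otimes>\<^bsub>\<Lambda>\<^esub> b = \<zero>\<^bsub>\<Lambda>\<^esub>" "good (curve T (nxt x), xs)" "xs = [] \<or> hd xs \<noteq> nxt x"
  shows "coef b (curve T (nxt x), xs) = 0"
proof -
  have "good (curve T x, x # xs)" using assms by (auto simp: good_Cons)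
  then show ?thesis using coef_arr_mult[OF assms(2), of "curve T x" "x # xs" x] assms(3) by (simp add: coef_zero)
qed

text \<open>
  Multiplying by \<open>x\<close> from the left maps the paths starting at its end injectively to paths, except
  for those starting with \<open>nxt x\<close>, which become \<open>0\<close>.
\<close>

lemma arr_left_annihilator:
  assumes x: "internal_triangle T x" and b: "b \<in> carrier \<Lambda>" "idm (curve T (nxt x)) \<otimes>\<^bsub>\<Lambda>\<^esub> b = b"
    and 0: "arr x \<otimes>\<^bsub>\<Lambda>\<^esub> b = \<zero>\<^bsub>\<Lambda>\<^esub>"
  shows "\<exists>c\<in>carrier \<Lambda>. idm (curve T (nxt (nxt x))) \<otimes>\<^bsub>\<Lambda>\<^esub> c = c \<and> b = arr (nxt x) \<otimes>\<^bsub>\<Lambda>\<^esub> c"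
proof -
  obtain c where c: "c \<in> carrier \<Lambda>" "\<And>q. good q \<Longrightarrow> coef c q =
      (if fst q = curve T (nxt (nxt x)) \<and> good (curve T (nxt x), nxt x # snd q) then coef b (curve T (nxt x), nxt x # snd q) else 0)"
    using \<Lambda>_from_coefs[of "\<lambda>q. if fst q = curve T (nxt (nxt x)) \<and> good (curve T (nxt x), nxt x # snd q)
      then coef b (curve T (nxt x), nxt x # snd q) else 0"] by blast
  have xa: "x \<in> arcs Q" using x by (simp add: internal_iff)
  have "b = arr (nxt x) \<otimes>\<^bsub>\<Lambda>\<^esub> c"
  proof (rule \<Lambda>_eqI)
    fix q assume "good q"
    moreover obtain u xs where q: "q = (u, xs)" by fastforce
    ultimately have g: "good (u, xs)" by simp
    show "coef b q = coef (arr (nxt x) \<otimes>\<^bsub>\<Lambda>\<^esub> c) q"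
    proof (cases "xs \<noteq> [] \<and> hd xs = nxt x")
      case True
      then obtain ys where xs: "xs = nxt x # ys" by (cases xs) auto
      then have u: "u = curve T (nxt x)" "good (curve T (nxt (nxt x)), ys)" using g by (auto simp: good_Cons)
      then show ?thesis using g c by (simp add: q xs coef_arr_mult)
    next
      case False
      have "coef b (u, xs) = 0"
        using coef_idm_supp[OF b g] arr_mult_eq_0_coef[OF xa b(1) 0, of xs] g False by metis
      moreover have "coef (arr (nxt x) \<otimes>\<^bsub>\<Lambda>\<^esub> c) (u, xs) = 0"
        using coef_arr_supp[OF c(1) g] False by blast
      ultimately show ?thesis by (simp add: q)
    qed
  qed (use b c in auto)
  moreover have "idm (curve T (nxt (nxt x))) \<otimes>\<^bsub>\<Lambda>\<^esub> c = c"
    by (rule \<Lambda>_eqI) (use c in \<open>auto simp: coef_idm_mult\<close>)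
  ultimately show ?thesis using c by blast
qed

lemma arr_left_cancel_noninternal:
  assumes x: "x \<in> arcs Q" "\<not> internal_triangle T x" and b: "b \<in> carrier \<Lambda>" "idm (curve T (nxt x)) \<otimes>\<^bsub>\<Lambda>\<^esub> b = b"
    and 0: "arr x \<otimes>\<^bsub>\<Lambda>\<^esub> b = \<zero>\<^bsub>\<Lambda>\<^esub>"
  shows "b = \<zero>\<^bsub>\<Lambda>\<^esub>"
proof (rule \<Lambda>_eqI)
  fix q assume "good q"
  moreover obtain u xs where q: "q = (u, xs)" by fastforce
  ultimately have g: "good (u, xs)" by simp
  have "xs = [] \<or> hd xs \<noteq> nxt x" using g x by (cases xs) (auto simp: good_Cons internal_iff)
  then have "coef b (u, xs) = 0"
    using coef_idm_supp[OF b g] arr_mult_eq_0_coef[OF x(1) b(1) 0, of xs] g by metis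
  then show "coef b q = coef \<zero>\<^bsub>\<Lambda>\<^esub> q" using g by (simp add: q coef_zero)
qed (use b in auto)

text \<open>
  A path starting with an arrow \<open>y\<close> other than \<open>nxt x\<close> stays outside the ideal when \<open>x\<close> is put in
  front of it.
\<close>

lemma arr_left_cancel:
  assumes x: "x \<in> arcs Q" and y: "curve T y = curve T (nxt x)" "y \<noteq> nxt x" and b: "b \<in> carrier \<Lambda>"
    and 0: "arr x \<otimes>\<^bsub>\<Lambda>\<^esub> (arr y \<otimes>\<^bsub>\<Lambda>\<^esub> b) = \<zero>\<^bsub>\<Lambda>\<^esub>"
  shows "arr y \<otimes>\<^bsub>\<Lambda>\<^esub> b = \<zero>\<^bsub>\<Lambda>\<^esub>"
proof (rule \<Lambda>_eqI)
  fix q assume "good q"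
  moreover obtain u xs where q: "q = (u, xs)" by fastforce
  ultimately have g: "good (u, xs)" by simp
  have "coef (arr y \<otimes>\<^bsub>\<Lambda>\<^esub> b) (u, xs) = 0"
  proof (rule ccontr)
    assume *: "coef (arr y \<otimes>\<^bsub>\<Lambda>\<^esub> b) (u, xs) \<noteq> 0"
    with coef_arr_supp[OF b g] have xs: "xs \<noteq> []" "hd xs = y" by auto
    then have "u = curve T (nxt x)" using g y by (cases xs) (auto simp: good_Cons)
    then show False
      using arr_mult_eq_0_coef[OF x _ 0, of xs] g xs y b * by auto
  qed
  then show "coef (arr y \<otimes>\<^bsub>\<Lambda>\<^esub> b) q = coef \<zero>\<^bsub>\<Lambda>\<^esub> q" using g by (simp add: q coef_zero)
qed (use b in auto)

text \<open>
  The summands have disjoint supports, since the paths in them start with different arrows.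
\<close>

lemma arr_independent:
  assumes xy: "x \<noteq> y" and a: "a \<in> carrier \<Lambda>" and b: "b \<in> carrier \<Lambda>"
    and 0: "arr x \<otimes>\<^bsub>\<Lambda>\<^esub> a \<oplus>\<^bsub>\<Lambda>\<^esub> arr y \<otimes>\<^bsub>\<Lambda>\<^esub> b = \<zero>\<^bsub>\<Lambda>\<^esub>"
  shows "arr x \<otimes>\<^bsub>\<Lambda>\<^esub> a = \<zero>\<^bsub>\<Lambda>\<^esub>" "arr y \<otimes>\<^bsub>\<Lambda>\<^esub> b = \<zero>\<^bsub>\<Lambda>\<^esub>"
proof -
  have "coef (arr x \<otimes>\<^bsub>\<Lambda>\<^esub> a) q = 0 \<and> coef (arr y \<otimes>\<^bsub>\<Lambda>\<^esub> b) q = 0" if "good q" for q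
  proof -
    obtain u xs where q: "q = (u, xs)" by fastforce
    then have g: "good (u, xs)" using that by simp
    have "coef (arr x \<otimes>\<^bsub>\<Lambda>\<^esub> a) (u, xs) + coef (arr y \<otimes>\<^bsub>\<Lambda>\<^esub> b) (u, xs) = 0"
      using coef_add[of "arr x \<otimes>\<^bsub>\<Lambda>\<^esub> a" "arr y \<otimes>\<^bsub>\<Lambda>\<^esub> b" "(u, xs)"] a b g 0 by (simp add: coef_zero)
    moreover have "coef (arr x \<otimes>\<^bsub>\<Lambda>\<^esub> a) (u, xs) = 0 \<or> coef (arr y \<otimes>\<^bsub>\<Lambda>\<^esub> b) (u, xs) = 0"
      using coef_arr_supp[OF a g] coef_arr_supp[OF b g] xy by blast
    ultimately show ?thesis by (auto simp: q)
  qed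
  note coefs = this
  show "arr x \<otimes>\<^bsub>\<Lambda>\<^esub> a = \<zero>\<^bsub>\<Lambda>\<^esub>" by (rule \<Lambda>_eqI) (use a coefs in \<open>simp_all add: coef_zero\<close>)
  show "arr y \<otimes>\<^bsub>\<Lambda>\<^esub> b = \<zero>\<^bsub>\<Lambda>\<^esub>" by (rule \<Lambda>_eqI) (use b coefs in \<open>simp_all add: coef_zero\<close>)
qed

text \<open>
  A path killed by \<open>x\<close> starts with \<open>nxt x\<close>, and one killed by \<open>y\<close> with \<open>nxt y\<close>.
\<close>

lemma arr_common_annihilator:
  assumes xy: "x \<in> arcs Q" "y \<in> arcs Q" "x \<noteq> y" "curve T (nxt x) = curve T (nxt y)"
    and b: "b \<in> carrier \<Lambda>" "idm (curve T (nxt x)) \<otimes>\<^bsub>\<Lambda>\<^esub> b = b"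
    and 0: "arr x \<otimes>\<^bsub>\<Lambda>\<^esub> b = \<zero>\<^bsub>\<Lambda>\<^esub>" "arr y \<otimes>\<^bsub>\<Lambda>\<^esub> b = \<zero>\<^bsub>\<Lambda>\<^esub>"
  shows "b = \<zero>\<^bsub>\<Lambda>\<^esub>"
proof (rule \<Lambda>_eqI)
  fix q assume "good q"
  moreover obtain u xs where q: "q = (u, xs)" by fastforce
  ultimately have g: "good (u, xs)" by simp
  have "nxt x \<noteq> nxt y" using nxt_inj[of x y] xy by simp
  then have "xs = [] \<or> hd xs \<noteq> nxt x \<or> hd xs \<noteq> nxt y" by auto
  then have "coef b (u, xs) = 0"
    using coef_idm_supp[OF b g] arr_mult_eq_0_coef[OF xy(1) b(1) 0(1), of xs]
      arr_mult_eq_0_coef[OF xy(2) b(1) 0(2), of xs] g xy(4) by metis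
  then show "coef b q = coef \<zero>\<^bsub>\<Lambda>\<^esub> q" using g by (simp add: q coef_zero)
qed (use b in auto)

text \<open>
  Dually, the paths killed by \<open>nxt x\<close> from the right are those ending with \<open>x\<close>.
\<close>

lemma arr_right_annihilator:
  assumes x: "internal_triangle T x" and a: "a \<in> carrier \<Lambda>" "a \<otimes>\<^bsub>\<Lambda>\<^esub> idm (curve T (nxt x)) = a"
    and 0: "a \<otimes>\<^bsub>\<Lambda>\<^esub> arr (nxt x) = \<zero>\<^bsub>\<Lambda>\<^esub>"
  shows "\<exists>c\<in>carrier \<Lambda>. a = c \<otimes>\<^bsub>\<Lambda>\<^esub> arr x"
proof -
  have xa: "x \<in> arcs Q" "nxt x \<in> arcs Q" using x by (auto simp: internal_iff)
  obtain c where c: "c \<in> carrier \<Lambda>" "\<And>q. good q \<Longrightarrow> coef c q =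
      (if good (fst q, snd q @ [x]) then coef a (fst q, snd q @ [x]) else 0)"
    using \<Lambda>_from_coefs[of "\<lambda>q. if good (fst q, snd q @ [x]) then coef a (fst q, snd q @ [x]) else 0"] by blast
  have "a = c \<otimes>\<^bsub>\<Lambda>\<^esub> arr x"
  proof (rule \<Lambda>_eqI)
    fix q assume "good q"
    moreover obtain u xs where q: "q = (u, xs)" by fastforce
    ultimately have g: "good (u, xs)" by simp
    show "coef a q = coef (c \<otimes>\<^bsub>\<Lambda>\<^esub> arr x) q"
    proof (cases "xs \<noteq> [] \<and> last xs = x")
      case True
      then have xs: "butlast xs @ [x] = xs" by auto
      then have "good (u, butlast xs)" using g good_append[of u "butlast xs" "[x]"] by simp
      then show ?thesis using g c True xs by (simp add: q coef_mult_arr)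
    next
      case False
      have "coef a (u, xs) = 0"
      proof (rule ccontr)
        assume *: "coef a (u, xs) \<noteq> 0"
        have e: "path_end Q u xs = curve T (nxt x)" using coef_mult_idm[OF a(1) g, of "curve T (nxt x)"] a(2) * by metis
        have "xs = [] \<or> nxt x \<noteq> nxt (last xs)"
        proof (cases "xs = []")
          case False
          then have "last xs \<in> set xs" by simp
          then have "last xs \<in> sides T" using good_distinct[OF g] by blast
          then show ?thesis using \<open>\<not> (xs \<noteq> [] \<and> last xs = x)\<close> nxt_inj[of x "last xs"] xa by auto
        qed simp
        then have "good (u, xs @ [nxt x])" using g e xa by (auto simp: good_append good_Cons)
        then show False
          using coef_mult_arr[OF a(1), of u "xs @ [nxt x]" "nxt x"] 0 * by (simp add: coef_zero)
      qed
      moreover have "coef (c \<otimes>\<^bsub>\<Lambda>\<^esub> arr x) (u, xs) = 0" using coef_mult_arr[OF c(1) g, of x] False by auto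
      ultimately show ?thesis by (simp add: q)
    qed
  qed (use a c in auto)
  then show ?thesis using c by blast
qed

subsection \<open>Generators of the algebra\<close>

lemma proj_path: "(u, xs) \<in> quiver_paths Q \<Longrightarrow>
  proj (path_elt (u, xs)) = foldl (\<lambda>X x. X \<otimes>\<^bsub>\<Lambda>\<^esub> arr x) (idm u) xs"
proof (induction xs rule: rev_induct)
  case Nil
  then show ?case by (simp add: idm_def quiver_paths_Nil)
next
  case (snoc x xs)
  then have p: "(u, xs) \<in> quiver_paths Q" "x \<in> arcs Q" "path_end Q u xs = curve T x"
    by (auto simp: quiver_paths_append quiver_paths_Cons)
  then have "path_elt (u, xs @ [x]) = path_elt (u, xs) \<otimes>\<^bsub>KQ\<^esub> path_elt (curve T x, [x])"
    by (simp add: path_elt_mult)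
  then have "proj (path_elt (u, xs @ [x])) = proj (path_elt (u, xs)) \<otimes>\<^bsub>\<Lambda>\<^esub> arr x"
    using p by (simp add: proj_simps(2) path_elt_in_KQ path_elt_arrow_KQ arr_def)
  then show ?case using snoc.IH p by simp
qed

lemma \<Lambda>_induct [consumes 1, case_names add mult scal idm arr]:
  assumes X: "X \<in> carrier \<Lambda>"
    and add: "\<And>X Y. X \<in> carrier \<Lambda> \<Longrightarrow> Y \<in> carrier \<Lambda> \<Longrightarrow> P X \<Longrightarrow> P Y \<Longrightarrow> P (X \<oplus>\<^bsub>\<Lambda>\<^esub> Y)"
    and mult: "\<And>X Y. X \<in> carrier \<Lambda> \<Longrightarrow> Y \<in> carrier \<Lambda> \<Longrightarrow> P X \<Longrightarrow> P Y \<Longrightarrow> P (X \<otimes>\<^bsub>\<Lambda>\<^esub> Y)"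
    and scal: "\<And>c. P (scal c)" and idm: "\<And>u. u \<in> arc_set T \<Longrightarrow> P (idm u)" and arr: "\<And>x. x \<in> arcs Q \<Longrightarrow> P (arr x)"
  shows "P X"
proof -
  obtain r where r: "r \<in> carrier KQ" "X = proj r" using proj_surj[OF X] by blast
  have "P (proj r)"
    using r(1)
  proof (induction rule: path_algebra_induct)
    case zero
    have "scal 0 = proj (\<lambda>_. 0)" by (simp add: scalar_def proj_def)
    then show ?case using scal[of 0] by simp
  next
    case (add g h)
    then show ?case using assms(2)[of "proj g" "proj h"] proj_simps(3)[of g h] proj_simps(1)
      by (simp add: path_algebra_simps(5))
  next
    case (elt c q)
    obtain u xs where q: "q = (u, xs)" by fastforce
    have path: "P (proj (path_elt (u, xs))) \<and> proj (path_elt (u, xs)) \<in> carrier \<Lambda>"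
      using elt(2) unfolding q
    proof (induction xs rule: rev_induct)
      case Nil
      then show ?case using idm[of u] by (simp add: idm_def quiver_paths_Nil proj_simps(1) path_elt_Nil_KQ)
    next
      case (snoc x xs)
      then have p: "(u, xs) \<in> quiver_paths Q" "x \<in> arcs Q"
        by (auto simp: quiver_paths_append quiver_paths_Cons)
      have "proj (path_elt (u, xs @ [x])) = proj (path_elt (u, xs)) \<otimes>\<^bsub>\<Lambda>\<^esub> arr x"
        using snoc.prems p by (simp add: proj_path)
      then show ?case using snoc.IH[OF p(1)] arr[OF p(2)] mult by simp
    qed
    have "(\<lambda>p. c * \<one>\<^bsub>KQ\<^esub> p) \<otimes>\<^bsub>KQ\<^esub> path_elt q = (\<lambda>p. c * path_elt q p)"
      using path_elt_in_KQ[OF elt(2)] by (simp add: KQ_scale_mult)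
    then have "proj (\<lambda>p. c * path_elt q p) = scal c \<otimes>\<^bsub>\<Lambda>\<^esub> proj (path_elt q)"
      using proj_simps(2)[OF KQ_scale[OF KQ.one_closed, of c] path_elt_in_KQ[OF elt(2)]]
      by (simp add: scalar_def proj_def)
    then show ?case using mult[OF scal_closed _ scal] path by (simp add: q)
  qed
  then show ?thesis by (simp add: r)
qed

lemma module_hom_generatorsI:
  assumes M: "right_module \<Lambda> M" and N: "right_module \<Lambda> N"
    and closed: "\<And>m. m \<in> carrier M \<Longrightarrow> f m \<in> carrier N"
    and add: "\<And>m n. m \<in> carrier M \<Longrightarrow> n \<in> carrier M \<Longrightarrow> f (m \<oplus>\<^bsub>M\<^esub> n) = f m \<oplus>\<^bsub>N\<^esub> f n"
    and scal: "\<And>c m. m \<in> carrier M \<Longrightarrow> f (scal c \<odot>\<^bsub>M\<^esub> m) = scal c \<odot>\<^bsub>N\<^esub> f m"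
    and idm: "\<And>u m. m \<in> carrier M \<Longrightarrow> f (idm u \<odot>\<^bsub>M\<^esub> m) = idm u \<odot>\<^bsub>N\<^esub> f m"
    and arr: "\<And>x m. m \<in> carrier M \<Longrightarrow> f (arr x \<odot>\<^bsub>M\<^esub> m) = arr x \<odot>\<^bsub>N\<^esub> f m"
  shows "f \<in> module_hom \<Lambda> M N"
proof (rule module_homI[OF closed add])
  interpret M: right_module \<Lambda> M by fact
  interpret N: right_module \<Lambda> N by fact
  fix X m assume X: "X \<in> carrier \<Lambda>" and m: "m \<in> carrier M"
  from X have "\<forall>m\<in>carrier M. f (X \<odot>\<^bsub>M\<^esub> m) = X \<odot>\<^bsub>N\<^esub> f m"
  proof (induction rule: \<Lambda>_induct)
    case (add X Y)
    then show ?case using assms(4) closed by (simp add: M.smult_add_ring N.smult_add_ring M.smult_closed)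
  next
    case (mult X Y)
    then show ?case using closed by (simp add: M.smult_assoc N.smult_assoc M.smult_closed)
  qed (use scal idm arr in auto)
  then show "f (X \<odot>\<^bsub>M\<^esub> m) = X \<odot>\<^bsub>N\<^esub> f m" using m by blast
qed auto

subsection \<open>String modules\<close>

abbreviation "SM \<equiv> string_module Q I"

lemma is_string_letters:
  assumes w: "is_string Q I w" and i: "i < length (snd w)"
  shows "letter_arrow (snd w ! i) \<in> arcs Q" "letter_start Q (snd w ! i) = string_vertex Q w i"
    "letter_end Q (snd w ! i) = string_vertex Q w (Suc i)"
proof -
  obtain u ls where [simp]: "w = (u, ls)" by fastforce
  show "letter_arrow (snd w ! i) \<in> arcs Q" using w i by (force simp: is_string_def simp del: quiver_simps)
  show "letter_end Q (snd w ! i) = string_vertex Q w (Suc i)" by (simp add: string_vertex_def)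
  show "letter_start Q (snd w ! i) = string_vertex Q w i"
    using w i by (cases i) (auto simp: is_string_def string_vertex_def hd_conv_nth simp del: quiver_simps)
qed

lemma string_vertex_arc: "is_string Q I w \<Longrightarrow> i \<le> length (snd w) \<Longrightarrow> string_vertex Q w i \<in> arc_set T"
proof (cases i)
  case 0
  then show "is_string Q I w \<Longrightarrow> ?thesis" by (auto simp: string_vertex_def is_string_def)
next
  case (Suc j)
  assume "is_string Q I w" "i \<le> length (snd w)"
  then have "letter_arrow (snd w ! j) \<in> arcs Q" using is_string_letters(1)[of w j] Suc by simp
  then show ?thesis by (cases "snd w ! j") (auto simp: string_vertex_def Suc)
qed

lemma is_string_consecutive:
  assumes w: "is_string Q I w" and i: "Suc i < length (snd w)"
  shows "snd w ! i = Dir x \<Longrightarrow> snd w ! Suc i = Dir y \<Longrightarrow> curve T y = curve T (nxt x) \<and> y \<noteq> nxt x"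
    "snd w ! i = Inv y \<Longrightarrow> snd w ! Suc i = Inv x \<Longrightarrow> curve T y = curve T (nxt x) \<and> y \<noteq> nxt x"
    "snd w ! i = Dir x \<Longrightarrow> snd w ! Suc i = Inv y \<Longrightarrow> curve T (nxt y) = curve T (nxt x) \<and> y \<noteq> x"
    "snd w ! i = Inv x \<Longrightarrow> snd w ! Suc i = Dir y \<Longrightarrow> curve T y = curve T x \<and> y \<noteq> x"
proof -
  have a: "letter_arrow (snd w ! i) \<in> arcs Q" "letter_arrow (snd w ! Suc i) \<in> arcs Q"
    and e: "letter_end Q (snd w ! i) = letter_start Q (snd w ! Suc i)"
    using is_string_letters[OF w, of i] is_string_letters[OF w, of "Suc i"] i by auto
  have n: "snd w ! Suc i \<noteq> letter_inverse (snd w ! i)"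
    and d: "\<And>x y. snd w ! i = Dir x \<Longrightarrow> snd w ! Suc i = Dir y \<Longrightarrow> path_elt (tail Q x, [x, y]) \<notin> I"
    and v: "\<And>x y. snd w ! i = Inv y \<Longrightarrow> snd w ! Suc i = Inv x \<Longrightarrow> path_elt (tail Q x, [x, y]) \<notin> I"
    using w i by (auto simp: is_string_def split_beta simp del: quiver_simps)
  show "snd w ! i = Dir x \<Longrightarrow> snd w ! Suc i = Dir y \<Longrightarrow> curve T y = curve T (nxt x) \<and> y \<noteq> nxt x"
    using a e d path_elt_in_ideal[of x y] by auto
  show "snd w ! i = Inv y \<Longrightarrow> snd w ! Suc i = Inv x \<Longrightarrow> curve T y = curve T (nxt x) \<and> y \<noteq> nxt x"
    using a e v path_elt_in_ideal[of x y] by auto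
  show "snd w ! i = Dir x \<Longrightarrow> snd w ! Suc i = Inv y \<Longrightarrow> curve T (nxt y) = curve T (nxt x) \<and> y \<noteq> x"
    using e n by auto
  show "snd w ! i = Inv x \<Longrightarrow> snd w ! Suc i = Dir y \<Longrightarrow> curve T y = curve T x \<and> y \<noteq> x"
    using e n by auto
qed

end

context triangulated_surface
begin

text \<open>
  Each position of a string is the target of at most one arrow coming from the left and at most
  one coming from the right, and an arrow moves basis vectors injectively.
\<close>

lemma arrow_action_simps:
  "i < length (snd w) \<Longrightarrow> is_string Q I w \<Longrightarrow> snd w ! i = Dir x \<Longrightarrow> arrow_action w f x (Suc i) = f i"
  "i < length (snd w) \<Longrightarrow> is_string Q I w \<Longrightarrow> snd w ! i = Inv x \<Longrightarrow> arrow_action w f x i = f (Suc i)"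
  "\<not> (0 < j \<and> j \<le> length (snd w) \<and> snd w ! (j - 1) = Dir x) \<Longrightarrow>
     \<not> (j < length (snd w) \<and> snd w ! j = Inv x) \<Longrightarrow> arrow_action w f x j = 0"
proof -
  assume i: "i < length (snd w)" and w: "is_string Q I w" and l: "snd w ! i = Dir x"
  then show "arrow_action w f x (Suc i) = f i"
    using is_string_consecutive(3)[OF w, of i x x] by (auto simp: arrow_action_def)
next
  assume i: "i < length (snd w)" and w: "is_string Q I w" and l: "snd w ! i = Inv x"
  show "arrow_action w f x i = f (Suc i)"
  proof (cases i)
    case (Suc k)
    then have "snd w ! k \<noteq> Dir x" using is_string_consecutive(3)[OF w, of k x x] i l by auto
    then show ?thesis using i l Suc by (auto simp: arrow_action_def)
  qed (use i l in \<open>auto simp: arrow_action_def\<close>)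
qed (auto simp: arrow_action_def)

definition vertex_part :: "('a, 's) str \<Rightarrow> 'a \<Rightarrow> (nat \<Rightarrow> 'k) \<Rightarrow> nat \<Rightarrow> 'k" where
  "vertex_part w u f = (\<lambda>j. if string_vertex Q w j = u then f j else 0)"

lemma path_action_Nil: "path_action Q w f (u, []) = vertex_part w u f"
  and path_action_snoc: "path_action Q w f (u, xs @ [x]) = arrow_action w (path_action Q w f (u, xs)) x"
  by (simp_all add: path_action_def vertex_part_def)

lemma arrow_action_linear:
  fixes f g :: "nat \<Rightarrow> 'k"
  shows "arrow_action w (\<lambda>j. f j + g j) x = (\<lambda>j. arrow_action w f x j + arrow_action w g x j)"
  "arrow_action w (\<lambda>j. c * f j) x = (\<lambda>j. c * arrow_action w f x j)"
  "arrow_action w (\<lambda>j. 0) x = (\<lambda>j. 0 :: 'k)"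
  by (auto simp: arrow_action_def fun_eq_iff distrib_left)

lemma path_action_linear:
  fixes f g :: "nat \<Rightarrow> 'k"
  shows "path_action Q w (\<lambda>j. f j + g j) q = (\<lambda>j. path_action Q w f q j + path_action Q w g q j)"
  "path_action Q w (\<lambda>j. c * f j) q = (\<lambda>j. c * path_action Q w f q j)"
  "path_action Q w (\<lambda>j. 0) q = (\<lambda>j. 0 :: 'k)"
proof -
  obtain u xs where q: "q = (u, xs)" by fastforce
  show "path_action Q w (\<lambda>j. f j + g j) q = (\<lambda>j. path_action Q w f q j + path_action Q w g q j)"
    unfolding q by (induction xs rule: rev_induct) (auto simp: path_action_Nil path_action_snoc arrow_action_linear vertex_part_def)
  show "path_action Q w (\<lambda>j. c * f j) q = (\<lambda>j. c * path_action Q w f q j)"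
    unfolding q by (induction xs rule: rev_induct) (auto simp: path_action_Nil path_action_snoc arrow_action_linear vertex_part_def)
  show "path_action Q w (\<lambda>j. 0) q = (\<lambda>j. 0 :: 'k)"
    unfolding q by (induction xs rule: rev_induct) (auto simp: path_action_Nil path_action_snoc arrow_action_linear vertex_part_def)
qed

context
  fixes w :: "('a, 's) str"
  assumes w: "is_string Q I w"
begin

lemma arrow_action_vertex:
  "vertex_part w v (arrow_action w f x) = (if v = curve T (nxt x) then arrow_action w f x else (\<lambda>_. 0))"
  "arrow_action w (vertex_part w v f) x = (if v = curve T x then arrow_action w f x else (\<lambda>_. 0))"
proof -
  have D: "string_vertex Q w j = curve T (nxt x)" "string_vertex Q w (j - Suc 0) = curve T x"
    if "0 < j" "j \<le> length (snd w)" "snd w ! (j - Suc 0) = Dir x" for j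
    using is_string_letters(2,3)[OF w, of "j - Suc 0"] that by auto
  have I: "string_vertex Q w i = curve T (nxt x)" "string_vertex Q w (Suc i) = curve T x"
    if "i < length (snd w)" "snd w ! i = Inv x" for i
    using is_string_letters(2,3)[OF w that(1)] that(2) by auto
  show "vertex_part w v (arrow_action w f x) = (if v = curve T (nxt x) then arrow_action w f x else (\<lambda>_. 0))"
    using D I by (auto simp: vertex_part_def arrow_action_def fun_eq_iff)
  show "arrow_action w (vertex_part w v f) x = (if v = curve T x then arrow_action w f x else (\<lambda>_. 0))"
    using D I by (auto simp: vertex_part_def arrow_action_def fun_eq_iff)
qed

text \<open>
  A nonzero value would require two consecutive letters of the string whose composition is a
  relation.
\<close>

lemma arrow_action_nxt:
  fixes f :: "nat \<Rightarrow> 'k"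
  shows "arrow_action w (arrow_action w f x) (nxt x) = (\<lambda>_. 0)"
proof (rule ext)
  fix j
  show "arrow_action w (arrow_action w f x) (nxt x) j = 0"
  proof (rule ccontr)
    assume *: "arrow_action w (arrow_action w f x) (nxt x) j \<noteq> 0"
    then consider i where "j = Suc i" "i < length (snd w)" "snd w ! i = Dir (nxt x)"
      | "j < length (snd w)" "snd w ! j = Inv (nxt x)"
    proof -
      have "(0 < j \<and> j \<le> length (snd w) \<and> snd w ! (j - 1) = Dir (nxt x)) \<or> (j < length (snd w) \<and> snd w ! j = Inv (nxt x))"
        using * arrow_action_simps(3)[of j w "nxt x"] by blast
      then show thesis using that(1)[of "j - 1"] that(2) by auto
    qed
    then show False
    proof cases
      case 1
      then have "arrow_action w f x i \<noteq> 0" using * arrow_action_simps(1)[OF 1(2) w 1(3), of "arrow_action w f x"] 1(1) by simp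
      then obtain k where "i = Suc k" "snd w ! k = Dir x"
        using arrow_action_simps(3)[of i w x f] 1 by (cases i) auto
      then show False using is_string_consecutive(1)[OF w, of k x "nxt x"] 1 by auto
    next
      case 2
      then have "arrow_action w f x (Suc j) \<noteq> 0" using * arrow_action_simps(2)[OF 2(1) w 2(2), of "arrow_action w f x"] by simp
      then have "Suc j < length (snd w) \<and> snd w ! Suc j = Inv x"
        using arrow_action_simps(3)[of "Suc j" w x f] 2 by auto
      then show False using is_string_consecutive(2)[OF w, of j "nxt x" x] 2 by auto
    qed
  qed
qed

lemma path_action_vertex:
  assumes "(u, xs) \<in> quiver_paths Q"
  shows "vertex_part w v (path_action Q w f (u, xs)) = (if v = path_end Q u xs then path_action Q w f (u, xs) else (\<lambda>_. 0))"
proof (cases xs rule: rev_cases)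
  case Nil
  then show ?thesis by (auto simp: path_action_Nil vertex_part_def fun_eq_iff)
next
  case (snoc ys x)
  then show ?thesis by (simp add: path_action_snoc arrow_action_vertex)
qed

lemma path_action_append:
  fixes f :: "nat \<Rightarrow> 'k"
  assumes p: "(u, xs) \<in> quiver_paths Q"
  shows "path_action Q w (path_action Q w f (u, xs)) (v, ys) =
    (if path_end Q u xs = v then path_action Q w f (u, xs @ ys) else (\<lambda>_. 0))"
proof (induction ys rule: rev_induct)
  case Nil
  then show ?case using path_action_vertex[OF p] by (auto simp: path_action_Nil)
next
  case (snoc y ys)
  have "path_action Q w f (u, xs @ ys @ [y]) = arrow_action w (path_action Q w f (u, xs @ ys)) y"
    using path_action_snoc[of w f u "xs @ ys" y] by simp
  with snoc show ?case by (simp add: path_action_snoc arrow_action_linear)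
qed

lemma path_action_bad:
  fixes f :: "nat \<Rightarrow> 'k"
  assumes p: "(u, xs) \<in> quiver_paths Q" and bad: "\<not> good (u, xs)"
  shows "path_action Q w f (u, xs) = (\<lambda>_. 0)"
proof -
  have "\<not> successively (\<lambda>x y. y \<noteq> nxt x) xs" using p bad by (auto simp: good_def)
  then obtain as x bs where xs: "xs = as @ [x, nxt x] @ bs" using bad_path_split by fastforce
  have "path_action Q w f (u, as @ [x, nxt x]) = (\<lambda>_. 0)"
    using path_action_snoc[of w f u "as @ [x]" "nxt x"] path_action_snoc[of w f u as x]
    by (simp add: arrow_action_nxt)
  moreover have "path_action Q w f (u, ys) = (\<lambda>_. 0) \<Longrightarrow> path_action Q w f (u, ys @ zs) = (\<lambda>_. 0)" for ys zs
  proof (induction zs rule: rev_induct)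
    case (snoc z zs)
    then show ?case using path_action_snoc[of w f u "ys @ zs" z] by (simp add: arrow_action_linear)
  qed simp
  ultimately show ?thesis using xs by (metis append.assoc)
qed

text \<open>
  The action of the path algebra; it annihilates the ideal and therefore does not depend on the
  representative chosen in the definition of a string module.
\<close>

definition act :: "(('a, 's) path \<Rightarrow> 'k) \<Rightarrow> (nat \<Rightarrow> 'k) \<Rightarrow> nat \<Rightarrow> 'k" where
  "act r f = (\<lambda>j. \<Sum>q | r q \<noteq> 0. r q * path_action Q w f q j)"

lemma act_eq: "finite S \<Longrightarrow> {q. r q \<noteq> 0} \<subseteq> S \<Longrightarrow> act r f j = (\<Sum>q\<in>S. r q * path_action Q w f q j)"
  unfolding act_def by (rule sum.mono_neutral_left) auto

lemma act_add_left:
  assumes "r \<in> carrier KQ" "s \<in> carrier KQ"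
  shows "act (\<lambda>q. r q + s q) f = (\<lambda>j. act r f j + act s f j)"
proof
  fix j
  let ?S = "{q. r q \<noteq> 0} \<union> {q. s q \<noteq> 0}"
  have "finite ?S" using assms by (simp add: path_algebra_simps(1))
  moreover have "{q. r q \<noteq> 0} \<subseteq> ?S" "{q. s q \<noteq> 0} \<subseteq> ?S" "{q. r q + s q \<noteq> 0} \<subseteq> ?S" by auto
  ultimately show "act (\<lambda>q. r q + s q) f j = act r f j + act s f j"
    by (simp only: act_eq[of ?S] distrib_right sum.distrib)
qed

lemma act_scale_left: "act (\<lambda>q. c * r q) f = (\<lambda>j. c * act r f j)"
  by (cases "c = 0") (auto simp: act_def sum_distrib_left mult.assoc)

lemma act_linear:
  "act r (\<lambda>j. f j + g j) = (\<lambda>j. act r f j + act r g j)"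
  "act r (\<lambda>j. c * f j) = (\<lambda>j. c * act r f j)"
  "act r (\<lambda>j. 0) = (\<lambda>j. 0)"
  by (auto simp: act_def path_action_linear distrib_left sum.distrib sum_distrib_left mult.left_commute fun_eq_iff)

lemma act_path_elt: "act (path_elt q) f = path_action Q w f q"
proof
  fix j
  have "act (path_elt q) f j = (\<Sum>p\<in>{q}. path_elt q p * path_action Q w f p j)"
    by (rule act_eq) (auto simp: path_elt_def)
  then show "act (path_elt q) f j = path_action Q w f q j" by (simp add: path_elt_def)
qed

lemma act_zero: "act (\<lambda>_. 0) f = (\<lambda>_. 0)"
  by (simp add: act_def)

lemma act_mult:
  assumes r: "r \<in> carrier KQ" and s: "s \<in> carrier KQ"
  shows "act (r \<otimes>\<^bsub>KQ\<^esub> s) f = act s (act r f)"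
  using r
proof (induction rule: path_algebra_induct)
  case zero
  have "(\<lambda>_. 0) \<otimes>\<^bsub>KQ\<^esub> s = (\<lambda>_. 0)" using KQ.l_null[OF s] by (simp only: path_algebra_simps(4))
  then show ?case by (simp add: act_zero act_linear)
next
  case (add g h)
  have "(\<lambda>p. g p + h p) \<otimes>\<^bsub>KQ\<^esub> s = (\<lambda>p. (g \<otimes>\<^bsub>KQ\<^esub> s) p + (h \<otimes>\<^bsub>KQ\<^esub> s) p)"
    using KQ.l_distr[OF add(1,2) s] by (simp only: path_algebra_simps(5))
  then show ?case using add s by (simp add: act_add_left KQ.m_closed act_linear)
next
  case (elt c q)
  obtain u xs where q: "q = (u, xs)" by fastforce
  note p = path_elt_in_KQ[OF elt(2)]
  have "act (path_elt q \<otimes>\<^bsub>KQ\<^esub> s) f = act s (path_action Q w f q)"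
    using s
  proof (induction rule: path_algebra_induct)
    case zero
    have "path_elt q \<otimes>\<^bsub>KQ\<^esub> (\<lambda>_. 0) = (\<lambda>_. 0)" using KQ.r_null[OF p] by (simp only: path_algebra_simps(4))
    then show ?case by (simp add: act_zero)
  next
    case (add g h)
    have "path_elt q \<otimes>\<^bsub>KQ\<^esub> (\<lambda>p. g p + h p) = (\<lambda>t. (path_elt q \<otimes>\<^bsub>KQ\<^esub> g) t + (path_elt q \<otimes>\<^bsub>KQ\<^esub> h) t)"
      using KQ.r_distr[OF add(1,2) p] by (simp only: path_algebra_simps(5))
    then show ?case using add p by (simp add: act_add_left KQ.m_closed)
  next
    case (elt c' q')
    obtain v ys where q': "q' = (v, ys)" by fastforce
    have "path_elt q \<otimes>\<^bsub>KQ\<^esub> (\<lambda>t. c' * path_elt q' t) = (\<lambda>t. c' * (path_elt q \<otimes>\<^bsub>KQ\<^esub> path_elt q') t)"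
      by (rule ext) (auto simp: path_algebra_simps(2) sum_distrib_left mult.left_commute)
    then show ?case using \<open>q \<in> quiver_paths Q\<close>
      by (simp add: act_scale_left act_path_elt q q' path_elt_mult path_action_append path_algebra_simps(4) act_zero)
  qed
  then show ?case by (simp add: KQ_scale_mult act_scale_left act_linear act_path_elt)
qed

lemma act_ideal: "i \<in> I \<Longrightarrow> act i f = (\<lambda>_. 0)"
proof
  fix j assume i: "i \<in> I"
  have "i q * path_action Q w f q j = 0" if "i q \<noteq> 0" for q
  proof -
    have "q \<in> quiver_paths Q" "\<not> good q"
      using i that unfolding ideal_eq by (cases q; auto simp: path_algebra_simps(1))+
    then show ?thesis using path_action_bad[of "fst q" "snd q" f] by simp
  qed
  then show "act i f j = 0" by (simp add: act_def)
qed

lemma path_action_support: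
  fixes f :: "nat \<Rightarrow> 'k"
  assumes "\<forall>j>length (snd w). f j = 0"
  shows "\<forall>j>length (snd w). path_action Q w f q j = 0"
proof -
  obtain u xs where q: "q = (u, xs)" by fastforce
  show ?thesis unfolding q using assms
    by (induction xs rule: rev_induct) (auto simp: path_action_Nil path_action_snoc vertex_part_def arrow_action_def)
qed

lemma string_module_simps:
  "carrier (SM w) = {f. \<forall>j>length (snd w). f j = 0}"
  "\<zero>\<^bsub>SM w\<^esub> = (\<lambda>_. 0)"
  "f \<oplus>\<^bsub>SM w\<^esub> g = (\<lambda>j. f j + g j)"
  by (simp_all add: string_module_def)

lemma string_module_smult:
  assumes r: "r \<in> carrier KQ"
  shows "proj r \<odot>\<^bsub>SM w\<^esub> f = act r f"
proof -
  have "proj r \<odot>\<^bsub>SM w\<^esub> f = act (coef (proj r)) f"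
    by (simp add: string_module_def act_def coef_def Let_def)
  moreover have "coef (proj r) \<in> proj r" unfolding coef_def by (rule someI[of _ r]) (rule proj_self[OF r])
  then obtain i where i: "i \<in> I" "coef (proj r) = (\<lambda>q. i q + r q)"
    by (auto simp: proj_def a_r_coset_def' path_algebra_simps(5))
  have "i \<in> carrier KQ" using I.Icarr[OF i(1)] .
  ultimately show ?thesis using act_add_left[of i r f] r act_ideal[OF i(1)] by (simp add: i(2))
qed

lemma right_module_string: "right_module \<Lambda> (SM w)"
proof (intro right_module.intro right_module_axioms.intro)
  show "ring \<Lambda>" by (rule \<Lambda>.ring_axioms)
  show "abelian_group (SM w)"
  proof (rule abelian_groupI)
    fix f assume f: "f \<in> carrier (SM w)"
    then have "(\<lambda>j. - f j) \<in> carrier (SM w)" by (simp add: string_module_simps)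
    moreover have "(\<lambda>j. - f j) \<oplus>\<^bsub>SM w\<^esub> f = \<zero>\<^bsub>SM w\<^esub>" by (simp add: string_module_simps)
    ultimately show "\<exists>g\<in>carrier (SM w). g \<oplus>\<^bsub>SM w\<^esub> f = \<zero>\<^bsub>SM w\<^esub>" by blast
  qed (auto simp: string_module_simps add_ac)
  fix X f assume X: "X \<in> carrier \<Lambda>" and f: "f \<in> carrier (SM w)"
  obtain r where r: "r \<in> carrier KQ" "X = proj r" using proj_surj[OF X] by blast
  show "X \<odot>\<^bsub>SM w\<^esub> f \<in> carrier (SM w)"
    using f path_action_support[of f] by (auto simp: r string_module_smult string_module_simps act_def)
  {
    fix g
    show "X \<odot>\<^bsub>SM w\<^esub> (f \<oplus>\<^bsub>SM w\<^esub> g) = X \<odot>\<^bsub>SM w\<^esub> f \<oplus>\<^bsub>SM w\<^esub> X \<odot>\<^bsub>SM w\<^esub> g"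
      by (simp add: r string_module_smult string_module_simps act_linear)
  }
  fix Y assume Y: "Y \<in> carrier \<Lambda>"
  obtain s where s: "s \<in> carrier KQ" "Y = proj s" using proj_surj[OF Y] by blast
  show "(X \<oplus>\<^bsub>\<Lambda>\<^esub> Y) \<odot>\<^bsub>SM w\<^esub> f = X \<odot>\<^bsub>SM w\<^esub> f \<oplus>\<^bsub>SM w\<^esub> Y \<odot>\<^bsub>SM w\<^esub> f"
  proof -
    have "(X \<oplus>\<^bsub>\<Lambda>\<^esub> Y) \<odot>\<^bsub>SM w\<^esub> f = act (r \<oplus>\<^bsub>KQ\<^esub> s) f"
      using string_module_smult[OF KQ.a_closed[OF r(1) s(1)]] r s by (simp add: proj_simps(3))
    then show ?thesis using r s by (simp add: path_algebra_simps(5) act_add_left string_module_smult string_module_simps)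
  qed
  show "(X \<otimes>\<^bsub>\<Lambda>\<^esub> Y) \<odot>\<^bsub>SM w\<^esub> f = Y \<odot>\<^bsub>SM w\<^esub> (X \<odot>\<^bsub>SM w\<^esub> f)"
    using string_module_smult[OF KQ.m_closed[OF r(1) s(1)]] r s
    by (simp add: proj_simps(2) act_mult string_module_smult)
next
  fix f assume f: "f \<in> carrier (SM w)"
  have "act \<one>\<^bsub>KQ\<^esub> f j = f j" for j
  proof -
    let ?S = "(\<lambda>u. (u, [])) ` arc_set T"
    have "act \<one>\<^bsub>KQ\<^esub> f j = (\<Sum>q\<in>?S. \<one>\<^bsub>KQ\<^esub> q * path_action Q w f q j)"
      using finite_verts by (intro act_eq) (auto simp: path_algebra_simps(3) split: if_splits)
    also have "\<dots> = (\<Sum>u\<in>arc_set T. if u = string_vertex Q w j then f j else 0)"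
      by (subst sum.reindex) (auto simp: inj_on_def path_algebra_simps(3) path_action_Nil vertex_part_def intro!: sum.cong)
    also have "\<dots> = f j"
      using finite_verts f string_vertex_arc[OF w, of j] by (cases "j \<le> length (snd w)") (auto simp: string_module_simps)
    finally show ?thesis .
  qed
  then show "\<one>\<^bsub>\<Lambda>\<^esub> \<odot>\<^bsub>SM w\<^esub> f = f"
    using string_module_smult[OF KQ.one_closed] by (auto simp: proj_simps(4))
qed

lemma string_module_scal: "f \<in> carrier (SM w) \<Longrightarrow> scal c \<odot>\<^bsub>SM w\<^esub> f = (\<lambda>j. c * f j)"
proof -
  assume f: "f \<in> carrier (SM w)"
  have "act \<one>\<^bsub>KQ\<^esub> f = f"
    using right_module.smult_one[OF right_module_string f] string_module_smult[OF KQ.one_closed, of f]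
    by (simp add: proj_simps(4))
  then show ?thesis
    using string_module_smult[OF KQ_scale[OF KQ.one_closed], of c f] by (simp add: scalar_def proj_def act_scale_left)
qed

lemma string_module_zero: "\<zero>\<^bsub>\<Lambda>\<^esub> \<odot>\<^bsub>SM w\<^esub> f = (\<lambda>_. 0)"
  using string_module_smult[OF KQ.zero_closed, of f] unfolding proj_simps(5)
  by (simp add: path_algebra_simps(4) act_zero)

lemma string_module_idm: "idm u \<odot>\<^bsub>SM w\<^esub> f = (if u \<in> arc_set T then vertex_part w u f else (\<lambda>_. 0))"
proof (cases "u \<in> arc_set T")
  case True
  then show ?thesis using string_module_smult[OF path_elt_Nil_KQ[OF True]]
    by (simp add: idm_def act_path_elt path_action_Nil)
next
  case False
  then show ?thesis by (simp add: idm_def string_module_zero)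
qed

lemma string_module_arr: "arr x \<odot>\<^bsub>SM w\<^esub> f = arrow_action w f x"
proof (cases "x \<in> arcs Q")
  case True
  have "arr x \<odot>\<^bsub>SM w\<^esub> f = path_action Q w f (curve T x, [] @ [x])"
    using string_module_smult[OF path_elt_arrow_KQ[OF True]] True by (simp add: arr_def act_path_elt)
  then show ?thesis by (simp only: path_action_snoc path_action_Nil arrow_action_vertex) simp
next
  case False
  have "arrow_action w f x j = 0" for j
  proof (rule arrow_action_simps(3))
    show "\<not> (0 < j \<and> j \<le> length (snd w) \<and> snd w ! (j - 1) = Dir x)"
      using is_string_letters(1)[OF w, of "j - 1"] False by (cases j) (auto simp del: quiver_simps)
    show "\<not> (j < length (snd w) \<and> snd w ! j = Inv x)"
      using is_string_letters(1)[OF w, of j] False by (auto simp del: quiver_simps)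
  qed
  then show ?thesis using False by (auto simp: arr_def string_module_zero)
qed

end

text \<open>
  Every element is a sum of multiples of basis vectors.
\<close>

lemma string_module_induct:
  assumes w: "is_string Q I w" and m: "m \<in> carrier (SM w)"
    and add: "\<And>m n. m \<in> carrier (SM w) \<Longrightarrow> n \<in> carrier (SM w) \<Longrightarrow> P m \<Longrightarrow> P n \<Longrightarrow> P (m \<oplus>\<^bsub>SM w\<^esub> n)"
    and single: "\<And>c j. j \<le> length (snd w) \<Longrightarrow> P (\<lambda>i. if i = j then c else 0)"
  shows "P m"
proof -
  have "P (\<lambda>j. if j < k then m j else 0)" if "k \<le> Suc (length (snd w))" for k
    using that
  proof (induction k)
    case 0
    have "(\<lambda>i. if i = 0 then 0 else 0) = (\<lambda>j. if j < (0::nat) then m j else 0)" by auto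
    then show ?case using single[of 0 0] by simp
  next
    case (Suc k)
    have "(\<lambda>j. if j < Suc k then m j else 0) =
        (\<lambda>j. if j < k then m j else 0) \<oplus>\<^bsub>SM w\<^esub> (\<lambda>j. if j = k then m k else 0)"
      unfolding string_module_simps(3)[OF w] by (auto simp: fun_eq_iff less_Suc_eq)
    moreover have "(\<lambda>j. if j < k then m j else 0) \<in> carrier (SM w)" "(\<lambda>j. if j = k then m k else 0) \<in> carrier (SM w)"
      using Suc.prems by (auto simp: string_module_simps[OF w])
    ultimately show ?case using Suc add single[of k "m k"] by simp
  qed
  moreover have "(\<lambda>j. if j < Suc (length (snd w)) then m j else 0) = m"
    using m by (auto simp: string_module_simps[OF w] fun_eq_iff)
  ultimately show ?thesis by force
qed

end

section \<open>Strings of arcs\<close>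

locale arc_string = triangulated_surface T field_type
  for T :: "('s, 'a) triangulation" and field_type :: "'k::field itself" +
  fixes w :: "('a, 's) str" and \<gamma> :: "'s list"
  assumes string: "is_string Q I w" and arc: "corresponding_arc T w \<gamma>"
begin

abbreviation "ls \<equiv> snd w"
abbreviation "len \<equiv> length ls"
abbreviation "vert \<equiv> string_vertex Q w"
abbreviation "es \<equiv> end_side T \<gamma>"

definition pos :: "arc_end \<Rightarrow> nat" where
  "pos e = (case e of Start \<Rightarrow> 0 | Terminal \<Rightarrow> len)"

lemma pos_simps [simp]: "pos Start = 0" "pos Terminal = len" by (simp_all add: pos_def)

lemma pos_le: "pos e \<le> len" by (cases e) auto

lemma string_eq: "w = crossing_string T \<gamma>" "crossing_arc T \<gamma>"
  using arc unfolding corresponding_arc_def by simp_all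

lemma ls_eq: "ls = map2 (crossing_letter T) \<gamma> (tl \<gamma>)"
  using arg_cong[OF string_eq(1), of snd] unfolding crossing_string_def by simp

lemma length_arc: "length \<gamma> = Suc len"
  using string_eq(2) unfolding ls_eq by (cases \<gamma>) (simp_all add: crossing_arc_def)

lemma arc_side:
  assumes "i \<le> len"
  shows "\<gamma> ! i \<in> sides T" "curve T (\<gamma> ! i) \<in> arc_set T"
proof -
  have "\<gamma> ! i \<in> set \<gamma>" using assms by (simp add: length_arc)
  then show "\<gamma> ! i \<in> sides T" "curve T (\<gamma> ! i) \<in> arc_set T"
    using arc unfolding corresponding_arc_def crossing_arc_def by blast+
qed

lemma opp_arc:
  assumes "i \<le> len"
  shows "opp (\<gamma> ! i) \<in> sides T" "opp (\<gamma> ! i) \<noteq> \<gamma> ! i" "curve T (opp (\<gamma> ! i)) = curve T (\<gamma> ! i)"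
    "opp (opp (\<gamma> ! i)) = \<gamma> ! i"
  by (rule opp_side(1-3)[OF arc_side(1,2)[OF assms]] opp_opp[OF arc_side(1,2)[OF assms]])+

lemma letter_eq: "i < len \<Longrightarrow> ls ! i = crossing_letter T (\<gamma> ! i) (\<gamma> ! Suc i)"
proof -
  assume "i < len"
  then have "i < length \<gamma>" "i < length (tl \<gamma>)" using length_arc by simp_all
  then show ?thesis unfolding ls_eq by (simp add: nth_tl)
qed

text \<open>
  Between two crossings the arc cuts off a corner of a triangle: the side through which it enters
  and the side through which it leaves are consecutive, in one order or the other.
\<close>

lemma letter_Dir: "i < len \<Longrightarrow> ls ! i = Dir x \<Longrightarrow> x = opp (\<gamma> ! i) \<and> \<gamma> ! Suc i = nxt x"
  using letter_eq[of i] by (auto simp: crossing_letter_def Let_def split: if_splits)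

lemma letter_Inv:
  assumes i: "i < len" "ls ! i = Inv x"
  shows "x = \<gamma> ! Suc i \<and> nxt x = opp (\<gamma> ! i)"
proof -
  have x: "x = \<gamma> ! Suc i" "\<gamma> ! Suc i \<noteq> nxt (opp (\<gamma> ! i))"
    using letter_eq[OF i(1)] i(2) by (auto simp: crossing_letter_def Let_def split: if_splits)
  have "\<gamma> ! Suc i = nxt (opp (\<gamma> ! i)) \<or> \<gamma> ! Suc i = nxt (nxt (opp (\<gamma> ! i)))"
    using string_eq(2) length_arc i(1) by (simp add: crossing_arc_def Let_def)
  then have "x = nxt (nxt (opp (\<gamma> ! i)))" using x by simp
  then show ?thesis using x i nxt3[OF opp_arc(1)[of i]] by simp
qed

lemma letter_arc: "i < len \<Longrightarrow> letter_arrow (ls ! i) \<in> arcs Q"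
  by (rule is_string_letters(1)[OF string])

lemma vert_eq: "i \<le> len \<Longrightarrow> vert i = curve T (\<gamma> ! i)"
proof (cases i)
  case 0
  have "fst w = curve T (hd \<gamma>)" using arg_cong[OF string_eq(1), of fst] by (simp add: crossing_string_def)
  moreover have "\<gamma> \<noteq> []" using length_arc by auto
  ultimately show ?thesis using 0 by (simp add: string_vertex_def hd_conv_nth)
next
  case (Suc j)
  assume "i \<le> len"
  then show ?thesis using letter_Dir[of j] letter_Inv[of j] opp_arc[of i] Suc
    by (cases "ls ! j") (auto simp: string_vertex_def)
qed

lemma end_side_eq: "es Start = \<gamma> ! 0" "es Terminal = opp (\<gamma> ! len)"
proof -
  have "\<gamma> \<noteq> []" using length_arc by auto
  then show "es Start = \<gamma> ! 0" "es Terminal = opp (\<gamma> ! len)"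
    using length_arc by (simp_all add: hd_conv_nth last_conv_nth)
qed

lemma end_side: "es e \<in> sides T" "curve T (es e) \<in> arc_set T" "vert (pos e) = curve T (es e)"
  using arc_side opp_arc vert_eq by (cases e; simp add: end_side_eq del: end_side.simps)+

lemma end_sides_neq: "len = 0 \<Longrightarrow> es Start \<noteq> es Terminal"
  using opp_arc(2)[of 0] by (simp add: end_side_eq del: end_side.simps)

definition bvec :: "nat \<Rightarrow> nat \<Rightarrow> 'k" where "bvec i = (\<lambda>j. if j = i then 1 else 0)"

lemma bvec_carrier: "i \<le> len \<Longrightarrow> bvec i \<in> carrier (SM w)"
  using string by (auto simp: string_module_simps bvec_def)

text \<open>
  The triangle where the arc ends lies on the other side of the last crossing than the triangle of
  the adjacent letter.
\<close>

lemma end_no_letter: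
  assumes y: "y = es e" 
  shows "i < len \<Longrightarrow> i = pos e \<Longrightarrow> ls ! i \<noteq> Dir y"
    and "i < len \<Longrightarrow> Suc i = pos e \<Longrightarrow> ls ! i \<noteq> Inv y"
    and "z \<in> sides T \<Longrightarrow> nxt z = y \<Longrightarrow> i < len \<Longrightarrow> i = pos e \<Longrightarrow> ls ! i \<noteq> Inv z"
    and "z \<in> sides T \<Longrightarrow> nxt z = y \<Longrightarrow> i < len \<Longrightarrow> Suc i = pos e \<Longrightarrow> ls ! i \<noteq> Dir z"
  using letter_Dir[of i] letter_Inv[of i] opp_arc(2)[of i] opp_arc(2)[of "Suc i"] y
  by (cases e; auto simp: end_side_eq simp del: end_side.simps)+

lemma arr_end_kills: "arrow_action w (bvec (pos e)) (es e) = (\<lambda>_. 0)"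
proof
  fix j
  show "arrow_action w (bvec (pos e)) (es e) j = 0"
    using end_no_letter(1)[of "es e" e "j - 1"] end_no_letter(2)[of "es e" e j]
    by (cases j) (auto simp: arrow_action_def bvec_def)
qed

lemma arr_misses_end: "nxt (nxt z) = es e \<Longrightarrow> z \<in> sides T \<Longrightarrow> arrow_action w f (nxt z) (pos e) = 0"
  using end_no_letter(3)[of "es e" e "nxt z" "pos e"] end_no_letter(4)[of "es e" e "nxt z" "pos e - 1"] pos_le[of e]
  by (auto simp: arrow_action_def)

text \<open>
  Each crossing of the arc with the curve of \<open>y\<close> borders on the triangle of \<open>y\<close>.  Unless the arc ends in that triangle, it
  leaves the triangle through one of the two other sides.  In one case the letter is \<open>y\<close>, and \<open>y\<close> does
  not kill the basis vector; in the other it is \<open>z\<close>, and \<open>z\<close> reaches the basis vector.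
\<close>

lemma kernel_in_image:
  assumes y: "y \<in> sides T" and z: "z \<in> sides T" "nxt z = y" and m: "\<forall>j>len. m j = 0"
    and supp: "vertex_part w (curve T y) m = m"
    and ker: "arrow_action w m y = (\<lambda>_. 0)" and ends: "\<And>e. es e = y \<Longrightarrow> m (pos e) = 0"
  obtains m' where "\<forall>j>len. m' j = 0" "vertex_part w (curve T z) m' = m'" "arrow_action w m' z = m"
proof -
  define m' where "m' i = (if i < len \<and> ls ! i = Dir z then m (Suc i) else 0) +
    (if 0 < i \<and> i \<le> len \<and> ls ! (i - 1) = Inv z then m (i - 1) else 0)" for i
  have DI: False if "i < len" "0 < i" "ls ! (i - 1) = Inv z" "ls ! i = Dir z" for i
    using is_string_consecutive(4)[OF string, of "i - 1" z z] that by simp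
  have reach: "m j = 0 \<or> (0 < j \<and> ls ! (j - 1) = Dir z) \<or> (j < len \<and> ls ! j = Inv z)" if j: "j \<le> len" for j
  proof (rule ccontr)
    assume *: "\<not> ?thesis"
    then have "vert j = curve T y" using fun_cong[OF supp, of j] by (auto simp: vertex_part_def split: if_splits)
    then have "curve T (\<gamma> ! j) = curve T y" using vert_eq j by simp
    then have "y = \<gamma> ! j \<or> y = opp (\<gamma> ! j)" by (intro opp_side(4)[OF arc_side[OF j] y]) simp
    then show False
    proof
      assume yj: "y = \<gamma> ! j"
      show False
      proof (cases j)
        case 0
        then show False using ends[of Start] yj * by (simp add: end_side_eq del: end_side.simps)
      next
        case (Suc i)
        show False
        proof (cases "ls ! i")
          case (Dir z')
          then have "nxt z' = nxt z" "z' \<in> sides T" using letter_Dir[of i z'] Suc j yj z letter_arc[of i] by auto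
          then have "z' = z" using nxt_inj z by blast
          then show False using * Dir Suc by simp
        next
          case (Inv z')
          then have "z' = y" using letter_Inv[of i z'] Suc j yj by simp
          then have "arrow_action w m y i = m j" using arrow_action_simps(2)[OF _ string, of i y m] Inv Suc j by simp
          then show False using ker * by (metis (full_types))
        qed
      qed
    next
      assume yj: "y = opp (\<gamma> ! j)"
      show False
      proof (cases "j = len")
        case True
        then show False using ends[of Terminal] yj * by (simp add: end_side_eq del: end_side.simps)
      next
        case False
        then have jl: "j < len" using j by simp
        show False
        proof (cases "ls ! j")
          case (Inv z')
          then have "nxt z' = nxt z" "z' \<in> sides T" using letter_Inv[of j z'] jl yj z letter_arc[of j] by auto
          then have "z' = z" using nxt_inj z by blast
          then show False using * Inv jl by simp
        next
          case (Dir z')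
          then have "z' = y" using letter_Dir[of j z'] jl yj by simp
          then have "arrow_action w m y (Suc j) = m j" using arrow_action_simps(1)[OF _ string, of j y m] Dir jl by simp
          then show False using ker * by (metis (full_types))
        qed
      qed
    qed
  qed
  show thesis
  proof (rule that)
    show "\<forall>j>len. m' j = 0" by (auto simp: m'_def)
    have "vert i = curve T z" if "m' i \<noteq> 0" for i
    proof -
      have "(i < len \<and> ls ! i = Dir z) \<or> (0 < i \<and> i \<le> len \<and> ls ! (i - 1) = Inv z)"
        using that by (auto simp: m'_def split: if_splits)
      then show ?thesis
        using is_string_letters(2)[OF string, of i] is_string_letters(3)[OF string, of "i - 1"] by auto
    qed
    then show "vertex_part w (curve T z) m' = m'" by (auto simp: vertex_part_def fun_eq_iff)
    show "arrow_action w m' z = m"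
    proof
      fix j
      consider "j > len" | i where "j = Suc i" "i < len" "ls ! i = Dir z" | "j < len" "ls ! j = Inv z"
        | "j \<le> len" "\<not> (0 < j \<and> ls ! (j - 1) = Dir z)" "\<not> (j < len \<and> ls ! j = Inv z)"
      proof -
        have "j > len \<or> (0 < j \<and> j \<le> len \<and> ls ! (j - 1) = Dir z) \<or> (j < len \<and> ls ! j = Inv z) \<or>
          (j \<le> len \<and> \<not> (0 < j \<and> ls ! (j - 1) = Dir z) \<and> \<not> (j < len \<and> ls ! j = Inv z))" by linarith
        then show thesis using that(1) that(2)[of "j - 1"] that(3,4) by auto
      qed
      then show "arrow_action w m' z j = m j"
      proof cases
        case 1
        then show ?thesis using m by (simp add: arrow_action_def)
      next
        case 2
        then have "m' i = m (Suc i)" using DI[of i] by (auto simp: m'_def)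
        then show ?thesis using arrow_action_simps(1)[OF 2(2) string 2(3), of m'] 2(1) by simp
      next
        case 3
        then have "m' (Suc j) = m j" using DI[of "Suc j"] by (auto simp: m'_def)
        then show ?thesis using arrow_action_simps(2)[OF 3(1) string 3(2), of m'] by simp
      next
        case 4
        then show ?thesis using reach[of j] arrow_action_simps(3)[of j w z m'] by auto
      qed
    qed
  qed
qed

end

section \<open>A projective resolution of a string module\<close>

context arc_string
begin

text \<open>
  The generators of the resolution are numbered as follows.  In degree \<open>0\<close>, generator \<open>i\<close> belongs to
  position \<open>i\<close>.  In positive degree, the generators \<open>0\<close> and \<open>1\<close> belong to the two ends of the arc,
  and in degree \<open>1\<close> the generator \<open>j + 2\<close> belongs to letter \<open>j\<close>.  The generator of an end that does
  not contribute is kept, with the idempotent \<open>0\<close>, in order that the numbering is uniform.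

  The differential in degree \<open>0\<close> sends the generator of a letter \<open>Dir z\<close> from position \<open>j\<close> to \<open>j + 1\<close>
  to \<open>g\<^sub>j z - g\<^sub>j\<^sub>+\<^sub>1\<close>, that of a letter \<open>Inv z\<close> to \<open>g\<^sub>j\<^sub>+\<^sub>1 z - g\<^sub>j\<close>, and that of an end with opposite
  side \<open>x\<close> to \<open>g x\<close>, where \<open>g\<close> belongs to the position of the end.  So the component of the image at
  a position is the sum of a contribution \<open>left\<close> from the letter or end before it and a contribution
  \<open>right\<close> from the letter or end after it.
\<close>

definition end_of :: "nat \<Rightarrow> arc_end" where "end_of k = (if k = 0 then Start else Terminal)"

definition side_at :: "nat \<Rightarrow> nat \<Rightarrow> 's" where "side_at k n = (nxt ^^ n) (es (end_of k))"

lemma side_at_Suc: "side_at k (Suc n) = nxt (side_at k n)" and side_at_0: "side_at k 0 = es (end_of k)"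
  by (simp_all add: side_at_def)

lemma side_at_side: "side_at k n \<in> sides T"
  by (induction n) (auto simp: side_at_Suc side_at_0 end_side simp del: end_side.simps)

definition idem :: "nat \<Rightarrow> nat \<Rightarrow> (('a, 's) path \<Rightarrow> 'k) set" where
  "idem n k =
    (if n = 0 then idm (vert k)
     else if k < 2 then
       (if (if n = 1 then side_at k 0 \<in> arcs Q else internal_triangle T (side_at k 0))
        then idm (curve T (side_at k n)) else \<zero>\<^bsub>\<Lambda>\<^esub>)
     else idm (curve T (nxt (letter_arrow (ls ! (k - 2))))))"

definition rank :: "nat \<Rightarrow> nat" where
  "rank n = (if n = 0 then Suc len else if n = 1 then len + 2 else 2)"

definition Res :: "nat \<Rightarrow> ((('a, 's) path \<Rightarrow> 'k) set, nat \<Rightarrow> (('a, 's) path \<Rightarrow> 'k) set) module" where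
  "Res n = idem_module \<Lambda> (idem n) (rank n)"

definition left :: "nat \<Rightarrow> (nat \<Rightarrow> (('a, 's) path \<Rightarrow> 'k) set) \<Rightarrow> (('a, 's) path \<Rightarrow> 'k) set" where
  "left i f = (case i of 0 \<Rightarrow> arr (es Start) \<otimes>\<^bsub>\<Lambda>\<^esub> f 0
    | Suc j \<Rightarrow> (case ls ! j of Inv z \<Rightarrow> arr z \<otimes>\<^bsub>\<Lambda>\<^esub> f (j + 2) | Dir z \<Rightarrow> \<ominus>\<^bsub>\<Lambda>\<^esub> f (j + 2)))"

definition right :: "nat \<Rightarrow> (nat \<Rightarrow> (('a, 's) path \<Rightarrow> 'k) set) \<Rightarrow> (('a, 's) path \<Rightarrow> 'k) set" where
  "right i f = (if i < len then (case ls ! i of Dir z \<Rightarrow> arr z \<otimes>\<^bsub>\<Lambda>\<^esub> f (i + 2) | Inv z \<Rightarrow> \<ominus>\<^bsub>\<Lambda>\<^esub> f (i + 2))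
     else arr (es Terminal) \<otimes>\<^bsub>\<Lambda>\<^esub> f 1)"

definition diff :: "nat \<Rightarrow> (nat \<Rightarrow> (('a, 's) path \<Rightarrow> 'k) set) \<Rightarrow> nat \<Rightarrow> (('a, 's) path \<Rightarrow> 'k) set" where
  "diff n f = (case n of 0 \<Rightarrow> (\<lambda>i. if i \<le> len then left i f \<oplus>\<^bsub>\<Lambda>\<^esub> right i f else \<zero>\<^bsub>\<Lambda>\<^esub>)
     | Suc m \<Rightarrow> (\<lambda>k. if k < 2 then arr (side_at k n) \<otimes>\<^bsub>\<Lambda>\<^esub> f k else \<zero>\<^bsub>\<Lambda>\<^esub>))"

abbreviation "aug \<equiv> lin_comb (SM w) (Suc len) bvec"

abbreviation "gen n k \<equiv> unit_vec_at \<Lambda> k (idem n k)"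

lemma idem_closed [simp, intro]: "idem n k \<in> carrier \<Lambda>" by (auto simp: idem_def)

lemma idem_idem [simp]: "idem n k \<otimes>\<^bsub>\<Lambda>\<^esub> idem n k = idem n k" by (auto simp: idem_def idm_idem)

lemma Res_projective: "fg_projective \<Lambda> (Res n)"
  unfolding Res_def by (rule fg_projective_idem_module[OF \<Lambda>.ring_axioms]) auto

lemma Res_right_module: "right_module \<Lambda> (Res n)"
  unfolding Res_def by (rule right_module_idem_module[OF \<Lambda>.ring_axioms]) auto

lemma Res_el: "f \<in> carrier (Res n) \<Longrightarrow> f k \<in> carrier \<Lambda>"
  by (cases "k < rank n") (auto simp: Res_def idem_module_simps)

lemma Res_idem: "f \<in> carrier (Res n) \<Longrightarrow> k < rank n \<Longrightarrow> idem n k \<otimes>\<^bsub>\<Lambda>\<^esub> f k = f k"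
  by (auto simp: Res_def idem_module_simps)

lemma Res_out: "f \<in> carrier (Res n) \<Longrightarrow> \<not> k < rank n \<Longrightarrow> f k = \<zero>\<^bsub>\<Lambda>\<^esub>"
  by (auto simp: Res_def idem_module_simps)

lemma Res_carrierI: "(\<And>k. k < rank n \<Longrightarrow> f k \<in> carrier \<Lambda> \<and> idem n k \<otimes>\<^bsub>\<Lambda>\<^esub> f k = f k) \<Longrightarrow>
   (\<And>k. k \<ge> rank n \<Longrightarrow> f k = \<zero>\<^bsub>\<Lambda>\<^esub>) \<Longrightarrow> f \<in> carrier (Res n)"
  by (auto simp: Res_def idem_module_simps)

lemma Res_ops: "f \<oplus>\<^bsub>Res n\<^esub> g = (\<lambda>i. f i \<oplus>\<^bsub>\<Lambda>\<^esub> g i)" "a \<odot>\<^bsub>Res n\<^esub> f = (\<lambda>i. f i \<otimes>\<^bsub>\<Lambda>\<^esub> a)"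
  "\<zero>\<^bsub>Res n\<^esub> = (\<lambda>_. \<zero>\<^bsub>\<Lambda>\<^esub>)"
  by (simp_all add: Res_def idem_module_simps)

lemma gen_carrier: "k < rank n \<Longrightarrow> gen n k \<in> carrier (Res n)"
  unfolding Res_def by (rule unit_vec_idem_module[OF \<Lambda>.ring_axioms]) auto

lemma right_module_M: "right_module \<Lambda> (SM w)" by (rule right_module_string[OF string])

lemma bvec_idm: "i \<le> len \<Longrightarrow> idm (vert i) \<odot>\<^bsub>SM w\<^esub> bvec i = bvec i"
  using string_vertex_arc[OF string, of i]
  by (auto simp: string_module_idm[OF string] vertex_part_def bvec_def)

lemma aug_hom: "aug \<in> module_hom \<Lambda> (Res 0) (SM w)"
  unfolding Res_def using lin_comb_hom[OF right_module_M, of "Suc len" bvec "idem 0"] bvec_carrier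
  by (simp add: rank_def)

lemma aug_unit: "i \<le> len \<Longrightarrow> r \<in> carrier \<Lambda> \<Longrightarrow> aug (unit_vec_at \<Lambda> i r) = r \<odot>\<^bsub>SM w\<^esub> bvec i"
  using lin_comb_unit[OF right_module_M, of "Suc len" bvec i r] bvec_carrier by simp

lemma aug_gen: "i \<le> len \<Longrightarrow> aug (gen 0 i) = bvec i"
  by (simp add: aug_unit bvec_idm idem_def)

subsection \<open>The differentials are homomorphisms\<close>

lemma left_right_simps:
  assumes f: "\<And>k. f k \<in> carrier \<Lambda>" and g: "\<And>k. g k \<in> carrier \<Lambda>" and a: "a \<in> carrier \<Lambda>"
  shows "left i f \<in> carrier \<Lambda>" "right i f \<in> carrier \<Lambda>"
    "left i (\<lambda>k. f k \<oplus>\<^bsub>\<Lambda>\<^esub> g k) = left i f \<oplus>\<^bsub>\<Lambda>\<^esub> left i g" "right i (\<lambda>k. f k \<oplus>\<^bsub>\<Lambda>\<^esub> g k) = right i f \<oplus>\<^bsub>\<Lambda>\<^esub> right i g"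
    "left i (\<lambda>k. f k \<otimes>\<^bsub>\<Lambda>\<^esub> a) = left i f \<otimes>\<^bsub>\<Lambda>\<^esub> a" "right i (\<lambda>k. f k \<otimes>\<^bsub>\<Lambda>\<^esub> a) = right i f \<otimes>\<^bsub>\<Lambda>\<^esub> a"
  using f g a
  by (auto simp: left_def right_def \<Lambda>.r_distr \<Lambda>.minus_add \<Lambda>.l_minus \<Lambda>.m_assoc split: nat.splits letter.splits)

lemma idm_arr_mult: "X \<in> carrier \<Lambda> \<Longrightarrow> u = curve T x \<Longrightarrow> idm u \<otimes>\<^bsub>\<Lambda>\<^esub> (arr x \<otimes>\<^bsub>\<Lambda>\<^esub> X) = arr x \<otimes>\<^bsub>\<Lambda>\<^esub> X"
  by (simp add: idm_arr flip: \<Lambda>.m_assoc)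

lemma letter_idem: "f \<in> carrier (Res 1) \<Longrightarrow> j < len \<Longrightarrow>
   idm (curve T (nxt (letter_arrow (ls ! j)))) \<otimes>\<^bsub>\<Lambda>\<^esub> f (j + 2) = f (j + 2)"
  using Res_idem[of f 1 "j + 2"] by (simp add: idem_def rank_def)

lemma idm_left_right:
  assumes f: "f \<in> carrier (Res 1)" and i: "i \<le> len"
  shows "idm (vert i) \<otimes>\<^bsub>\<Lambda>\<^esub> left i f = left i f" "idm (vert i) \<otimes>\<^bsub>\<Lambda>\<^esub> right i f = right i f"
proof -
  note fR = Res_el[OF f]
  show "idm (vert i) \<otimes>\<^bsub>\<Lambda>\<^esub> left i f = left i f"
  proof (cases i)
    case 0
    then show ?thesis using fR end_side(3)[of Start] by (simp add: left_def idm_arr_mult del: end_side.simps)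
  next
    case (Suc j)
    then show ?thesis using is_string_letters(3)[OF string, of j] letter_idem[OF f, of j] fR i
      by (auto simp: left_def idm_arr_mult \<Lambda>.r_minus split: letter.splits)
  qed
  show "idm (vert i) \<otimes>\<^bsub>\<Lambda>\<^esub> right i f = right i f"
  proof (cases "i < len")
    case False
    then have "i = len" using i by simp
    then show ?thesis using fR end_side(3)[of Terminal] by (simp add: right_def idm_arr_mult del: end_side.simps)
  next
    case True
    then show ?thesis using is_string_letters(2)[OF string, of i] letter_idem[OF f, of i] fR
      by (auto simp: right_def idm_arr_mult \<Lambda>.r_minus split: letter.splits)
  qed
qed

lemma diff_hom: "diff n \<in> module_hom \<Lambda> (Res (Suc n)) (Res n)"
proof (cases n)
  case 0
  show ?thesis unfolding 0
  proof (rule module_homI)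
    fix f assume f: "f \<in> carrier (Res (Suc 0))"
    then have f1: "f \<in> carrier (Res 1)" by simp
    show "diff 0 f \<in> carrier (Res 0)"
    proof (rule Res_carrierI)
      fix i assume "i < rank 0"
      then have i: "i \<le> len" by (simp add: rank_def)
      note c = left_right_simps(1,2)[OF Res_el[OF f] Res_el[OF f] \<Lambda>.one_closed]
      show "diff 0 f i \<in> carrier \<Lambda> \<and> idem 0 i \<otimes>\<^bsub>\<Lambda>\<^esub> diff 0 f i = diff 0 f i"
        using i c idm_left_right[OF f1 i] by (simp add: diff_def idem_def \<Lambda>.r_distr)
    qed (simp add: rank_def diff_def)
  next
    fix f g assume f: "f \<in> carrier (Res (Suc 0))" and g: "g \<in> carrier (Res (Suc 0))"
    note c = left_right_simps[OF Res_el[OF f] Res_el[OF g] \<Lambda>.one_closed] left_right_simps(1,2)[OF Res_el[OF g] Res_el[OF g] \<Lambda>.one_closed]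
    show "diff 0 (f \<oplus>\<^bsub>Res (Suc 0)\<^esub> g) = diff 0 f \<oplus>\<^bsub>Res 0\<^esub> diff 0 g"
      using c by (auto simp: diff_def Res_ops fun_eq_iff \<Lambda>.a_ac)
  next
    fix a f assume a: "a \<in> carrier \<Lambda>" and f: "f \<in> carrier (Res (Suc 0))"
    note c = left_right_simps[OF Res_el[OF f] Res_el[OF f] a]
    show "diff 0 (a \<odot>\<^bsub>Res (Suc 0)\<^esub> f) = a \<odot>\<^bsub>Res 0\<^esub> diff 0 f"
      using c a by (auto simp: diff_def Res_ops fun_eq_iff \<Lambda>.l_distr)
  qed
next
  case (Suc m)
  show ?thesis unfolding Suc
  proof (rule module_homI)
    fix f assume f: "f \<in> carrier (Res (Suc (Suc m)))"
    show "diff (Suc m) f \<in> carrier (Res (Suc m))"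
    proof (rule Res_carrierI)
      fix k assume "k < rank (Suc m)"
      show "diff (Suc m) f k \<in> carrier \<Lambda> \<and> idem (Suc m) k \<otimes>\<^bsub>\<Lambda>\<^esub> diff (Suc m) f k = diff (Suc m) f k"
      proof (cases "k < 2 \<and> internal_triangle T (side_at k 0)")
        case True
        then have "side_at k 0 \<in> arcs Q" by (simp add: internal_iff)
        with True show ?thesis using Res_el[OF f] idm_arr_mult[of "f k" "curve T (side_at k (Suc m))" "side_at k (Suc m)"]
          by (simp add: diff_def idem_def del: quiver_simps)
      next
        case False
        have "k < 2 \<Longrightarrow> f k = \<zero>\<^bsub>\<Lambda>\<^esub>"
          using Res_idem[OF f, of k] False Res_el[OF f, of k] by (simp add: idem_def rank_def)
        then show ?thesis by (simp add: diff_def)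
      qed
    next
      fix k assume "k \<ge> rank (Suc m)"
      then show "diff (Suc m) f k = \<zero>\<^bsub>\<Lambda>\<^esub>" by (simp add: diff_def rank_def split: if_splits)
    qed
  next
    fix f g assume f: "f \<in> carrier (Res (Suc (Suc m)))" and g: "g \<in> carrier (Res (Suc (Suc m)))"
    show "diff (Suc m) (f \<oplus>\<^bsub>Res (Suc (Suc m))\<^esub> g) = diff (Suc m) f \<oplus>\<^bsub>Res (Suc m)\<^esub> diff (Suc m) g"
      using Res_el[OF f] Res_el[OF g] by (auto simp: diff_def Res_ops fun_eq_iff \<Lambda>.r_distr)
  next
    fix a f assume a: "a \<in> carrier \<Lambda>" and f: "f \<in> carrier (Res (Suc (Suc m)))"
    show "diff (Suc m) (a \<odot>\<^bsub>Res (Suc (Suc m))\<^esub> f) = a \<odot>\<^bsub>Res (Suc m)\<^esub> diff (Suc m) f"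
      using Res_el[OF f] a by (auto simp: diff_def Res_ops fun_eq_iff \<Lambda>.m_assoc)
  qed
qed

subsection \<open>Exactness in positive degrees\<close>

lemma arr_bvec_Dir: "j < len \<Longrightarrow> ls ! j = Dir z \<Longrightarrow> arr z \<odot>\<^bsub>SM w\<^esub> bvec j = bvec (Suc j)"
proof (unfold string_module_arr[OF string], rule ext)
  fix i assume j: "j < len" "ls ! j = Dir z"
  show "arrow_action w (bvec j) z i = bvec (Suc j) i"
    using j is_string_consecutive(4)[OF string, of i z z]
    by (cases i) (auto simp: arrow_action_def bvec_def)
qed

lemma arr_bvec_Inv: "j < len \<Longrightarrow> ls ! j = Inv z \<Longrightarrow> arr z \<odot>\<^bsub>SM w\<^esub> bvec (Suc j) = bvec j"
proof (unfold string_module_arr[OF string], rule ext)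
  fix i assume j: "j < len" "ls ! j = Inv z"
  show "arrow_action w (bvec (Suc j)) z i = bvec j i"
    using j is_string_consecutive(4)[OF string, of j z z]
    by (cases i; cases j) (auto simp: arrow_action_def bvec_def)
qed

lemma arr_bvec_end: "arr (es e) \<odot>\<^bsub>SM w\<^esub> bvec (pos e) = (\<lambda>_. 0)"
  unfolding string_module_arr[OF string] by (rule arr_end_kills)

lemma diff_0_end_gen:
  assumes k: "k < 2" and r: "r \<in> carrier \<Lambda>"
  shows "diff 0 (unit_vec_at \<Lambda> k r) = unit_vec_at \<Lambda> (pos (end_of k)) (arr (side_at k 0) \<otimes>\<^bsub>\<Lambda>\<^esub> r)"
proof -
  have "k = 0 \<or> k = 1" using k by auto
  then show ?thesis using r
    by (auto simp: diff_def left_def right_def unit_vec_at_def fun_eq_iff side_at_def end_of_def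
        simp del: end_side.simps split: nat.splits letter.splits)
qed

lemma left_right_letter_gen:
  assumes j: "j < len" and r: "r \<in> carrier \<Lambda>"
  shows "left i (unit_vec_at \<Lambda> (Suc (Suc j)) r) =
      (if i = Suc j then (case ls ! j of Inv z \<Rightarrow> arr z \<otimes>\<^bsub>\<Lambda>\<^esub> r | Dir z \<Rightarrow> \<ominus>\<^bsub>\<Lambda>\<^esub> r) else \<zero>\<^bsub>\<Lambda>\<^esub>)"
    and "right i (unit_vec_at \<Lambda> (Suc (Suc j)) r) =
      (if i = j then (case ls ! j of Dir z \<Rightarrow> arr z \<otimes>\<^bsub>\<Lambda>\<^esub> r | Inv z \<Rightarrow> \<ominus>\<^bsub>\<Lambda>\<^esub> r) else \<zero>\<^bsub>\<Lambda>\<^esub>)"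
proof -
  show "left i (unit_vec_at \<Lambda> (Suc (Suc j)) r) =
      (if i = Suc j then (case ls ! j of Inv z \<Rightarrow> arr z \<otimes>\<^bsub>\<Lambda>\<^esub> r | Dir z \<Rightarrow> \<ominus>\<^bsub>\<Lambda>\<^esub> r) else \<zero>\<^bsub>\<Lambda>\<^esub>)"
  proof (cases i)
    case (Suc k)
    then show ?thesis by (cases "k = j"; cases "ls ! k") (simp_all add: left_def unit_vec_at_def)
  qed (simp add: left_def unit_vec_at_def)
  show "right i (unit_vec_at \<Lambda> (Suc (Suc j)) r) =
      (if i = j then (case ls ! j of Dir z \<Rightarrow> arr z \<otimes>\<^bsub>\<Lambda>\<^esub> r | Inv z \<Rightarrow> \<ominus>\<^bsub>\<Lambda>\<^esub> r) else \<zero>\<^bsub>\<Lambda>\<^esub>)"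
    using j by (cases "i = j"; cases "ls ! i") (simp_all add: right_def unit_vec_at_def)
qed

lemma diff_0_letter_gen:
  assumes j: "j < len" and r: "r \<in> carrier \<Lambda>"
  shows "ls ! j = Dir z \<Longrightarrow> diff 0 (unit_vec_at \<Lambda> (j + 2) r) =
      unit_vec_at \<Lambda> j (arr z \<otimes>\<^bsub>\<Lambda>\<^esub> r) \<oplus>\<^bsub>Res 0\<^esub> unit_vec_at \<Lambda> (Suc j) (\<ominus>\<^bsub>\<Lambda>\<^esub> r)"
    and "ls ! j = Inv z \<Longrightarrow> diff 0 (unit_vec_at \<Lambda> (j + 2) r) =
      unit_vec_at \<Lambda> (Suc j) (arr z \<otimes>\<^bsub>\<Lambda>\<^esub> r) \<oplus>\<^bsub>Res 0\<^esub> unit_vec_at \<Lambda> j (\<ominus>\<^bsub>\<Lambda>\<^esub> r)"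
  using j r by (auto simp: diff_def left_right_letter_gen unit_vec_at_def[of _ _ "arr z \<otimes>\<^bsub>\<Lambda>\<^esub> r"]
      unit_vec_at_def[of _ _ "\<ominus>\<^bsub>\<Lambda>\<^esub> r"] fun_eq_iff Res_ops)

lemma aug_diff: "f \<in> carrier (Res 1) \<Longrightarrow> aug (diff 0 f) = \<zero>\<^bsub>SM w\<^esub>"
proof -
  interpret M: right_module \<Lambda> "SM w" by (rule right_module_M)
  assume f: "f \<in> carrier (Res 1)"
  show ?thesis
  proof (rule idem_module_hom_eqI[of \<Lambda> "rank 1" "idem 1" "SM w" "\<lambda>f. aug (diff 0 f)" "\<lambda>_. \<zero>\<^bsub>SM w\<^esub>" f])
    show "(\<lambda>f. aug (diff 0 f)) \<in> module_hom \<Lambda> (idem_module \<Lambda> (idem 1) (rank 1)) (SM w)"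
      using module_hom_comp[OF diff_hom aug_hom] by (simp add: Res_def)
    show "(\<lambda>_. \<zero>\<^bsub>SM w\<^esub>) \<in> module_hom \<Lambda> (idem_module \<Lambda> (idem 1) (rank 1)) (SM w)"
      by (rule module_homI) auto
    show "f \<in> carrier (idem_module \<Lambda> (idem 1) (rank 1))" using f by (simp add: Res_def)
    fix k assume k: "k < rank 1"
    show "aug (diff 0 (gen 1 k)) = \<zero>\<^bsub>SM w\<^esub>"
    proof (cases "k < 2")
      case True
      then show ?thesis
        using arr_bvec_end[of "end_of k"] pos_le[of "end_of k"] bvec_carrier[OF pos_le[of "end_of k"]]
        by (simp add: diff_0_end_gen aug_unit M.smult_assoc side_at_0 string_module_simps(2)[OF string, symmetric] del: end_side.simps)
    next
      case False
      then obtain j where j: "k = j + 2" "j < len" using k by (metis add.commute add_less_cancel_right le_Suc_ex not_less rank_def One_nat_def zero_neq_one)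
      let ?\<iota> = "idem 1 (j + 2)"
      have b: "bvec j \<in> carrier (SM w)" "bvec (Suc j) \<in> carrier (SM w)" using bvec_carrier j by auto
      have u: "unit_vec_at \<Lambda> i r \<in> carrier (Res 0)" if "i \<le> len" "r \<in> carrier \<Lambda>" "idm (vert i) \<otimes>\<^bsub>\<Lambda>\<^esub> r = r" for i r
        unfolding Res_def by (rule unit_vec_idem_module[OF \<Lambda>.ring_axioms]) (use that in \<open>auto simp: rank_def idem_def\<close>)
      note add = LinearCombinations.module_hom_add[OF aug_hom]
      show ?thesis
      proof (cases "ls ! j")
        case (Dir z)
        have v: "vert j = curve T z" "vert (Suc j) = curve T (nxt z)"
          using is_string_letters(2,3)[OF string j(2)] Dir by auto
        have "aug (diff 0 (gen 1 k)) = (arr z \<otimes>\<^bsub>\<Lambda>\<^esub> ?\<iota>) \<odot>\<^bsub>SM w\<^esub> bvec j \<oplus>\<^bsub>SM w\<^esub> (\<ominus>\<^bsub>\<Lambda>\<^esub> ?\<iota>) \<odot>\<^bsub>SM w\<^esub> bvec (Suc j)"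
          unfolding j(1) diff_0_letter_gen(1)[OF j(2) idem_closed Dir]
          using j v Dir by (subst add) (auto intro!: u simp: idm_arr_mult \<Lambda>.r_minus idem_def idm_idem aug_unit)
        also have "\<dots> = \<zero>\<^bsub>SM w\<^esub>"
          using b arr_bvec_Dir[OF j(2) Dir] by (simp add: M.smult_assoc M.smult_minus_ring M.M.r_neg M.smult_closed)
        finally show ?thesis .
      next
        case (Inv z)
        have v: "vert (Suc j) = curve T z" "vert j = curve T (nxt z)"
          using is_string_letters(2,3)[OF string j(2)] Inv by auto
        have "aug (diff 0 (gen 1 k)) = (arr z \<otimes>\<^bsub>\<Lambda>\<^esub> ?\<iota>) \<odot>\<^bsub>SM w\<^esub> bvec (Suc j) \<oplus>\<^bsub>SM w\<^esub> (\<ominus>\<^bsub>\<Lambda>\<^esub> ?\<iota>) \<odot>\<^bsub>SM w\<^esub> bvec j"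
          unfolding j(1) diff_0_letter_gen(2)[OF j(2) idem_closed Inv]
          using j v Inv by (subst add) (auto intro!: u simp: idm_arr_mult \<Lambda>.r_minus idem_def idm_idem aug_unit)
        also have "\<dots> = \<zero>\<^bsub>SM w\<^esub>"
          using b arr_bvec_Inv[OF j(2) Inv] by (simp add: M.smult_assoc M.smult_minus_ring M.M.r_neg M.smult_closed)
        finally show ?thesis .
      qed
    qed
  qed (use \<Lambda>.ring_axioms right_module_M in auto)
qed

end

context arc_string
begin

lemma diff_diff: "f \<in> carrier (Res (Suc (Suc n))) \<Longrightarrow> diff n (diff (Suc n) f) = \<zero>\<^bsub>Res n\<^esub>"
proof -
  assume f: "f \<in> carrier (Res (Suc (Suc n)))"
  note fR = Res_el[OF f]
  have nil: "arr x \<otimes>\<^bsub>\<Lambda>\<^esub> (arr (nxt x) \<otimes>\<^bsub>\<Lambda>\<^esub> f k) = \<zero>\<^bsub>\<Lambda>\<^esub>" for x k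
    using fR by (simp add: arr_nxt flip: \<Lambda>.m_assoc)
  show ?thesis
  proof (cases n)
    case 0
    have "left i (diff (Suc 0) f) = \<zero>\<^bsub>\<Lambda>\<^esub>" for i
      using nil[of "es Start" 0]
      by (cases i; cases "ls ! (i - 1)") (simp_all add: left_def diff_def side_at_def end_of_def del: end_side.simps)
    moreover have "right i (diff (Suc 0) f) = \<zero>\<^bsub>\<Lambda>\<^esub>" for i
      using nil[of "es Terminal" 1]
      by (cases "ls ! i") (simp_all add: right_def diff_def side_at_def end_of_def del: end_side.simps)
    ultimately show ?thesis by (simp add: 0 diff_def[of 0] Res_ops fun_eq_iff)
  next
    case (Suc m)
    then show ?thesis using nil by (auto simp: diff_def Res_ops side_at_Suc fun_eq_iff)
  qed
qed

text \<open>
  Where only the two ends contribute, the complex is the sum of two complexes whose differentials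
  run through the arrows of a triangle; these are exact by \<open>arr_left_annihilator\<close>.
\<close>

lemma diff_Suc_image:
  assumes f: "f \<in> carrier (Res (Suc m))" and 0: "\<And>k. k < 2 \<Longrightarrow> arr (side_at k m) \<otimes>\<^bsub>\<Lambda>\<^esub> f k = \<zero>\<^bsub>\<Lambda>\<^esub>"
    and out: "\<And>k. \<not> k < 2 \<Longrightarrow> f k = \<zero>\<^bsub>\<Lambda>\<^esub>"
  shows "f \<in> diff (Suc m) ` carrier (Res (Suc (Suc m)))"
proof -
  have "\<exists>c\<in>carrier \<Lambda>. idem (Suc (Suc m)) k \<otimes>\<^bsub>\<Lambda>\<^esub> c = c \<and> f k = arr (side_at k (Suc m)) \<otimes>\<^bsub>\<Lambda>\<^esub> c" if k: "k < 2" for k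
  proof (cases "internal_triangle T (side_at k 0)")
    case True
    then have i: "internal_triangle T (side_at k m)" by (simp add: side_at_def internal_funpow)
    have "idem (Suc m) k = idm (curve T (nxt (side_at k m)))"
      using True k internal_arc[OF True] by (auto simp: idem_def side_at_Suc)
    then have "idm (curve T (nxt (side_at k m))) \<otimes>\<^bsub>\<Lambda>\<^esub> f k = f k"
      using Res_idem[OF f, of k] k by (simp add: rank_def)
    from arr_left_annihilator[OF i Res_el[OF f] this 0[OF k]] show ?thesis
      using True k by (simp add: idem_def side_at_Suc)
  next
    case False
    have "f k = \<zero>\<^bsub>\<Lambda>\<^esub>"
    proof (cases "idem (Suc m) k = \<zero>\<^bsub>\<Lambda>\<^esub>")
      case True
      then show ?thesis using Res_idem[OF f, of k] k Res_el[OF f, of k] by (simp add: rank_def)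
    next
      case idem: False
      then have m: "m = 0" "side_at k 0 \<in> arcs Q" using False k by (auto simp: idem_def split: if_splits)
      then have "idm (curve T (nxt (side_at k 0))) \<otimes>\<^bsub>\<Lambda>\<^esub> f k = f k"
        using Res_idem[OF f, of k] k by (simp add: rank_def idem_def side_at_Suc)
      then show ?thesis using arr_left_cancel_noninternal[OF m(2) False Res_el[OF f]] 0[OF k] m by simp
    qed
    then show ?thesis using k by (intro bexI[of _ "\<zero>\<^bsub>\<Lambda>\<^esub>"]) auto
  qed
  then obtain c where c: "\<And>k. k < 2 \<Longrightarrow> c k \<in> carrier \<Lambda> \<and> idem (Suc (Suc m)) k \<otimes>\<^bsub>\<Lambda>\<^esub> c k = c k \<and>
    f k = arr (side_at k (Suc m)) \<otimes>\<^bsub>\<Lambda>\<^esub> c k" by metis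
  have "(\<lambda>k. if k < 2 then c k else \<zero>\<^bsub>\<Lambda>\<^esub>) \<in> carrier (Res (Suc (Suc m)))"
    by (rule Res_carrierI) (use c in \<open>auto simp: rank_def\<close>)
  moreover have "diff (Suc m) (\<lambda>k. if k < 2 then c k else \<zero>\<^bsub>\<Lambda>\<^esub>) = f"
    using c out by (auto simp: diff_def fun_eq_iff)
  ultimately show ?thesis by blast
qed

lemma minus_eqD: "a \<in> carrier \<Lambda> \<Longrightarrow> b \<in> carrier \<Lambda> \<Longrightarrow> \<ominus>\<^bsub>\<Lambda>\<^esub> a \<oplus>\<^bsub>\<Lambda>\<^esub> b = \<zero>\<^bsub>\<Lambda>\<^esub> \<Longrightarrow> a = b"
  by (metis \<Lambda>.add.inv_closed \<Lambda>.minus_equality \<Lambda>.minus_minus \<Lambda>.a_comm)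

text \<open>
  A relation between the relations of degree \<open>1\<close> involves no letter.  At each position the
  contributions of both sides cancel, and they are paths starting with different arrows unless one of
  them is the coefficient of a letter itself.
\<close>

lemma kernel_diff_0:
  assumes f: "f \<in> carrier (Res 1)" and 0: "diff 0 f = \<zero>\<^bsub>Res 0\<^esub>"
  shows "f \<in> diff 1 ` carrier (Res 2)"
proof -
  note fR = Res_el[OF f]
  have eq: "left i f \<oplus>\<^bsub>\<Lambda>\<^esub> right i f = \<zero>\<^bsub>\<Lambda>\<^esub>" if "i \<le> len" for i
    using fun_cong[OF 0, of i] that by (simp add: diff_def Res_ops)
  have arcs: "x \<in> arcs Q" if "j < len" "ls ! j = Dir x \<or> ls ! j = Inv x" for j x
    using letter_arc[OF that(1)] that(2) by (auto simp del: quiver_simps)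
  note idm_f = letter_idem[OF f, simplified]
  \<comment> \<open>The arrow of a letter kills its coefficient: going up along a direct path of the string to its
    top, where two different arrows start, the coefficient is killed by the whole path.\<close>
  have D: "arr x \<otimes>\<^bsub>\<Lambda>\<^esub> f (Suc (Suc j)) = \<zero>\<^bsub>\<Lambda>\<^esub>" if "j < len" "ls ! j = Dir x" for j x
    using that
  proof (induction j arbitrary: x)
    case 0
    have "es Start \<noteq> x" using letter_Dir[OF 0] opp_arc(2)[of 0] by (simp add: end_side_eq del: end_side.simps)
    moreover have "arr (es Start) \<otimes>\<^bsub>\<Lambda>\<^esub> f 0 \<oplus>\<^bsub>\<Lambda>\<^esub> arr x \<otimes>\<^bsub>\<Lambda>\<^esub> f (Suc (Suc 0)) = \<zero>\<^bsub>\<Lambda>\<^esub>"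
      using eq[of 0] 0 by (simp add: left_def right_def del: end_side.simps)
    ultimately show ?case using arr_independent(2) fR by blast
  next
    case (Suc k)
    show ?case
    proof (cases "ls ! k")
      case (Inv y)
      have "arr y \<otimes>\<^bsub>\<Lambda>\<^esub> f (Suc (Suc k)) \<oplus>\<^bsub>\<Lambda>\<^esub> arr x \<otimes>\<^bsub>\<Lambda>\<^esub> f (Suc (Suc (Suc k))) = \<zero>\<^bsub>\<Lambda>\<^esub>"
        using eq[of "Suc k"] Suc Inv by (simp add: left_def right_def)
      moreover have "y \<noteq> x" using is_string_consecutive(4)[OF string, of k y x] Suc Inv by auto
      ultimately show ?thesis using arr_independent(2) fR by blast
    next
      case (Dir y)
      have "f (Suc (Suc k)) = arr x \<otimes>\<^bsub>\<Lambda>\<^esub> f (Suc (Suc (Suc k)))"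
        by (rule minus_eqD) (use eq[of "Suc k"] Suc Dir fR in \<open>simp_all add: left_def right_def\<close>)
      moreover have "arr y \<otimes>\<^bsub>\<Lambda>\<^esub> f (Suc (Suc k)) = \<zero>\<^bsub>\<Lambda>\<^esub>" using Suc Dir by simp
      ultimately show ?thesis
        using arr_left_cancel[of y x] is_string_consecutive(1)[OF string, of k y x] Suc Dir arcs[of k y] fR by simp
    qed
  qed
  have I: "arr x \<otimes>\<^bsub>\<Lambda>\<^esub> f (Suc (Suc j)) = \<zero>\<^bsub>\<Lambda>\<^esub>" if "j < len" "ls ! j = Inv x" for j x
    using that
  proof (induction "len - Suc j" arbitrary: x j)
    case 0
    then have l: "Suc j = len" by simp
    have "x \<noteq> es Terminal" using letter_Inv[OF 0(2,3)] opp_arc(2)[of len] l by (simp add: end_side_eq del: end_side.simps)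
    moreover have "arr x \<otimes>\<^bsub>\<Lambda>\<^esub> f (Suc (Suc j)) \<oplus>\<^bsub>\<Lambda>\<^esub> arr (es Terminal) \<otimes>\<^bsub>\<Lambda>\<^esub> f 1 = \<zero>\<^bsub>\<Lambda>\<^esub>"
    proof -
      have "left (Suc j) f = arr x \<otimes>\<^bsub>\<Lambda>\<^esub> f (Suc (Suc j))" by (simp add: left_def 0(3))
      moreover have "right (Suc j) f = arr (es Terminal) \<otimes>\<^bsub>\<Lambda>\<^esub> f 1" using l by (simp add: right_def)
      ultimately show ?thesis using eq[of "Suc j"] l by (simp only: order_refl)
    qed
    ultimately show ?case using arr_independent(1) fR by blast
  next
    case (Suc d)
    then have l: "Suc j < len" by simp
    show ?case
    proof (cases "ls ! Suc j")
      case (Dir y)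
      have "arr x \<otimes>\<^bsub>\<Lambda>\<^esub> f (Suc (Suc j)) \<oplus>\<^bsub>\<Lambda>\<^esub> arr y \<otimes>\<^bsub>\<Lambda>\<^esub> f (Suc (Suc (Suc j))) = \<zero>\<^bsub>\<Lambda>\<^esub>"
        using eq[of "Suc j"] Suc Dir l by (simp add: left_def right_def)
      moreover have "x \<noteq> y" using is_string_consecutive(4)[OF string l Suc(4) Dir] by auto
      ultimately show ?thesis using arr_independent(1) fR by blast
    next
      case (Inv y)
      have "f (Suc (Suc (Suc j))) = arr x \<otimes>\<^bsub>\<Lambda>\<^esub> f (Suc (Suc j))"
        by (rule minus_eqD) (use eq[of "Suc j"] Suc Inv fR l in \<open>simp_all add: left_def right_def \<Lambda>.a_comm\<close>)
      moreover have "arr y \<otimes>\<^bsub>\<Lambda>\<^esub> f (Suc (Suc (Suc j))) = \<zero>\<^bsub>\<Lambda>\<^esub>" using Suc(1)[of "Suc j" y] Suc(2) l Inv by simp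
      ultimately show ?thesis
        using arr_left_cancel[of y x] is_string_consecutive(2)[OF string l Suc(4) Inv] arcs[of "Suc j" y] Inv l fR by simp
    qed
  qed
  have cancel: "f (Suc (Suc j)) = \<zero>\<^bsub>\<Lambda>\<^esub>"
    if "f (Suc (Suc j)) = arr y \<otimes>\<^bsub>\<Lambda>\<^esub> b" "b \<in> carrier \<Lambda>" "x \<in> arcs Q" "arr x \<otimes>\<^bsub>\<Lambda>\<^esub> f (Suc (Suc j)) = \<zero>\<^bsub>\<Lambda>\<^esub>"
      "curve T y = curve T (nxt x) \<and> y \<noteq> nxt x" for j x y b
    using arr_left_cancel[of x y b] that by simp
  \<comment> \<open>Going down, the coefficient also starts with a path continuing the string, or it is killed by
    two different arrows; both force it to vanish.\<close>
  have Z: "f (Suc (Suc j)) = \<zero>\<^bsub>\<Lambda>\<^esub>" if j: "j < len" for j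
  proof (cases "ls ! j")
    case (Dir x)
    note x = arcs[OF j disjI1[OF Dir]] D[OF j Dir]
    show ?thesis
    proof (cases "Suc j < len")
      case False
      then have l: "Suc j = len" using j by simp
      have "f (Suc (Suc j)) = arr (es Terminal) \<otimes>\<^bsub>\<Lambda>\<^esub> f 1"
      proof (rule minus_eqD)
        have "left (Suc j) f = \<ominus>\<^bsub>\<Lambda>\<^esub> f (Suc (Suc j))" by (simp add: left_def Dir)
        moreover have "right (Suc j) f = arr (es Terminal) \<otimes>\<^bsub>\<Lambda>\<^esub> f 1" using l by (simp add: right_def)
        ultimately show "\<ominus>\<^bsub>\<Lambda>\<^esub> f (Suc (Suc j)) \<oplus>\<^bsub>\<Lambda>\<^esub> arr (es Terminal) \<otimes>\<^bsub>\<Lambda>\<^esub> f 1 = \<zero>\<^bsub>\<Lambda>\<^esub>"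
          using eq[of "Suc j"] l by (simp only: order_refl)
      qed (use fR in auto)
      moreover have "curve T (es Terminal) = curve T (nxt x) \<and> es Terminal \<noteq> nxt x"
        using letter_Dir[OF j Dir] opp_arc[of len] l by (simp add: end_side_eq del: end_side.simps)
      ultimately show ?thesis using cancel x fR by blast
    next
      case l: True
      show ?thesis
      proof (cases "ls ! Suc j")
        case D2: (Dir y)
        have "f (Suc (Suc j)) = arr y \<otimes>\<^bsub>\<Lambda>\<^esub> f (Suc (Suc (Suc j)))"
          by (rule minus_eqD) (use eq[of "Suc j"] Dir D2 fR l in \<open>simp_all add: left_def right_def\<close>)
        then show ?thesis using cancel x fR is_string_consecutive(1)[OF string l Dir D2] by blast
      next
        case (Inv y)
        have "f (Suc (Suc j)) = \<ominus>\<^bsub>\<Lambda>\<^esub> f (Suc (Suc (Suc j)))"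
          by (rule minus_eqD) (use eq[of "Suc j"] Dir Inv fR l in \<open>simp_all add: left_def right_def\<close>)
        then have "arr y \<otimes>\<^bsub>\<Lambda>\<^esub> f (Suc (Suc j)) = \<zero>\<^bsub>\<Lambda>\<^esub>" using I[OF l Inv] fR by (simp add: \<Lambda>.r_minus)
        moreover have "curve T (nxt x) = curve T (nxt y)" "x \<noteq> y"
          using is_string_consecutive(3)[OF string l Dir Inv] by auto
        ultimately show ?thesis
          using arr_common_annihilator[of x y "f (Suc (Suc j))"] x
            arcs[OF l disjI2[OF Inv]] fR idm_f[OF j] Dir by (simp del: quiver_simps)
      qed
    qed
  next
    case (Inv x)
    note x = arcs[OF j disjI2[OF Inv]] I[OF j Inv]
    show ?thesis
    proof (cases j)
      case 0
      have "f (Suc (Suc j)) = arr (es Start) \<otimes>\<^bsub>\<Lambda>\<^esub> f 0"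
        by (rule minus_eqD) (use eq[of 0] Inv fR j 0 in \<open>simp_all add: left_def right_def \<Lambda>.a_comm del: end_side.simps\<close>)
      moreover have "curve T (es Start) = curve T (nxt x) \<and> es Start \<noteq> nxt x"
      proof -
        have "nxt x = opp (\<gamma> ! 0)" using letter_Inv[OF j Inv] 0 by blast
        then show ?thesis using opp_arc[of 0] by (simp add: end_side_eq del: end_side.simps)
      qed
      ultimately show ?thesis using cancel x fR by blast
    next
      case (Suc k)
      then have k: "Suc k < len" and kl: "k < len" using j by auto
      show ?thesis
      proof (cases "ls ! k")
        case I2: (Inv y)
        have "f (Suc (Suc j)) = arr y \<otimes>\<^bsub>\<Lambda>\<^esub> f (Suc (Suc k))"
          by (rule minus_eqD) (use eq[of j] Inv I2 fR j Suc in \<open>simp_all add: left_def right_def \<Lambda>.a_comm\<close>)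
        then show ?thesis using cancel x fR is_string_consecutive(2)[OF string k I2] Inv Suc by blast
      next
        case (Dir y)
        have "f (Suc (Suc j)) = \<ominus>\<^bsub>\<Lambda>\<^esub> f (Suc (Suc k))"
          by (rule minus_eqD) (use eq[of j] Dir Inv fR j Suc in \<open>simp_all add: left_def right_def \<Lambda>.a_comm\<close>)
        then have "arr y \<otimes>\<^bsub>\<Lambda>\<^esub> f (Suc (Suc j)) = \<zero>\<^bsub>\<Lambda>\<^esub>" using D[OF kl Dir] fR by (simp add: \<Lambda>.r_minus)
        moreover have "curve T (nxt x) = curve T (nxt y)" "x \<noteq> y"
          using is_string_consecutive(3)[OF string k Dir, of x] Inv Suc by auto
        ultimately show ?thesis
          using arr_common_annihilator[of x y "f (Suc (Suc j))"] x
            arcs[OF kl disjI1[OF Dir]] fR idm_f[OF j] Inv by (simp del: quiver_simps)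
      qed
    qed
  qed
  have out: "f k = \<zero>\<^bsub>\<Lambda>\<^esub>" if "\<not> k < 2" for k
  proof (cases "k < rank 1")
    case True
    then show ?thesis using Z[of "k - 2"] that by (simp add: rank_def numeral_2_eq_2 Suc_diff_Suc less_diff_conv2)
  qed (rule Res_out[OF f])
  have E0: "arr (es Start) \<otimes>\<^bsub>\<Lambda>\<^esub> f 0 = \<zero>\<^bsub>\<Lambda>\<^esub>"
  proof (cases "len = 0")
    case True
    then show ?thesis using eq[of 0] arr_independent(1)[OF end_sides_neq[OF True] fR fR]
      by (simp add: left_def right_def del: end_side.simps)
  next
    case False
    then show ?thesis using eq[of 0] Z[of 0] fR by (cases "ls ! 0") (simp_all add: left_def right_def del: end_side.simps)
  qed
  have E1: "arr (es Terminal) \<otimes>\<^bsub>\<Lambda>\<^esub> f 1 = \<zero>\<^bsub>\<Lambda>\<^esub>"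
  proof (cases len)
    case 0
    then show ?thesis using eq[of 0] arr_independent(2)[OF end_sides_neq[OF 0] fR fR]
      by (simp add: left_def right_def del: end_side.simps)
  next
    case (Suc j)
    then show ?thesis using eq[of len] Z[of j] fR
      by (cases "ls ! j") (simp_all add: left_def right_def del: end_side.simps)
  qed
  have "arr (side_at k 0) \<otimes>\<^bsub>\<Lambda>\<^esub> f k = \<zero>\<^bsub>\<Lambda>\<^esub>" if "k < 2" for k
  proof -
    have "k = 0 \<or> k = 1" using that by auto
    then show ?thesis using E0 E1 by (auto simp: side_at_def end_of_def simp del: end_side.simps)
  qed
  then show ?thesis using diff_Suc_image[of f 0] f out by (simp add: numeral_2_eq_2)
qed

lemma kernel_diff_Suc:
  assumes f: "f \<in> carrier (Res (Suc (Suc m)))" and 0: "diff (Suc m) f = \<zero>\<^bsub>Res (Suc m)\<^esub>"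
  shows "f \<in> diff (Suc (Suc m)) ` carrier (Res (Suc (Suc (Suc m))))"
proof (rule diff_Suc_image[OF f])
  show "arr (side_at k (Suc m)) \<otimes>\<^bsub>\<Lambda>\<^esub> f k = \<zero>\<^bsub>\<Lambda>\<^esub>" if "k < 2" for k
    using fun_cong[OF 0, of k] that by (simp add: diff_def Res_ops)
  show "f k = \<zero>\<^bsub>\<Lambda>\<^esub>" if "\<not> k < 2" for k using Res_out[OF f, of k] that by (simp add: rank_def)
qed

subsection \<open>Exactness in degree zero\<close>

text \<open>
  Modulo the image of the first differential, the linear section \<open>sec\<close> of the augmentation
  commutes with the action of the algebra.  The submodule generated by the image of \<open>sec\<close> is
  everything, hence an element differs from the section of its augmentation by a boundary.
\<close>

definition sec :: "(nat \<Rightarrow> 'k) \<Rightarrow> nat \<Rightarrow> (('a, 's) path \<Rightarrow> 'k) set" where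
  "sec m = (\<lambda>i. if i \<le> len then scal (m i) \<otimes>\<^bsub>\<Lambda>\<^esub> idm (vert i) else \<zero>\<^bsub>\<Lambda>\<^esub>)"

lemma mult_scal_left: "X \<in> carrier \<Lambda> \<Longrightarrow> Y \<in> carrier \<Lambda> \<Longrightarrow> X \<otimes>\<^bsub>\<Lambda>\<^esub> (scal c \<otimes>\<^bsub>\<Lambda>\<^esub> Y) = scal c \<otimes>\<^bsub>\<Lambda>\<^esub> (X \<otimes>\<^bsub>\<Lambda>\<^esub> Y)"
  by (simp add: scal_commute \<Lambda>.m_assoc[symmetric])

lemma sec_carrier: "sec m \<in> carrier (Res 0)"
  by (rule Res_carrierI) (auto simp: sec_def rank_def idem_def mult_scal_left idm_idem)

text \<open>
  For an arrow \<open>x\<close> the difference is the boundary of the combination of the generators with arrow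
  \<open>x\<close>, corrected at the generators whose arrow precedes \<open>x\<close> in its triangle: there the second term
  \<open>- g\<^sub>t\<close> of the boundary, multiplied by \<open>x\<close>, supplies the components that \<open>x\<close> kills in the string
  module without killing them in the free module.
\<close>

lemma sec_arr:
  assumes x: "x \<in> arcs Q"
  shows "\<exists>f\<in>carrier (Res 1). \<forall>i. sec m i \<otimes>\<^bsub>\<Lambda>\<^esub> arr x = diff 0 f i \<oplus>\<^bsub>\<Lambda>\<^esub> sec (arrow_action w m x) i"
proof -
  let ?h = "idm (curve T (nxt x))"
  define lt where "lt z s t = (if z = x then scal (m s) \<otimes>\<^bsub>\<Lambda>\<^esub> ?h else \<zero>\<^bsub>\<Lambda>\<^esub>) \<oplus>\<^bsub>\<Lambda>\<^esub>
    (if nxt z = x then \<ominus>\<^bsub>\<Lambda>\<^esub> (scal (m t) \<otimes>\<^bsub>\<Lambda>\<^esub> arr x) else \<zero>\<^bsub>\<Lambda>\<^esub>)" for z s t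
  define f where "f k = (if k < 2 then (if side_at k 0 = x then scal (m (pos (end_of k))) \<otimes>\<^bsub>\<Lambda>\<^esub> ?h else \<zero>\<^bsub>\<Lambda>\<^esub>)
    else if k < len + 2 then (case ls ! (k - 2) of Dir z \<Rightarrow> lt z (k - 2) (Suc (k - 2)) | Inv z \<Rightarrow> lt z (Suc (k - 2)) (k - 2))
    else \<zero>\<^bsub>\<Lambda>\<^esub>)" for k
  have nx: "nxt x \<noteq> x" "x \<noteq> nxt x" using x nxt_neq[of x] nxt_neq[of x, symmetric] by auto
  have [simp]: "lt z s t \<in> carrier \<Lambda>" for z s t by (simp add: lt_def)
  have lt_idm: "idm (curve T (nxt z)) \<otimes>\<^bsub>\<Lambda>\<^esub> lt z s t = lt z s t" for z s t
    by (auto simp: lt_def \<Lambda>.r_distr \<Lambda>.r_minus mult_scal_left idm_idem idm_arr)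
  have lt_arr: "arr z \<otimes>\<^bsub>\<Lambda>\<^esub> lt z s t = (if z = x then scal (m s) \<otimes>\<^bsub>\<Lambda>\<^esub> arr x else \<zero>\<^bsub>\<Lambda>\<^esub>)" for z s t
    using nx by (auto simp: lt_def \<Lambda>.r_distr \<Lambda>.r_minus mult_scal_left arr_idm arr_nxt)
  have f: "f \<in> carrier (Res 1)"
  proof (rule Res_carrierI)
    fix k assume k: "k < rank 1"
    show "f k \<in> carrier \<Lambda> \<and> idem 1 k \<otimes>\<^bsub>\<Lambda>\<^esub> f k = f k"
    proof (cases "k < 2")
      case True
      then show ?thesis using x by (auto simp: f_def idem_def side_at_Suc mult_scal_left idm_idem simp del: quiver_simps)
    next
      case False
      then show ?thesis using k by (cases "ls ! (k - 2)") (auto simp: f_def idem_def rank_def lt_idm)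
    qed
  qed (simp add: f_def rank_def)
  have fl: "f (Suc (Suc j)) = (case ls ! j of Dir z \<Rightarrow> lt z j (Suc j) | Inv z \<Rightarrow> lt z (Suc j) j)" if "j < len" for j
    using that by (cases "ls ! j") (simp_all add: f_def)
  have f01: "f 0 = (if es Start = x then scal (m 0) \<otimes>\<^bsub>\<Lambda>\<^esub> ?h else \<zero>\<^bsub>\<Lambda>\<^esub>)"
    "f 1 = (if es Terminal = x then scal (m len) \<otimes>\<^bsub>\<Lambda>\<^esub> ?h else \<zero>\<^bsub>\<Lambda>\<^esub>)"
    by (simp_all add: f_def side_at_def end_of_def del: end_side.simps)
  have L: "left i f = (if \<gamma> ! i = x then scal (m i) \<otimes>\<^bsub>\<Lambda>\<^esub> arr x else \<zero>\<^bsub>\<Lambda>\<^esub>) \<ominus>\<^bsub>\<Lambda>\<^esub>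
      (if 0 < i \<and> ls ! (i - 1) = Dir x then scal (m (i - 1)) \<otimes>\<^bsub>\<Lambda>\<^esub> ?h else \<zero>\<^bsub>\<Lambda>\<^esub>)" if i: "i \<le> len" for i
  proof (cases i)
    case 0
    then show ?thesis by (simp add: left_def f01 end_side_eq mult_scal_left arr_idm a_minus_def del: end_side.simps)
  next
    case (Suc j)
    then have j: "j < len" using i by simp
    show ?thesis
    proof (cases "ls ! j")
      case (Inv z)
      then show ?thesis using letter_Inv[OF j Inv] Suc fl[OF j] by (simp add: left_def lt_arr a_minus_def)
    next
      case (Dir z)
      have "left i f = \<ominus>\<^bsub>\<Lambda>\<^esub> lt z j i" using Suc Dir fl[OF j] by (simp add: left_def)
      also have "\<dots> = (if nxt z = x then scal (m i) \<otimes>\<^bsub>\<Lambda>\<^esub> arr x else \<zero>\<^bsub>\<Lambda>\<^esub>) \<ominus>\<^bsub>\<Lambda>\<^esub>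
          (if z = x then scal (m j) \<otimes>\<^bsub>\<Lambda>\<^esub> ?h else \<zero>\<^bsub>\<Lambda>\<^esub>)"
        by (simp add: lt_def \<Lambda>.minus_add a_minus_def \<Lambda>.a_comm)
      finally show ?thesis using letter_Dir[OF j Dir] Suc Dir by simp
    qed
  qed
  have R: "right i f = (if opp (\<gamma> ! i) = x then scal (m i) \<otimes>\<^bsub>\<Lambda>\<^esub> arr x else \<zero>\<^bsub>\<Lambda>\<^esub>) \<ominus>\<^bsub>\<Lambda>\<^esub>
      (if i < len \<and> ls ! i = Inv x then scal (m (Suc i)) \<otimes>\<^bsub>\<Lambda>\<^esub> ?h else \<zero>\<^bsub>\<Lambda>\<^esub>)" if i: "i \<le> len" for i
  proof (cases "i < len")
    case False
    then have "i = len" using i by simp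
    then show ?thesis by (simp add: right_def f01(2)[unfolded One_nat_def] end_side_eq mult_scal_left arr_idm a_minus_def del: end_side.simps)
  next
    case j: True
    show ?thesis
    proof (cases "ls ! i")
      case (Dir z)
      then show ?thesis using letter_Dir[OF j Dir] j fl[OF j] by (simp add: right_def lt_arr a_minus_def)
    next
      case (Inv z)
      have "right i f = \<ominus>\<^bsub>\<Lambda>\<^esub> lt z (Suc i) i" using Inv j fl[OF j] by (simp add: right_def)
      also have "\<dots> = (if nxt z = x then scal (m i) \<otimes>\<^bsub>\<Lambda>\<^esub> arr x else \<zero>\<^bsub>\<Lambda>\<^esub>) \<ominus>\<^bsub>\<Lambda>\<^esub>
          (if z = x then scal (m (Suc i)) \<otimes>\<^bsub>\<Lambda>\<^esub> ?h else \<zero>\<^bsub>\<Lambda>\<^esub>)"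
        by (simp add: lt_def \<Lambda>.minus_add a_minus_def \<Lambda>.a_comm)
      finally have "right i f = \<dots>" .
      moreover have "opp (\<gamma> ! i) = nxt z" using letter_Inv[OF j Inv] by metis
      ultimately show ?thesis using Inv j by simp
    qed
  qed
  have "sec m i \<otimes>\<^bsub>\<Lambda>\<^esub> arr x = diff 0 f i \<oplus>\<^bsub>\<Lambda>\<^esub> sec (arrow_action w m x) i" if i: "i \<le> len" for i
  proof -
    define A1 A2 B1 B2 where
      "A1 = (if \<gamma> ! i = x then scal (m i) \<otimes>\<^bsub>\<Lambda>\<^esub> arr x else \<zero>\<^bsub>\<Lambda>\<^esub>)" and
      "A2 = (if opp (\<gamma> ! i) = x then scal (m i) \<otimes>\<^bsub>\<Lambda>\<^esub> arr x else \<zero>\<^bsub>\<Lambda>\<^esub>)" and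
      "B1 = (if 0 < i \<and> ls ! (i - 1) = Dir x then scal (m (i - 1)) \<otimes>\<^bsub>\<Lambda>\<^esub> ?h else \<zero>\<^bsub>\<Lambda>\<^esub>)" and
      "B2 = (if i < len \<and> ls ! i = Inv x then scal (m (Suc i)) \<otimes>\<^bsub>\<Lambda>\<^esub> ?h else \<zero>\<^bsub>\<Lambda>\<^esub>)"
    have c: "A1 \<in> carrier \<Lambda>" "A2 \<in> carrier \<Lambda>" "B1 \<in> carrier \<Lambda>" "B2 \<in> carrier \<Lambda>"
      by (simp_all add: A1_def A2_def B1_def B2_def)
    have d: "diff 0 f i = (A1 \<ominus>\<^bsub>\<Lambda>\<^esub> B1) \<oplus>\<^bsub>\<Lambda>\<^esub> (A2 \<ominus>\<^bsub>\<Lambda>\<^esub> B2)"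
      using i L[OF i] R[OF i] unfolding A1_def A2_def B1_def B2_def by (simp add: diff_def)
    have a: "sec m i \<otimes>\<^bsub>\<Lambda>\<^esub> arr x = A1 \<oplus>\<^bsub>\<Lambda>\<^esub> A2"
    proof (cases "curve T x = vert i")
      case True
      then have "x = \<gamma> ! i \<or> x = opp (\<gamma> ! i)"
        using x vert_eq[OF i] by (intro opp_side(4)[OF arc_side[OF i]]) auto
      then have "(\<gamma> ! i = x \<and> opp (\<gamma> ! i) \<noteq> x) \<or> (\<gamma> ! i \<noteq> x \<and> opp (\<gamma> ! i) = x)"
        using opp_arc(2)[OF i] by metis
      moreover have "sec m i \<otimes>\<^bsub>\<Lambda>\<^esub> arr x = scal (m i) \<otimes>\<^bsub>\<Lambda>\<^esub> arr x"
        using i True[symmetric] by (simp add: sec_def \<Lambda>.m_assoc idm_arr)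
      moreover have "A1 = (if \<gamma> ! i = x then sec m i \<otimes>\<^bsub>\<Lambda>\<^esub> arr x else \<zero>\<^bsub>\<Lambda>\<^esub>)"
        "A2 = (if opp (\<gamma> ! i) = x then sec m i \<otimes>\<^bsub>\<Lambda>\<^esub> arr x else \<zero>\<^bsub>\<Lambda>\<^esub>)"
        unfolding A1_def A2_def calculation(2) by (rule refl)+
      moreover have "sec m i \<otimes>\<^bsub>\<Lambda>\<^esub> arr x \<in> carrier \<Lambda>" using calculation(2) by simp
      ultimately show ?thesis by (metis \<Lambda>.l_zero \<Lambda>.r_zero)
    next
      case False
      then have "\<gamma> ! i \<noteq> x" "opp (\<gamma> ! i) \<noteq> x" using vert_eq[OF i] opp_arc(3)[OF i] by auto
      then show ?thesis using i False by (simp add: A1_def A2_def sec_def \<Lambda>.m_assoc idm_arr_0)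
    qed
    have b: "sec (arrow_action w m x) i = B1 \<oplus>\<^bsub>\<Lambda>\<^esub> B2"
    proof -
      have v1: "vert i = curve T (nxt x)" if "0 < i" "ls ! (i - 1) = Dir x"
        using is_string_letters(3)[OF string, of "i - 1"] that i by simp
      have v2: "vert i = curve T (nxt x)" if "i < len" "ls ! i = Inv x"
        using is_string_letters(2)[OF string, of i] that by simp
      have "arrow_action w m x i = (if 0 < i \<and> ls ! (i - 1) = Dir x then m (i - 1) else 0) +
          (if i < len \<and> ls ! i = Inv x then m (Suc i) else 0)"
        using i by (simp add: arrow_action_def)
      then show ?thesis using i v1 v2 by (auto simp: sec_def B1_def B2_def scal_simps)
    qed
    have "(A1 \<oplus>\<^bsub>\<Lambda>\<^esub> \<ominus>\<^bsub>\<Lambda>\<^esub> B1) \<oplus>\<^bsub>\<Lambda>\<^esub> (A2 \<oplus>\<^bsub>\<Lambda>\<^esub> \<ominus>\<^bsub>\<Lambda>\<^esub> B2) \<oplus>\<^bsub>\<Lambda>\<^esub> (B1 \<oplus>\<^bsub>\<Lambda>\<^esub> B2) =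
        (A1 \<oplus>\<^bsub>\<Lambda>\<^esub> A2) \<oplus>\<^bsub>\<Lambda>\<^esub> ((\<ominus>\<^bsub>\<Lambda>\<^esub> B1 \<oplus>\<^bsub>\<Lambda>\<^esub> B1) \<oplus>\<^bsub>\<Lambda>\<^esub> (\<ominus>\<^bsub>\<Lambda>\<^esub> B2 \<oplus>\<^bsub>\<Lambda>\<^esub> B2))"
      using c \<Lambda>.add.inv_closed by (simp only: \<Lambda>.a_ac \<Lambda>.a_closed)
    then show ?thesis unfolding a b d using c by (simp add: a_minus_def \<Lambda>.l_neg)
  qed
  moreover have "sec m i \<otimes>\<^bsub>\<Lambda>\<^esub> arr x = diff 0 f i \<oplus>\<^bsub>\<Lambda>\<^esub> sec (arrow_action w m x) i" if "\<not> i \<le> len" for i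
    using that by (simp add: sec_def diff_def)
  ultimately show ?thesis using f by blast
qed

lemma image_diff:
  shows "\<zero>\<^bsub>Res n\<^esub> \<in> diff n ` carrier (Res (Suc n))"
    and "x \<in> diff n ` carrier (Res (Suc n)) \<Longrightarrow> y \<in> diff n ` carrier (Res (Suc n)) \<Longrightarrow>
      x \<oplus>\<^bsub>Res n\<^esub> y \<in> diff n ` carrier (Res (Suc n))"
    and "x \<in> diff n ` carrier (Res (Suc n)) \<Longrightarrow> a \<in> carrier \<Lambda> \<Longrightarrow> a \<odot>\<^bsub>Res n\<^esub> x \<in> diff n ` carrier (Res (Suc n))"
proof -
  interpret S: right_module \<Lambda> "Res (Suc n)" by (rule Res_right_module)
  show "\<zero>\<^bsub>Res n\<^esub> \<in> diff n ` carrier (Res (Suc n))"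
    using module_hom_zero[OF Res_right_module Res_right_module diff_hom] S.M.zero_closed by (metis image_eqI)
  {
    assume "x \<in> diff n ` carrier (Res (Suc n))" "y \<in> diff n ` carrier (Res (Suc n))"
    then obtain f g where fg: "f \<in> carrier (Res (Suc n))" "x = diff n f" "g \<in> carrier (Res (Suc n))" "y = diff n g" by blast
    show "x \<oplus>\<^bsub>Res n\<^esub> y \<in> diff n ` carrier (Res (Suc n))"
      unfolding fg(2,4) LinearCombinations.module_hom_add[OF diff_hom fg(1,3), symmetric]
      by (rule imageI[OF S.M.a_closed[OF fg(1,3)]])
  }
  {
    assume "x \<in> diff n ` carrier (Res (Suc n))" and a: "a \<in> carrier \<Lambda>"
    then obtain f where f: "f \<in> carrier (Res (Suc n))" "x = diff n f" by blast
    show "a \<odot>\<^bsub>Res n\<^esub> x \<in> diff n ` carrier (Res (Suc n))"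
      unfolding f(2) LinearCombinations.module_hom_smult[OF diff_hom a f(1), symmetric]
      by (rule imageI[OF S.smult_closed[OF a f(1)]])
  }
qed

lemma sec_equivariant:
  assumes X: "X \<in> carrier \<Lambda>" and m: "m \<in> carrier (SM w)"
  shows "X \<odot>\<^bsub>Res 0\<^esub> sec m \<ominus>\<^bsub>Res 0\<^esub> sec (X \<odot>\<^bsub>SM w\<^esub> m) \<in> diff 0 ` carrier (Res 1)"
proof -
  interpret P: right_module \<Lambda> "Res 0" by (rule Res_right_module)
  interpret M: right_module \<Lambda> "SM w" by (rule right_module_M)
  let ?Im = "diff 0 ` carrier (Res 1)"
  note im = image_diff(1)[where n = 0, folded One_nat_def] image_diff(2)[where n = 0, folded One_nat_def]
    image_diff(3)[where n = 0, folded One_nat_def]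
  note [simp] = sec_carrier
  have D: "X \<odot>\<^bsub>Res 0\<^esub> sec m \<ominus>\<^bsub>Res 0\<^esub> sec m' \<in> ?Im" if "\<And>i. i \<le> len \<Longrightarrow> sec m i \<otimes>\<^bsub>\<Lambda>\<^esub> X = sec m' i" "X \<in> carrier \<Lambda>" for X m m'
  proof -
    have "X \<odot>\<^bsub>Res 0\<^esub> sec m = sec m'" using that by (auto simp: Res_ops sec_def fun_eq_iff)
    then show ?thesis using im(1) P.M.r_neg[OF sec_carrier, of m'] by (simp add: a_minus_def)
  qed
  have secs: "sec m i \<otimes>\<^bsub>\<Lambda>\<^esub> scal c = scal (c * m i) \<otimes>\<^bsub>\<Lambda>\<^esub> idm (vert i)" if "i \<le> len" for m i c
    using that by (simp add: sec_def scal_commute scal_simps \<Lambda>.m_closed)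
  from X have "\<forall>m\<in>carrier (SM w). X \<odot>\<^bsub>Res 0\<^esub> sec m \<ominus>\<^bsub>Res 0\<^esub> sec (X \<odot>\<^bsub>SM w\<^esub> m) \<in> ?Im"
  proof (induction rule: \<Lambda>_induct)
    case (add X Y)
    show ?case
    proof
      fix m assume m: "m \<in> carrier (SM w)"
      let ?a = "X \<odot>\<^bsub>Res 0\<^esub> sec m" and ?b = "Y \<odot>\<^bsub>Res 0\<^esub> sec m"
      let ?c = "sec (X \<odot>\<^bsub>SM w\<^esub> m)" and ?d = "sec (Y \<odot>\<^bsub>SM w\<^esub> m)"
      have s: "sec (X \<odot>\<^bsub>SM w\<^esub> m \<oplus>\<^bsub>SM w\<^esub> Y \<odot>\<^bsub>SM w\<^esub> m) = ?c \<oplus>\<^bsub>Res 0\<^esub> ?d"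
        by (auto simp: sec_def Res_ops string_module_simps[OF string] scal_simps fun_eq_iff)
      have cl: "?a \<in> carrier (Res 0)" "?b \<in> carrier (Res 0)" "?c \<in> carrier (Res 0)" "?d \<in> carrier (Res 0)"
        using add by (auto intro: P.smult_closed)
      have "(?a \<oplus>\<^bsub>Res 0\<^esub> ?b) \<ominus>\<^bsub>Res 0\<^esub> (?c \<oplus>\<^bsub>Res 0\<^esub> ?d) = (?a \<ominus>\<^bsub>Res 0\<^esub> ?c) \<oplus>\<^bsub>Res 0\<^esub> (?b \<ominus>\<^bsub>Res 0\<^esub> ?d)"
        using cl by (simp add: a_minus_def P.M.minus_add P.M.a_ac)
      then show "(X \<oplus>\<^bsub>\<Lambda>\<^esub> Y) \<odot>\<^bsub>Res 0\<^esub> sec m \<ominus>\<^bsub>Res 0\<^esub> sec ((X \<oplus>\<^bsub>\<Lambda>\<^esub> Y) \<odot>\<^bsub>SM w\<^esub> m) \<in> ?Im"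
        using add m im(2) by (simp add: P.smult_add_ring M.smult_add_ring s)
    qed
  next
    case (mult X Y)
    show ?case
    proof
      fix m assume m: "m \<in> carrier (SM w)"
      let ?a = "X \<odot>\<^bsub>Res 0\<^esub> sec m" and ?m = "X \<odot>\<^bsub>SM w\<^esub> m"
      have cl: "?a \<in> carrier (Res 0)" "?m \<in> carrier (SM w)" "Y \<odot>\<^bsub>Res 0\<^esub> ?a \<in> carrier (Res 0)"
        "Y \<odot>\<^bsub>Res 0\<^esub> sec ?m \<in> carrier (Res 0)" "sec (Y \<odot>\<^bsub>SM w\<^esub> ?m) \<in> carrier (Res 0)"
        using mult m by (auto intro!: P.smult_closed M.smult_closed)
      have ac: "Y \<odot>\<^bsub>Res 0\<^esub> (\<ominus>\<^bsub>Res 0\<^esub> sec ?m) = \<ominus>\<^bsub>Res 0\<^esub> (Y \<odot>\<^bsub>Res 0\<^esub> sec ?m)"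
        using P.smult_add_module[OF mult(2), of "\<ominus>\<^bsub>Res 0\<^esub> sec ?m" "sec ?m"] mult(2) cl
          P.M.minus_equality[of "Y \<odot>\<^bsub>Res 0\<^esub> (\<ominus>\<^bsub>Res 0\<^esub> sec ?m)" "Y \<odot>\<^bsub>Res 0\<^esub> sec ?m"]
        by (simp add: P.M.l_neg P.smult_closed)
      have "Y \<odot>\<^bsub>Res 0\<^esub> (?a \<ominus>\<^bsub>Res 0\<^esub> sec ?m) \<oplus>\<^bsub>Res 0\<^esub> (Y \<odot>\<^bsub>Res 0\<^esub> sec ?m \<ominus>\<^bsub>Res 0\<^esub> sec (Y \<odot>\<^bsub>SM w\<^esub> ?m)) =
        Y \<odot>\<^bsub>Res 0\<^esub> ?a \<ominus>\<^bsub>Res 0\<^esub> sec (Y \<odot>\<^bsub>SM w\<^esub> ?m)"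
        using cl mult(2) by (simp add: a_minus_def P.smult_add_module ac P.M.a_assoc P.M.r_neg1)
      moreover have "Y \<odot>\<^bsub>Res 0\<^esub> (?a \<ominus>\<^bsub>Res 0\<^esub> sec ?m) \<in> ?Im" using im(3) mult m by blast
      moreover have "Y \<odot>\<^bsub>Res 0\<^esub> sec ?m \<ominus>\<^bsub>Res 0\<^esub> sec (Y \<odot>\<^bsub>SM w\<^esub> ?m) \<in> ?Im" using mult cl by blast
      ultimately have "Y \<odot>\<^bsub>Res 0\<^esub> ?a \<ominus>\<^bsub>Res 0\<^esub> sec (Y \<odot>\<^bsub>SM w\<^esub> ?m) \<in> ?Im" using im(2) by metis
      then show "(X \<otimes>\<^bsub>\<Lambda>\<^esub> Y) \<odot>\<^bsub>Res 0\<^esub> sec m \<ominus>\<^bsub>Res 0\<^esub> sec ((X \<otimes>\<^bsub>\<Lambda>\<^esub> Y) \<odot>\<^bsub>SM w\<^esub> m) \<in> ?Im"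
        using mult m by (simp add: P.smult_assoc M.smult_assoc)
    qed
  next
    case (scal c)
    show ?case
      by (intro ballI D) (simp_all add: secs string_module_scal[OF string], simp add: sec_def)
  next
    case (idm u)
    show ?case
      using idm by (intro ballI D)
        (auto simp: sec_def \<Lambda>.m_assoc idm_idem idm_orth string_module_idm[OF string] vertex_part_def scal_simps)
  next
    case (arr x)
    show ?case
    proof
      fix m assume "m \<in> carrier (SM w)"
      obtain f where f: "f \<in> carrier (Res 1)" "\<And>i. sec m i \<otimes>\<^bsub>\<Lambda>\<^esub> arr x = diff 0 f i \<oplus>\<^bsub>\<Lambda>\<^esub> sec (arrow_action w m x) i"
        using sec_arr[OF arr, of m] by blast
      let ?s = "sec (arrow_action w m x)"
      have df: "diff 0 f \<in> carrier (Res 0)" using module_hom_carrier[OF diff_hom, of f 0] f by simp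
      have "arr x \<odot>\<^bsub>Res 0\<^esub> sec m = diff 0 f \<oplus>\<^bsub>Res 0\<^esub> ?s"
        using f(2) by (simp add: Res_ops)
      then have "arr x \<odot>\<^bsub>Res 0\<^esub> sec m \<ominus>\<^bsub>Res 0\<^esub> sec (arr x \<odot>\<^bsub>SM w\<^esub> m) = diff 0 f"
        using df by (simp add: string_module_arr[OF string] a_minus_def P.M.a_assoc P.M.r_neg)
      then show "arr x \<odot>\<^bsub>Res 0\<^esub> sec m \<ominus>\<^bsub>Res 0\<^esub> sec (arr x \<odot>\<^bsub>SM w\<^esub> m) \<in> ?Im" using f by auto
    qed
  qed
  then show ?thesis using m by blast
qed

lemma kernel_aug:
  assumes z: "z \<in> carrier (Res 0)" and 0: "aug z = \<zero>\<^bsub>SM w\<^esub>"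
  shows "z \<in> diff 0 ` carrier (Res 1)"
proof -
  interpret P: right_module \<Lambda> "Res 0" by (rule Res_right_module)
  interpret M: right_module \<Lambda> "SM w" by (rule right_module_M)
  let ?Im = "diff 0 ` carrier (Res 1)"
  note im = image_diff(1)[where n = 0, folded One_nat_def] image_diff(2)[where n = 0, folded One_nat_def]
    image_diff(3)[where n = 0, folded One_nat_def]
  have sec0: "sec \<zero>\<^bsub>SM w\<^esub> = \<zero>\<^bsub>Res 0\<^esub>"
    by (auto simp: sec_def Res_ops string_module_simps[OF string] scal_simps fun_eq_iff)
  have aug0: "aug \<zero>\<^bsub>Res 0\<^esub> = \<zero>\<^bsub>SM w\<^esub>" by (rule module_hom_zero[OF Res_right_module right_module_M aug_hom])
  have F: "Res 0 = idem_module \<Lambda> (idem 0) (rank 0)" by (rule Res_def)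
  have "z \<ominus>\<^bsub>Res 0\<^esub> sec (aug z) \<in> ?Im"
  proof (rule idem_module_induct[of \<Lambda> "rank 0" "idem 0" z "\<lambda>z. z \<ominus>\<^bsub>Res 0\<^esub> sec (aug z) \<in> ?Im", folded F])
    show "\<zero>\<^bsub>Res 0\<^esub> \<ominus>\<^bsub>Res 0\<^esub> sec (aug \<zero>\<^bsub>Res 0\<^esub>) \<in> ?Im"
    proof -
      have "\<zero>\<^bsub>Res 0\<^esub> \<ominus>\<^bsub>Res 0\<^esub> \<zero>\<^bsub>Res 0\<^esub> = \<zero>\<^bsub>Res 0\<^esub>" using P.M.r_neg[OF P.M.zero_closed] by (simp only: a_minus_def)
      then show ?thesis using im(1) by (simp only: aug0 sec0)
    qed
  next
    fix f g assume fg: "f \<in> carrier (Res 0)" "g \<in> carrier (Res 0)"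
      "f \<ominus>\<^bsub>Res 0\<^esub> sec (aug f) \<in> ?Im" "g \<ominus>\<^bsub>Res 0\<^esub> sec (aug g) \<in> ?Im"
    let ?c = "sec (aug f)" and ?d = "sec (aug g)"
    have s: "sec (aug (f \<oplus>\<^bsub>Res 0\<^esub> g)) = ?c \<oplus>\<^bsub>Res 0\<^esub> ?d"
      unfolding LinearCombinations.module_hom_add[OF aug_hom fg(1,2)]
      by (auto simp: sec_def Res_ops string_module_simps[OF string] scal_simps fun_eq_iff)
    have "(f \<oplus>\<^bsub>Res 0\<^esub> g) \<ominus>\<^bsub>Res 0\<^esub> (?c \<oplus>\<^bsub>Res 0\<^esub> ?d) = (f \<ominus>\<^bsub>Res 0\<^esub> ?c) \<oplus>\<^bsub>Res 0\<^esub> (g \<ominus>\<^bsub>Res 0\<^esub> ?d)"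
      using fg(1,2) sec_carrier by (simp add: a_minus_def P.M.minus_add P.M.a_ac)
    then show "(f \<oplus>\<^bsub>Res 0\<^esub> g) \<ominus>\<^bsub>Res 0\<^esub> sec (aug (f \<oplus>\<^bsub>Res 0\<^esub> g)) \<in> ?Im"
      using im(2)[OF fg(3,4)] by (simp add: s)
  next
    fix i a assume i: "i < rank 0" and a: "a \<in> carrier \<Lambda>"
    then have il: "i \<le> len" by (simp add: rank_def)
    have "sec (bvec i) = gen 0 i"
      using il by (auto simp: sec_def bvec_def unit_vec_at_def idem_def scal_simps fun_eq_iff)
    moreover have "aug (a \<odot>\<^bsub>Res 0\<^esub> gen 0 i) = a \<odot>\<^bsub>SM w\<^esub> bvec i"
      using LinearCombinations.module_hom_smult[OF aug_hom a gen_carrier[OF i]] aug_gen[OF il] by simp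
    ultimately show "a \<odot>\<^bsub>Res 0\<^esub> gen 0 i \<ominus>\<^bsub>Res 0\<^esub> sec (aug (a \<odot>\<^bsub>Res 0\<^esub> gen 0 i)) \<in> ?Im"
      using sec_equivariant[OF a bvec_carrier[OF il]] by simp
  qed (use z \<Lambda>.ring_axioms in auto)
  moreover have "z \<ominus>\<^bsub>Res 0\<^esub> \<zero>\<^bsub>Res 0\<^esub> = z" using z P.M.add.inv_one P.M.r_zero by (simp add: a_minus_def)
  ultimately show ?thesis by (simp add: 0 sec0)
qed

lemma aug_surj: "aug ` carrier (Res 0) = carrier (SM w)"
proof
  show "aug ` carrier (Res 0) \<subseteq> carrier (SM w)" using module_hom_carrier[OF aug_hom] by blast
  interpret P: right_module \<Lambda> "Res 0" by (rule Res_right_module)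
  have "(\<lambda>j. if j < k then m j else 0) \<in> aug ` carrier (Res 0)" if "k \<le> Suc len" for m k
    using that
  proof (induction k)
    case 0
    have "aug \<zero>\<^bsub>Res 0\<^esub> = \<zero>\<^bsub>SM w\<^esub>" by (rule module_hom_zero[OF Res_right_module right_module_M aug_hom])
    then show ?case using P.M.zero_closed by (auto simp: string_module_simps[OF string] intro!: image_eqI[of _ _ "\<zero>\<^bsub>Res 0\<^esub>"])
  next
    case (Suc k)
    then obtain z where z: "z \<in> carrier (Res 0)" "aug z = (\<lambda>j. if j < k then m j else 0)" by auto
    have g: "gen 0 k \<in> carrier (Res 0)" using Suc by (intro gen_carrier) (simp add: rank_def)
    then have g': "scal (m k) \<odot>\<^bsub>Res 0\<^esub> gen 0 k \<in> carrier (Res 0)" by (intro P.smult_closed) auto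
    have sb: "scal (m k) \<odot>\<^bsub>SM w\<^esub> bvec k = (\<lambda>j. m k * bvec k j)"
      using Suc by (intro string_module_scal[OF string bvec_carrier]) simp
    have "aug (z \<oplus>\<^bsub>Res 0\<^esub> scal (m k) \<odot>\<^bsub>Res 0\<^esub> gen 0 k) = aug z \<oplus>\<^bsub>SM w\<^esub> scal (m k) \<odot>\<^bsub>SM w\<^esub> bvec k"
      using Suc by (simp add: LinearCombinations.module_hom_add[OF aug_hom z(1) g']
          LinearCombinations.module_hom_smult[OF aug_hom scal_closed g] aug_gen)
    also have "\<dots> = (\<lambda>j. if j < Suc k then m j else 0)"
      unfolding sb z(2) string_module_simps(3)[OF string] by (auto simp: bvec_def fun_eq_iff less_Suc_eq)
    finally have "aug (z \<oplus>\<^bsub>Res 0\<^esub> scal (m k) \<odot>\<^bsub>Res 0\<^esub> gen 0 k) = (\<lambda>j. if j < Suc k then m j else 0)" .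
    then show ?case by (rule image_eqI[OF sym P.M.a_closed[OF z(1) g']])
  qed
  from this[of "Suc len"] show "carrier (SM w) \<subseteq> aug ` carrier (Res 0)"
  proof (intro subsetI)
    fix m assume *: "\<And>m. Suc len \<le> Suc len \<Longrightarrow> (\<lambda>j. if j < Suc len then m j else 0) \<in> aug ` carrier (Res 0)" and "m \<in> carrier (SM w)"
    then have "(\<lambda>j. if j < Suc len then m j else 0) = m" by (auto simp: string_module_simps[OF string] fun_eq_iff)
    then show "m \<in> aug ` carrier (Res 0)" using *[of m] by simp
  qed
qed

theorem Res_resolution: "projective_resolution \<Lambda> (SM w) Res diff aug"
  unfolding projective_resolution_def
proof (intro conjI allI)
  show "diff 0 ` carrier (Res 1) = hom_kernel (Res 0) (SM w) aug"
    using kernel_aug aug_diff module_hom_carrier[OF diff_hom, of _ 0] by (auto simp: hom_kernel_def)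
  fix n
  show "diff (Suc n) ` carrier (Res (Suc (Suc n))) = hom_kernel (Res (Suc n)) (Res n) (diff n)"
  proof (intro equalityI subsetI)
    fix f assume "f \<in> hom_kernel (Res (Suc n)) (Res n) (diff n)"
    then show "f \<in> diff (Suc n) ` carrier (Res (Suc (Suc n)))"
      using kernel_diff_0[of f] kernel_diff_Suc[of f]
      by (cases n) (auto simp: hom_kernel_def numeral_2_eq_2)
  qed (use diff_diff module_hom_carrier[OF diff_hom] in \<open>auto simp: hom_kernel_def\<close>)
qed (rule Res_projective diff_hom aug_hom aug_surj)+

end

section \<open>Evaluation of cocycles at the ends\<close>

context arc_string
begin

definition end_index :: "arc_end \<Rightarrow> nat" where "end_index e = (case e of Start \<Rightarrow> 0 | Terminal \<Rightarrow> 1)"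

lemma end_index [simp]: "end_of (end_index e) = e" "end_index e < 2"
  by (cases e; simp add: end_of_def end_index_def)+

lemma side_at_end_index: "side_at (end_index e) n = (nxt ^^ n) (es e)"
  by (simp add: side_at_def)

lemma Res_hom_eqI:
  assumes "right_module \<Lambda> B" "g \<in> module_hom \<Lambda> (Res n) B" "h \<in> module_hom \<Lambda> (Res n) B"
    and "\<And>k. k < rank n \<Longrightarrow> g (gen n k) = h (gen n k)" and "f \<in> carrier (Res n)"
  shows "g f = h f"
  using assms unfolding Res_def
  by (intro idem_module_hom_eqI[of \<Lambda> "rank n" "idem n" B g h f]) (auto simp: \<Lambda>.ring_axioms)

lemma gen_idem: "k < rank n \<Longrightarrow> idem n k \<odot>\<^bsub>Res n\<^esub> gen n k = gen n k"
  by (auto simp: Res_ops unit_vec_at_def fun_eq_iff)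

lemma gen_0: "idem n k = \<zero>\<^bsub>\<Lambda>\<^esub> \<Longrightarrow> gen n k = \<zero>\<^bsub>Res n\<^esub>"
  by (auto simp: Res_ops unit_vec_at_def)

lemma idem_internal: "k < 2 \<Longrightarrow> internal_triangle T (side_at k 0) \<Longrightarrow> idem (Suc n) k = idm (curve T (side_at k (Suc n)))"
  using internal_arc by (auto simp: idem_def)

lemma idem_not_internal: "k < 2 \<Longrightarrow> \<not> internal_triangle T (side_at k 0) \<Longrightarrow> idem (Suc (Suc n)) k = \<zero>\<^bsub>\<Lambda>\<^esub>"
  by (auto simp: idem_def)

lemma diff_Suc_gen:
  assumes k: "k < 2" and i: "internal_triangle T (side_at k 0)"
  shows "diff (Suc n) (gen (Suc (Suc n)) k) = arr (side_at k (Suc n)) \<odot>\<^bsub>Res (Suc n)\<^esub> gen (Suc n) k"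
  using k idem_internal[OF k i]
  by (auto simp: diff_def unit_vec_at_def Res_ops fun_eq_iff side_at_Suc idm_arr arr_idm)

lemma Res_lin_comb:
  assumes A: "right_module \<Lambda> A" and a: "\<And>k. k < rank n \<Longrightarrow> a k \<in> carrier A"
  shows "lin_comb A (rank n) a \<in> module_hom \<Lambda> (Res n) A"
    and "k < rank n \<Longrightarrow> lin_comb A (rank n) a (gen n k) = idem n k \<odot>\<^bsub>A\<^esub> a k"
  unfolding Res_def using lin_comb_hom[OF A a] lin_comb_unit[OF A a] by auto

end

locale two_arc_strings = triangulated_surface T field_type +
  V: arc_string T field_type v \<gamma>v + W: arc_string T field_type w \<gamma>w
  for T :: "('s, 'a) triangulation" and field_type :: "'k::field itself"
    and v w :: "('a, 's) str" and \<gamma>v \<gamma>w :: "'s list"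
begin

text \<open>
  The pairs of ends that contribute to degree \<open>n\<close>.  Since turning three times around a triangle
  is the identity, they depend on \<open>n\<close> only modulo \<open>3\<close>.
\<close>

definition pairs :: "nat \<Rightarrow> (arc_end \<times> arc_end) set" where
  "pairs n = {(e, f). internal_triangle T (V.es e) \<and> W.es f = (nxt ^^ n) (V.es e)}"

lemma finite_pairs: "finite (pairs n)"
proof (rule finite_subset)
  show "pairs n \<subseteq> {Start, Terminal} \<times> {Start, Terminal}"
  proof
    fix p :: "arc_end \<times> arc_end" show "p \<in> {Start, Terminal} \<times> {Start, Terminal}"
      by (cases p; cases "fst p"; cases "snd p") auto
  qed
qed simp

lemma nxt_funpow_side: "x \<in> sides T \<Longrightarrow> (nxt ^^ n) x \<in> sides T"
  by (induction n) auto

lemma pairs_3: "pairs (n + 3 * k) = pairs n"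
proof -
  have "(nxt ^^ (n + 3 * k)) x = (nxt ^^ n) x" if "x \<in> sides T" for x
  proof (induction k)
    case (Suc k)
    have eq: "n + 3 * Suc k = Suc (Suc (Suc (n + 3 * k)))" by simp
    show ?case unfolding eq using Suc nxt3[OF nxt_funpow_side[OF that, of "n + 3 * k"]] by simp
  qed simp
  then show ?thesis using V.end_side(1) by (simp add: pairs_def del: end_side.simps)
qed

lemma follows_iff: "follows T \<gamma>v e \<gamma>w f \<longleftrightarrow> (e, f) \<in> pairs 2"
proof -
  let ?x = "V.es e" and ?y = "W.es f"
  have "?x \<in> sides T" "?y \<in> sides T" by (rule V.end_side W.end_side)+
  then show ?thesis
    using internal_nxt[of ?y] internal_nxt[of ?x] internal_nxt[of "nxt ?x"] nxt3[of ?x] nxt3[of ?y]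
    by (auto simp: follows_def pairs_def Let_def numeral_2_eq_2 simp del: end_side.simps)
qed

abbreviation "N \<equiv> SM w"

lemma pair_internal: "(e, f) \<in> pairs n \<Longrightarrow> internal_triangle T (V.side_at (V.end_index e) 0)"
  by (simp add: pairs_def V.side_at_end_index)

text \<open>
  The value lies in the image of the arrow preceding the side at which the arc of \<open>w\<close> ends, and no
  such arrow reaches the basis vector at the end.
\<close>

lemma coboundary_at_end:
  assumes g: "g \<in> module_hom \<Lambda> (V.Res (Suc n)) N" and ef: "(e, f) \<in> pairs (Suc (Suc n))"
  shows "g (V.diff (Suc n) (V.gen (Suc (Suc n)) (V.end_index e))) (W.pos f) = 0"
proof -
  let ?k = "V.end_index e" and ?z = "V.side_at (V.end_index e) n"
  have k: "?k < V.rank (Suc n)" by (auto simp: V.rank_def intro: less_le_trans[OF V.end_index(2)])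
  have "g (V.diff (Suc n) (V.gen (Suc (Suc n)) ?k)) = arrow_action w (g (V.gen (Suc n) ?k)) (nxt ?z)"
    using V.diff_Suc_gen[OF V.end_index(2) pair_internal[OF ef], of n]
      LinearCombinations.module_hom_smult[OF g arr_closed V.gen_carrier[OF k]]
    by (simp add: V.side_at_Suc string_module_arr[OF W.string])
  moreover have "nxt (nxt ?z) = W.es f"
    using ef by (simp add: pairs_def V.side_at_end_index funpow_swap1)
  ultimately show ?thesis using W.arr_misses_end[of ?z f] V.side_at_side by simp
qed

text \<open>
  The value of the cocycle at each end lies in the kernel of an arrow; having no coefficient at the
  ends of the other arc, it lies in the image of the preceding arrow.  The preimages are the values
  of the cochain sought.
\<close>

lemma cocycle_eq_coboundary:
  assumes h: "h \<in> module_hom \<Lambda> (V.Res (Suc (Suc n))) N"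
    and cocycle: "\<And>x. x \<in> carrier (V.Res (Suc (Suc (Suc n)))) \<Longrightarrow> h (V.diff (Suc (Suc n)) x) = \<zero>\<^bsub>N\<^esub>"
    and ends: "\<And>e f. (e, f) \<in> pairs (Suc (Suc n)) \<Longrightarrow> h (V.gen (Suc (Suc n)) (V.end_index e)) (W.pos f) = 0"
  obtains g where "g \<in> module_hom \<Lambda> (V.Res (Suc n)) N"
    "\<And>x. x \<in> carrier (V.Res (Suc (Suc n))) \<Longrightarrow> h x = g (V.diff (Suc n) x)"
proof -
  let ?n = "Suc (Suc n)"
  interpret N: right_module \<Lambda> N by (rule W.right_module_M)
  have r: "V.rank ?n = 2" "V.rank (Suc ?n) = 2" by (simp_all add: V.rank_def)
  have r1: "k < V.rank (Suc n)" if "k < 2" for k using that by (auto simp: V.rank_def)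
  have "\<exists>m'. m' \<in> carrier N \<and> (internal_triangle T (V.side_at k 0) \<longrightarrow>
      vertex_part w (curve T (V.side_at k (Suc n))) m' = m' \<and> arrow_action w m' (V.side_at k (Suc n)) = h (V.gen ?n k))"
    if k: "k < 2" for k
  proof (cases "internal_triangle T (V.side_at k 0)")
    case True
    let ?y = "V.side_at k ?n" and ?z = "V.side_at k (Suc n)" and ?m = "h (V.gen ?n k)"
    have gk: "V.gen ?n k \<in> carrier (V.Res ?n)" using k r by (intro V.gen_carrier) simp
    have iy: "internal_triangle T ?y" using internal_funpow[OF True, of ?n] by (simp add: V.side_at_def)
    have supp: "vertex_part w (curve T ?y) ?m = ?m"
      using LinearCombinations.module_hom_smult[OF h V.idem_closed gk, of ?n k] V.gen_idem[of k ?n] k r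
        V.idem_internal[OF k True, of "Suc n"] internal_arc[OF iy]
      by (simp add: string_module_idm[OF W.string])
    have ker: "arrow_action w ?m ?y = (\<lambda>_. 0)"
      using cocycle[OF V.gen_carrier[of k "Suc ?n"]] k r V.diff_Suc_gen[OF k True, of "Suc n"]
        LinearCombinations.module_hom_smult[OF h arr_closed gk, of ?y]
      by (simp add: string_module_arr[OF W.string] string_module_simps[OF W.string])
    have "?m (W.pos f) = 0" if f: "W.es f = ?y" for f
    proof -
      have "(V.end_of k, f) \<in> pairs ?n" using True f by (simp add: pairs_def V.side_at_def)
      moreover have "V.end_index (V.end_of k) = k"
        using k by (auto simp: V.end_index_def V.end_of_def less_2_cases_iff)
      ultimately show ?thesis using ends[of "V.end_of k" f] by simp
    qed
    then obtain m' where "\<forall>j>W.len. m' j = 0" "vertex_part w (curve T ?z) m' = m'" "arrow_action w m' ?z = ?m"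
      using W.kernel_in_image[of ?y ?z ?m] V.side_at_side supp ker module_hom_carrier[OF h gk]
      by (auto simp: V.side_at_Suc string_module_simps[OF W.string])
    then show ?thesis by (auto simp: string_module_simps[OF W.string])
  qed auto
  then obtain a where a: "\<And>k. k < 2 \<Longrightarrow> a k \<in> carrier N"
    "\<And>k. k < 2 \<Longrightarrow> internal_triangle T (V.side_at k 0) \<Longrightarrow> vertex_part w (curve T (V.side_at k (Suc n))) (a k) = a k"
    "\<And>k. k < 2 \<Longrightarrow> internal_triangle T (V.side_at k 0) \<Longrightarrow> arrow_action w (a k) (V.side_at k (Suc n)) = h (V.gen ?n k)"
    by metis
  define g where "g = lin_comb N (V.rank (Suc n)) (\<lambda>k. if k < 2 then a k else \<zero>\<^bsub>N\<^esub>)"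
  have g: "g \<in> module_hom \<Lambda> (V.Res (Suc n)) N"
    unfolding g_def by (rule V.Res_lin_comb(1)[OF W.right_module_M]) (use a in auto)
  have gg: "g (V.gen (Suc n) k) = V.idem (Suc n) k \<odot>\<^bsub>N\<^esub> a k" if k: "k < 2" for k
    unfolding g_def using V.Res_lin_comb(2)[OF W.right_module_M _ r1[OF k], of "\<lambda>k. if k < 2 then a k else \<zero>\<^bsub>N\<^esub>"] a k by simp
  show thesis
  proof (rule that[OF g])
    show "h x = g (V.diff (Suc n) x)" if "x \<in> carrier (V.Res ?n)" for x
    proof (rule V.Res_hom_eqI[OF W.right_module_M h module_hom_comp[OF V.diff_hom g] _ that])
      fix k assume "k < V.rank ?n"
      then have k: "k < 2" by (simp add: r)
      show "h (V.gen ?n k) = g (V.diff (Suc n) (V.gen ?n k))"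
      proof (cases "internal_triangle T (V.side_at k 0)")
        case True
        have "internal_triangle T (V.side_at k (Suc n))" using internal_funpow[OF True, of "Suc n"] by (simp add: V.side_at_def)
        then have "V.idem (Suc n) k \<odot>\<^bsub>N\<^esub> a k = a k"
          using a(2)[OF k True] V.idem_internal[OF k True, of n] internal_arc by (simp add: string_module_idm[OF W.string])
        then show ?thesis
          using V.diff_Suc_gen[OF k True, of n] a(3)[OF k True] gg[OF k]
            LinearCombinations.module_hom_smult[OF g arr_closed V.gen_carrier[OF r1[OF k]]]
          by (simp add: string_module_arr[OF W.string])
      next
        case False
        then have z: "V.gen ?n k = \<zero>\<^bsub>V.Res ?n\<^esub>" using k by (intro V.gen_0 V.idem_not_internal)
        show ?thesis unfolding z
          using module_hom_zero[OF V.Res_right_module W.right_module_M h]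
            module_hom_zero[OF V.Res_right_module W.right_module_M module_hom_comp[OF V.diff_hom g]] by simp
      qed
    qed
  qed
qed

text \<open>
  The basis vector at an end is killed by the arrow opposite to that end, so each combination of
  these vectors is the value of a cocycle.
\<close>

lemma cocycle_with_values:
  fixes c :: "arc_end \<times> arc_end \<Rightarrow> 'k"
  obtains h where "h \<in> module_hom \<Lambda> (V.Res (Suc (Suc n))) N"
    "\<And>x. x \<in> carrier (V.Res (Suc (Suc (Suc n)))) \<Longrightarrow> h (V.diff (Suc (Suc n)) x) = \<zero>\<^bsub>N\<^esub>"
    "\<And>e f. (e, f) \<in> pairs (Suc (Suc n)) \<Longrightarrow> h (V.gen (Suc (Suc n)) (V.end_index e)) (W.pos f) = c (e, f)"
proof -
  let ?n = "Suc (Suc n)"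
  interpret N: right_module \<Lambda> N by (rule W.right_module_M)
  have r: "V.rank ?n = 2" "V.rank (Suc ?n) = 2" by (simp_all add: V.rank_def)
  define b where "b e f j = (if (e, f) \<in> pairs ?n then c (e, f) * W.bvec (W.pos f) j else 0)" for e f and j :: nat
  define a where "a k j = b (V.end_of k) Start j + b (V.end_of k) Terminal j" for k j
  have aN: "a k \<in> carrier N" for k
    using W.pos_le[of Start] W.pos_le[of Terminal]
    by (auto simp: a_def b_def string_module_simps[OF W.string] W.bvec_def)
  have same: "f = f'" if "(e, f) \<in> pairs ?n" "(e, f') \<in> pairs ?n" "W.pos f = W.pos f'" for e f f'
  proof (rule ccontr)
    assume "f \<noteq> f'"
    then have "W.len = 0" "{f, f'} = {Start, Terminal}" using that(3) by (cases f; cases f'; auto)+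
    then show False using W.end_sides_neq that(1,2) by (auto simp: pairs_def doubleton_eq_iff simp del: end_side.simps)
  qed
  have vals: "a (V.end_index e) (W.pos f) = c (e, f)" if ef: "(e, f) \<in> pairs ?n" for e f
    using ef same[of e Start Terminal] by (cases f) (auto simp: a_def b_def W.bvec_def)
  have kill: "arrow_action w (b (V.end_of k) f) (V.side_at k ?n) = (\<lambda>_. 0)" for k f
  proof (cases "(V.end_of k, f) \<in> pairs ?n")
    case True
    then have "V.side_at k ?n = W.es f" by (simp add: pairs_def V.side_at_def)
    moreover have "b (V.end_of k) f = (\<lambda>j. c (V.end_of k, f) * W.bvec (W.pos f) j)" using True by (auto simp: b_def)
    ultimately show ?thesis using W.arr_end_kills[of f] by (simp add: arrow_action_linear)
  next
    case False
    then have "b (V.end_of k) f = (\<lambda>_. 0)" by (auto simp: b_def)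
    then show ?thesis by (simp add: arrow_action_linear)
  qed
  have supp: "vertex_part w (curve T (V.side_at k ?n)) (a k) = a k" for k
  proof
    fix j
    have "b (V.end_of k) f j = 0 \<or> string_vertex Q w j = curve T (V.side_at k ?n)" for f
      using W.end_side(3)[of f] by (auto simp: b_def W.bvec_def pairs_def V.side_at_def)
    then show "vertex_part w (curve T (V.side_at k ?n)) (a k) j = a k j"
      by (auto simp: vertex_part_def a_def)
  qed
  define h where "h = lin_comb N (V.rank ?n) a"
  have h: "h \<in> module_hom \<Lambda> (V.Res ?n) N" unfolding h_def by (rule V.Res_lin_comb(1)[OF W.right_module_M aN])
  have hg: "h (V.gen ?n k) = a k" if k: "k < 2" and i: "internal_triangle T (V.side_at k 0)" for k
  proof -
    have "internal_triangle T (V.side_at k ?n)" using internal_funpow[OF i, of ?n] by (simp add: V.side_at_def)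
    then show ?thesis
      unfolding h_def using V.Res_lin_comb(2)[OF W.right_module_M aN, of k ?n] k r
        V.idem_internal[OF k i, of "Suc n"] supp[of k] internal_arc
      by (simp add: string_module_idm[OF W.string])
  qed
  show thesis
  proof (rule that[OF h])
    show "h (V.diff ?n x) = \<zero>\<^bsub>N\<^esub>" if "x \<in> carrier (V.Res (Suc ?n))" for x
    proof (rule V.Res_hom_eqI[OF W.right_module_M module_hom_comp[OF V.diff_hom h] _ _ that])
      show "(\<lambda>_. \<zero>\<^bsub>N\<^esub>) \<in> module_hom \<Lambda> (V.Res (Suc ?n)) N" by (rule module_homI) auto
      fix k assume "k < V.rank (Suc ?n)"
      then have k: "k < 2" by (simp add: r)
      have gk: "V.gen ?n k \<in> carrier (V.Res ?n)" using k r by (intro V.gen_carrier) simp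
      show "h (V.diff ?n (V.gen (Suc ?n) k)) = \<zero>\<^bsub>N\<^esub>"
      proof (cases "internal_triangle T (V.side_at k 0)")
        case True
        have "h (V.diff ?n (V.gen (Suc ?n) k)) = arrow_action w (a k) (V.side_at k ?n)"
          using V.diff_Suc_gen[OF k True, of "Suc n"] hg[OF k True]
            LinearCombinations.module_hom_smult[OF h arr_closed gk]
          by (simp add: string_module_arr[OF W.string])
        also have "\<dots> = (\<lambda>_. 0)"
          unfolding a_def by (simp add: arrow_action_linear kill)
        finally show ?thesis by (simp add: string_module_simps[OF W.string])
      next
        case False
        then have z: "V.gen (Suc ?n) k = \<zero>\<^bsub>V.Res (Suc ?n)\<^esub>" using k by (intro V.gen_0 V.idem_not_internal)
        show ?thesis unfolding z
          using module_hom_zero[OF V.Res_right_module W.right_module_M module_hom_comp[OF V.diff_hom h]] by simp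
      qed
    qed
    show "h (V.gen ?n (V.end_index e)) (W.pos f) = c (e, f)" if ef: "(e, f) \<in> pairs ?n" for e f
      using hg[OF V.end_index(2) pair_internal[OF ef]] vals[OF ef] by simp
  qed
qed

end

section \<open>Ext groups of string modules\<close>

text \<open>
  An arbitrary resolution \<open>P\<close> of \<open>M(v)\<close>, with chain maps over the identity of \<open>M(v)\<close> from and to the
  explicit one.
\<close>

locale string_ext = two_arc_strings T field_type v w \<gamma>v \<gamma>w
  for T :: "('s, 'a) triangulation" and field_type :: "'k::field itself"
    and v w :: "('a, 's) str" and \<gamma>v \<gamma>w :: "'s list" +
  fixes P :: "nat \<Rightarrow> ((('a, 's) path \<Rightarrow> 'k) set, 'p) module" and d :: "nat \<Rightarrow> 'p \<Rightarrow> 'p" and \<epsilon> :: "'p \<Rightarrow> nat \<Rightarrow> 'k"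
    and \<Psi> :: "nat \<Rightarrow> (nat \<Rightarrow> (('a, 's) path \<Rightarrow> 'k) set) \<Rightarrow> 'p" and \<Phi> :: "nat \<Rightarrow> 'p \<Rightarrow> nat \<Rightarrow> (('a, 's) path \<Rightarrow> 'k) set"
  assumes P: "projective_resolution \<Lambda> (SM v) P d \<epsilon>"
    and \<Psi>: "\<And>n. \<Psi> n \<in> module_hom \<Lambda> (V.Res n) (P n)" "\<And>x. x \<in> carrier (V.Res 0) \<Longrightarrow> \<epsilon> (\<Psi> 0 x) = V.aug x"
      "\<And>n x. x \<in> carrier (V.Res (Suc n)) \<Longrightarrow> d n (\<Psi> (Suc n) x) = \<Psi> n (V.diff n x)"
    and \<Phi>: "\<And>n. \<Phi> n \<in> module_hom \<Lambda> (P n) (V.Res n)" "\<And>x. x \<in> carrier (P 0) \<Longrightarrow> V.aug (\<Phi> 0 x) = \<epsilon> x"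
      "\<And>n x. x \<in> carrier (P (Suc n)) \<Longrightarrow> V.diff n (\<Phi> (Suc n) x) = \<Phi> n (d n x)"
begin

lemmas PD = projective_resolutionD[OF P]

lemma N_module: "right_module \<Lambda> N" by (rule W.right_module_M)

text \<open>
  The generator of the resolution belonging to an end is carried to the given resolution, and a
  cochain is evaluated there; the coefficient at an end of the other string is read off.
\<close>

definition end_elt :: "nat \<Rightarrow> arc_end \<Rightarrow> 'p" where
  "end_elt n e = \<Psi> n (V.gen n (V.end_index e))"

definition end_value :: "nat \<Rightarrow> ('p \<Rightarrow> nat \<Rightarrow> 'k) \<Rightarrow> arc_end \<times> arc_end \<Rightarrow> 'k" where
  "end_value n h = (\<lambda>(e, f). if (e, f) \<in> pairs n then h (end_elt n e) (W.pos f) else 0)"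

lemma end_elt_carrier: "end_elt (Suc n) e \<in> carrier (P (Suc n))"
  unfolding end_elt_def by (rule module_hom_carrier[OF \<Psi>(1) V.gen_carrier])
    (auto simp: V.rank_def intro: less_le_trans[OF V.end_index(2)])

definition is_cocycle :: "nat \<Rightarrow> ('p \<Rightarrow> nat \<Rightarrow> 'k) \<Rightarrow> bool" where
  "is_cocycle n h \<longleftrightarrow> h \<in> module_hom \<Lambda> (P n) N \<and> (\<forall>x\<in>carrier (P (Suc n)). h (d n x) = \<zero>\<^bsub>N\<^esub>)"

lemma end_value_coboundary:
  assumes g: "g \<in> module_hom \<Lambda> (P (Suc n)) N"
    and hg: "\<And>x. x \<in> carrier (P (Suc (Suc n))) \<Longrightarrow> h x = g (d (Suc n) x)"
  shows "end_value (Suc (Suc n)) h = (\<lambda>_. 0)"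
proof -
  have "h (end_elt (Suc (Suc n)) e) (W.pos f) = 0" if ef: "(e, f) \<in> pairs (Suc (Suc n))" for e f
  proof -
    have gk: "V.gen (Suc (Suc n)) (V.end_index e) \<in> carrier (V.Res (Suc (Suc n)))"
      by (rule V.gen_carrier) (simp add: V.rank_def)
    have "h (end_elt (Suc (Suc n)) e) = g (\<Psi> (Suc n) (V.diff (Suc n) (V.gen (Suc (Suc n)) (V.end_index e))))"
      using hg[OF end_elt_carrier] \<Psi>(3)[OF gk] by (simp add: end_elt_def)
    then show ?thesis
      using coboundary_at_end[OF module_hom_comp[OF \<Psi>(1) g] ef] by simp
  qed
  then show ?thesis by (auto simp: end_value_def fun_eq_iff)
qed

text \<open>
  The cocycle becomes a coboundary on the explicit resolution, and pulling it back to \<open>P\<close> recovers it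
  up to a coboundary.
\<close>

lemma coboundary_if_end_value_0:
  assumes h: "is_cocycle (Suc (Suc n)) h" and 0: "end_value (Suc (Suc n)) h = (\<lambda>_. 0)"
  obtains g where "g \<in> module_hom \<Lambda> (P (Suc n)) N"
    "\<And>x. x \<in> carrier (P (Suc (Suc n))) \<Longrightarrow> h x = g (d (Suc n) x)"
proof -
  let ?n = "Suc (Suc n)"
  have hom: "h \<in> module_hom \<Lambda> (P ?n) N" and c: "\<And>x. x \<in> carrier (P (Suc ?n)) \<Longrightarrow> h (d ?n x) = \<zero>\<^bsub>N\<^esub>"
    using h by (auto simp: is_cocycle_def)
  interpret N: right_module \<Lambda> N by (rule N_module)
  obtain g where g: "g \<in> module_hom \<Lambda> (V.Res (Suc n)) N"
    "\<And>x. x \<in> carrier (V.Res ?n) \<Longrightarrow> h (\<Psi> ?n x) = g (V.diff (Suc n) x)"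
  proof (rule cocycle_eq_coboundary[OF module_hom_comp[OF \<Psi>(1) hom]])
    show "h (\<Psi> ?n (V.diff ?n x)) = \<zero>\<^bsub>N\<^esub>" if x: "x \<in> carrier (V.Res (Suc ?n))" for x
      using c[OF module_hom_carrier[OF \<Psi>(1) x]] \<Psi>(3)[OF x] by simp
    show "h (\<Psi> ?n (V.gen ?n (V.end_index e))) (W.pos f) = 0" if "(e, f) \<in> pairs ?n" for e f
      using fun_cong[OF 0, of "(e, f)"] that by (simp add: end_value_def end_elt_def)
  qed (use that in blast)
  have "\<Psi> m (\<Phi> m x) \<in> carrier (P m)" if "x \<in> carrier (P m)" for m x
    by (rule module_hom_carrier[OF \<Psi>(1) module_hom_carrier[OF \<Phi>(1) that]])
  obtain k where k: "k \<in> module_hom \<Lambda> (P (Suc n)) N"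
    "\<And>x. x \<in> carrier (P ?n) \<Longrightarrow> h x = h (\<Psi> ?n (\<Phi> ?n x)) \<oplus>\<^bsub>N\<^esub> k (d (Suc n) x)"
  proof (rule cocycle_chain_map_id[OF P V.right_module_M _ _ _ N_module hom c, of "\<lambda>m x. \<Psi> m (\<Phi> m x)"])
    show "(\<lambda>x. \<Psi> m (\<Phi> m x)) \<in> module_hom \<Lambda> (P m) (P m)" for m by (rule module_hom_comp[OF \<Phi>(1) \<Psi>(1)])
    show "\<epsilon> (\<Psi> 0 (\<Phi> 0 x)) = \<epsilon> x" if "x \<in> carrier (P 0)" for x
      using \<Psi>(2)[OF module_hom_carrier[OF \<Phi>(1) that]] \<Phi>(2)[OF that] by simp
    show "d m (\<Psi> (Suc m) (\<Phi> (Suc m) x)) = \<Psi> m (\<Phi> m (d m x))" if "x \<in> carrier (P (Suc m))" for m x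
      using \<Psi>(3)[OF module_hom_carrier[OF \<Phi>(1) that]] \<Phi>(3)[OF that] by simp
  qed (use that in auto)
  show thesis
  proof (rule that)
    show "(\<lambda>y. g (\<Phi> (Suc n) y) \<oplus>\<^bsub>N\<^esub> k y) \<in> module_hom \<Lambda> (P (Suc n)) N"
      by (rule module_hom_plus[OF PD(2) N_module module_hom_comp[OF \<Phi>(1) g(1)] k(1)])
    show "h x = g (\<Phi> (Suc n) (d (Suc n) x)) \<oplus>\<^bsub>N\<^esub> k (d (Suc n) x)" if x: "x \<in> carrier (P ?n)" for x
      using k(2)[OF x] g(2)[OF module_hom_carrier[OF \<Phi>(1) x]] \<Phi>(3)[OF x] by simp
  qed
qed

lemma end_value_surj:
  assumes c: "\<And>p. p \<notin> pairs (Suc (Suc n)) \<Longrightarrow> c p = 0"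
  obtains h where "is_cocycle (Suc (Suc n)) h" "end_value (Suc (Suc n)) h = c"
proof -
  let ?n = "Suc (Suc n)"
  obtain h where h: "h \<in> module_hom \<Lambda> (V.Res ?n) N"
    "\<And>x. x \<in> carrier (V.Res (Suc ?n)) \<Longrightarrow> h (V.diff ?n x) = \<zero>\<^bsub>N\<^esub>"
    "\<And>e f. (e, f) \<in> pairs ?n \<Longrightarrow> h (V.gen ?n (V.end_index e)) (W.pos f) = c (e, f)"
    using cocycle_with_values[of n c] by metis
  interpret N: right_module \<Lambda> N by (rule N_module)
  obtain g where g: "g \<in> module_hom \<Lambda> (V.Res (Suc n)) N"
    "\<And>x. x \<in> carrier (V.Res ?n) \<Longrightarrow> h x = h (\<Phi> ?n (\<Psi> ?n x)) \<oplus>\<^bsub>N\<^esub> g (V.diff (Suc n) x)"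
  proof (rule cocycle_chain_map_id[OF V.Res_resolution V.right_module_M, where \<Phi> = "\<lambda>m x. \<Phi> m (\<Psi> m x)" and N = N and f = h and n = "Suc n"])
    show "(\<lambda>x. \<Phi> m (\<Psi> m x)) \<in> module_hom \<Lambda> (V.Res m) (V.Res m)" for m by (rule module_hom_comp[OF \<Psi>(1) \<Phi>(1)])
    show "V.aug (\<Phi> 0 (\<Psi> 0 x)) = V.aug x" if "x \<in> carrier (V.Res 0)" for x
      using \<Phi>(2)[OF module_hom_carrier[OF \<Psi>(1) that]] \<Psi>(2)[OF that] by simp
    show "V.diff m (\<Phi> (Suc m) (\<Psi> (Suc m) x)) = \<Phi> m (\<Psi> m (V.diff m x))" if "x \<in> carrier (V.Res (Suc m))" for m x
      using \<Phi>(3)[OF module_hom_carrier[OF \<Psi>(1) that]] \<Psi>(3)[OF that] by simp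
  qed (use N_module h that in blast)+
  show thesis
  proof (rule that)
    show "is_cocycle ?n (\<lambda>x. h (\<Phi> ?n x))"
      unfolding is_cocycle_def
      using module_hom_comp[OF \<Phi>(1) h(1)] \<Phi>(3) h(2) module_hom_carrier[OF \<Phi>(1)] by metis
    have "h (\<Phi> ?n (end_elt ?n e)) (W.pos f) = c (e, f)" if ef: "(e, f) \<in> pairs ?n" for e f
    proof -
      have gk: "V.gen ?n (V.end_index e) \<in> carrier (V.Res ?n)" by (rule V.gen_carrier) (simp add: V.rank_def)
      show ?thesis
        using fun_cong[OF g(2)[OF gk], of "W.pos f"] h(3)[OF ef] coboundary_at_end[OF g(1) ef]
        by (simp add: end_elt_def string_module_simps[OF W.string])
    qed
    then show "end_value ?n (\<lambda>x. h (\<Phi> ?n x)) = c" using c by (auto simp: end_value_def fun_eq_iff)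
  qed
qed

subsection \<open>Ext as a quotient computed by evaluation\<close>

definition Coc :: "nat \<Rightarrow> ('k, 'p \<Rightarrow> nat \<Rightarrow> 'k) module" where
  "Coc n = (hom_space \<Lambda> scal (P n) N)\<lparr>carrier := cocycles \<Lambda> scal P d N n\<rparr>"

lemma Coc_simps:
  "carrier (Coc n) = {h. is_cocycle n h \<and> h \<in> extensional (carrier (P n))}"
  "\<zero>\<^bsub>Coc n\<^esub> = (\<lambda>x\<in>carrier (P n). (\<lambda>j. 0))"
  "g \<oplus>\<^bsub>Coc n\<^esub> h = (\<lambda>x\<in>carrier (P n). (\<lambda>j. g x j + h x j))"
  "is_cocycle n h \<Longrightarrow> c \<odot>\<^bsub>Coc n\<^esub> h = (\<lambda>x\<in>carrier (P n). (\<lambda>j. c * h x j))"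
proof -
  show "carrier (Coc n) = {h. is_cocycle n h \<and> h \<in> extensional (carrier (P n))}"
    by (auto simp: Coc_def cocycles_def hom_space_def is_cocycle_def)
  show "is_cocycle n h \<Longrightarrow> c \<odot>\<^bsub>Coc n\<^esub> h = (\<lambda>x\<in>carrier (P n). (\<lambda>j. c * h x j))"
    by (auto simp: Coc_def hom_space_def is_cocycle_def restrict_def fun_eq_iff module_hom_carrier
        string_module_scal[OF W.string])
qed (simp_all add: Coc_def hom_space_def string_module_simps[OF W.string])

lemma N_scale:
  assumes m: "m \<in> carrier N" and X: "X \<in> carrier \<Lambda>"
  shows "(\<lambda>j. c * m j) \<in> carrier N" "X \<odot>\<^bsub>N\<^esub> (\<lambda>j. c * m j) = (\<lambda>j. c * (X \<odot>\<^bsub>N\<^esub> m) j)"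
proof -
  interpret N: right_module \<Lambda> N by (rule N_module)
  have s: "(\<lambda>j. c * m j) = scal c \<odot>\<^bsub>N\<^esub> m" using m by (simp add: string_module_scal[OF W.string])
  show "(\<lambda>j. c * m j) \<in> carrier N" unfolding s by (rule N.smult_closed[OF scal_closed m])
  have "X \<odot>\<^bsub>N\<^esub> (scal c \<odot>\<^bsub>N\<^esub> m) = scal c \<odot>\<^bsub>N\<^esub> (X \<odot>\<^bsub>N\<^esub> m)"
    using N.smult_assoc[OF scal_closed X m, of c] N.smult_assoc[OF X scal_closed m, of c] scal_commute[OF X, of c] by simp
  then show "X \<odot>\<^bsub>N\<^esub> (\<lambda>j. c * m j) = (\<lambda>j. c * (X \<odot>\<^bsub>N\<^esub> m) j)"
    using N.smult_closed[OF X m] s by (simp add: string_module_scal[OF W.string])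
qed

lemma is_cocycle_restrict: "is_cocycle n h \<Longrightarrow> is_cocycle n (restrict h (carrier (P n)))"
  using module_hom_cong[OF _ PD(2), of n h "restrict h (carrier (P n))" N] module_hom_carrier[OF PD(3)]
  by (simp add: is_cocycle_def)

lemma is_cocycle_linear:
  assumes g: "is_cocycle n g" and h: "is_cocycle n h"
  shows "is_cocycle n (\<lambda>x j. g x j + h x j)" "is_cocycle n (\<lambda>x j. c * h x j)"
proof -
  interpret N: right_module \<Lambda> N by (rule N_module)
  have gh: "g \<in> module_hom \<Lambda> (P n) N" "h \<in> module_hom \<Lambda> (P n) N" using g h by (auto simp: is_cocycle_def)
  show "is_cocycle n (\<lambda>x j. g x j + h x j)"
    using module_hom_plus[OF PD(2) N_module gh] g h by (auto simp: is_cocycle_def string_module_simps[OF W.string])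
  have "(\<lambda>x j. c * h x j) \<in> module_hom \<Lambda> (P n) N"
  proof (rule module_homI)
    fix x assume x: "x \<in> carrier (P n)"
    show "(\<lambda>j. c * h x j) \<in> carrier N" by (rule N_scale[OF module_hom_carrier[OF gh(2) x] scal_closed])
    {
      fix y assume y: "y \<in> carrier (P n)"
      show "(\<lambda>j. c * h (x \<oplus>\<^bsub>P n\<^esub> y) j) = (\<lambda>j. c * h x j) \<oplus>\<^bsub>N\<^esub> (\<lambda>j. c * h y j)"
        using LinearCombinations.module_hom_add[OF gh(2) x y] by (simp add: string_module_simps[OF W.string] distrib_left)
    }
    fix a assume a: "a \<in> carrier \<Lambda>"
    show "(\<lambda>j. c * h (a \<odot>\<^bsub>P n\<^esub> x) j) = a \<odot>\<^bsub>N\<^esub> (\<lambda>j. c * h x j)"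
      using LinearCombinations.module_hom_smult[OF gh(2) a x] N_scale(2)[OF module_hom_carrier[OF gh(2) x] a] by simp
  qed
  then show "is_cocycle n (\<lambda>x j. c * h x j)" using h by (auto simp: is_cocycle_def string_module_simps[OF W.string])
qed

lemma is_cocycle_zero: "is_cocycle n (\<lambda>x j. 0)"
proof -
  interpret N: right_module \<Lambda> N by (rule N_module)
  have "(\<lambda>x. \<zero>\<^bsub>N\<^esub>) \<in> module_hom \<Lambda> (P n) N" by (rule module_homI) auto
  then show ?thesis by (simp add: is_cocycle_def string_module_simps[OF W.string])
qed

lemma vectorspace_Coc: "vectorspace (class_ring :: 'k ring) (Coc n)"
proof (intro vectorspace.intro moduleI)
  show "cring (class_ring :: 'k ring)" by (rule class_cring.is_cring)
  show "field (class_ring :: 'k ring)" by (rule class_field)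
  have ext: "x \<notin> carrier (P n) \<Longrightarrow> h \<in> carrier (Coc n) \<Longrightarrow> h x = undefined" for x h
    by (simp add: Coc_simps(1) extensional_def)
  have coc: "h \<in> carrier (Coc n) \<Longrightarrow> is_cocycle n h" for h by (simp add: Coc_simps(1))
  have add: "g \<oplus>\<^bsub>Coc n\<^esub> h \<in> carrier (Coc n)" if "g \<in> carrier (Coc n)" "h \<in> carrier (Coc n)" for g h
    using is_cocycle_restrict[OF is_cocycle_linear(1)[OF coc[OF that(1)] coc[OF that(2)]]]
    by (simp add: Coc_simps(1,3))
  have smult: "c \<odot>\<^bsub>Coc n\<^esub> h \<in> carrier (Coc n)" if "h \<in> carrier (Coc n)" for c h
    using is_cocycle_restrict[OF is_cocycle_linear(2)[OF coc[OF that] coc[OF that]]] coc[OF that]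
    by (simp add: Coc_simps(1,4))
  show "abelian_group (Coc n)"
  proof (rule abelian_groupI)
    show "\<zero>\<^bsub>Coc n\<^esub> \<in> carrier (Coc n)"
      using is_cocycle_restrict[OF is_cocycle_zero] by (simp add: Coc_simps(1,2))
    fix h assume h: "h \<in> carrier (Coc n)"
    show "\<zero>\<^bsub>Coc n\<^esub> \<oplus>\<^bsub>Coc n\<^esub> h = h"
      using ext[OF _ h] by (auto simp: Coc_simps(2,3) restrict_def fun_eq_iff)
    have "((-1) \<odot>\<^bsub>Coc n\<^esub> h) \<oplus>\<^bsub>Coc n\<^esub> h = \<zero>\<^bsub>Coc n\<^esub>"
      using coc[OF h] by (simp add: Coc_simps(2,3,4) restrict_def fun_eq_iff)
    then show "\<exists>g\<in>carrier (Coc n). g \<oplus>\<^bsub>Coc n\<^esub> h = \<zero>\<^bsub>Coc n\<^esub>" using smult[OF h] by blast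
  qed (use add in \<open>auto simp: Coc_simps(3) restrict_def fun_eq_iff add_ac\<close>)
  fix h :: "'p \<Rightarrow> nat \<Rightarrow> 'k" assume h: "h \<in> carrier (Coc n)"
  show "\<one>\<^bsub>(class_ring :: 'k ring)\<^esub> \<odot>\<^bsub>Coc n\<^esub> h = h"
    using ext[OF _ h] by (auto simp: Coc_simps(4)[OF coc[OF h]] restrict_def fun_eq_iff)
  fix a :: 'k
  show "a \<odot>\<^bsub>Coc n\<^esub> h \<in> carrier (Coc n)" by (rule smult[OF h])
  fix b :: 'k
  show "(a \<oplus>\<^bsub>class_ring\<^esub> b) \<odot>\<^bsub>Coc n\<^esub> h = a \<odot>\<^bsub>Coc n\<^esub> h \<oplus>\<^bsub>Coc n\<^esub> b \<odot>\<^bsub>Coc n\<^esub> h"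
    by (auto simp: Coc_simps(3) Coc_simps(4)[OF coc[OF h]] restrict_def fun_eq_iff distrib_right)
  show "(a \<otimes>\<^bsub>class_ring\<^esub> b) \<odot>\<^bsub>Coc n\<^esub> h = a \<odot>\<^bsub>Coc n\<^esub> (b \<odot>\<^bsub>Coc n\<^esub> h)"
    using Coc_simps(4)[OF coc[OF smult[OF h]], of a b]
    by (auto simp: Coc_simps(4)[OF coc[OF h]] restrict_def fun_eq_iff mult.assoc)
next
  fix a :: 'k and g h assume gh: "g \<in> carrier (Coc n)" "h \<in> carrier (Coc n)"
  then have c: "is_cocycle n g" "is_cocycle n h" by (auto simp: Coc_simps(1))
  have "is_cocycle n (g \<oplus>\<^bsub>Coc n\<^esub> h)"
    using is_cocycle_restrict[OF is_cocycle_linear(1)[OF c]] by (simp add: Coc_simps(3))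
  from Coc_simps(4)[OF this, of a] show "a \<odot>\<^bsub>Coc n\<^esub> (g \<oplus>\<^bsub>Coc n\<^esub> h) = a \<odot>\<^bsub>Coc n\<^esub> g \<oplus>\<^bsub>Coc n\<^esub> a \<odot>\<^bsub>Coc n\<^esub> h"
    by (auto simp: Coc_simps(3) Coc_simps(4)[OF c(1)] Coc_simps(4)[OF c(2)] restrict_def fun_eq_iff distrib_left)
qed

lemma end_value_cong: "(\<And>x. x \<in> carrier (P (Suc n)) \<Longrightarrow> g x = h x) \<Longrightarrow> end_value (Suc n) g = end_value (Suc n) h"
  using end_elt_carrier by (auto simp: end_value_def fun_eq_iff)

lemma evaluation_Coc: "evaluation (Coc (Suc (Suc n))) (end_value (Suc (Suc n))) (pairs (Suc (Suc n)))"
proof (intro evaluation.intro evaluation_axioms.intro vectorspace_Coc finite_pairs)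
  let ?n = "Suc (Suc n)"
  fix g h assume g: "g \<in> carrier (Coc ?n)" and h: "h \<in> carrier (Coc ?n)"
  show "end_value ?n (g \<oplus>\<^bsub>Coc ?n\<^esub> h) i = end_value ?n g i + end_value ?n h i" for i
    using end_elt_carrier[of "Suc n"] by (auto simp: end_value_def Coc_simps(3) split: prod.splits)
next
  let ?n = "Suc (Suc n)"
  fix h and c :: 'k and i assume "h \<in> carrier (Coc ?n)"
  then have "is_cocycle ?n h" by (simp add: Coc_simps(1))
  from Coc_simps(4)[OF this, of c] show "end_value ?n (c \<odot>\<^bsub>Coc ?n\<^esub> h) i = c * end_value ?n h i"
    using end_elt_carrier[of "Suc n"] by (auto simp: end_value_def split: prod.splits)
next
  let ?n = "Suc (Suc n)"
  fix t :: "arc_end \<times> arc_end \<Rightarrow> 'k" assume "\<And>i. i \<notin> pairs ?n \<Longrightarrow> t i = 0"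
  then obtain h where h: "is_cocycle ?n h" "end_value ?n h = t" using end_value_surj[of n t] by metis
  have "end_value ?n (restrict h (carrier (P ?n))) = end_value ?n h" by (rule end_value_cong) simp
  then show "\<exists>x\<in>carrier (Coc ?n). end_value ?n x = t"
    using h is_cocycle_restrict[OF h(1)] by (intro bexI[of _ "restrict h (carrier (P ?n))"]) (auto simp: Coc_simps(1))
qed (auto simp: end_value_def split: prod.splits)

lemma coboundaries_eq: "coboundaries \<Lambda> scal P d N (Suc (Suc n)) = evaluation.B (Coc (Suc (Suc n))) (end_value (Suc (Suc n)))"
proof -
  let ?n = "Suc (Suc n)"
  interpret E: evaluation "Coc ?n" "end_value ?n" "pairs ?n" by (rule evaluation_Coc)
  have cob: "coboundaries \<Lambda> scal P d N ?n = {\<lambda>x\<in>carrier (P ?n). g (d (Suc n) x) | g.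
      g \<in> module_hom \<Lambda> (P (Suc n)) N \<inter> extensional (carrier (P (Suc n)))}"
    by (simp add: coboundaries_def hom_space_def)
  show ?thesis
  proof (intro equalityI subsetI)
    fix h assume "h \<in> coboundaries \<Lambda> scal P d N ?n"
    then obtain g where g: "g \<in> module_hom \<Lambda> (P (Suc n)) N" "h = (\<lambda>x\<in>carrier (P ?n). g (d (Suc n) x))"
      unfolding cob by blast
    have "is_cocycle ?n (\<lambda>x. g (d (Suc n) x))"
      unfolding is_cocycle_def using module_hom_comp[OF PD(3) g(1)] PD(9) module_hom_zero[OF PD(2) N_module g(1)] by simp
    then have "is_cocycle ?n h" unfolding g(2) by (rule is_cocycle_restrict)
    moreover have "end_value ?n h = (\<lambda>_. 0)" by (rule end_value_coboundary[OF g(1)]) (simp add: g(2))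
    ultimately show "h \<in> E.B" by (simp add: E.B_def Coc_simps(1) g(2))
  next
    fix h assume h: "h \<in> E.B"
    then have "is_cocycle ?n h" "end_value ?n h = (\<lambda>_. 0)" "h \<in> extensional (carrier (P ?n))"
      by (auto simp: E.B_def Coc_simps(1) fun_eq_iff)
    then obtain g where g: "g \<in> module_hom \<Lambda> (P (Suc n)) N" "\<And>x. x \<in> carrier (P ?n) \<Longrightarrow> h x = g (d (Suc n) x)"
      using coboundary_if_end_value_0[of n h] by metis
    let ?g = "restrict g (carrier (P (Suc n)))"
    have "?g \<in> module_hom \<Lambda> (P (Suc n)) N"
      by (rule module_hom_cong[OF _ PD(2) g(1)]) simp
    moreover have "h = (\<lambda>x\<in>carrier (P ?n). ?g (d (Suc n) x))"
      using g(2) \<open>h \<in> extensional _\<close> module_hom_carrier[OF PD(3)] by (auto simp: extensional_def restrict_def fun_eq_iff)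
    ultimately show "h \<in> coboundaries \<Lambda> scal P d N ?n" unfolding cob by blast
  qed
qed

lemma Ext_T_eq: "Ext_T T P d w (Suc (Suc n)) =
    quotient_space (Coc (Suc (Suc n))) (evaluation.B (Coc (Suc (Suc n))) (end_value (Suc (Suc n))))"
  unfolding Ext_T_def Let_def Ext_def coboundaries_eq Coc_def ..

end

section \<open>The classes of the arrow extensions\<close>

context triangulated_surface
begin

text \<open>
  For the algebra itself this is \<open>arr_right_annihilator\<close>; the property passes to free modules and
  to their direct summands.
\<close>

lemma projective_annihilator:
  assumes C: "fg_projective \<Lambda> C" and x: "internal_triangle T x" and u: "u \<in> carrier C"
    and e: "idm (curve T (nxt x)) \<odot>\<^bsub>C\<^esub> u = u" and 0: "arr (nxt x) \<odot>\<^bsub>C\<^esub> u = \<zero>\<^bsub>C\<^esub>"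
  shows "\<exists>c\<in>carrier C. idm (curve T x) \<odot>\<^bsub>C\<^esub> c = c \<and> u = arr x \<odot>\<^bsub>C\<^esub> c"
proof -
  obtain n i r where i: "i \<in> module_hom \<Lambda> C (free_module \<Lambda> n)" and r: "r \<in> module_hom \<Lambda> (free_module \<Lambda> n) C"
    and ri: "\<And>x. x \<in> carrier C \<Longrightarrow> r (i x) = x" and C': "right_module \<Lambda> C"
    using C unfolding fg_projective_def by blast
  interpret C: right_module \<Lambda> C by fact
  have F: "right_module \<Lambda> (free_module \<Lambda> n)" by (rule right_module_free_module[OF \<Lambda>.ring_axioms])
  let ?y = "i u"
  have y: "?y \<in> carrier (free_module \<Lambda> n)" by (rule module_hom_carrier[OF i u])
  then have yR: "?y j \<in> carrier \<Lambda>" for j by (cases "j < n") (auto simp: free_module_simps)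
  have 1: "(\<lambda>j. ?y j \<otimes>\<^bsub>\<Lambda>\<^esub> idm (curve T (nxt x))) = ?y"
    using LinearCombinations.module_hom_smult[OF i idm_closed u, of "curve T (nxt x)"] e by (simp add: free_module_simps)
  have 2: "(\<lambda>j. ?y j \<otimes>\<^bsub>\<Lambda>\<^esub> arr (nxt x)) = (\<lambda>_. \<zero>\<^bsub>\<Lambda>\<^esub>)"
    using LinearCombinations.module_hom_smult[OF i arr_closed u, of "nxt x"] 0 module_hom_zero[OF C' F i]
    by (simp add: free_module_simps)
  have "\<exists>c\<in>carrier \<Lambda>. ?y j = c \<otimes>\<^bsub>\<Lambda>\<^esub> arr x" for j
    by (rule arr_right_annihilator[OF x yR fun_cong[OF 1] fun_cong[OF 2]])
  then obtain c where c: "\<And>j. c j \<in> carrier \<Lambda>" "\<And>j. ?y j = c j \<otimes>\<^bsub>\<Lambda>\<^esub> arr x" by metis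
  let ?c = "\<lambda>j. if j < n then c j else \<zero>\<^bsub>\<Lambda>\<^esub>"
  have c': "?c \<in> carrier (free_module \<Lambda> n)" using c by (simp add: free_module_simps)
  have "?y = arr x \<odot>\<^bsub>free_module \<Lambda> n\<^esub> ?c"
    using y c by (auto simp: free_module_simps fun_eq_iff)
  then have u': "u = arr x \<odot>\<^bsub>C\<^esub> r ?c"
    using ri[OF u] LinearCombinations.module_hom_smult[OF r arr_closed c', of x] by simp
  have rc: "r ?c \<in> carrier C" by (rule module_hom_carrier[OF r c'])
  have "idm (curve T x) \<odot>\<^bsub>C\<^esub> (idm (curve T x) \<odot>\<^bsub>C\<^esub> r ?c) = idm (curve T x) \<odot>\<^bsub>C\<^esub> r ?c"
    using C.smult_assoc[OF idm_closed idm_closed rc, of "curve T x" "curve T x"] by (simp add: idm_idem)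
  moreover have "arr x \<odot>\<^bsub>C\<^esub> (idm (curve T x) \<odot>\<^bsub>C\<^esub> r ?c) = u"
    using C.smult_assoc[OF idm_closed arr_closed rc, of "curve T x" x] u' by (simp add: idm_arr)
  ultimately show ?thesis
    by (intro bexI[of _ "idm (curve T x) \<odot>\<^bsub>C\<^esub> r ?c"] conjI C.smult_closed[OF idm_closed rc]) simp_all
qed

lemma R_string_arrows:
  assumes x: "x \<in> arcs Q"
  shows "{e \<in> arcs Q. tail Q e = head Q x \<and> path_elt (tail Q x, [x, e]) \<notin> I} =
    {e \<in> arcs Q. curve T e = curve T (nxt x) \<and> e \<noteq> nxt x}" (is "?E = ?E'")
proof -
  have mem: "e \<in> ?E \<longleftrightarrow> e \<in> ?E'" for e
  proof (cases "e \<in> arcs Q \<and> head Q x = tail Q e")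
    case True
    then have "path_elt (tail Q x, [x, e]) \<in> I \<longleftrightarrow> e = nxt x" by (intro path_elt_in_ideal[OF x]) simp_all
    with True show ?thesis by (auto simp del: quiver_simps(4))
  next
    case False
    then show ?thesis by (auto simp del: quiver_simps(4))
  qed
  show ?thesis by (rule Set.set_eqI) (rule mem)
qed

lemma R_string:
  assumes p: "is_R_string Q I x p" and x: "x \<in> arcs Q"
  obtains xs where "p = (curve T (nxt x), map Dir xs)" "is_string Q I p" "xs = [] \<or> hd xs \<noteq> nxt x"
    "\<And>y. xs \<noteq> [] \<Longrightarrow> \<not> is_string Q I (curve T (nxt x), map Dir (xs @ [y]))"
    "\<And>y. xs = [] \<Longrightarrow> y \<in> arcs Q \<Longrightarrow> curve T y = curve T (nxt x) \<Longrightarrow> y = nxt x"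
proof -
  let ?E = "{e \<in> arcs Q. tail Q e = head Q x \<and> path_elt (tail Q x, [x, e]) \<notin> I}"
  have E: "e \<in> ?E \<longleftrightarrow> e \<in> arcs Q \<and> curve T e = curve T (nxt x) \<and> e \<noteq> nxt x" for e
    unfolding R_string_arrows[OF x] by simp
  show thesis
  proof (cases "?E = {}")
    case True
    then have "p = (curve T (nxt x), [])" using p by (simp add: is_R_string_def Let_def)
    moreover have "is_string Q I (curve T (nxt x), [])" using x by (simp add: is_string_def)
    moreover have "y = nxt x" if "y \<in> arcs Q" "curve T y = curve T (nxt x)" for y
      using E[of y] that True by blast
    ultimately show thesis by (intro that[of "[]"]) simp_all
  next
    case False
    have "\<exists>e xs. e \<in> ?E \<and> p = (head Q x, map Dir (e # xs)) \<and> is_string Q I p \<and>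
        (\<forall>y. \<not> is_string Q I (head Q x, map Dir ((e # xs) @ [y])))"
      using p unfolding is_R_string_def Let_def if_not_P[OF False] .
    then obtain e xs where e: "e \<in> ?E" "p = (head Q x, map Dir (e # xs))" "is_string Q I p"
      "\<And>y. \<not> is_string Q I (head Q x, map Dir ((e # xs) @ [y]))"
      by blast
    have hx: "head Q x = curve T (nxt x)" by simp
    show thesis
    proof (rule that[of "e # xs"])
      show "e # xs = [] \<or> hd (e # xs) \<noteq> nxt x" using e(1) E[of e] by (metis list.sel(1))
    qed (use e(2-4) in \<open>simp_all only: hx list.simps\<close>)
  qed
qed

lemma direct_string_action:
  "arrow_action (u, map Dir xs) f x 0 = 0"
  "xs = [] \<or> hd xs \<noteq> x \<Longrightarrow> arrow_action (u, map Dir xs) (\<lambda>j. if j = 0 then 1 else 0) x = (\<lambda>_. 0)"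
  "arrow_action (u, map Dir xs) f x (Suc j) = (if j < length xs \<and> xs ! j = x then f j else 0)"
proof -
  show 1: "arrow_action (u, map Dir xs) f x 0 = 0" by (auto simp: arrow_action_def)
  show 3: "arrow_action (u, map Dir xs) f x (Suc j) = (if j < length xs \<and> xs ! j = x then f j else 0)" for f :: "nat \<Rightarrow> 'b" and j
    by (auto simp: arrow_action_def)
  show "xs = [] \<or> hd xs \<noteq> x \<Longrightarrow> arrow_action (u, map Dir xs) (\<lambda>j. if j = 0 then 1 else 0) x = (\<lambda>_. 0)"
  proof
    fix j assume "xs = [] \<or> hd xs \<noteq> x"
    then show "arrow_action (u, map Dir xs) (\<lambda>j. if j = 0 then 1 else 0) x j = 0"
      by (cases j; cases xs) (auto simp: arrow_action_def nth_Cons split: nat.splits)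
  qed
qed

end

context arc_string
begin

abbreviation "oriented \<equiv> oriented_string Q w"

lemma length_oriented [simp]: "length (snd (oriented f)) = len"
  by (cases f) (auto simp: string_inverse_def)

lemma diff_0_end:
  assumes i: "internal_triangle T (es e)"
  shows "diff 0 (gen 1 (end_index e)) = arr (es e) \<odot>\<^bsub>Res 0\<^esub> gen 0 (pos e)"
proof -
  let ?\<beta> = "nxt (es e)"
  have "idem 1 (end_index e) = idm (curve T ?\<beta>)"
    using idem_internal[OF end_index(2), of e 0] i by (simp add: side_at_end_index)
  moreover have "idem 0 (pos e) = idm (curve T (es e))" by (simp add: idem_def end_side(3))
  moreover have "diff 0 (unit_vec_at \<Lambda> (end_index e) (idm (curve T ?\<beta>))) =
      unit_vec_at \<Lambda> (pos e) (arr (es e) \<otimes>\<^bsub>\<Lambda>\<^esub> idm (curve T ?\<beta>))"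
    using diff_0_end_gen[OF end_index(2) idm_closed, of e "curve T ?\<beta>"] by (simp add: side_at_end_index del: end_side.simps)
  ultimately show ?thesis
    by (auto simp: Res_ops fun_eq_iff unit_vec_at_def arr_idm idm_arr simp del: end_side.simps One_nat_def)
qed

lemma oriented_first:
  "len \<noteq> 0 \<Longrightarrow> snd (oriented f) ! 0 = (case f of Terminal \<Rightarrow> ls ! 0 | Start \<Rightarrow> letter_inverse (ls ! (len - 1)))"
  by (cases f) (auto simp: string_inverse_def rev_nth)

lemma ext_inclusion_ends:
  "ext_inclusion w f m len = m (pos f)" "ext_inclusion w f m 0 = m (pos (other_end f))"
  by (cases f; simp)+

text \<open>
  This is why the class of an arrow extension at \<open>f\<close> vanishes at the pairs with the other end of
  the arc.
\<close>

lemma oriented_first_end: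
  assumes x: "x \<in> sides T" "W = nxt x" "es (other_end f) = W" and l: "len \<noteq> 0"
  shows "snd (oriented f) ! 0 \<noteq> Inv x"
proof (cases f)
  case Start
  have "ls ! (len - 1) \<noteq> Dir x"
    using end_no_letter(4)[of "nxt x" Terminal x "len - 1"] x l Start by simp
  then show ?thesis using Start oriented_first[OF l, of f] by (cases "ls ! (len - 1)") auto
next
  case Terminal
  have "ls ! 0 \<noteq> Inv x" using end_no_letter(3)[of "nxt x" Start x 0] x l Terminal by simp
  then show ?thesis using Terminal oriented_first[OF l, of f] by simp
qed

end

locale string_ext_cover = string_ext T field_type v w \<gamma>v \<gamma>w P d \<epsilon> \<Psi> \<Phi>
  for T :: "('s, 'a) triangulation" and field_type :: "'k::field itself"
    and v w :: "('a, 's) str" and \<gamma>v \<gamma>w :: "'s list"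
    and P :: "nat \<Rightarrow> ((('a, 's) path \<Rightarrow> 'k) set, 'p) module" and d :: "nat \<Rightarrow> 'p \<Rightarrow> 'p" and \<epsilon> :: "'p \<Rightarrow> nat \<Rightarrow> 'k"
    and \<Psi> \<Phi> +
  fixes C :: "((('a, 's) path \<Rightarrow> 'k) set, 'c) module" and \<pi> :: "'c \<Rightarrow> nat \<Rightarrow> 'k"
  assumes C: "projective_cover \<Lambda> C (SM v) \<pi>"
begin

abbreviation "M \<equiv> SM v"
abbreviation "\<Omega> \<equiv> C\<lparr>carrier := hom_kernel C M \<pi>\<rparr>"

lemma cover: "fg_projective \<Lambda> C" "right_module \<Lambda> C" "\<pi> \<in> module_hom \<Lambda> C M" "\<pi> ` carrier C = carrier M"
  using C by (auto simp: projective_cover_def fg_projective_def)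

lemma M_module: "right_module \<Lambda> M" by (rule V.right_module_M)

lemma \<Omega>_simps: "x \<in> hom_kernel C M \<pi> \<longleftrightarrow> x \<in> carrier C \<and> \<pi> x = (\<lambda>_. 0)"
  "x \<oplus>\<^bsub>\<Omega>\<^esub> y = x \<oplus>\<^bsub>C\<^esub> y" "a \<odot>\<^bsub>\<Omega>\<^esub> x = a \<odot>\<^bsub>C\<^esub> x" "\<zero>\<^bsub>\<Omega>\<^esub> = \<zero>\<^bsub>C\<^esub>"
  by (simp_all add: hom_kernel_def string_module_simps[OF V.string])

lemma \<Omega>_module: "right_module \<Lambda> \<Omega>"
proof -
  interpret C: right_module \<Lambda> C by (rule cover)
  interpret M: right_module \<Lambda> M by (rule M_module)
  have 0: "\<pi> x = \<zero>\<^bsub>M\<^esub> \<longleftrightarrow> \<pi> x = (\<lambda>_. 0)" for x by (simp add: string_module_simps[OF V.string])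
  note hom = LinearCombinations.module_hom_add[OF cover(3)] LinearCombinations.module_hom_smult[OF cover(3)]
    module_hom_zero[OF cover(2) M_module cover(3)] module_hom_minus[OF cover(2) M_module cover(3)]
  show ?thesis
  proof (intro right_module.intro right_module_axioms.intro)
    show "abelian_group \<Omega>"
    proof (rule abelian_groupI)
      fix x assume x: "x \<in> carrier \<Omega>"
      then have "\<ominus>\<^bsub>C\<^esub> x \<in> carrier \<Omega>" by (simp add: hom_kernel_def hom)
      moreover have "\<ominus>\<^bsub>C\<^esub> x \<oplus>\<^bsub>\<Omega>\<^esub> x = \<zero>\<^bsub>\<Omega>\<^esub>" using x by (simp add: hom_kernel_def C.M.l_neg)
      ultimately show "\<exists>y\<in>carrier \<Omega>. y \<oplus>\<^bsub>\<Omega>\<^esub> x = \<zero>\<^bsub>\<Omega>\<^esub>" by blast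
    qed (auto simp: hom_kernel_def hom C.M.a_ac)
  qed (auto simp: hom_kernel_def hom \<Lambda>.ring_axioms C.smult_closed C.smult_add_ring C.smult_add_module C.smult_assoc C.smult_one)
qed

context
  fixes e f p
  assumes ef: "(e, f) \<in> pairs 2" and p: "is_R_string Q I (V.es e) p"
    and x: "is_string Q I (extension_string (W.oriented f) (nxt (V.es e)) p)"
begin

abbreviation (input) "\<alpha> \<equiv> V.es e"
abbreviation (input) "\<beta> \<equiv> nxt \<alpha>"
abbreviation (input) "E \<equiv> extension_string (W.oriented f) \<beta> p"

lemma internal: "internal_triangle T \<alpha>" and end_w: "W.es f = nxt \<beta>" and \<alpha>_arrow: "\<alpha> \<in> arcs Q"
  using ef internal_arc[of \<alpha>] by (auto simp: pairs_def numeral_2_eq_2 simp del: quiver_simps)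

lemma p_string: "is_string Q I p" using R_string[OF p \<alpha>_arrow] by metis

lemma L_module: "right_module \<Lambda> (SM p)" by (rule right_module_string[OF p_string])

lemma E_letters: "length (snd E) = Suc (W.len + length (snd p))" "snd E ! W.len = Inv \<beta>"
  "i < W.len \<Longrightarrow> snd E ! i = snd (W.oriented f) ! i"
  by (auto simp: extension_string_def nth_append)

text \<open>
  The value of \<open>f2\<close> at the generator of an end \<open>e'\<close> is the product of the value of \<open>f1\<close> with the arrow
  \<open>\<beta>\<close> of \<open>e'\<close>.  At the position of \<open>f\<close> it is read off through the letter \<open>Inv \<beta>\<close> joining \<open>w\<close> and \<open>p\<close> in
  the extension string, hence equals the component of \<open>f1\<close> at the top of \<open>R(\<alpha>)\<close>, which is known
  because \<open>f1\<close> lifts \<open>\<rho> \<circ> f0 \<circ> d 0\<close>.  At the far end of the string no letter brings a contribution.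
\<close>

lemma arrow_class:
  assumes match: "\<And>e'. (e', f) \<in> pairs 2 \<Longrightarrow> e' = e"
    and X: "X \<in> induced_Ext2 \<Lambda> scal M P d \<epsilon> C \<pi> N (SM E) (SM p) (ext_inclusion w f) (ext_projection w)"
  obtains f2 \<rho> \<sigma> c0 where "f2 \<in> carrier (Coc 2)" "X = evaluation.cls (Coc 2) (end_value 2) f2"
    "\<rho> \<in> module_hom \<Lambda> \<Omega> (SM p)" "\<sigma> \<in> module_hom \<Lambda> (SM p) \<Omega>" "\<And>y. y \<in> carrier (SM p) \<Longrightarrow> \<rho> (\<sigma> y) = y"
    "c0 \<in> carrier C" "\<pi> c0 = V.bvec (V.pos e)"
    "\<And>q. end_value 2 f2 q = (if q = (e, f) then \<rho> (arr \<alpha> \<odot>\<^bsub>C\<^esub> c0) 0 else 0)"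
proof -
  let ?\<iota> = "ext_inclusion w f" and ?g = "ext_projection w"
  obtain f2 \<rho> \<sigma> f0 f1 where X2: "X = coboundaries \<Lambda> scal P d N 2 +>\<^bsub>hom_space \<Lambda> scal (P 2) N\<^esub> f2"
    and ex: "exact_sequence \<Lambda> N (SM E) (SM p) ?\<iota> ?g"
    and \<rho>: "\<rho> \<in> module_hom \<Lambda> \<Omega> (SM p)" "\<sigma> \<in> module_hom \<Lambda> (SM p) \<Omega>" "\<And>y. y \<in> carrier (SM p) \<Longrightarrow> \<rho> (\<sigma> y) = y"
    and f0: "f0 \<in> module_hom \<Lambda> (P 0) C" "\<And>x. x \<in> carrier (P 0) \<Longrightarrow> \<pi> (f0 x) = \<epsilon> x"
    and f1: "f1 \<in> module_hom \<Lambda> (P 1) (SM E)" "\<And>x. x \<in> carrier (P 1) \<Longrightarrow> ?g (f1 x) = \<rho> (f0 (d 0 x))"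
    and f2: "f2 \<in> carrier (hom_space \<Lambda> scal (P 2) N)" "\<And>x. x \<in> carrier (P 2) \<Longrightarrow> ?\<iota> (f2 x) = f1 (d 1 x)"
    using X unfolding induced_Ext2_def by blast
  have E_module: "right_module \<Lambda> (SM E)" by (rule right_module_string[OF x])
  have f2h: "f2 \<in> module_hom \<Lambda> (P 2) N" "f2 \<in> extensional (carrier (P 2))" using f2 by (auto simp: hom_space_def)
  have \<iota>: "?\<iota> \<in> module_hom \<Lambda> N (SM E)" "inj_on ?\<iota> (carrier N)" using ex by (auto simp: exact_sequence_def)
  interpret N: right_module \<Lambda> N by (rule N_module)
  note S2 = numeral_2_eq_2 One_nat_def
  have "f2 (d 2 y) = \<zero>\<^bsub>N\<^esub>" if y: "y \<in> carrier (P 3)" for y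
  proof -
    have y': "y \<in> carrier (P (Suc (Suc 1)))" "d 2 y \<in> carrier (P 2)"
      using y module_hom_carrier[OF PD(3)[of 2], of y] by (simp_all add: numeral_3_eq_3 numeral_2_eq_2)
    have "?\<iota> (f2 (d 2 y)) = f1 \<zero>\<^bsub>P 1\<^esub>" using f2(2)[OF y'(2)] PD(9)[OF y'(1)] by (simp add: numeral_2_eq_2)
    then have "?\<iota> (f2 (d 2 y)) = ?\<iota> \<zero>\<^bsub>N\<^esub>"
      using module_hom_zero[OF PD(2) E_module f1(1)] module_hom_zero[OF N_module E_module \<iota>(1)] by simp
    then show ?thesis using \<iota>(2) module_hom_carrier[OF f2h(1) y'(2)] by (auto dest: inj_onD)
  qed
  then have coc: "is_cocycle 2 f2" using f2h by (simp add: is_cocycle_def numeral_3_eq_3 numeral_2_eq_2)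
  then have f2c: "f2 \<in> carrier (Coc 2)" using f2h by (simp add: Coc_simps(1))
  interpret Ev: evaluation "Coc 2" "end_value 2" "pairs 2" using evaluation_Coc[of 0] by (simp add: numeral_2_eq_2)
  have "X = Ev.cls f2"
    unfolding X2 Ev.cls_def using coboundaries_eq[of 0] by (simp add: numeral_2_eq_2 Coc_def a_r_coset_def')
  define c0 where "c0 = f0 (\<Psi> 0 (V.gen 0 (V.pos e)))"
  have g0: "V.gen 0 (V.pos e) \<in> carrier (V.Res 0)" using V.pos_le[of e] by (intro V.gen_carrier) (simp add: V.rank_def)
  note \<Psi>g0 = module_hom_carrier[OF \<Psi>(1) g0]
  have c0: "c0 \<in> carrier C" "\<pi> c0 = V.bvec (V.pos e)"
    using module_hom_carrier[OF f0(1) \<Psi>g0] f0(2)[OF \<Psi>g0] \<Psi>(2)[OF g0] V.aug_gen[OF V.pos_le[of e]] by (simp_all add: c0_def)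
  have g1: "V.gen 1 (V.end_index e') \<in> carrier (V.Res 1)" for e'
    by (rule V.gen_carrier) (auto simp: V.rank_def intro: less_le_trans[OF V.end_index(2)])
  have t: "end_elt 1 e' \<in> carrier (P 1)" for e' using end_elt_carrier[of 0 e'] by simp
  have at_end: "?\<iota> (f2 (end_elt 2 e')) = arrow_action E (f1 (end_elt 1 e')) (nxt (V.es e'))" if "(e', f') \<in> pairs 2" for e' f'
  proof -
    have g2: "V.gen 2 (V.end_index e') \<in> carrier (V.Res 2)" by (rule V.gen_carrier) (simp add: V.rank_def)
    have "d 1 (end_elt 2 e') = \<Psi> 1 (V.diff 1 (V.gen 2 (V.end_index e')))"
      using \<Psi>(3)[of "V.gen 2 (V.end_index e')" 1] g2 by (simp add: end_elt_def numeral_2_eq_2)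
    also have "V.diff 1 (V.gen 2 (V.end_index e')) = arr (nxt (V.es e')) \<odot>\<^bsub>V.Res 1\<^esub> V.gen 1 (V.end_index e')"
      using V.diff_Suc_gen[OF V.end_index(2) pair_internal[OF that], of 0]
      by (simp add: numeral_2_eq_2 V.side_at_end_index)
    finally have "d 1 (end_elt 2 e') = arr (nxt (V.es e')) \<odot>\<^bsub>P 1\<^esub> end_elt 1 e'"
      using LinearCombinations.module_hom_smult[OF \<Psi>(1) arr_closed g1] by (simp add: end_elt_def)
    moreover have "end_elt 2 e' \<in> carrier (P 2)" using end_elt_carrier[of 1 e'] by (simp add: numeral_2_eq_2)
    ultimately show ?thesis
      using f2(2) LinearCombinations.module_hom_smult[OF f1(1) arr_closed t] by (simp add: string_module_arr[OF x])
  qed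
  have "end_value 2 f2 (e', f') = (if (e', f') = (e, f) then \<rho> (arr \<alpha> \<odot>\<^bsub>C\<^esub> c0) 0 else 0)" for e' f'
  proof (cases "(e', f') \<in> pairs 2")
    case False
    then show ?thesis using ef by (auto simp: end_value_def)
  next
    case pr: True
    have w': "W.es f' = nxt (nxt (V.es e'))" using pr by (simp add: pairs_def numeral_2_eq_2)
    show ?thesis
    proof (cases "f' = f")
      case True
      then have e': "e' = e" using match pr by blast
      have "f2 (end_elt 2 e) (W.pos f) = arrow_action E (f1 (end_elt 1 e)) \<beta> W.len"
        using fun_cong[OF at_end[OF ef], of W.len] by (simp add: W.ext_inclusion_ends)
      also have "\<dots> = f1 (end_elt 1 e) (Suc W.len)"
        by (rule arrow_action_simps(2)[OF _ x]) (simp_all add: E_letters)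
      also have "\<dots> = \<rho> (f0 (d 0 (end_elt 1 e))) 0"
        using fun_cong[OF f1(2)[OF t[of e]], of 0] by (simp add: ext_projection_def)
      also have "d 0 (end_elt 1 e) = arr \<alpha> \<odot>\<^bsub>P 0\<^esub> \<Psi> 0 (V.gen 0 (V.pos e))"
      proof -
        have "d 0 (end_elt 1 e) = \<Psi> 0 (V.diff 0 (V.gen 1 (V.end_index e)))"
          using \<Psi>(3)[of "V.gen 1 (V.end_index e)" 0] g1 by (simp add: end_elt_def)
        also have "V.diff 0 (V.gen 1 (V.end_index e)) = arr \<alpha> \<odot>\<^bsub>V.Res 0\<^esub> V.gen 0 (V.pos e)"
          by (rule V.diff_0_end[OF internal])
        finally show ?thesis using LinearCombinations.module_hom_smult[OF \<Psi>(1) arr_closed g0] by simp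
      qed
      also have "f0 (arr \<alpha> \<odot>\<^bsub>P 0\<^esub> \<Psi> 0 (V.gen 0 (V.pos e))) = arr \<alpha> \<odot>\<^bsub>C\<^esub> c0"
        unfolding c0_def by (rule LinearCombinations.module_hom_smult[OF f0(1) arr_closed \<Psi>g0])
      finally show ?thesis using pr e' True by (simp add: end_value_def)
    next
      case False
      then have f': "f' = other_end f" by (cases f; cases f') auto
      have "snd E ! 0 \<noteq> Inv (nxt (V.es e'))"
      proof (cases "W.len = 0")
        case True
        have "nxt (V.es e') \<noteq> \<beta>"
          using W.end_sides_neq[OF True] w' end_w False by (cases f; cases f') auto
        then show ?thesis using E_letters(2) True by simp
      next
        case l: False
        have "snd (W.oriented f) ! 0 \<noteq> Inv (nxt (V.es e'))"
          using W.oriented_first_end[OF _ refl _ l, of "nxt (V.es e')" f] w' f' V.end_side(1)[of e'] by simp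
        then show ?thesis using E_letters(3)[of 0] l by simp
      qed
      then have "arrow_action E (f1 (end_elt 1 e')) (nxt (V.es e')) 0 = 0" by (simp add: arrow_action_def)
      then have "f2 (end_elt 2 e') (W.pos f') = 0"
        using fun_cong[OF at_end[OF pr], of 0] f' by (simp add: W.ext_inclusion_ends)
      then show ?thesis using False by (simp add: end_value_def)
    qed
  qed
  then show thesis
    using that[OF f2c \<open>X = Ev.cls f2\<close> \<rho> c0] by (metis (no_types, lifting) surj_pair)
qed

text \<open>
  Let \<open>u\<close> be the image under the splitting \<open>\<sigma>\<close> of the generator of \<open>R(\<alpha>)\<close>.  It is killed by \<open>\<beta>\<close>, so it
  equals \<open>c \<alpha>\<close> for some \<open>c\<close> in the cover.  As \<open>c \<alpha>\<close> lies in the syzygy, \<open>\<alpha>\<close> kills the image of \<open>c\<close> in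
  \<open>M(v)\<close>, which therefore is a multiple \<open>l\<close> of the basis vector at \<open>e\<close> plus an element reached by the
  arrow before \<open>\<alpha>\<close>.  Multiplied by \<open>\<alpha>\<close>, the latter contributes nothing, so \<open>u\<close> is \<open>l c\<^sub>0 \<alpha>\<close> up to an element
  \<open>m \<alpha>\<close> with \<open>m\<close> in the syzygy.  The image of \<open>m \<alpha>\<close> under \<open>\<rho>\<close> has no coefficient at the top of \<open>R(\<alpha>)\<close>.
  Since \<open>\<rho>(u)\<close> has coefficient \<open>1\<close> there, \<open>l\<close> times the coefficient of \<open>\<rho>(c\<^sub>0 \<alpha>)\<close> is \<open>1\<close>.
\<close>

lemma top_coefficient_nonzero:
  assumes match: "\<And>e'. V.es e' = \<alpha> \<Longrightarrow> e' = e"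
    and \<rho>: "\<rho> \<in> module_hom \<Lambda> \<Omega> (SM p)" and \<sigma>: "\<sigma> \<in> module_hom \<Lambda> (SM p) \<Omega>" and split: "\<And>y. y \<in> carrier (SM p) \<Longrightarrow> \<rho> (\<sigma> y) = y"
    and c0: "c0 \<in> carrier C" "\<pi> c0 = V.bvec (V.pos e)"
  shows "\<rho> (arr \<alpha> \<odot>\<^bsub>C\<^esub> c0) 0 \<noteq> 0"
proof -
  interpret C: right_module \<Lambda> C by (rule cover)
  interpret M: right_module \<Lambda> M by (rule M_module)
  interpret \<Omega>: right_module \<Lambda> \<Omega> by (rule \<Omega>_module)
  interpret L: right_module \<Lambda> "SM p" by (rule L_module)
  obtain xs where xs: "p = (curve T \<beta>, map Dir xs)" "xs = [] \<or> hd xs \<noteq> \<beta>"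
    using R_string[OF p \<alpha>_arrow] by metis
  let ?b = "(\<lambda>j. if j = 0 then 1 else 0) :: nat \<Rightarrow> 'k"
  let ?z = "nxt \<beta>" and ?\<omega> = "arr \<alpha> \<odot>\<^bsub>C\<^esub> c0"
  have b: "?b \<in> carrier (SM p)" by (simp add: string_module_simps[OF p_string])
  define u where "u = \<sigma> ?b"
  have u: "u \<in> carrier \<Omega>" "\<rho> u = ?b" using module_hom_carrier[OF \<sigma> b] split[OF b] by (simp_all add: u_def)
  have uC: "u \<in> carrier C" using u by (simp add: \<Omega>_simps)
  have "idm (curve T \<beta>) \<odot>\<^bsub>SM p\<^esub> ?b = ?b"
    unfolding string_module_idm[OF p_string] using \<alpha>_arrow
    by (auto simp: vertex_part_def string_vertex_def xs(1) fun_eq_iff)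
  then have u1: "idm (curve T \<beta>) \<odot>\<^bsub>C\<^esub> u = u"
    using LinearCombinations.module_hom_smult[OF \<sigma> idm_closed b, of "curve T \<beta>"] unfolding u_def \<Omega>_simps(3) by metis
  have "arr \<beta> \<odot>\<^bsub>SM p\<^esub> ?b = \<zero>\<^bsub>SM p\<^esub>"
    unfolding string_module_arr[OF p_string] string_module_simps(2)[OF p_string] unfolding xs(1)
    by (rule direct_string_action(2)[OF xs(2)])
  then have u2: "arr \<beta> \<odot>\<^bsub>C\<^esub> u = \<zero>\<^bsub>C\<^esub>"
    using LinearCombinations.module_hom_smult[OF \<sigma> arr_closed b, of \<beta>] module_hom_zero[OF L_module \<Omega>_module \<sigma>]
    by (simp add: u_def \<Omega>_simps)
  obtain c where c: "c \<in> carrier C" "idm (curve T \<alpha>) \<odot>\<^bsub>C\<^esub> c = c" "u = arr \<alpha> \<odot>\<^bsub>C\<^esub> c"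
    using projective_annihilator[OF cover(1) internal uC u1 u2] by blast
  let ?m = "\<pi> c"
  have m: "?m \<in> carrier M" by (rule module_hom_carrier[OF cover(3) c(1)])
  have a: "curve T \<alpha> \<in> arc_set T" using \<alpha>_arrow by simp
  have m1: "vertex_part v (curve T \<alpha>) ?m = ?m"
    using LinearCombinations.module_hom_smult[OF cover(3) idm_closed c(1), of "curve T \<alpha>"] c(2) a
    by (simp add: string_module_idm[OF V.string] del: end_side.simps)
  have m2: "arrow_action v ?m \<alpha> = (\<lambda>_. 0)"
    using LinearCombinations.module_hom_smult[OF cover(3) arr_closed c(1), of \<alpha>] u(1) c(3)
    by (simp add: string_module_arr[OF V.string] \<Omega>_simps del: end_side.simps)
  define l where "l = ?m (V.pos e)"
  define n where "n j = ?m j + (- l) * V.bvec (V.pos e) j" for j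
  have n: "\<forall>j>V.len. n j = 0"
    using m V.bvec_carrier[OF V.pos_le[of e]] by (auto simp: n_def string_module_simps[OF V.string])
  have n1: "vertex_part v (curve T \<alpha>) n = n"
  proof
    fix j show "vertex_part v (curve T \<alpha>) n j = n j"
      using fun_cong[OF m1, of j] V.end_side(3)[of e] by (auto simp: vertex_part_def n_def V.bvec_def split: if_splits)
  qed
  have n2: "arrow_action v n \<alpha> = (\<lambda>_. 0)"
    unfolding n_def arrow_action_linear m2 V.arr_end_kills by simp
  have "n (V.pos e') = 0" if "V.es e' = \<alpha>" for e'
    using match[OF that] by (simp add: n_def l_def V.bvec_def)
  note vanish = this
  have z: "?z \<in> sides T" "nxt ?z = \<alpha>" using V.end_side(1)[of e] by simp_all
  obtain m' where m': "\<forall>j>V.len. m' j = 0" "arrow_action v m' ?z = n"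
    by (rule V.kernel_in_image[OF V.end_side(1) z n n1 n2 vanish]) blast
  then have "m' \<in> carrier M" by (simp add: string_module_simps[OF V.string])
  then obtain c' where c': "c' \<in> carrier C" "\<pi> c' = m'" using cover(4) by (metis imageE)
  let ?t = "arr ?z \<odot>\<^bsub>C\<^esub> c' \<oplus>\<^bsub>C\<^esub> scal l \<odot>\<^bsub>C\<^esub> c0"
  have t: "arr ?z \<odot>\<^bsub>C\<^esub> c' \<in> carrier C" "scal l \<odot>\<^bsub>C\<^esub> c0 \<in> carrier C" "?t \<in> carrier C"
    using c' c0 by (auto intro!: C.smult_closed C.M.a_closed)
  have "\<pi> ?t = ?m"
  proof -
    have "\<pi> ?t = n \<oplus>\<^bsub>M\<^esub> (\<lambda>j. l * V.bvec (V.pos e) j)"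
      using LinearCombinations.module_hom_add[OF cover(3) t(1,2)] LinearCombinations.module_hom_smult[OF cover(3) _ c'(1)]
        LinearCombinations.module_hom_smult[OF cover(3) _ c0(1)] c' c0 m' V.bvec_carrier[OF V.pos_le[of e]]
      by (simp add: string_module_arr[OF V.string] string_module_scal[OF V.string])
    then show ?thesis by (simp add: string_module_simps[OF V.string] n_def)
  qed
  then have k: "c \<ominus>\<^bsub>C\<^esub> ?t \<in> carrier \<Omega>"
    using module_hom_diff[OF cover(2) M_module cover(3) c(1) t(3)] c t m M.M.r_neg[OF m] C.M.minus_closed
    by (simp add: \<Omega>_simps a_minus_def string_module_simps(2)[OF V.string])
  have \<omega>: "?\<omega> \<in> carrier \<Omega>"
    using LinearCombinations.module_hom_smult[OF cover(3) arr_closed c0(1), of \<alpha>] c0 C.smult_closed[OF arr_closed c0(1)]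
      V.arr_bvec_end[of e] by (simp add: \<Omega>_simps del: end_side.simps)
  have "u = arr \<alpha> \<odot>\<^bsub>C\<^esub> (c \<ominus>\<^bsub>C\<^esub> ?t) \<oplus>\<^bsub>C\<^esub> scal l \<odot>\<^bsub>C\<^esub> ?\<omega>"
  proof -
    have "arr \<alpha> \<odot>\<^bsub>C\<^esub> ?t = (arr ?z \<otimes>\<^bsub>\<Lambda>\<^esub> arr \<alpha>) \<odot>\<^bsub>C\<^esub> c' \<oplus>\<^bsub>C\<^esub> (scal l \<otimes>\<^bsub>\<Lambda>\<^esub> arr \<alpha>) \<odot>\<^bsub>C\<^esub> c0"
      using t c' c0 by (simp add: C.smult_add_module C.smult_assoc)
    also have "arr ?z \<otimes>\<^bsub>\<Lambda>\<^esub> arr \<alpha> = \<zero>\<^bsub>\<Lambda>\<^esub>" using arr_nxt[of ?z] V.end_side(1)[of e] by simp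
    also have "(scal l \<otimes>\<^bsub>\<Lambda>\<^esub> arr \<alpha>) \<odot>\<^bsub>C\<^esub> c0 = scal l \<odot>\<^bsub>C\<^esub> ?\<omega>"
      using C.smult_assoc[OF arr_closed scal_closed c0(1), of \<alpha> l] by (simp add: scal_commute)
    finally have "arr \<alpha> \<odot>\<^bsub>C\<^esub> ?t = scal l \<odot>\<^bsub>C\<^esub> ?\<omega>" using c' C.smult_closed[OF scal_closed C.smult_closed[OF arr_closed c0(1)]] by simp
    then have "arr \<alpha> \<odot>\<^bsub>C\<^esub> (c \<ominus>\<^bsub>C\<^esub> ?t) \<oplus>\<^bsub>C\<^esub> scal l \<odot>\<^bsub>C\<^esub> ?\<omega> = arr \<alpha> \<odot>\<^bsub>C\<^esub> ((c \<ominus>\<^bsub>C\<^esub> ?t) \<oplus>\<^bsub>C\<^esub> ?t)"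
      using C.smult_add_module[OF arr_closed C.M.minus_closed[OF c(1) t(3)] t(3), of \<alpha>] by simp
    also have "(c \<ominus>\<^bsub>C\<^esub> ?t) \<oplus>\<^bsub>C\<^esub> ?t = c" using c(1) t(3) by (simp add: a_minus_def C.M.a_assoc C.M.l_neg)
    finally show ?thesis using c(3) by simp
  qed
  then have "\<rho> u = arr \<alpha> \<odot>\<^bsub>SM p\<^esub> \<rho> (c \<ominus>\<^bsub>C\<^esub> ?t) \<oplus>\<^bsub>SM p\<^esub> scal l \<odot>\<^bsub>SM p\<^esub> \<rho> ?\<omega>"
    using LinearCombinations.module_hom_add[OF \<rho> \<Omega>.smult_closed[OF arr_closed k] \<Omega>.smult_closed[OF scal_closed \<omega>]]
      LinearCombinations.module_hom_smult[OF \<rho> arr_closed k] LinearCombinations.module_hom_smult[OF \<rho> scal_closed \<omega>]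
    by (simp add: \<Omega>_simps)
  then have "?b = (\<lambda>j. arrow_action p (\<rho> (c \<ominus>\<^bsub>C\<^esub> ?t)) \<alpha> j + l * \<rho> ?\<omega> j)"
    unfolding u(2) string_module_simps(3)[OF p_string] string_module_arr[OF p_string]
      string_module_scal[OF p_string module_hom_carrier[OF \<rho> \<omega>]] .
  from fun_cong[OF this, of 0] have "1 = l * \<rho> ?\<omega> 0" unfolding xs(1) direct_string_action(1) by simp
  then show ?thesis by auto
qed

end

end

section \<open>Existence of the arrow extensions\<close>

context triangulated_surface
begin

text \<open>
  The condition on consecutive letters of a string, stated through the triangles instead of the
  ideal; it is visibly symmetric under reversing the string.
\<close>

definition joins :: "'s letter \<Rightarrow> 's letter \<Rightarrow> bool" where
  "joins a b \<longleftrightarrow> letter_end Q a = letter_start Q b \<and>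
    (case a of Dir x \<Rightarrow> (case b of Dir y \<Rightarrow> y \<noteq> nxt x | Inv y \<Rightarrow> y \<noteq> x)
             | Inv x \<Rightarrow> (case b of Dir y \<Rightarrow> y \<noteq> x | Inv y \<Rightarrow> x \<noteq> nxt y))"

lemma is_string_iff:
  "is_string Q I (u, ls) \<longleftrightarrow> u \<in> arc_set T \<and> letter_arrow ` set ls \<subseteq> arcs Q \<and>
     (ls \<noteq> [] \<longrightarrow> letter_start Q (hd ls) = u) \<and> successively joins ls"
proof -
  have join: "joins a b \<longleftrightarrow> letter_end Q a = letter_start Q b \<and> b \<noteq> letter_inverse a \<and>
      (\<forall>x y. a = Dir x \<and> b = Dir y \<longrightarrow> path_elt (tail Q x, [x, y]) \<notin> I) \<and>
      (\<forall>x y. a = Inv y \<and> b = Inv x \<longrightarrow> path_elt (tail Q x, [x, y]) \<notin> I)"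
    if "letter_arrow a \<in> arcs Q" "letter_arrow b \<in> arcs Q" for a b
  proof (cases "letter_end Q a = letter_start Q b")
    case True
    show ?thesis
    proof (cases a)
      case (Dir x)
      then show ?thesis using that True path_elt_in_ideal[of x]
        by (cases b) (auto simp: joins_def simp del: quiver_simps)
    next
      case (Inv x)
      show ?thesis
      proof (cases b)
        case (Inv y)
        then show ?thesis using that True path_elt_in_ideal[of y x] \<open>a = Inv x\<close>
          by (auto simp: joins_def simp del: quiver_simps)
      qed (use Inv in \<open>auto simp: joins_def simp del: quiver_simps\<close>)
    qed
  qed (simp add: joins_def)
  show ?thesis
  proof (cases "letter_arrow ` set ls \<subseteq> arcs Q")
    case True
    then have "letter_arrow (ls ! i) \<in> arcs Q" if "i < length ls" for i using that by force
    then show ?thesis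
      using join unfolding is_string_def successively_conv_nth
      by (auto simp del: quiver_simps(2-4))
  next
    case False
    then show ?thesis by (auto simp add: is_string_def simp del: quiver_simps)
  qed
qed

lemma is_string_direct: "is_string Q I (u, map Dir xs) \<longleftrightarrow> good (u, xs)"
proof (induction xs arbitrary: u)
  case (Cons x xs)
  show ?case unfolding good_Cons Cons.IH[symmetric] is_string_iff
    by (cases xs) (auto simp: successively_Cons joins_def)
qed (simp add: is_string_iff)

lemma letter_inverse_simps [simp]: "letter_arrow (letter_inverse l) = letter_arrow l"
  "letter_start Q (letter_inverse l) = letter_end Q l" "letter_end Q (letter_inverse l) = letter_start Q l"
  by (cases l; simp)+

lemma joins_inverse: "joins (letter_inverse b) (letter_inverse a) \<longleftrightarrow> joins a b"
  by (cases a; cases b) (auto simp: joins_def)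

lemma is_string_inverse:
  assumes w: "is_string Q I w"
  shows "is_string Q I (string_inverse Q w)"
proof -
  obtain u ls where [simp]: "w = (u, ls)" by fastforce
  have "string_vertex Q w (length ls) \<in> arc_set T" using string_vertex_arc[OF w, of "length ls"] by simp
  moreover have "letter_start Q (hd (rev (map letter_inverse ls))) = string_vertex Q w (length ls)" if "ls \<noteq> []"
    using that by (simp add: hd_rev last_map string_vertex_def last_conv_nth)
  ultimately show ?thesis
    using w by (simp add: string_inverse_def is_string_iff successively_rev successively_map joins_inverse image_image del: quiver_simps(2-4))
qed

lemma string_vertex_inverse:
  assumes w: "is_string Q I w" and j: "j \<le> length (snd w)"
  shows "string_vertex Q (string_inverse Q w) j = string_vertex Q w (length (snd w) - j)"
proof (cases j)
  case 0
  then show ?thesis by (simp add: string_vertex_def[of _ "string_inverse Q w"]) (simp add: string_inverse_def)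
next
  case (Suc i)
  then show ?thesis
    using is_string_letters(2)[OF w, of "length (snd w) - j"] j
    by (simp add: string_vertex_def[of _ "string_inverse Q w"]) (simp add: string_inverse_def rev_nth)
qed

text \<open>
  Paths outside the ideal have bounded length, so a direct string can be continued until it is
  maximal.
\<close>

lemma R_string_exists:
  assumes x: "x \<in> arcs Q"
  shows "\<exists>p. is_R_string Q I x p"
proof -
  let ?E = "{e \<in> arcs Q. tail Q e = head Q x \<and> path_elt (tail Q x, [x, e]) \<notin> I}"
  show ?thesis
  proof (cases "?E = {}")
    case True
    then show ?thesis unfolding is_R_string_def Let_def if_P[OF True] by blast
  next
    case False
    then obtain e where e: "e \<in> ?E" by blast
    then have e': "e \<in> arcs Q" "curve T e = curve T (nxt x)" unfolding R_string_arrows[OF x] by auto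
    define P where "P q \<longleftrightarrow> good (curve T (nxt x), e # q)" for q
    have "P []" using e' by (simp add: P_def good_Cons)
    moreover have "\<forall>q. P q \<longrightarrow> length q < Suc (card (sides T))"
    proof (intro allI impI)
      fix q assume "P q"
      then have "distinct (e # q)" "set (e # q) \<subseteq> sides T" using good_distinct unfolding P_def by blast+
      then show "length q < Suc (card (sides T))"
        using card_mono[OF finite_sides, of "set (e # q)"] distinct_card[of "e # q"] by simp
    qed
    ultimately obtain q where q: "P q" "\<And>q'. P q' \<Longrightarrow> length q' \<le> length q"
      using ex_has_greatest_nat[of P "[]" length] by metis
    have "\<not> P (q @ [y])" for y using q(2)[of "q @ [y]"] by auto
    then have "is_string Q I (head Q x, map Dir (e # q)) \<and> (\<forall>y. \<not> is_string Q I (head Q x, map Dir ((e # q) @ [y])))"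
      using q(1) unfolding is_string_direct by (simp add: P_def)
    then show ?thesis unfolding is_R_string_def Let_def if_not_P[OF False] using e by blast
  qed
qed

end

context arc_string
begin

lemma oriented_string: "is_string Q I (oriented f)"
  using string is_string_inverse[OF string] by (cases f) auto

lemma oriented_last:
  "len \<noteq> 0 \<Longrightarrow> snd (oriented f) ! (len - 1) = (case f of Terminal \<Rightarrow> ls ! (len - 1) | Start \<Rightarrow> letter_inverse (ls ! 0))"
  by (cases f) (auto simp: string_inverse_def rev_nth)

lemma oriented_vertex: "j \<le> len \<Longrightarrow> string_vertex Q (oriented f) j = vert (case f of Start \<Rightarrow> len - j | Terminal \<Rightarrow> j)"
  using string_vertex_inverse[OF string, of j] by (cases f) auto

lemma ext_inclusion_apply:
  "m \<in> carrier (SM w) \<Longrightarrow>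
     ext_inclusion w f m j = (if j \<le> len then m (case f of Start \<Rightarrow> len - j | Terminal \<Rightarrow> j) else 0)"
  by (cases f) (auto simp: string_module_simps[OF string])

lemma arrow_action_oriented:
  assumes m: "m \<in> carrier (SM w)"
  shows "arrow_action (oriented f) (ext_inclusion w f m) x = ext_inclusion w f (arrow_action w m x)"
proof (cases f)
  case Start
  have inv: "letter_inverse l = Dir x \<longleftrightarrow> l = Inv x" "letter_inverse l = Inv x \<longleftrightarrow> l = Dir x" for l by (cases l; simp)+
  have "arrow_action (string_inverse Q w) (ext_inclusion w Start m) x j = ext_inclusion w Start (arrow_action w m x) j" for j
  proof (cases "j \<le> len")
    case True
    have r: "i < len \<Longrightarrow> snd (string_inverse Q w) ! i = letter_inverse (ls ! (len - Suc i))" for i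
      by (simp add: string_inverse_def rev_nth)
    have l: "length (snd (string_inverse Q w)) = len" by (simp add: string_inverse_def)
    define k where "k = len - j"
    have k: "j = len - k" "k \<le> len" using True by (simp_all add: k_def)
    have 1: "0 < j \<and> j \<le> len \<and> snd (string_inverse Q w) ! (j - 1) = Dir x \<longleftrightarrow> k < len \<and> ls ! k = Inv x"
    proof (cases "0 < j")
      case True
      then have "len - Suc (j - 1) = k" "j - 1 < len" "k < len" using k by auto
      then show ?thesis using r[of "j - 1"] True k by (simp add: inv)
    qed (use k in simp)
    have 2: "j < len \<and> snd (string_inverse Q w) ! j = Inv x \<longleftrightarrow> 0 < k \<and> k \<le> len \<and> ls ! (k - 1) = Dir x"
    proof (cases "j < len")
      case True
      then have "len - Suc j = k - 1" "0 < k" using k by auto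
      then show ?thesis using r[of j] True k by (simp add: inv)
    qed (use k in auto)
    have 3: "len - (j - 1) = Suc k" "j - 1 \<le> len" if "k < len" using that k by auto
    have 4: "len - Suc j = k - 1" "Suc j \<le> len" if "0 < k" using that k by auto
    have "arrow_action (string_inverse Q w) (ext_inclusion w Start m) x j =
        (if k < len \<and> ls ! k = Inv x then m (Suc k) else 0) + (if 0 < k \<and> k \<le> len \<and> ls ! (k - 1) = Dir x then m (k - 1) else 0)"
      unfolding arrow_action_def l 1 2 using 3 4 by simp
    then show ?thesis using True by (simp add: arrow_action_def k_def[symmetric] add.commute)
  next
    case False
    then show ?thesis by (auto simp: arrow_action_def string_inverse_def)
  qed
  then show ?thesis using Start by auto
qed simp

context
  fixes f \<beta> p xs
  assumes \<beta>: "\<beta> \<in> arcs Q" "nxt \<beta> = es f"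
    and p: "is_string Q I p" "p = (curve T \<beta>, map Dir xs)" "xs = [] \<or> hd xs \<noteq> \<beta>"
begin

abbreviation (input) "E \<equiv> extension_string (oriented f) \<beta> p"

text \<open>
  The new letter is \<open>\<beta>\<close>, inverted, in the triangle where the arc ends.  No letter of \<open>w\<close> meets this
  triangle at that end, and \<open>p\<close> does not start with \<open>\<beta>\<close>, so no forbidden pair of letters arises.
\<close>

lemma extension_is_string: "is_string Q I E"
proof -
  let ?w = "oriented f"
  have w: "fst ?w \<in> arc_set T" "letter_arrow ` set (snd ?w) \<subseteq> arcs Q"
    "snd ?w \<noteq> [] \<Longrightarrow> letter_start Q (hd (snd ?w)) = fst ?w" "successively joins (snd ?w)"
    using oriented_string[of f] is_string_iff[of "fst ?w" "snd ?w"] by auto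
  have "letter_start Q (Inv \<beta>) = fst ?w" if "snd ?w = []"
  proof -
    have "len = 0" using that length_oriented[of f] by simp
    then have "fst ?w = vert (pos f)" using oriented_vertex[of 0 f] by (cases f) (auto simp: string_vertex_def)
    then show ?thesis using end_side(3)[of f] \<beta> by simp
  qed
  moreover have "joins (last (snd ?w)) (Inv \<beta>)" if "snd ?w \<noteq> []"
  proof -
    have "0 < length (snd (oriented f))" using that by (rule length_greater_0_conv[THEN iffD2])
    then have l: "0 < len" "len \<noteq> 0" by simp_all
    then have last: "last (snd ?w) = (case f of Terminal \<Rightarrow> ls ! (len - 1) | Start \<Rightarrow> letter_inverse (ls ! 0))"
      using that oriented_last[of f] by (simp add: last_conv_nth)
    have \<beta>s: "\<beta> \<in> sides T" using \<beta>(1) by simp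
    show ?thesis
    proof (cases f)
      case Start
      have "ls ! 0 \<noteq> Dir (nxt \<beta>)" "ls ! 0 \<noteq> Inv \<beta>"
        using end_no_letter(1)[OF \<beta>(2), of 0] end_no_letter(3)[OF \<beta>(2) \<beta>s refl, of 0] l Start by simp_all
      moreover have "letter_start Q (ls ! 0) = curve T (nxt \<beta>)"
        using is_string_letters(2)[OF string l(1)] end_side(3)[of f] \<beta>(2) Start by simp
      ultimately show ?thesis unfolding last unfolding Start by (cases "ls ! 0") (auto simp: joins_def)
    next
      case Terminal
      have "ls ! (len - 1) \<noteq> Inv (nxt \<beta>)" "ls ! (len - 1) \<noteq> Dir \<beta>"
        using end_no_letter(2)[OF \<beta>(2), of "len - 1"] end_no_letter(4)[OF \<beta>(2) \<beta>s refl, of "len - 1"] l Terminal by simp_all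
      moreover have "letter_end Q (ls ! (len - 1)) = curve T (nxt \<beta>)"
        using is_string_letters(3)[OF string, of "len - 1"] end_side(3)[of f] \<beta>(2) l Terminal by simp
      ultimately show ?thesis unfolding last unfolding Terminal by (cases "ls ! (len - 1)") (auto simp: joins_def)
    qed
  qed
  moreover have "snd p = [] \<or> joins (Inv \<beta>) (hd (snd p))"
  proof (cases "snd p = []")
    case that: False
    have "letter_start Q (hd (snd p)) = curve T \<beta>" using p(1) that by (simp add: p(2) is_string_iff)
    then show ?thesis using p(3) by (cases xs) (auto simp: p(2) joins_def)
  qed simp
  moreover have "letter_arrow ` set (snd p) \<subseteq> arcs Q" "successively joins (snd p)"
    using p(1) is_string_iff[of "fst p" "snd p"] by auto
  ultimately show ?thesis
    using w \<beta>(1) unfolding extension_string_def is_string_iff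
    by (cases "snd ?w = []") (simp_all add: successively_append_iff successively_Cons image_Un del: quiver_simps(4))
qed

lemma p_simps: "fst p = curve T \<beta>" "length (snd p) = length xs"
  by (simp_all add: p(2))

lemma extension_nth: "length (snd E) = Suc (len + length xs)" "i < len \<Longrightarrow> snd E ! i = snd (oriented f) ! i"
  "snd E ! len = Inv \<beta>" "snd E ! Suc (len + i) = snd p ! i"
  by (auto simp: extension_string_def nth_append p_simps)

lemma extension_vertex: "string_vertex Q E j =
    (if j \<le> len then string_vertex Q (oriented f) j else string_vertex Q p (j - Suc len))"
proof -
  have "string_vertex Q E (Suc (len + i)) = string_vertex Q p i" for i
    by (cases i) (simp_all add: string_vertex_def extension_nth p_simps)
  from this[of "j - Suc len"] show ?thesis
    by (auto simp: string_vertex_def extension_nth extension_string_def[of "oriented f"] nth_append)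
qed

lemma ext_inclusion_hom: "ext_inclusion w f \<in> module_hom \<Lambda> (SM w) (SM E)"
proof -
  note simps = string_module_simps[OF string] string_module_simps[OF extension_is_string]
  note right_module_M
  then interpret M: right_module \<Lambda> "SM w" .
  show ?thesis
  proof (rule module_hom_generatorsI[OF right_module_M right_module_string[OF extension_is_string]])
    fix m assume m: "m \<in> carrier (SM w)"
    show c: "ext_inclusion w f m \<in> carrier (SM E)"
      using m by (simp add: simps(4) extension_nth ext_inclusion_apply)
    show "ext_inclusion w f (m \<oplus>\<^bsub>SM w\<^esub> n) = ext_inclusion w f m \<oplus>\<^bsub>SM E\<^esub> ext_inclusion w f n" if "n \<in> carrier (SM w)" for n
      unfolding simps(3,6) by (cases f) auto
    show "ext_inclusion w f (scal c \<odot>\<^bsub>SM w\<^esub> m) = scal c \<odot>\<^bsub>SM E\<^esub> ext_inclusion w f m" for c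
      unfolding string_module_scal[OF string m] string_module_scal[OF extension_is_string c]
      by (cases f) auto
    show "ext_inclusion w f (idm u \<odot>\<^bsub>SM w\<^esub> m) = idm u \<odot>\<^bsub>SM E\<^esub> ext_inclusion w f m" for u
    proof
      fix j
      show "ext_inclusion w f (idm u \<odot>\<^bsub>SM w\<^esub> m) j = (idm u \<odot>\<^bsub>SM E\<^esub> ext_inclusion w f m) j"
        using extension_vertex[of j] oriented_vertex[of j f] m
        unfolding ext_inclusion_apply[OF M.smult_closed[OF idm_closed m]] string_module_idm[OF extension_is_string]
        by (auto simp: string_module_idm[OF string] vertex_part_def ext_inclusion_apply)
    qed
    show "ext_inclusion w f (arr x \<odot>\<^bsub>SM w\<^esub> m) = arr x \<odot>\<^bsub>SM E\<^esub> ext_inclusion w f m" for x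
    proof
      fix j
      have 0: "ext_inclusion w f m i = 0" if "len < i" for i using that by (simp add: ext_inclusion_apply[OF m])
      have "arrow_action E (ext_inclusion w f m) x j = arrow_action (oriented f) (ext_inclusion w f m) x j"
      proof (cases "j \<le> len")
        case True
        then show ?thesis using extension_nth(2)[of j] extension_nth(2)[of "j - 1"] extension_nth(3) 0[of "Suc len"]
          by (cases "j = len") (auto simp: arrow_action_def extension_nth(1))
      next
        case False
        then show ?thesis using extension_nth(3) 0[of "Suc j"] 0[of "j - 1"]
          by (cases "j = Suc len") (auto simp: arrow_action_def)
      qed
      then show "ext_inclusion w f (arr x \<odot>\<^bsub>SM w\<^esub> m) j = (arr x \<odot>\<^bsub>SM E\<^esub> ext_inclusion w f m) j"
        by (simp add: string_module_arr[OF string] string_module_arr[OF extension_is_string] arrow_action_oriented[OF m])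
    qed
  qed
qed

lemma ext_projection_hom: "ext_projection w \<in> module_hom \<Lambda> (SM E) (SM p)"
proof -
  note simps = string_module_simps[OF p(1)] string_module_simps[OF extension_is_string]
  show ?thesis
  proof (rule module_hom_generatorsI[OF right_module_string[OF extension_is_string] right_module_string[OF p(1)]])
    fix m assume m: "m \<in> carrier (SM E)"
    show c: "ext_projection w m \<in> carrier (SM p)"
      using m unfolding simps(1,4) by (simp add: extension_nth ext_projection_def p_simps)
    show "ext_projection w (m \<oplus>\<^bsub>SM E\<^esub> n) = ext_projection w m \<oplus>\<^bsub>SM p\<^esub> ext_projection w n" if "n \<in> carrier (SM E)" for n
      unfolding simps(3,6) by (simp add: ext_projection_def)
    show "ext_projection w (scal c \<odot>\<^bsub>SM E\<^esub> m) = scal c \<odot>\<^bsub>SM p\<^esub> ext_projection w m" for c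
      unfolding string_module_scal[OF p(1) c] string_module_scal[OF extension_is_string m]
      by (simp add: ext_projection_def)
    show "ext_projection w (idm u \<odot>\<^bsub>SM E\<^esub> m) = idm u \<odot>\<^bsub>SM p\<^esub> ext_projection w m" for u
      unfolding string_module_idm[OF p(1)] string_module_idm[OF extension_is_string]
      by (auto simp: ext_projection_def vertex_part_def extension_vertex fun_eq_iff)
    show "ext_projection w (arr x \<odot>\<^bsub>SM E\<^esub> m) = arr x \<odot>\<^bsub>SM p\<^esub> ext_projection w m" for x
    proof
      fix j
      show "ext_projection w (arr x \<odot>\<^bsub>SM E\<^esub> m) j = (arr x \<odot>\<^bsub>SM p\<^esub> ext_projection w m) j"
        unfolding string_module_arr[OF p(1)] string_module_arr[OF extension_is_string]
        using extension_nth(3) extension_nth(4)[of j] extension_nth(4)[of "j - 1"]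
        by (cases j) (simp_all add: ext_projection_def arrow_action_def extension_nth(1) p_simps)
    qed
  qed
qed

text \<open>
  The letter \<open>Inv \<beta>\<close> maps the part of \<open>p\<close> to the part of \<open>w\<close>, so that the latter is a submodule.
\<close>

lemma extension_exact: "exact_sequence \<Lambda> (SM w) (SM E) (SM p) (ext_inclusion w f) (ext_projection w)"
proof -
  note simps = string_module_simps[OF string] string_module_simps[OF p(1)] string_module_simps[OF extension_is_string]
  have inv: "ext_inclusion w f (ext_inclusion w f m) = m" if "m \<in> carrier (SM w)" for m
    using that by (cases f) (auto simp: simps(1) fun_eq_iff)
  have "ext_inclusion w f ` carrier (SM w) = hom_kernel (SM E) (SM p) (ext_projection w)"
  proof (intro equalityI subsetI)
    fix h assume "h \<in> ext_inclusion w f ` carrier (SM w)"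
    then show "h \<in> hom_kernel (SM E) (SM p) (ext_projection w)"
      using module_hom_carrier[OF ext_inclusion_hom]
      by (auto simp: hom_kernel_def simps(5) ext_projection_def ext_inclusion_apply)
  next
    fix h assume "h \<in> hom_kernel (SM E) (SM p) (ext_projection w)"
    then have "(\<lambda>j. h (Suc len + j)) = (\<lambda>_. 0)" unfolding hom_kernel_def simps(5) ext_projection_def by simp
    from fun_cong[OF this] have h0: "h (Suc len + j) = 0" for j .
    have "h j = 0" if "len < j" for j using h0[of "j - Suc len"] that by simp
    then have h: "h \<in> carrier (SM w)" by (simp add: simps(1))
    then have "ext_inclusion w f h \<in> carrier (SM w)" by (simp add: simps(1) ext_inclusion_apply)
    then show "h \<in> ext_inclusion w f ` carrier (SM w)" using inv[OF h] by (metis imageI)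
  qed
  moreover have "ext_projection w ` carrier (SM E) = carrier (SM p)"
  proof
    show "ext_projection w ` carrier (SM E) \<subseteq> carrier (SM p)" using module_hom_carrier[OF ext_projection_hom] by blast
    show "carrier (SM p) \<subseteq> ext_projection w ` carrier (SM E)"
    proof
      fix y assume y: "y \<in> carrier (SM p)"
      let ?h = "\<lambda>j. if j \<le> len then 0 else y (j - Suc len)"
      have h: "?h \<in> carrier (SM E)" using y unfolding simps(4,7) by (auto simp: extension_nth(1) p_simps)
      have "y = ext_projection w ?h" by (rule ext) (simp add: ext_projection_def)
      then show "y \<in> ext_projection w ` carrier (SM E)" using imageI[OF h, of "ext_projection w"] by (simp only:)
    qed
  qed
  moreover have "inj_on (ext_inclusion w f) (carrier (SM w))"
    by (rule inj_on_inverseI[of _ "ext_inclusion w f"]) (rule inv)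
  ultimately show ?thesis
    unfolding exact_sequence_def using ext_inclusion_hom ext_projection_hom by blast
qed

end

end

context triangulated_surface
begin

text \<open>
  The module \<open>R(\<alpha>)\<close> is \<open>e\<Lambda>/\<beta>\<Lambda>\<close> with \<open>e\<close> the idempotent at the end of \<open>\<alpha>\<close>: a homomorphism from it
  is given by an element of that vertex killed by \<open>\<beta>\<close>.
\<close>

lemma R_module_hom:
  assumes U: "right_module \<Lambda> U" and x: "x \<in> arcs Q" and p: "is_R_string Q I x p"
    and u: "u \<in> carrier U" "idm (curve T (nxt x)) \<odot>\<^bsub>U\<^esub> u = u" "arr (nxt x) \<odot>\<^bsub>U\<^esub> u = \<zero>\<^bsub>U\<^esub>"
  obtains \<sigma> where "\<sigma> \<in> module_hom \<Lambda> (SM p) U" "\<sigma> (\<lambda>j. if j = 0 then 1 else 0) = u"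
proof -
  interpret U: right_module \<Lambda> U by fact
  obtain xs where xs: "p = (curve T (nxt x), map Dir xs)" "is_string Q I p" "xs = [] \<or> hd xs \<noteq> nxt x"
    and max: "\<And>y. xs \<noteq> [] \<Longrightarrow> \<not> is_string Q I (curve T (nxt x), map Dir (xs @ [y]))"
      "\<And>y. xs = [] \<Longrightarrow> y \<in> arcs Q \<Longrightarrow> curve T y = curve T (nxt x) \<Longrightarrow> y = nxt x"
    using R_string[OF p x] by metis
  define n where "n = length xs"
  have np: "length (snd p) = n" "\<And>j. j < n \<Longrightarrow> snd p ! j = Dir (xs ! j)" by (simp_all add: xs(1) n_def)
  define v where "v j = string_vertex Q p j" for j
  have v: "v 0 = curve T (nxt x)" "\<And>j. j < n \<Longrightarrow> v (Suc j) = curve T (nxt (xs ! j))" "\<And>j. j < n \<Longrightarrow> v j = curve T (xs ! j)"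
    "\<And>j. j \<le> n \<Longrightarrow> v j \<in> arc_set T"
    using is_string_letters(2,3)[OF xs(2)] string_vertex_arc[OF xs(2)] np by (auto simp: v_def string_vertex_def xs(1))
  have arc: "xs ! j \<in> arcs Q" if "j < n" for j using is_string_letters(1)[OF xs(2), of j] np that by simp
  have next_arrow: "xs ! Suc j \<noteq> nxt (xs ! j)" if "Suc j < n" for j
    using is_string_consecutive(1)[OF xs(2), of j] np that by simp
  define \<omega> where "\<omega> = rec_nat u (\<lambda>j m. arr (xs ! j) \<odot>\<^bsub>U\<^esub> m)"
  have \<omega>: "\<omega> 0 = u" "\<omega> (Suc j) = arr (xs ! j) \<odot>\<^bsub>U\<^esub> \<omega> j" for j by (simp_all add: \<omega>_def)
  have \<omega>U: "\<omega> j \<in> carrier U" for j by (induction j) (simp_all add: \<omega> u U.smult_closed)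
  note z = U.smult_zero_ring and s0 = U.smult_zero_module
  have idm: "idm y \<odot>\<^bsub>U\<^esub> \<omega> j = (if y = v j then \<omega> j else \<zero>\<^bsub>U\<^esub>)" if "j \<le> n" for y j
  proof (cases j)
    case 0
    have "idm y \<odot>\<^bsub>U\<^esub> u = (idm (v 0) \<otimes>\<^bsub>\<Lambda>\<^esub> idm y) \<odot>\<^bsub>U\<^esub> u"
      using U.smult_assoc[OF idm_closed idm_closed u(1), of "v 0" y] u(2) by (simp add: v)
    then show ?thesis using u z idm_orth[of "v 0" y] by (auto simp: 0 \<omega> v)
  next
    case (Suc i)
    have "idm y \<odot>\<^bsub>U\<^esub> \<omega> j = (arr (xs ! i) \<otimes>\<^bsub>\<Lambda>\<^esub> idm y) \<odot>\<^bsub>U\<^esub> \<omega> i"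
      using U.smult_assoc[OF arr_closed idm_closed \<omega>U, of "xs ! i" y i] by (simp add: Suc \<omega>)
    then show ?thesis using that arr_idm[of "xs ! i"] arr_idm_0[of y "xs ! i"] z[OF \<omega>U] v(2)[of i] by (auto simp: Suc \<omega>)
  qed
  have arr_0: "arr y \<odot>\<^bsub>U\<^esub> \<omega> j = \<zero>\<^bsub>U\<^esub>" if j: "j \<le> n" and y: "\<not> (j < n \<and> y = xs ! j)" for y j
  proof (cases "y \<in> arcs Q \<and> curve T y = v j")
    case False
    then show ?thesis
    proof (cases "y \<in> arcs Q")
      case True
      with False have "idm (curve T y) \<odot>\<^bsub>U\<^esub> \<omega> j = \<zero>\<^bsub>U\<^esub>" using idm[OF j, of "curve T y"] by simp
      then show ?thesis
        using U.smult_assoc[OF idm_closed arr_closed \<omega>U, of "curve T y" y j] s0[OF arr_closed] by (simp add: idm_arr)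
    next
      case False
      then have "arr y = \<zero>\<^bsub>\<Lambda>\<^esub>" unfolding arr_def by (rule if_not_P)
      then show ?thesis by (simp add: z[OF \<omega>U])
    qed
  next
    case True
    show ?thesis
    proof (cases j)
      case 0
      have "y = nxt x"
      proof (rule ccontr)
        assume ne: "y \<noteq> nxt x"
        then have "xs \<noteq> []" using max(2)[of y] True by (auto simp: 0 v)
        then have 1: "0 < n" "xs ! 0 \<noteq> nxt x" using xs(3) by (auto simp: n_def hd_conv_nth)
        have "y = opp (nxt x)" using arrows_consecutive[OF x, of y] True ne by (simp add: 0 v(1) del: quiver_simps(4))
        moreover have "xs ! 0 = opp (nxt x)"
          using arrows_consecutive[OF x arc[OF 1(1)]] 1(2) v(1) v(3)[OF 1(1)] by (simp del: quiver_simps(4))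
        ultimately show False using y 1(1) by (simp add: 0)
      qed
      then show ?thesis using u(3) by (simp add: 0 \<omega>)
    next
      case (Suc i)
      then have i: "i < n" using j by simp
      have "y = nxt (xs ! i)"
      proof (rule ccontr)
        assume ne: "y \<noteq> nxt (xs ! i)"
        have y': "y = opp (nxt (xs ! i))"
          using arrows_consecutive[OF arc[OF i], of y] True ne v(2)[OF i] by (simp add: Suc del: quiver_simps(4))
        show False
        proof (cases "Suc i < n")
          case l: True
          have "xs ! Suc i = opp (nxt (xs ! i))"
            using arrows_consecutive[OF arc[OF i] arc[OF l]] next_arrow[OF l] v(2)[OF i] v(3)[OF l] by (simp del: quiver_simps(4))
          then show False using y l y' by (simp add: Suc)
        next
          case False
          then have "n = Suc i" "xs \<noteq> []" using i by (auto simp: n_def)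
          then have l: "last xs = xs ! i" "xs \<noteq> []" by (simp_all add: n_def last_conv_nth)
          have "good (curve T (nxt x), xs @ [y])"
            unfolding good_append using xs(2) True ne v(2)[OF i] Suc
            by (auto simp: xs(1) is_string_direct path_end_def l good_Cons)
          then show False using max(1)[OF l(2), of y] unfolding is_string_direct by simp
        qed
      qed
      then show ?thesis
        using U.smult_assoc[OF arr_closed arr_closed \<omega>U, of "xs ! i" y i] z[OF \<omega>U] by (simp add: Suc \<omega> arr_nxt)
    qed
  qed
  define \<sigma> where "\<sigma> m = finsum U (\<lambda>j. scal (m j) \<odot>\<^bsub>U\<^esub> \<omega> j) {..n}" for m
  let ?s = "\<lambda>j c i. if i = j then c else (0 :: 'k)"
  have \<sigma>U: "\<sigma> m \<in> carrier U" for m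
    unfolding \<sigma>_def by (rule U.M.finsum_closed) (simp add: \<omega>U U.smult_closed)
  have add: "\<sigma> (\<lambda>j. m j + m' j) = \<sigma> m \<oplus>\<^bsub>U\<^esub> \<sigma> m'" for m m'
    unfolding \<sigma>_def by (subst U.M.finsum_addf[symmetric]) (auto simp: scal_add U.smult_add_ring \<omega>U U.smult_closed)
  have single: "\<sigma> (?s j c) = scal c \<odot>\<^bsub>U\<^esub> \<omega> j" if "j \<le> n" for j c
  proof -
    have "\<sigma> (?s j c) = finsum U (\<lambda>i. if j = i then scal c \<odot>\<^bsub>U\<^esub> \<omega> i else \<zero>\<^bsub>U\<^esub>) {..n}"
      unfolding \<sigma>_def by (rule U.M.finsum_cong') (auto simp: scal_0 z[OF \<omega>U] \<omega>U U.smult_closed)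
    also have "\<dots> = scal c \<odot>\<^bsub>U\<^esub> \<omega> j"
      using that by (intro U.M.finsum_singleton) (auto simp: \<omega>U U.smult_closed)
    finally show ?thesis .
  qed
  have zero: "\<sigma> (\<lambda>_. 0) = \<zero>\<^bsub>U\<^esub>" using single[of 0 0] z[OF \<omega>U] by (simp add: scal_0)
  interpret L: right_module \<Lambda> "SM p" by (rule right_module_string[OF xs(2)])
  note Ls = string_module_simps[OF xs(2)]
  have sL: "?s j c \<in> carrier (SM p)" if "j \<le> n" for j c using that by (simp add: Ls np)
  have compat: "\<sigma> (X \<odot>\<^bsub>SM p\<^esub> m) = X \<odot>\<^bsub>U\<^esub> \<sigma> m"
    if X: "X \<in> carrier \<Lambda>" and m: "m \<in> carrier (SM p)"
      and s: "\<And>j c. j \<le> n \<Longrightarrow> \<sigma> (X \<odot>\<^bsub>SM p\<^esub> ?s j c) = X \<odot>\<^bsub>U\<^esub> (scal c \<odot>\<^bsub>U\<^esub> \<omega> j)" for X m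
  proof (rule string_module_induct[OF xs(2) m])
    fix m m' assume mm: "m \<in> carrier (SM p)" "m' \<in> carrier (SM p)" and
      ih: "\<sigma> (X \<odot>\<^bsub>SM p\<^esub> m) = X \<odot>\<^bsub>U\<^esub> \<sigma> m" "\<sigma> (X \<odot>\<^bsub>SM p\<^esub> m') = X \<odot>\<^bsub>U\<^esub> \<sigma> m'"
    show "\<sigma> (X \<odot>\<^bsub>SM p\<^esub> (m \<oplus>\<^bsub>SM p\<^esub> m')) = X \<odot>\<^bsub>U\<^esub> \<sigma> (m \<oplus>\<^bsub>SM p\<^esub> m')"
      unfolding L.smult_add_module[OF X mm] unfolding Ls(3) add ih by (simp add: U.smult_add_module X \<sigma>U)
  next
    fix j c assume "j \<le> length (snd p)"
    then show "\<sigma> (X \<odot>\<^bsub>SM p\<^esub> ?s j c) = X \<odot>\<^bsub>U\<^esub> \<sigma> (?s j c)" by (simp add: np s single)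
  qed
  have swap: "X \<odot>\<^bsub>U\<^esub> (scal c \<odot>\<^bsub>U\<^esub> \<omega> j) = scal c \<odot>\<^bsub>U\<^esub> (X \<odot>\<^bsub>U\<^esub> \<omega> j)" if "X \<in> carrier \<Lambda>" for X c j
    using U.smult_assoc[OF scal_closed that \<omega>U, of c j] U.smult_assoc[OF that scal_closed \<omega>U, of c j] scal_commute[OF that, of c] by simp
  have "\<sigma> \<in> module_hom \<Lambda> (SM p) U"
  proof (rule module_hom_generatorsI[OF L.right_module_axioms U])
    fix m assume m: "m \<in> carrier (SM p)"
    show "\<sigma> m \<in> carrier U" by (rule \<sigma>U)
    show "\<sigma> (m \<oplus>\<^bsub>SM p\<^esub> m') = \<sigma> m \<oplus>\<^bsub>U\<^esub> \<sigma> m'" for m' unfolding Ls(3) by (rule add)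
    show "\<sigma> (scal c \<odot>\<^bsub>SM p\<^esub> m) = scal c \<odot>\<^bsub>U\<^esub> \<sigma> m" for c
    proof (rule compat[OF scal_closed m])
      fix j c' assume j: "j \<le> n"
      have "scal c \<odot>\<^bsub>SM p\<^esub> ?s j c' = ?s j (c' * c)"
        unfolding string_module_scal[OF xs(2) sL[OF j]] by (auto simp: fun_eq_iff)
      then show "\<sigma> (scal c \<odot>\<^bsub>SM p\<^esub> ?s j c') = scal c \<odot>\<^bsub>U\<^esub> (scal c' \<odot>\<^bsub>U\<^esub> \<omega> j)"
        by (simp add: single[OF j] scal_mult U.smult_assoc \<omega>U)
    qed
    show "\<sigma> (idm y \<odot>\<^bsub>SM p\<^esub> m) = idm y \<odot>\<^bsub>U\<^esub> \<sigma> m" for y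
    proof (rule compat[OF idm_closed m])
      fix j c assume j: "j \<le> n"
      have "idm y \<odot>\<^bsub>SM p\<^esub> ?s j c = (if y = v j then ?s j c else (\<lambda>_. 0))"
        unfolding string_module_idm[OF xs(2)] using v(4)[OF j] by (auto simp: vertex_part_def v_def fun_eq_iff)
      then show "\<sigma> (idm y \<odot>\<^bsub>SM p\<^esub> ?s j c) = idm y \<odot>\<^bsub>U\<^esub> (scal c \<odot>\<^bsub>U\<^esub> \<omega> j)"
        unfolding swap[OF idm_closed] idm[OF j] by (simp add: single[OF j] zero s0)
    qed
    show "\<sigma> (arr y \<odot>\<^bsub>SM p\<^esub> m) = arr y \<odot>\<^bsub>U\<^esub> \<sigma> m" for y
    proof (rule compat[OF arr_closed m])
      fix j c assume j: "j \<le> n"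
      have "arrow_action p (?s j c) y i = (if j < n \<and> y = xs ! j then ?s (Suc j) c else (\<lambda>_. 0)) i" for i
        unfolding xs(1) by (cases i) (auto simp: direct_string_action n_def)
      then have a: "arr y \<odot>\<^bsub>SM p\<^esub> ?s j c = (if j < n \<and> y = xs ! j then ?s (Suc j) c else (\<lambda>_. 0))"
        unfolding string_module_arr[OF xs(2)] by (rule ext)
      show "\<sigma> (arr y \<odot>\<^bsub>SM p\<^esub> ?s j c) = arr y \<odot>\<^bsub>U\<^esub> (scal c \<odot>\<^bsub>U\<^esub> \<omega> j)"
      proof (cases "j < n \<and> y = xs ! j")
        case True
        then show ?thesis unfolding a swap[OF arr_closed] by (simp add: single \<omega>)
      next
        case False
        then show ?thesis unfolding a swap[OF arr_closed] arr_0[OF j False] if_not_P[OF False] by (simp add: zero s0)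
      qed
    qed
  qed
  moreover have "\<sigma> (?s 0 1) = u" using single[of 0 1] u(1) by (simp add: scal_1 \<omega> U.smult_one)
  ultimately show thesis using that by blast
qed

text \<open>
  An endomorphism of \<open>R(\<alpha>)\<close> that preserves the top is bijective: since a path outside the ideal
  repeats no arrow, it differs from the identity only on the top.
\<close>

lemma R_module_endomorphism:
  assumes x: "x \<in> arcs Q" and p: "is_R_string Q I x p"
    and \<tau>: "\<tau> \<in> module_hom \<Lambda> (SM p) (SM p)" and top: "\<tau> (\<lambda>j. if j = 0 then 1 else 0) 0 = 1"
  shows "bij_betw \<tau> (carrier (SM p)) (carrier (SM p))"
proof -
  obtain xs where xs: "p = (curve T (nxt x), map Dir xs)" "is_string Q I p" using R_string[OF p x] by metis
  have dist: "distinct xs" using good_distinct[of "curve T (nxt x)" xs] is_string_direct xs by auto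
  let ?s = "\<lambda>j c i. if i = j then c else (0 :: 'k)"
  define n where "n = length xs"
  define t where "t = \<tau> (?s 0 1)"
  have np: "length (snd p) = n" by (simp add: xs(1) n_def)
  interpret L: right_module \<Lambda> "SM p" by (rule right_module_string[OF xs(2)])
  note Ls = string_module_simps[OF xs(2)]
  have sL: "?s j c \<in> carrier (SM p)" if "j \<le> n" for j c using that by (simp add: Ls np)
  have tL: "t \<in> carrier (SM p)" unfolding t_def by (rule module_hom_carrier[OF \<tau> sL]) simp
  have top': "\<tau> (?s 0 c) = (\<lambda>i. c * t i)" for c
  proof -
    have "?s 0 c = scal c \<odot>\<^bsub>SM p\<^esub> ?s 0 1" unfolding string_module_scal[OF xs(2) sL[OF le0]] by (auto simp: fun_eq_iff)
    then have "\<tau> (?s 0 c) = scal c \<odot>\<^bsub>SM p\<^esub> t"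
      using LinearCombinations.module_hom_smult[OF \<tau> scal_closed sL[of 0 1], of c] by (simp add: t_def)
    then show ?thesis unfolding string_module_scal[OF xs(2) tL] .
  qed
  have step: "arrow_action p m (xs ! j) = ?s (Suc j) (m j)" if "j < n" for m j
  proof
    fix i show "arrow_action p m (xs ! j) i = ?s (Suc j) (m j) i"
      unfolding xs(1) using that dist by (cases i) (auto simp: direct_string_action n_def nth_eq_iff_index_eq)
  qed
  have rest: "\<tau> (?s (Suc j) c) = ?s (Suc j) c" if "j < n" for j c
    using that
  proof (induction j)
    case 0
    have "?s (Suc 0) c = arr (xs ! 0) \<odot>\<^bsub>SM p\<^esub> ?s 0 c" unfolding string_module_arr[OF xs(2)] step[OF 0] by simp
    then have "\<tau> (?s (Suc 0) c) = arrow_action p (\<tau> (?s 0 c)) (xs ! 0)"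
      using LinearCombinations.module_hom_smult[OF \<tau> arr_closed sL[of 0 c], of "xs ! 0"] string_module_arr[OF xs(2)] by simp
    moreover have "t 0 = 1" unfolding t_def by (rule top)
    ultimately show ?case unfolding top' step[OF 0] by (simp add: fun_eq_iff)
  next
    case (Suc j)
    have "?s (Suc (Suc j)) c = arr (xs ! Suc j) \<odot>\<^bsub>SM p\<^esub> ?s (Suc j) c"
      unfolding string_module_arr[OF xs(2)] step[OF Suc.prems] by simp
    then have "\<tau> (?s (Suc (Suc j)) c) = arrow_action p (\<tau> (?s (Suc j) c)) (xs ! Suc j)"
      using LinearCombinations.module_hom_smult[OF \<tau> arr_closed sL[of "Suc j" c], of "xs ! Suc j"] Suc.prems string_module_arr[OF xs(2)] by simp
    then show ?case using Suc step[OF Suc.prems] by simp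
  qed
  define r where "r i = (if i = 0 then 0 else t i)" for i
  have t: "t = (\<lambda>i. ?s 0 1 i + r i)" using top by (auto simp: r_def t_def fun_eq_iff)
  have \<tau>_eq: "\<tau> m = (\<lambda>i. m i + m 0 * r i)" if m: "m \<in> carrier (SM p)" for m
  proof (rule string_module_induct[OF xs(2) m])
    fix m m' assume mm: "m \<in> carrier (SM p)" "m' \<in> carrier (SM p)" and
      ih: "\<tau> m = (\<lambda>i. m i + m 0 * r i)" "\<tau> m' = (\<lambda>i. m' i + m' 0 * r i)"
    show "\<tau> (m \<oplus>\<^bsub>SM p\<^esub> m') = (\<lambda>i. (m \<oplus>\<^bsub>SM p\<^esub> m') i + (m \<oplus>\<^bsub>SM p\<^esub> m') 0 * r i)"
      unfolding LinearCombinations.module_hom_add[OF \<tau> mm] unfolding ih Ls(3) by (simp add: fun_eq_iff algebra_simps)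
  next
    fix j c assume j: "j \<le> length (snd p)"
    show "\<tau> (?s j c) = (\<lambda>i. ?s j c i + ?s j c 0 * r i)"
    proof (cases j)
      case 0
      show ?thesis unfolding 0 top' t by (auto simp: fun_eq_iff distrib_left)
    next
      case (Suc i)
      then have "i < n" using j np by simp
      then show ?thesis unfolding Suc by (simp add: rest)
    qed
  qed
  have r0: "r 0 = 0" by (simp add: r_def)
  show ?thesis
  proof (rule bij_betwI[where g = "\<lambda>m i. m i - m 0 * r i"])
    show "\<tau> \<in> carrier (SM p) \<rightarrow> carrier (SM p)" using module_hom_carrier[OF \<tau>] by blast
    show inv: "(\<lambda>m i. m i - m 0 * r i) \<in> carrier (SM p) \<rightarrow> carrier (SM p)"
      using tL by (auto simp: Ls r_def)
    fix m assume m: "m \<in> carrier (SM p)"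
    show "(\<lambda>i. \<tau> m i - \<tau> m 0 * r i) = m" by (simp add: \<tau>_eq[OF m] r0)
    show "\<tau> (\<lambda>i. m i - m 0 * r i) = m" using inv m by (subst \<tau>_eq) (auto simp: r0)
  qed
qed

end

context string_ext_cover
begin

text \<open>
  The generator of the projective cover at an end, multiplied by the arrow \<open>\<alpha>\<close> of that end,
  generates a copy of \<open>R(\<alpha>)\<close> in the syzygy.  The comparison with the explicit resolution, whose
  first syzygy has that summand by construction, splits it off.
\<close>

lemma R_summand_of_syzygy:
  assumes i: "internal_triangle T (V.es e)" and p: "is_R_string Q I (V.es e) p"
  obtains \<rho> \<sigma> where "\<rho> \<in> module_hom \<Lambda> \<Omega> (SM p)" "\<sigma> \<in> module_hom \<Lambda> (SM p) \<Omega>"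
    "\<And>y. y \<in> carrier (SM p) \<Longrightarrow> \<rho> (\<sigma> y) = y"
proof -
  let ?\<alpha> = "V.es e" and ?k = "V.end_index e" and ?b = "(\<lambda>j. if j = 0 then 1 else 0) :: nat \<Rightarrow> 'k"
  let ?\<beta> = "nxt ?\<alpha>"
  have \<alpha>: "?\<alpha> \<in> arcs Q" by (rule internal_arc[OF i])
  obtain xs where xs: "p = (curve T ?\<beta>, map Dir xs)" "is_string Q I p" "xs = [] \<or> hd xs \<noteq> ?\<beta>"
    using R_string[OF p \<alpha>] by metis
  have L: "right_module \<Lambda> (SM p)" by (rule right_module_string[OF xs(2)])
  interpret L: right_module \<Lambda> "SM p" by (rule L)
  interpret C: right_module \<Lambda> C by (rule cover)
  interpret R0: right_module \<Lambda> "V.Res 0" by (rule V.Res_right_module)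
  interpret R1: right_module \<Lambda> "V.Res 1" by (rule V.Res_right_module)
  note VR = projective_resolutionD[OF V.Res_resolution]
  note Ls = string_module_simps[OF xs(2)]
  have b: "?b \<in> carrier (SM p)" by (simp add: Ls)
  have b1: "idm (curve T ?\<beta>) \<odot>\<^bsub>SM p\<^esub> ?b = ?b"
    unfolding string_module_idm[OF xs(2)] using \<alpha> by (auto simp: vertex_part_def string_vertex_def xs(1) fun_eq_iff)
  have b2: "arr ?\<beta> \<odot>\<^bsub>SM p\<^esub> ?b = \<zero>\<^bsub>SM p\<^esub>"
    unfolding string_module_arr[OF xs(2)] Ls(2) unfolding xs(1) by (rule direct_string_action(2)[OF xs(3)])
  obtain c0 where c0: "c0 \<in> carrier C" "\<pi> c0 = V.bvec (V.pos e)"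
    using cover(4) V.bvec_carrier[OF V.pos_le[of e]] by (metis imageE)
  define \<omega> where "\<omega> = arr ?\<alpha> \<odot>\<^bsub>C\<^esub> c0"
  have \<omega>C: "\<omega> \<in> carrier C" unfolding \<omega>_def by (rule C.smult_closed[OF arr_closed c0(1)])
  have \<omega>: "\<omega> \<in> carrier \<Omega>"
    using LinearCombinations.module_hom_smult[OF cover(3) arr_closed c0(1), of ?\<alpha>] c0 \<omega>C
      V.arr_bvec_end[of e] by (simp add: \<omega>_def \<Omega>_simps del: end_side.simps)
  have \<omega>1: "idm (curve T ?\<beta>) \<odot>\<^bsub>\<Omega>\<^esub> \<omega> = \<omega>"
    using C.smult_assoc[OF arr_closed idm_closed c0(1), of ?\<alpha> "curve T ?\<beta>"] by (simp add: \<omega>_def arr_idm del: end_side.simps)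
  have \<omega>2: "arr ?\<beta> \<odot>\<^bsub>\<Omega>\<^esub> \<omega> = \<zero>\<^bsub>\<Omega>\<^esub>"
    using C.smult_assoc[OF arr_closed arr_closed c0(1), of ?\<alpha> ?\<beta>] c0(1) by (simp add: \<omega>_def arr_nxt del: end_side.simps)
  obtain \<sigma> where \<sigma>: "\<sigma> \<in> module_hom \<Lambda> (SM p) \<Omega>" "\<sigma> ?b = \<omega>"
    using R_module_hom[OF \<Omega>_module \<alpha> p \<omega> \<omega>1 \<omega>2] by metis
  \<comment> \<open>The coefficient at the generator of the end, applied to the generator of \<open>R(\<alpha>)\<close>, is well
    defined on the first syzygy of the explicit resolution; \<open>h\<close> carries \<open>\<Omega>\<close> there.\<close>
  obtain h where h: "h \<in> module_hom \<Lambda> C (V.Res 0)" "\<And>y. y \<in> carrier C \<Longrightarrow> V.aug (h y) = \<pi> y"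
  proof (rule fg_projective_lift[OF cover(1) V.Res_right_module M_module V.aug_hom cover(3)])
    show "\<pi> y \<in> V.aug ` carrier (V.Res 0)" if "y \<in> carrier C" for y
      using module_hom_carrier[OF cover(3) that] V.aug_surj by simp
  qed (use that in blast)
  have h\<Omega>: "h \<in> module_hom \<Lambda> \<Omega> (V.Res 0)"
    using module_hom_carrier[OF h(1)] LinearCombinations.module_hom_add[OF h(1)] LinearCombinations.module_hom_smult[OF h(1)]
    by (intro module_homI) (simp_all add: \<Omega>_simps)
  have \<phi>: "(\<lambda>g. g ?k \<odot>\<^bsub>SM p\<^esub> ?b) \<in> module_hom \<Lambda> (V.Res 1) (SM p)"
  proof (rule module_homI)
    fix g assume g: "g \<in> carrier (V.Res 1)"
    show "g ?k \<odot>\<^bsub>SM p\<^esub> ?b \<in> carrier (SM p)" by (rule L.smult_closed[OF V.Res_el[OF g] b])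
    show "(g \<oplus>\<^bsub>V.Res 1\<^esub> g') ?k \<odot>\<^bsub>SM p\<^esub> ?b = g ?k \<odot>\<^bsub>SM p\<^esub> ?b \<oplus>\<^bsub>SM p\<^esub> g' ?k \<odot>\<^bsub>SM p\<^esub> ?b" if g': "g' \<in> carrier (V.Res 1)" for g'
      unfolding V.Res_ops by (rule L.smult_add_ring[OF V.Res_el[OF g] V.Res_el[OF g'] b])
    show "(a \<odot>\<^bsub>V.Res 1\<^esub> g) ?k \<odot>\<^bsub>SM p\<^esub> ?b = a \<odot>\<^bsub>SM p\<^esub> (g ?k \<odot>\<^bsub>SM p\<^esub> ?b)" if a: "a \<in> carrier \<Lambda>" for a
      unfolding V.Res_ops by (rule L.smult_assoc[OF V.Res_el[OF g] a b])
  qed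
  have ker: "g ?k \<odot>\<^bsub>SM p\<^esub> ?b = \<zero>\<^bsub>SM p\<^esub>" if g: "g \<in> carrier (V.Res 1)" "V.diff 0 g = \<zero>\<^bsub>V.Res 0\<^esub>" for g
  proof -
    obtain g' where g': "g' \<in> carrier (V.Res 2)" "g = V.diff 1 g'" using V.kernel_diff_0[OF g] by blast
    have "g ?k = arr ?\<beta> \<otimes>\<^bsub>\<Lambda>\<^esub> g' ?k" using V.end_index(2)[of e] V.side_at_end_index[of e 1] by (simp add: g'(2) V.diff_def)
    then show ?thesis
      using L.smult_assoc[OF arr_closed V.Res_el[OF g'(1)] b] V.Res_el[OF g'(1)] b2 by simp
  qed
  obtain \<rho>0 where \<rho>0: "\<rho>0 \<in> module_hom \<Lambda> \<Omega> (SM p)"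
    "\<And>y g. y \<in> carrier \<Omega> \<Longrightarrow> g \<in> carrier (V.Res 1) \<Longrightarrow> V.diff 0 g = h y \<Longrightarrow> \<rho>0 y = g ?k \<odot>\<^bsub>SM p\<^esub> ?b"
  proof (rule module_hom_factor_surjective[OF R1.right_module_axioms R0.right_module_axioms \<Omega>_module L VR(3)[of 0, folded One_nat_def] \<phi> _ h\<Omega>])
    show "g ?k \<odot>\<^bsub>SM p\<^esub> ?b = \<zero>\<^bsub>SM p\<^esub>" if "g \<in> carrier (V.Res 1)" "V.diff 0 g = \<zero>\<^bsub>V.Res 0\<^esub>" for g
      by (rule ker[OF that])
  next
    fix y assume y: "y \<in> carrier \<Omega>"
    then have "V.aug (h y) = \<zero>\<^bsub>M\<^esub>" "h y \<in> carrier (V.Res 0)"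
      using h(2) module_hom_carrier[OF h\<Omega> y] by (simp_all add: \<Omega>_simps string_module_simps[OF V.string])
    then show "h y \<in> V.diff 0 ` carrier (V.Res 1)" using VR(6) by blast
  qed (use that in blast)
  \<comment> \<open>The composite with \<open>\<sigma>\<close> need not be the identity, since \<open>h c0\<close> may differ from the generator at
    the end by a boundary; but it preserves the top, hence is bijective and can be corrected.\<close>
  have g0: "V.gen 0 (V.pos e) \<in> carrier (V.Res 0)"
    using V.gen_carrier[of "V.pos e" 0] V.pos_le[of e] by (simp add: V.rank_def)
  have g1: "V.gen 1 ?k \<in> carrier (V.Res 1)"
    by (rule V.gen_carrier) (auto simp: V.rank_def intro: less_le_trans[OF V.end_index(2)])
  have hc0: "h c0 \<in> carrier (V.Res 0)" by (rule module_hom_carrier[OF h(1) c0(1)])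
  have "V.aug (h c0 \<ominus>\<^bsub>V.Res 0\<^esub> V.gen 0 (V.pos e)) = \<zero>\<^bsub>M\<^esub>"
  proof -
    interpret M: right_module \<Lambda> M by (rule M_module)
    show ?thesis
      using module_hom_diff[OF R0.right_module_axioms M_module V.aug_hom hc0 g0] h(2)[OF c0(1)] c0(2)
        V.aug_gen[OF V.pos_le[of e]] M.M.r_neg[OF V.bvec_carrier[OF V.pos_le[of e]]] by (simp add: a_minus_def)
  qed
  then obtain y where y: "y \<in> carrier (V.Res 1)" "h c0 \<ominus>\<^bsub>V.Res 0\<^esub> V.gen 0 (V.pos e) = V.diff 0 y"
    using VR(6)[of "h c0 \<ominus>\<^bsub>V.Res 0\<^esub> V.gen 0 (V.pos e)"] hc0 g0 R0.M.minus_closed by blast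
  have y0: "V.diff 0 y \<in> carrier (V.Res 0)" using module_hom_carrier[OF VR(3)[of 0]] y(1) by simp
  have "h c0 = V.gen 0 (V.pos e) \<oplus>\<^bsub>V.Res 0\<^esub> V.diff 0 y"
    unfolding y(2)[symmetric] a_minus_def using hc0 g0 R0.M.a_lcomm[of "V.gen 0 (V.pos e)" "h c0"] by (simp add: R0.M.r_neg)
  then have "h \<omega> = arr ?\<alpha> \<odot>\<^bsub>V.Res 0\<^esub> V.gen 0 (V.pos e) \<oplus>\<^bsub>V.Res 0\<^esub> arr ?\<alpha> \<odot>\<^bsub>V.Res 0\<^esub> V.diff 0 y"
    unfolding \<omega>_def LinearCombinations.module_hom_smult[OF h(1) arr_closed c0(1)]
    by (simp add: R0.smult_add_module[OF arr_closed g0 y0])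
  also have "\<dots> = V.diff 0 (V.gen 1 ?k \<oplus>\<^bsub>V.Res 1\<^esub> arr ?\<alpha> \<odot>\<^bsub>V.Res 1\<^esub> y)"
    using LinearCombinations.module_hom_add[OF VR(3)[of 0, folded One_nat_def] g1 R1.smult_closed[OF arr_closed y(1)]]
      LinearCombinations.module_hom_smult[OF VR(3)[of 0, folded One_nat_def] arr_closed y(1)] V.diff_0_end[OF i]
    by (simp del: end_side.simps)
  finally have "\<rho>0 \<omega> = (V.gen 1 ?k \<oplus>\<^bsub>V.Res 1\<^esub> arr ?\<alpha> \<odot>\<^bsub>V.Res 1\<^esub> y) ?k \<odot>\<^bsub>SM p\<^esub> ?b"
    using \<rho>0(2)[OF \<omega> R1.M.a_closed[OF g1 R1.smult_closed[OF arr_closed y(1)]]] by simp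
  also have "(V.gen 1 ?k \<oplus>\<^bsub>V.Res 1\<^esub> arr ?\<alpha> \<odot>\<^bsub>V.Res 1\<^esub> y) ?k = idm (curve T ?\<beta>) \<oplus>\<^bsub>\<Lambda>\<^esub> y ?k \<otimes>\<^bsub>\<Lambda>\<^esub> arr ?\<alpha>"
    using V.idem_internal[OF V.end_index(2), of e 0] i
    by (simp add: V.Res_ops unit_vec_at_def V.side_at_end_index del: end_side.simps)
  also have "(idm (curve T ?\<beta>) \<oplus>\<^bsub>\<Lambda>\<^esub> y ?k \<otimes>\<^bsub>\<Lambda>\<^esub> arr ?\<alpha>) \<odot>\<^bsub>SM p\<^esub> ?b = ?b \<oplus>\<^bsub>SM p\<^esub> arr ?\<alpha> \<odot>\<^bsub>SM p\<^esub> (y ?k \<odot>\<^bsub>SM p\<^esub> ?b)"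
    using V.Res_el[OF y(1), of ?k] b b1
    by (simp add: L.smult_add_ring L.smult_assoc del: end_side.simps)
  finally have \<rho>\<omega>: "\<rho>0 \<omega> = ?b \<oplus>\<^bsub>SM p\<^esub> arr ?\<alpha> \<odot>\<^bsub>SM p\<^esub> (y ?k \<odot>\<^bsub>SM p\<^esub> ?b)" .
  have top: "\<rho>0 (\<sigma> ?b) 0 = 1"
    unfolding \<sigma>(2) \<rho>\<omega> Ls(3) string_module_arr[OF xs(2)] unfolding xs(1) direct_string_action(1) by simp
  have \<tau>: "(\<lambda>m. \<rho>0 (\<sigma> m)) \<in> module_hom \<Lambda> (SM p) (SM p)" by (rule module_hom_comp[OF \<sigma>(1) \<rho>0(1)])
  have bij: "bij_betw (\<lambda>m. \<rho>0 (\<sigma> m)) (carrier (SM p)) (carrier (SM p))"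
    by (rule R_module_endomorphism[OF \<alpha> p \<tau> top])
  obtain \<rho> where \<rho>: "\<rho> \<in> module_hom \<Lambda> \<Omega> (SM p)" "\<And>y. y \<in> carrier \<Omega> \<Longrightarrow> \<rho>0 (\<sigma> (\<rho> y)) = \<rho>0 y"
  proof (rule module_hom_factor_injective[OF \<Omega>_module L \<tau> bij_betw_imp_inj_on[OF bij] \<rho>0(1)])
    show "\<rho>0 y \<in> (\<lambda>m. \<rho>0 (\<sigma> m)) ` carrier (SM p)" if "y \<in> carrier \<Omega>" for y
      unfolding bij_betw_imp_surj_on[OF bij] by (rule module_hom_carrier[OF \<rho>0(1) that])
  qed (use that in blast)
  show thesis
  proof (rule that[OF \<rho>(1) \<sigma>(1)])
    fix m assume m: "m \<in> carrier (SM p)"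
    have \<sigma>m: "\<sigma> m \<in> carrier \<Omega>" by (rule module_hom_carrier[OF \<sigma>(1) m])
    show "\<rho> (\<sigma> m) = m"
      using inj_onD[OF bij_betw_imp_inj_on[OF bij] \<rho>(2)[OF \<sigma>m] module_hom_carrier[OF \<rho>(1) \<sigma>m] m] .
  qed
qed

text \<open>
  The projection onto the summand is given; the components of the morphism from \<open>P\<close> to the spliced
  sequence exist because the modules \<open>P n\<close> are projective and that sequence is exact.
\<close>

lemma arrow_ext_classes_nonempty:
  assumes ef: "(e, f) \<in> pairs 2"
  shows "arrow_ext_classes T v w \<gamma>v P d \<epsilon> C \<pi> e f \<noteq> {}"
proof -
  let ?\<alpha> = "V.es e"
  let ?\<beta> = "nxt ?\<alpha>"
  have i: "internal_triangle T ?\<alpha>" and fz: "nxt ?\<beta> = W.es f"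
    using ef by (simp_all add: pairs_def numeral_2_eq_2 del: end_side.simps)
  have \<alpha>: "?\<alpha> \<in> arcs Q" by (rule internal_arc[OF i])
  have \<beta>: "?\<beta> \<in> arcs Q" by (rule internal_arc[OF internal_nxt[OF i]])
  obtain p where p: "is_R_string Q I ?\<alpha> p" using R_string_exists[OF \<alpha>] by blast
  obtain xs where xs: "p = (curve T ?\<beta>, map Dir xs)" "is_string Q I p" "xs = [] \<or> hd xs \<noteq> ?\<beta>"
    using R_string[OF p \<alpha>] by metis
  let ?E = "extension_string (W.oriented f) ?\<beta> p"
  have E: "is_string Q I ?E" by (rule W.extension_is_string[OF \<beta> fz xs(2,1,3)])
  have ex: "exact_sequence \<Lambda> N (SM ?E) (SM p) (ext_inclusion w f) (ext_projection w)"
    by (rule W.extension_exact[OF \<beta> fz xs(2,1,3)])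
  have L: "right_module \<Lambda> (SM p)" by (rule right_module_string[OF xs(2)])
  have E_module: "right_module \<Lambda> (SM ?E)" by (rule right_module_string[OF E])
  have \<iota>: "ext_inclusion w f \<in> module_hom \<Lambda> N (SM ?E)" "inj_on (ext_inclusion w f) (carrier N)"
    and g: "ext_projection w \<in> module_hom \<Lambda> (SM ?E) (SM p)" "ext_projection w ` carrier (SM ?E) = carrier (SM p)"
    and im: "ext_inclusion w f ` carrier N = hom_kernel (SM ?E) (SM p) (ext_projection w)"
    using ex unfolding exact_sequence_def by blast+
  obtain \<rho> \<sigma> where \<rho>: "\<rho> \<in> module_hom \<Lambda> \<Omega> (SM p)" "\<sigma> \<in> module_hom \<Lambda> (SM p) \<Omega>"
    "\<And>y. y \<in> carrier (SM p) \<Longrightarrow> \<rho> (\<sigma> y) = y"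
    using R_summand_of_syzygy[OF i p] by metis
  obtain f0 where f0: "f0 \<in> module_hom \<Lambda> (P 0) C" "\<And>x. x \<in> carrier (P 0) \<Longrightarrow> \<pi> (f0 x) = \<epsilon> x"
  proof (rule fg_projective_lift[OF PD(1) cover(2) M_module cover(3) PD(4)])
    show "\<epsilon> x \<in> \<pi> ` carrier C" if "x \<in> carrier (P 0)" for x
      using module_hom_carrier[OF PD(4) that] cover(4) by simp
  qed (use that in blast)
  have d0: "d 0 \<in> module_hom \<Lambda> (P 1) (P 0)" and d1: "d 1 \<in> module_hom \<Lambda> (P 2) (P 1)"
    using PD(3)[of 0] PD(3)[of 1] by (simp_all add: numeral_2_eq_2)
  note fd = module_hom_comp[OF d0 f0(1)]
  have f\<Omega>: "(\<lambda>x. f0 (d 0 x)) \<in> module_hom \<Lambda> (P 1) \<Omega>"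
  proof (rule module_homI)
    fix x assume x: "x \<in> carrier (P 1)"
    show "f0 (d 0 x) \<in> carrier \<Omega>"
      using f0(2)[OF module_hom_carrier[OF d0 x]] PD(8)[OF x] module_hom_carrier[OF fd x]
      by (simp add: \<Omega>_simps string_module_simps[OF V.string])
  qed (simp_all add: LinearCombinations.module_hom_add[OF fd] LinearCombinations.module_hom_smult[OF fd] del: One_nat_def)
  obtain f1 where f1: "f1 \<in> module_hom \<Lambda> (P 1) (SM ?E)" "\<And>x. x \<in> carrier (P 1) \<Longrightarrow> ext_projection w (f1 x) = \<rho> (f0 (d 0 x))"
  proof (rule fg_projective_lift[OF PD(1) E_module L g(1) module_hom_comp[OF f\<Omega> \<rho>(1)]])
    show "\<rho> (f0 (d 0 x)) \<in> ext_projection w ` carrier (SM ?E)" if "x \<in> carrier (P 1)" for x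
      unfolding g(2) by (rule module_hom_carrier[OF module_hom_comp[OF f\<Omega> \<rho>(1)] that])
  qed (use that in blast)
  note fd1 = module_hom_comp[OF d1 f1(1)]
  obtain f2 where f2: "f2 \<in> module_hom \<Lambda> (P 2) N" "\<And>x. x \<in> carrier (P 2) \<Longrightarrow> ext_inclusion w f (f2 x) = f1 (d 1 x)"
  proof (rule module_hom_factor_injective[OF PD(2) N_module \<iota> fd1])
    fix x assume x: "x \<in> carrier (P 2)"
    have "d 0 (d 1 x) = \<zero>\<^bsub>P 0\<^esub>" using PD(9)[of x 0] x by (simp add: numeral_2_eq_2)
    then have "ext_projection w (f1 (d 1 x)) = \<rho> (f0 \<zero>\<^bsub>P 0\<^esub>)"
      using f1(2)[OF module_hom_carrier[OF d1 x]] by simp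
    also have "f0 \<zero>\<^bsub>P 0\<^esub> = \<zero>\<^bsub>\<Omega>\<^esub>" using module_hom_zero[OF PD(2) cover(2) f0(1)] by simp
    also have "\<rho> \<zero>\<^bsub>\<Omega>\<^esub> = \<zero>\<^bsub>SM p\<^esub>" by (rule module_hom_zero[OF \<Omega>_module L \<rho>(1)])
    finally show "f1 (d 1 x) \<in> ext_inclusion w f ` carrier N"
      unfolding im hom_kernel_def using module_hom_carrier[OF fd1 x] by simp
  qed (use that in blast)
  let ?f2 = "restrict f2 (carrier (P 2))"
  have f2h: "?f2 \<in> carrier (hom_space \<Lambda> scal (P 2) N)"
    using module_hom_cong[OF _ PD(2) f2(1), of ?f2] by (simp add: hom_space_def)
  have "coboundaries \<Lambda> scal P d N 2 +>\<^bsub>hom_space \<Lambda> scal (P 2) N\<^esub> ?f2 \<in>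
      induced_Ext2 \<Lambda> scal M P d \<epsilon> C \<pi> N (SM ?E) (SM p) (ext_inclusion w f) (ext_projection w)"
    unfolding induced_Ext2_def using ex \<rho> f0 f1 f2 f2h by (intro CollectI exI conjI) auto
  then show ?thesis
    unfolding arrow_ext_classes_def Let_def using p E by blast
qed

end

section \<open>The dimension and the bases\<close>

context two_arc_strings
begin

lemma other_end_cases: "a = e \<or> a = other_end e" and other_end_neq: "other_end e \<noteq> e"
  by (cases a; cases e; simp) (cases e; simp)

text \<open>
  There are only two ends on each side, so a pair meeting \<open>(e, f)\<close> in neither component is the pair
  of the other ends.
\<close>

lemma pairs_if_ends_match:
  assumes match: "ends_match T \<gamma>v \<gamma>w" and ef: "(e, f) \<in> pairs 2"
  shows "pairs 2 = {(e, f)} \<union> (if (other_end e, other_end f) \<in> pairs 2 then {(other_end e, other_end f)} else {})"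
proof -
  have m: "a = a' \<longleftrightarrow> b = b'" if "(a, b) \<in> pairs 2" "(a', b') \<in> pairs 2" for a b a' b'
    using match that unfolding ends_match_def follows_iff by blast
  have "(a, b) = (e, f) \<or> (a, b) = (other_end e, other_end f)" if "(a, b) \<in> pairs 2" for a b
    using m[OF that ef] other_end_cases[of a e] other_end_cases[of b f] other_end_neq[of e] by auto
  then show ?thesis using ef by auto
qed

lemma card_pairs:
  assumes match: "ends_match T \<gamma>v \<gamma>w"
  shows "card (pairs 2) = (if follows_at_both_ends T \<gamma>v \<gamma>w then 2 else if follows_at_one_end T \<gamma>v \<gamma>w then 1 else 0)"
proof (cases "pairs 2 = {}")
  case True
  then show ?thesis by (simp add: follows_at_both_ends_def follows_at_one_end_def follows_iff)
next
  case False
  then obtain e f where ef: "(e, f) \<in> pairs 2" by (metis ex_in_conv surj_pair)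
  note S = pairs_if_ends_match[OF match ef]
  show ?thesis
  proof (cases "(other_end e, other_end f) \<in> pairs 2")
    case True
    then have "follows_at_both_ends T \<gamma>v \<gamma>w" using ef by (auto simp: follows_at_both_ends_def follows_iff)
    moreover have "card (pairs 2) = 2" using True other_end_neq[of e] by (subst S) (auto simp: eq_commute[of e])
    ultimately show ?thesis by simp
  next
    case False
    then have 1: "pairs 2 = {(e, f)}" using S by simp
    have "follows_at_one_end T \<gamma>v \<gamma>w" using ef False by (auto simp: follows_at_one_end_def follows_iff)
    moreover have "\<not> follows_at_both_ends T \<gamma>v \<gamma>w"
      using False other_end_neq by (auto simp: follows_at_both_ends_def follows_iff 1)
    ultimately show ?thesis using 1 by simp
  qed
qed

end

context string_ext_cover
begin

sublocale Ev2: evaluation "Coc 2" "end_value 2" "pairs 2"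
  using evaluation_Coc[of 0] by (simp add: numeral_2_eq_2)

lemma Ext_2_eq: "Ext_T T P d w 2 = Ev2.Quo"
  using Ext_T_eq[of 0] by (simp add: numeral_2_eq_2)

lemma arrow_class_value:
  assumes match: "ends_match T \<gamma>v \<gamma>w" and ef: "(e, f) \<in> pairs 2"
    and X: "X \<in> arrow_ext_classes T v w \<gamma>v P d \<epsilon> C \<pi> e f"
  obtains c where "c \<noteq> 0" "X \<in> carrier Ev2.Quo" "\<And>q. Ev2.ev X q = (if q = (e, f) then c else 0)"
proof -
  have m: "a = a' \<longleftrightarrow> b = b'" if "(a, b) \<in> pairs 2" "(a', b') \<in> pairs 2" for a b a' b'
    using match that unfolding ends_match_def follows_iff by blast
  obtain p where p: "is_R_string Q I (V.es e) p" "is_string Q I (extension_string (W.oriented f) (nxt (V.es e)) p)"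
    and X': "X \<in> induced_Ext2 \<Lambda> scal M P d \<epsilon> C \<pi> N (SM (extension_string (W.oriented f) (nxt (V.es e)) p)) (SM p)
      (ext_inclusion w f) (ext_projection w)"
    using X unfolding arrow_ext_classes_def Let_def by blast
  have unique: "a = e" if "(a, f) \<in> pairs 2" for a using m[OF that ef] by simp
  have unique': "a = e" if "V.es a = V.es e" for a
  proof (rule unique)
    show "(a, f) \<in> pairs 2" using ef unfolding pairs_def mem_Collect_eq prod.case that .
  qed
  show thesis
  proof (rule arrow_class[OF ef p unique X'])
    fix f2 \<rho> \<sigma> c0 assume f2: "f2 \<in> carrier (Coc 2)" "X = Ev2.cls f2"
      and \<rho>: "\<rho> \<in> module_hom \<Lambda> \<Omega> (SM p)" "\<sigma> \<in> module_hom \<Lambda> (SM p) \<Omega>" "\<And>y. y \<in> carrier (SM p) \<Longrightarrow> \<rho> (\<sigma> y) = y"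
      and c0: "c0 \<in> carrier C" "\<pi> c0 = V.bvec (V.pos e)"
      and at_pair: "\<And>q. end_value 2 f2 q = (if q = (e, f) then \<rho> (arr (V.es e) \<odot>\<^bsub>C\<^esub> c0) 0 else 0)"
    show thesis
    proof (rule that)
      show "\<rho> (arr (V.es e) \<odot>\<^bsub>C\<^esub> c0) 0 \<noteq> 0"
        by (rule top_coefficient_nonzero[OF ef p unique' \<rho> c0])
      show "X \<in> carrier Ev2.Quo" using f2 by (auto simp: Ev2.quotient_carrier)
      show "Ev2.ev X q = (if q = (e, f) then \<rho> (arr (V.es e) \<odot>\<^bsub>C\<^esub> c0) 0 else 0)" for q
        unfolding f2(2) Ev2.ev_cls[OF f2(1)] by (rule at_pair)
    qed
  qed
qed

lemma arrow_classes_basis_2: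
  assumes match: "ends_match T \<gamma>v \<gamma>w" and ef: "(e, f) \<in> pairs 2" "(other_end e, other_end f) \<in> pairs 2"
    and X: "X \<in> arrow_ext_classes T v w \<gamma>v P d \<epsilon> C \<pi> e f"
    and Y: "Y \<in> arrow_ext_classes T v w \<gamma>v P d \<epsilon> C \<pi> (other_end e) (other_end f)"
  shows "X \<noteq> Y" "vectorspace.basis class_ring Ev2.Quo {X, Y}"
proof -
  let ?p = "(e, f)" and ?q = "(other_end e, other_end f)"
  obtain c where c: "c \<noteq> 0" "X \<in> carrier Ev2.Quo" "\<And>q. Ev2.ev X q = (if q = ?p then c else 0)"
    using arrow_class_value[OF match ef(1) X] by metis
  obtain c' where c': "c' \<noteq> 0" "Y \<in> carrier Ev2.Quo" "\<And>q. Ev2.ev Y q = (if q = ?q then c' else 0)"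
    using arrow_class_value[OF match ef(2) Y] by metis
  have S: "pairs 2 = {?p, ?q}" using pairs_if_ends_match[OF match ef(1)] ef(2) by auto
  have ne: "?q \<noteq> ?p" using other_end_neq by simp
  let ?Z = "\<lambda>s. if s = ?p then X else Y" and ?c = "\<lambda>s. if s = ?p then c else c'"
  have Z: "?Z s \<in> carrier Ev2.Quo" "?c s \<noteq> 0" "\<And>i. Ev2.ev (?Z s) i = (if i = s then ?c s else 0)" if "s \<in> pairs 2" for s
    using that ne c c' unfolding S by auto
  have XY: "?Z ?p = X" "?Z ?q = Y" by (simp_all add: other_end_neq)
  show "X \<noteq> Y"
    using inj_onD[OF Ev2.basis_quotient(1)[OF Z(1) Z(3) Z(2)], of ?p ?q] ne S unfolding XY by auto
  have "?Z ` pairs 2 = {X, Y}" unfolding S image_insert image_empty XY ..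
  then show "vectorspace.basis class_ring Ev2.Quo {X, Y}"
    using Ev2.basis_quotient(2)[OF Z(1) Z(3) Z(2)] by simp
qed

lemma arrow_classes_basis_1:
  assumes match: "ends_match T \<gamma>v \<gamma>w" and ef: "(e, f) \<in> pairs 2" "(other_end e, other_end f) \<notin> pairs 2"
    and X: "X \<in> arrow_ext_classes T v w \<gamma>v P d \<epsilon> C \<pi> e f"
  shows "vectorspace.basis class_ring Ev2.Quo {X}"
proof -
  obtain c where c: "c \<noteq> 0" "X \<in> carrier Ev2.Quo" "\<And>q. Ev2.ev X q = (if q = (e, f) then c else 0)"
    using arrow_class_value[OF match ef(1) X] by metis
  have S: "pairs 2 = {(e, f)}" using pairs_if_ends_match[OF match ef(1)] ef(2) by auto
  show ?thesis using Ev2.basis_quotient(2)[of "\<lambda>_. X" "\<lambda>_. c"] c unfolding S by simp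
qed

end

theorem theorem4p1:
  fixes T :: "('s, 'a) triangulation"
    and I :: "(('a, 's) path \<Rightarrow> 'k::alg_closed_field) set"
    and v w :: "('a, 's) str"
    and \<gamma>v \<gamma>w :: "'s list"
    and P :: "nat \<Rightarrow> ((('a, 's) path \<Rightarrow> 'k) set, 'p) module"
    and C :: "((('a, 's) path \<Rightarrow> 'k) set, 'c) module"
  assumes T: "ideal_triangulation T"
    and I: "I = relation_ideal T"
    and v: "is_string (quiver T) I v" "corresponding_arc T v \<gamma>v"
    and w: "is_string (quiver T) I w" "corresponding_arc T w \<gamma>w"
    and P: "projective_resolution (bound_algebra (quiver T) I) (string_module (quiver T) I v) P d \<epsilon>"
    and C: "projective_cover (bound_algebra (quiver T) I) C (string_module (quiver T) I v) \<pi>"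
  shows
    "(ends_match T \<gamma>v \<gamma>w \<longrightarrow>
       vectorspace.fin_dim class_ring (Ext_T T P d w 2) \<and>
       vectorspace.dim class_ring (Ext_T T P d w 2) =
         (if follows_at_both_ends T \<gamma>v \<gamma>w then 2
          else if follows_at_one_end T \<gamma>v \<gamma>w then 1
          else 0) \<and>
       (\<forall>e f. follows T \<gamma>v e \<gamma>w f \<longrightarrow>
          arrow_ext_classes T v w \<gamma>v P d \<epsilon> C \<pi> e f \<noteq> {}) \<and>
       (\<forall>e f X Y. follows T \<gamma>v e \<gamma>w f \<and> follows T \<gamma>v (other_end e) \<gamma>w (other_end f) \<and>
          X \<in> arrow_ext_classes T v w \<gamma>v P d \<epsilon> C \<pi> e f \<and>
          Y \<in> arrow_ext_classes T v w \<gamma>v P d \<epsilon> C \<pi> (other_end e) (other_end f) \<longrightarrow>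
          X \<noteq> Y \<and> vectorspace.basis class_ring (Ext_T T P d w 2) {X, Y}) \<and>
       (\<forall>e f X. follows T \<gamma>v e \<gamma>w f \<and> \<not> follows T \<gamma>v (other_end e) \<gamma>w (other_end f) \<and>
          X \<in> arrow_ext_classes T v w \<gamma>v P d \<epsilon> C \<pi> e f \<longrightarrow>
          vectorspace.basis class_ring (Ext_T T P d w 2) {X})) \<and>
     (\<forall>k. \<exists>\<phi>. linear_map class_ring (Ext_T T P d w (2 + 3 * k)) (Ext_T T P d w 2) \<phi> \<and>
        bij_betw \<phi> (carrier (Ext_T T P d w (2 + 3 * k))) (carrier (Ext_T T P d w 2)))"
proof -
  interpret triangulated_surface T "TYPE('k)" by (rule triangulated_surface.intro[OF T])
  interpret S: two_arc_strings T "TYPE('k)" v w \<gamma>v \<gamma>w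
    by (intro two_arc_strings.intro arc_string.intro arc_string_axioms.intro triangulated_surface_axioms)
      (use v w I in simp_all)
  have P': "projective_resolution \<Lambda> (SM v) P d \<epsilon>" and C': "projective_cover \<Lambda> C (SM v) \<pi>" using P C I by simp_all
  obtain \<Psi> where \<Psi>: "\<And>n. \<Psi> n \<in> module_hom \<Lambda> (S.V.Res n) (P n)"
    "\<And>x. x \<in> carrier (S.V.Res 0) \<Longrightarrow> \<epsilon> (\<Psi> 0 x) = S.V.aug x"
    "\<And>n x. x \<in> carrier (S.V.Res (Suc n)) \<Longrightarrow> d n (\<Psi> (Suc n) x) = \<Psi> n (S.V.diff n x)"
    using chain_map_exists[OF S.V.Res_resolution P' S.V.right_module_M] by metis
  obtain \<Phi> where \<Phi>: "\<And>n. \<Phi> n \<in> module_hom \<Lambda> (P n) (S.V.Res n)"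
    "\<And>x. x \<in> carrier (P 0) \<Longrightarrow> S.V.aug (\<Phi> 0 x) = \<epsilon> x"
    "\<And>n x. x \<in> carrier (P (Suc n)) \<Longrightarrow> S.V.diff n (\<Phi> (Suc n) x) = \<Phi> n (d n x)"
    using chain_map_exists[OF P' S.V.Res_resolution S.V.right_module_M] by metis
  interpret E: string_ext_cover T "TYPE('k)" v w \<gamma>v \<gamma>w P d \<epsilon> \<Psi> \<Phi> C \<pi>
    by (intro string_ext_cover.intro string_ext.intro string_ext_axioms.intro string_ext_cover_axioms.intro
        S.two_arc_strings_axioms P' C' \<Psi> \<Phi>)
  have iso: "\<exists>\<phi>. linear_map class_ring (Ext_T T P d w (2 + 3 * k)) (Ext_T T P d w 2) \<phi> \<and>
      bij_betw \<phi> (carrier (Ext_T T P d w (2 + 3 * k))) (carrier (Ext_T T P d w 2))" for k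
  proof -
    have n: "2 + 3 * k = Suc (Suc (3 * k))" by simp
    have eq: "S.pairs (Suc (Suc (3 * k))) = S.pairs 2" using S.pairs_3[of 2 k] by simp
    obtain \<phi> where "linear_map class_ring (Ext_T T P d w (Suc (Suc (3 * k)))) E.Ev2.Quo \<phi>"
      "bij_betw \<phi> (carrier (Ext_T T P d w (Suc (Suc (3 * k))))) (carrier E.Ev2.Quo)"
      using evaluation_iso[OF E.evaluation_Coc[of "3 * k", unfolded eq] E.Ev2.evaluation_axioms, folded E.Ext_T_eq] by metis
    then show ?thesis unfolding n E.Ext_2_eq by blast
  qed
  show ?thesis
    unfolding S.follows_iff
  proof (intro conjI impI allI iso)
    assume match: "ends_match T \<gamma>v \<gamma>w"
    show "vectorspace.fin_dim class_ring (Ext_T T P d w 2)"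
      "vectorspace.dim class_ring (Ext_T T P d w 2) =
        (if follows_at_both_ends T \<gamma>v \<gamma>w then 2 else if follows_at_one_end T \<gamma>v \<gamma>w then 1 else 0)"
      using E.Ev2.dim_quotient S.card_pairs[OF match] unfolding E.Ext_2_eq by simp_all
    show "arrow_ext_classes T v w \<gamma>v P d \<epsilon> C \<pi> e f \<noteq> {}" if "(e, f) \<in> S.pairs 2" for e f
      by (rule E.arrow_ext_classes_nonempty[OF that])
    fix e f X
    show "X \<noteq> Y" "vectorspace.basis class_ring (Ext_T T P d w 2) {X, Y}"
      if "(e, f) \<in> S.pairs 2 \<and> (other_end e, other_end f) \<in> S.pairs 2 \<and>
        X \<in> arrow_ext_classes T v w \<gamma>v P d \<epsilon> C \<pi> e f \<and>
        Y \<in> arrow_ext_classes T v w \<gamma>v P d \<epsilon> C \<pi> (other_end e) (other_end f)" for Y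
      using E.arrow_classes_basis_2[OF match, of e f X Y] that unfolding E.Ext_2_eq by blast+
    show "vectorspace.basis class_ring (Ext_T T P d w 2) {X}"
      if "(e, f) \<in> S.pairs 2 \<and> (other_end e, other_end f) \<notin> S.pairs 2 \<and>
        X \<in> arrow_ext_classes T v w \<gamma>v P d \<epsilon> C \<pi> e f"
      using E.arrow_classes_basis_1[OF match, of e f X] that unfolding E.Ext_2_eq by blast
  qed
qed

end
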